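(* Let $x\in D$ be arbitrary. Assume: (D1) there is a function $\lambda_{\mathcal A}:D\to(0,\infty)$ such that for every $y\in D$, $\lambda_{\mathcal A}(y)=\lim_{s\to\infty}\nu_{d-1}(I_s(y))^{-1}\,\mathbb E\,\#\Xi_s(y)$; (D2) for every $\varepsilon>0$, $1-\mathbb P(E_{s,\varepsilon})\in O(s^{-2d})$ as $s\to\infty$; $h(s)\in o(g(s))$; and $\mathbb E[(\#X^{(s)})^2]\in O(s^{2d})$. (i) Then $$\lim_{s\to\infty}s^{-1}\frac{\mathbb E\sum_{X_i\in\Xi_s(x)}\Delta(X_i)}{\mathbb E\,\#\Xi_s(x)}=\lambda_{\mathcal A}(x)^{-1}\int_{-\infty}^0\lambda(x+re_1)\mu(x+re_1)\,dr .$$ (ii) If, additionally, either $X^{(s)}$ is a Poisson point process, or $\mu$ is constant on $D$ and $X^{(s)}=X\cap sD$ for some ergodic point process $X$, then $$\lim_{s\to\infty}s^{-1}\frac{\sum_{X_i\in\Xi_s(x)}\Delta(X_i)}{\mathbb E\,\#\Xi_s(x)}=\lambda_{\mathcal A}(x)^{-1}\int_{-\infty}^0\lambda(x+re_1)\mu(x+re_1)\,dr$$ in probability. Here $\lambda$ and $\mu$ are extended by zero outside $D$.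
   Context: Setting. $D\subset\mathbb R^d$ is open, bounded and convex; $e_1$ is the first standard unit vector and $\pi_1:\mathbb R^d\to\mathbb R$ the projection to the first coordinate. $\lambda,\mu:D\to[0,\infty)$ are continuous and bounded. For each $s\ge1$, $X^{(s)}$ is a simple point process on $sD$ with intensity function $\lambda^{(s)}(y)=\lambda(y/s)$, $y\in sD$; its points are denoted $X_i$. A node $X_i\in X^{(s)}$ generates traffic at rate $\mu^{(s)}(X_i)=\mu(X_i/s)$. An ergodic point process is in particular stationary. $\nu_{d-1}$ is $(d-1)$-dimensional Hausdorff measure, $B^k_r(y)$ is the $k$-dimensional ball of radius $r$ around $y$. Directed navigation. $\mathbf N$ is the set of locally finite subsets of $\mathbb R^d$. $\mathcal A:\mathbb R^d\times\mathbf N\to\mathbb R^d$ is a fixed directed navigation: a measurable function such that for all $\varphi\in\mathbf N$ and $y\in\varphi$: $\mathcal A(y,\varphi)\in\varphi$ and $\pi_1(\mathcal A(y,\varphi))\ge\pi_1(y)$. Write $\mathcal A(X_i)=\mathcal A(X_i,X^{(s)})$, and let $\mathcal A^k$ be the $k$-fold iterate (with $X^{(s)}$ fixed), $\mathcal A^0(X_i)=X_i$. Trajectories and traffic. $\Gamma(X_i)=\{\mathcal A^k(X_i):k\ge0\}$, $\bar\Gamma(X_i)=\bigcup_{k\ge0}[\mathcal A^k(X_i),\mathcal A^{k+1}(X_i)]$ (union of line segments), and the traffic flow at $X_i\in X^{(s)}$ is $\Delta(X_i)=\sum_{X_j\in X^{(s)}:\,X_i\in\Gamma(X_j)}\mu^{(s)}(X_j)$.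 Scales. $g,h:[1,\infty)\to[1,\infty)$ are unbounded increasing functions such that $g(s)/s$ and $h(s)/s$ tend monotonically to $0$ as $s\to\infty$. Links. $I_s(x)=B^d_{g(s)}(sx)\cap\{y\in\mathbb R^d:\pi_1(y)=\pi_1(sx)\}$ and $\Xi_s(x)=\{X_i\in X^{(s)}:[X_i,\mathcal A(X_i)]\cap I_s(x)\ne\emptyset\}$. Sub-ballisticity event. For a set $A\subset\mathbb R^d$, $A_\varepsilon=\{y\in A:B^d_\varepsilon(y)\subset A\}$. $Z_r(y)=\mathbb R\times B^{d-1}_r(o)+y$ is the horizontal cylinder of radius $r$ around $y$. $E_{s,\varepsilon}$ is the event that both (1) $\mathcal A(X_i)\ne X_i$ for all $X_i\in X^{(s)}\cap(sD)_{\varepsilon s}$, and (2) $\bar\Gamma(X_i)\cap(sD)_{\varepsilon s}\subset Z_{h(s)}(X_i)$ for all $X_i\in X^{(s)}$.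
   Formalization: Adds the assumption that, almost surely, the navigation has no cycles other than fixed points (A^k(X_i)=X_i with k≥1 implies A(X_i)=X_i); without it nodes sharing a first coordinate may form 2-cycles that stop the traffic, and (i) fails. *)

theory Defs
  imports "HOL-Probability.Probability" "HOL-Library.Landau_Symbols"
begin

section \<open>Hausdorff measure\<close>

text \<open>
  The usual normalisation: a set of diameter \<open>t\<close> contributes the volume of a \<open>k\<close>-dimensional
  ball of diameter \<open>t\<close>.  The empty set is singled out because \<open>0 ^ 0 = 1\<close>; with this
  convention the case \<open>k = 0\<close> is counting measure.
\<close>

definition hausdorff_weight :: "nat \<Rightarrow> 'a::metric_space set \<Rightarrow> ennreal" where
  "hausdorff_weight k U =
     (if U = {} then 0 else ennreal (unit_ball_vol (real k) * (diameter U / 2) ^ k))"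

definition hausdorff_content :: "nat \<Rightarrow> real \<Rightarrow> 'a::metric_space set \<Rightarrow> ennreal" where
  "hausdorff_content k \<delta> S =
     (INF U \<in> {U :: nat \<Rightarrow> 'a set. S \<subseteq> (\<Union>n. U n) \<and> (\<forall>n. bounded (U n) \<and> diameter (U n) \<le> \<delta>)}.
        \<Sum>n. hausdorff_weight k (U n))"

definition hausdorff_measure :: "nat \<Rightarrow> 'a::metric_space set \<Rightarrow> ennreal" where
  "hausdorff_measure k S = (SUP \<delta> \<in> {0<..}. hausdorff_content k \<delta> S)"


section \<open>Point processes\<close>

text \<open>
  A simple point process is encoded as a random locally finite set; the sigma-algebra on the
  space of these sets is the one generated by the counting maps.
\<close>

definition locally_finite :: "'a::metric_space set \<Rightarrow> bool" where
  "locally_finite \<phi> \<longleftrightarrow> (\<forall>B. bounded B \<longrightarrow> finite (\<phi> \<inter> B))"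

definition configs :: "'a::euclidean_space set measure" where
  "configs = sigma {\<phi>. locally_finite \<phi>}
     {{\<phi>. locally_finite \<phi> \<and> card (\<phi> \<inter> B) = n} | B n. B \<in> sets borel \<and> bounded B}"

definition point_process_on ::
    "'w measure \<Rightarrow> 'a::euclidean_space set \<Rightarrow> ('w \<Rightarrow> 'a set) \<Rightarrow> bool" where
  "point_process_on M S X \<longleftrightarrow> X \<in> measurable M configs \<and> (\<forall>\<omega>\<in>space M. X \<omega> \<subseteq> S)"

definition has_intensity_on ::
    "'w measure \<Rightarrow> 'a::euclidean_space set \<Rightarrow> ('w \<Rightarrow> 'a set) \<Rightarrow> ('a \<Rightarrow> real) \<Rightarrow> bool" where
  "has_intensity_on M S X f \<longleftrightarrow>
     (\<forall>B. B \<in> sets borel \<and> bounded B \<and> B \<subseteq> S \<longrightarrow>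
        (\<integral>\<^sup>+ \<omega>. of_nat (card (X \<omega> \<inter> B)) \<partial>M) = (\<integral>\<^sup>+ y\<in>B. ennreal (f y) \<partial>lborel))"

text \<open>
  The counting distribution is written out because \<open>poisson_pmf\<close> is only specified for
  positive rates, whereas the intensity may vanish on a set.
\<close>

definition poisson_process_on ::
    "'w measure \<Rightarrow> 'a::euclidean_space set \<Rightarrow> ('w \<Rightarrow> 'a set) \<Rightarrow> ('a \<Rightarrow> real) \<Rightarrow> bool" where
  "poisson_process_on M S X f \<longleftrightarrow>
     point_process_on M S X \<and>
     (\<forall>B n. B \<in> sets borel \<and> bounded B \<and> B \<subseteq> S \<longrightarrow>
        measure M {\<omega> \<in> space M. card (X \<omega> \<inter> B) = n} =
          (LINT y:B|lborel. f y) ^ n / fact n * exp (- (LINT y:B|lborel. f y))) \<and>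
     (\<forall>(B :: nat \<Rightarrow> 'a set) n.
        (\<forall>i<n. B i \<in> sets borel \<and> bounded (B i) \<and> B i \<subseteq> S) \<and> disjoint_family_on B {..<n} \<longrightarrow>
        prob_space.indep_vars M (\<lambda>_. count_space UNIV) (\<lambda>i \<omega>. card (X \<omega> \<inter> B i)) {..<n})"

definition stationary_process :: "'w measure \<Rightarrow> ('w \<Rightarrow> 'a::euclidean_space set) \<Rightarrow> bool" where
  "stationary_process M X \<longleftrightarrow>
     point_process_on M UNIV X \<and>
     (\<forall>z. distr M configs (\<lambda>\<omega>. (+) z ` X \<omega>) = distr M configs X)"

definition ergodic_process :: "'w measure \<Rightarrow> ('w \<Rightarrow> 'a::euclidean_space set) \<Rightarrow> bool" where
  "ergodic_process M X \<longleftrightarrow>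
     stationary_process M X \<and>
     (\<forall>S \<in> sets configs.
        (\<forall>z \<phi>. locally_finite \<phi> \<longrightarrow> ((+) z ` \<phi> \<in> S \<longleftrightarrow> \<phi> \<in> S)) \<longrightarrow>
        measure M {\<omega> \<in> space M. X \<omega> \<in> S} \<in> {0, 1})"


section \<open>Directed navigation\<close>

text \<open>
  The distinguished direction is the coordinate with index \<open>i\<close>, an arbitrary element of the
  finite index type of \<open>real ^ 'n\<close>.  All balls are closed.
\<close>

definition directed_navigation ::
    "'n::finite \<Rightarrow> (real ^ 'n \<Rightarrow> (real ^ 'n) set \<Rightarrow> real ^ 'n) \<Rightarrow> bool" where
  "directed_navigation i A \<longleftrightarrow>
     (\<lambda>(y, \<phi>). A y \<phi>) \<in> borel_measurable (borel \<Otimes>\<^sub>M configs) \<and>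
     (\<forall>\<phi> y. locally_finite \<phi> \<and> y \<in> \<phi> \<longrightarrow> A y \<phi> \<in> \<phi> \<and> A y \<phi> $ i \<ge> y $ i)"

definition nav_iter :: "('a \<Rightarrow> 'a set \<Rightarrow> 'a) \<Rightarrow> 'a set \<Rightarrow> nat \<Rightarrow> 'a \<Rightarrow> 'a" where
  "nav_iter A \<phi> k y = ((\<lambda>z. A z \<phi>) ^^ k) y"

definition trajectory :: "('a \<Rightarrow> 'a set \<Rightarrow> 'a) \<Rightarrow> 'a set \<Rightarrow> 'a \<Rightarrow> 'a set" where
  "trajectory A \<phi> y = range (\<lambda>k. nav_iter A \<phi> k y)"

definition trajectory_path ::
    "('a::real_vector \<Rightarrow> 'a set \<Rightarrow> 'a) \<Rightarrow> 'a set \<Rightarrow> 'a \<Rightarrow> 'a set" where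
  "trajectory_path A \<phi> y = (\<Union>k. closed_segment (nav_iter A \<phi> k y) (nav_iter A \<phi> (Suc k) y))"

definition traffic ::
    "('a::real_vector \<Rightarrow> real) \<Rightarrow> ('a \<Rightarrow> 'a set \<Rightarrow> 'a) \<Rightarrow> real \<Rightarrow> 'a set \<Rightarrow> 'a \<Rightarrow> real" where
  "traffic mu A s \<phi> y = (\<Sum>z | z \<in> \<phi> \<and> y \<in> trajectory A \<phi> z. mu (z /\<^sub>R s))"

definition link_window ::
    "'n::finite \<Rightarrow> (real \<Rightarrow> real) \<Rightarrow> real \<Rightarrow> real ^ 'n \<Rightarrow> (real ^ 'n) set" where
  "link_window i g s x = cball (s *\<^sub>R x) (g s) \<inter> {y. y $ i = (s *\<^sub>R x) $ i}"

definition crossing_nodes ::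
    "'n::finite \<Rightarrow> (real \<Rightarrow> real) \<Rightarrow> (real ^ 'n \<Rightarrow> (real ^ 'n) set \<Rightarrow> real ^ 'n) \<Rightarrow>
     real \<Rightarrow> real ^ 'n \<Rightarrow> (real ^ 'n) set \<Rightarrow> (real ^ 'n) set" where
  "crossing_nodes i g A s x \<phi> = {y \<in> \<phi>. closed_segment y (A y \<phi>) \<inter> link_window i g s x \<noteq> {}}"

definition scaled :: "real \<Rightarrow> 'a::real_vector set \<Rightarrow> 'a set" where
  "scaled s D = (\<lambda>y. s *\<^sub>R y) ` D"

definition inner_part :: "real \<Rightarrow> 'a::metric_space set \<Rightarrow> 'a set" where
  "inner_part \<epsilon> S = {y \<in> S. cball y \<epsilon> \<subseteq> S}"

definition horizontal_cylinder ::
    "'n::finite \<Rightarrow> real \<Rightarrow> real ^ 'n \<Rightarrow> (real ^ 'n) set" where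
  "horizontal_cylinder i r y = {y + t *\<^sub>R axis i 1 + v | t v. v $ i = 0 \<and> norm v \<le> r}"

text \<open>The sub-ballisticity event, as a condition on the realisation \<open>\<phi>\<close> of the process at scale \<open>s\<close>.\<close>

definition sub_ballistic ::
    "'n::finite \<Rightarrow> (real ^ 'n) set \<Rightarrow> (real \<Rightarrow> real) \<Rightarrow>
     (real ^ 'n \<Rightarrow> (real ^ 'n) set \<Rightarrow> real ^ 'n) \<Rightarrow> real \<Rightarrow> real \<Rightarrow> (real ^ 'n) set \<Rightarrow> bool" where
  "sub_ballistic i D h A s \<epsilon> \<phi> \<longleftrightarrow>
     (\<forall>y \<in> \<phi> \<inter> inner_part (\<epsilon> * s) (scaled s D). A y \<phi> \<noteq> y) \<and>
     (\<forall>y \<in> \<phi>. trajectory_path A \<phi> y \<inter> inner_part (\<epsilon> * s) (scaled s D)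
                 \<subseteq> horizontal_cylinder i (h s) y)"

definition admissible_scale :: "(real \<Rightarrow> real) \<Rightarrow> bool" where
  "admissible_scale g \<longleftrightarrow>
     (\<forall>s\<ge>1. g s \<ge> 1) \<and> mono_on {1..} g \<and> \<not> bdd_above (g ` {1..}) \<and>
     antimono_on {1..} (\<lambda>s. g s / s) \<and> ((\<lambda>s. g s / s) \<longlongrightarrow> 0) at_top"

definition zero_ext :: "'a set \<Rightarrow> ('a \<Rightarrow> real) \<Rightarrow> 'a \<Rightarrow> real" where
  "zero_ext D f y = (if y \<in> D then f y else 0)"

definition tendsto_in_prob ::
    "'w measure \<Rightarrow> (real \<Rightarrow> 'w \<Rightarrow> real) \<Rightarrow> real \<Rightarrow> bool" where
  "tendsto_in_prob M Y c \<longleftrightarrow>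
     (\<forall>\<delta>>0. ((\<lambda>s. measure M {\<omega> \<in> space M. \<bar>Y s \<omega> - c\<bar> > \<delta>}) \<longlongrightarrow> 0) at_top)"

end

theory Submission
  imports Defs
begin

text \<open>
  Almost surely no node lies on the hyperplane through \<open>s x\<close> orthogonal to \<open>e\<^sub>1\<close>, and trajectories
  do not cycle, so a trajectory crosses this hyperplane at most once. Hence the total flow through
  the link is the total rate of the nodes whose trajectory crosses the window. On the
  sub-ballisticity event it lies between the total rates of the nodes in two half-cylinders behind
  the window: the one of radius \<open>g + h\<close>, and the one of radius \<open>g - h\<close> restricted to a dilate
  \<open>c D\<close>, \<open>c < 1\<close>, about \<open>x\<close> (from there a trajectory cannot stop or leave the cylinder before reaching the
  window). By Campbell's formula both have mean \<open>s \<nu>(I\<^sub>s(x))\<close> times an integral of \<open>\<lambda> \<mu>\<close> along the ray,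
  which for \<open>c \<rightarrow> 1\<close> gives the limit; off the sub-ballisticity event the second moment bound leaves a
  contribution \<open>O(1)\<close>.

  In probability, the two bounds concentrate around their means. For a Poisson process this is
  Chebyshev's inequality with Campbell's variance formula. For an ergodic process it is a mean
  ergodic theorem: averages of translated cube counts whose second moment is nearly minimal
  converge in mean, by the parallelogram identity, to an invariant and hence constant limit; the
  count in a large region differs from the integral of such an average only near the boundary.
\<close>

section \<open>Slicing along a coordinate direction\<close>

text \<open>The normalisation in (D1) is genuine Hausdorff measure, so the link window has to be
  evaluated from coverings. Everything of dimension d-1 is obtained from d-dimensional Lebesgue
  measure by thickening sets to height 1: the lower bound becomes an isodiametric inequality in a
  slab, the upper bound an average over the slices of an efficient ball cover.

  For fixed c < 1 the gap between s times the dilate and s D is of order s, which eventually exceeds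
  both g and h; this is why c tends to 1 only after s has tended to infinity. The exponent 2d in
  (D2) is matched to the second moment: a bad event of probability O(s^(-2d)) against E N^2 =
  O(s^(2d)), for the number N of nodes, leaves a mean number of nodes of order 1, negligible against
  \<open>s * V s\<close>.

  In the ergodic case invariance of the limit holds because translates of near minimisers are near
  minimisers again. It holds only up to null sets that depend on the translation, so strictly
  invariant versions of level sets must be built before ergodicity applies.\<close>

definition perp :: "'a::euclidean_space \<Rightarrow> 'a \<Rightarrow> 'a" where
  "perp e y = y - (y \<bullet> e) *\<^sub>R e"

text \<open>Lebesgue measure of the hyperplane orthogonal to \<open>e\<close>, realised on the whole
  space and concentrated on that hyperplane, so that base points v and the points
  \<open>v + t *\<^sub>R e\<close> above them have one type. In dimension one it is the unit mass at
  0.\<close>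

definition perp_lborel :: "'a::euclidean_space \<Rightarrow> 'a measure" where
  "perp_lborel e = distr (\<Pi>\<^sub>M b\<in>Basis - {e}. lborel) borel (\<lambda>p. \<Sum>b\<in>Basis - {e}. p b *\<^sub>R b)"

lemma sets_perp_lborel [simp, measurable_cong]: "sets (perp_lborel e) = sets borel"
  by (simp add: perp_lborel_def)

lemma space_perp_lborel [simp]: "space (perp_lborel e) = UNIV"
  by (simp add: perp_lborel_def)

lemma perp_measurable [measurable]: "perp e \<in> borel_measurable borel"
  unfolding perp_def by measurable

lemma perp_inner_self [simp]: "e \<in> Basis \<Longrightarrow> perp e y \<bullet> e = 0"
  by (simp add: perp_def inner_diff_left)

lemma perp_inner_Basis: "e \<in> Basis \<Longrightarrow> b \<in> Basis \<Longrightarrow> perp e y \<bullet> b = (if b = e then 0 else y \<bullet> b)"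
  by (auto simp: perp_def inner_diff_left inner_Basis)

lemma perp_add: "perp e (x + y) = perp e x + perp e y"
  and perp_diff: "perp e (x - y) = perp e x - perp e y"
  and perp_scaleR: "perp e (c *\<^sub>R x) = c *\<^sub>R perp e x"
  by (simp_all add: perp_def algebra_simps)

lemma perp_axis [simp]: "e \<in> Basis \<Longrightarrow> perp e e = 0"
  by (simp add: perp_def)

lemma perp_decomp: "perp e y + (y \<bullet> e) *\<^sub>R e = y"
  by (simp add: perp_def)

lemma norm_perp_le: "e \<in> Basis \<Longrightarrow> norm (perp e y) \<le> norm y"
proof -
  assume e: "e \<in> Basis"
  have "(norm (perp e y))\<^sup>2 \<le> (norm y)\<^sup>2"
    using e by (simp add: perp_def power2_norm_eq_inner inner_diff_left inner_diff_right inner_commute)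
  then show ?thesis by (simp add: power2_le_iff_abs_le)
qed

lemma norm_perp_decomp:
  assumes "e \<in> Basis"
  shows "(norm y)\<^sup>2 = (norm (perp e y))\<^sup>2 + (y \<bullet> e)\<^sup>2"
  using assms by (simp add: perp_def power2_norm_eq_inner inner_diff_left inner_diff_right
      inner_commute) (simp add: power2_eq_square)

text \<open>Fubini for the coordinate \<open>e\<close>. Both orders are wanted: the inner integral
  runs along \<open>e\<close> for ray integrals and for Steiner symmetrisation, and over hyperplanes
  when a ball is cut into slices.\<close>

lemma
  fixes e :: "'a::euclidean_space"
  assumes e: "e \<in> Basis" and f: "f \<in> borel_measurable borel"
  shows nn_integral_lborel_perp:
      "(\<integral>\<^sup>+y. f y \<partial>lborel) = (\<integral>\<^sup>+v. (\<integral>\<^sup>+t. f (v + t *\<^sub>R e) \<partial>lborel) \<partial>perp_lborel e)"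
    and nn_integral_lborel_perp_rev:
      "(\<integral>\<^sup>+y. f y \<partial>lborel) = (\<integral>\<^sup>+t. (\<integral>\<^sup>+v. f (v + t *\<^sub>R e) \<partial>perp_lborel e) \<partial>lborel)"
proof -
  interpret P: product_sigma_finite "\<lambda>_::'a. lborel::real measure" by standard
  let ?I = "Basis - {e}"
  let ?S = "\<lambda>p::'a \<Rightarrow> real. \<Sum>b\<in>Basis. p b *\<^sub>R b"
  have ins: "insert e ?I = Basis" using e by auto
  have [measurable]: "f \<in> borel_measurable borel" by fact
  have mS: "?S \<in> borel_measurable (Pi\<^sub>M (insert e ?I) (\<lambda>_. lborel))"
    unfolding ins by measurable
  have mfS: "(\<lambda>p. f (?S p)) \<in> borel_measurable (Pi\<^sub>M (insert e ?I) (\<lambda>_. lborel))"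
    using measurable_compose[OF mS f] by simp
  have base: "(\<integral>\<^sup>+y. f y \<partial>lborel) = (\<integral>\<^sup>+p. f (?S p) \<partial>Pi\<^sub>M (insert e ?I) (\<lambda>_. lborel))"
    unfolding ins by (subst lborel_eq) (simp add: nn_integral_distr)
  have S_upd: "?S (p(e := t)) = (\<Sum>b\<in>?I. p b *\<^sub>R b) + t *\<^sub>R e" for p t
  proof -
    have "?S (p(e := t)) = t *\<^sub>R e + (\<Sum>b\<in>?I. (p(e := t)) b *\<^sub>R b)"
      by (subst sum.remove[OF _ e]) auto
    also have "(\<Sum>b\<in>?I. (p(e := t)) b *\<^sub>R b) = (\<Sum>b\<in>?I. p b *\<^sub>R b)"
      by (rule sum.cong) auto
    finally show ?thesis by (simp add: add.commute)
  qed
  have [measurable]: "(\<lambda>p. \<Sum>b\<in>?I. p b *\<^sub>R b) \<in> borel_measurable (Pi\<^sub>M ?I (\<lambda>_. lborel))"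
    by measurable
  show "(\<integral>\<^sup>+y. f y \<partial>lborel) = (\<integral>\<^sup>+v. (\<integral>\<^sup>+t. f (v + t *\<^sub>R e) \<partial>lborel) \<partial>perp_lborel e)"
    unfolding base perp_lborel_def
    by (subst P.product_nn_integral_insert[OF _ _ mfS], simp, simp, subst nn_integral_distr)
      (simp_all add: S_upd del: fun_upd_apply)
  show "(\<integral>\<^sup>+y. f y \<partial>lborel) = (\<integral>\<^sup>+t. (\<integral>\<^sup>+v. f (v + t *\<^sub>R e) \<partial>perp_lborel e) \<partial>lborel)"
    unfolding base perp_lborel_def
    by (subst P.product_nn_integral_insert_rev[OF _ _ mfS], simp, simp, subst nn_integral_distr)
      (simp_all add: S_upd del: fun_upd_apply)
qed

lemma AE_perp_lborel:
  assumes e: "e \<in> Basis"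
  shows "AE v in perp_lborel e. v \<bullet> e = 0"
  unfolding perp_lborel_def
proof (subst AE_distr_iff)
  show "AE p in Pi\<^sub>M (Basis - {e}) (\<lambda>_. lborel). (\<Sum>b\<in>Basis - {e}. p b *\<^sub>R b) \<bullet> e = 0"
    using e by (intro AE_I2) (auto simp: inner_sum_left inner_Basis intro!: sum.neutral)
qed measurable

text \<open>For r > 0 this is the volume of a (d-1)-dimensional ball in coordinates. The radius 0,
  which a set of diameter 0 produces, is reached by letting radii decrease to it; an upper bound
  suffices there.\<close>

lemma emeasure_perp_lborel_cball:
  fixes e :: "'a::euclidean_space"
  assumes e: "e \<in> Basis" and r: "r \<ge> 0"
  shows "emeasure (perp_lborel e) (cball 0 r) \<le>
           ennreal (unit_ball_vol (real (DIM('a) - 1)) * r ^ (DIM('a) - 1))"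
    and "r > 0 \<Longrightarrow> emeasure (perp_lborel e) (cball 0 r) =
           ennreal (unit_ball_vol (real (DIM('a) - 1)) * r ^ (DIM('a) - 1))"
proof -
  let ?k = "DIM('a) - 1"
  have card: "card (Basis - {e}) = ?k" using e by simp
  have nrm: "norm (\<Sum>b\<in>Basis - {e}. p b *\<^sub>R b) = sqrt (\<Sum>b\<in>Basis - {e}. (p b)\<^sup>2)" for p :: "'a \<Rightarrow> real"
  proof -
    have "(\<Sum>b\<in>Basis - {e}. p b *\<^sub>R b) \<bullet> (\<Sum>b\<in>Basis - {e}. p b *\<^sub>R b) = (\<Sum>b\<in>Basis - {e}. (p b)\<^sup>2)"
    proof -
      have "(\<Sum>b\<in>Basis - {e}. p b *\<^sub>R b) \<bullet> c = p c" if "c \<in> Basis - {e}" for c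
        using that by (simp add: inner_sum_left inner_Basis if_distrib cong: if_cong)
      then show ?thesis
        by (simp add: inner_sum_right power2_eq_square)
    qed
    then show ?thesis by (simp add: norm_eq_sqrt_inner)
  qed
  have pos: "emeasure (perp_lborel e) (cball 0 r) = ennreal (unit_ball_vol (real ?k) * r ^ ?k)"
    if "r > 0" for r
  proof -
    have "emeasure (perp_lborel e) (cball 0 r) = emeasure (Pi\<^sub>M (Basis - {e}) (\<lambda>_. lborel))
       ({f. sqrt (\<Sum>i\<in>Basis - {e}. (f i)\<^sup>2) \<le> r} \<inter> space (Pi\<^sub>M (Basis - {e}) (\<lambda>_. lborel)))"
      unfolding perp_lborel_def
      by (subst emeasure_distr) (auto simp: vimage_def nrm intro!: arg_cong2[where f=emeasure])
    also have "\<dots> = ennreal (unit_ball_vol (real ?k) * r ^ ?k)"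
      using emeasure_cball_aux[of "Basis - {e}" r] that card by simp
    finally show ?thesis .
  qed
  show "r > 0 \<Longrightarrow> emeasure (perp_lborel e) (cball 0 r) = ennreal (unit_ball_vol (real ?k) * r ^ ?k)"
    by (rule pos)
  show "emeasure (perp_lborel e) (cball 0 r) \<le> ennreal (unit_ball_vol (real ?k) * r ^ ?k)"
  proof (rule tendsto_lowerbound)
    show "((\<lambda>q. ennreal (unit_ball_vol (real ?k) * q ^ ?k)) \<longlongrightarrow> ennreal (unit_ball_vol (real ?k) * r ^ ?k)) (at_right r)"
      by (intro tendsto_intros)
    show "\<forall>\<^sub>F q in at_right r. emeasure (perp_lborel e) (cball 0 r) \<le> ennreal (unit_ball_vol (real ?k) * q ^ ?k)"
      unfolding eventually_at_right_field
    proof (intro exI[of _ "r + 1"] conjI allI impI)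
      fix q assume "r < q" "q < r + 1"
      then show "emeasure (perp_lborel e) (cball 0 r) \<le> ennreal (unit_ball_vol (real ?k) * q ^ ?k)"
        using r pos[of q] emeasure_mono[of "cball 0 r" "cball 0 q" "perp_lborel e"]
        by (simp add: cball_subset_cball_iff)
    qed simp
  qed simp
qed

text \<open>The height 1 is chosen so that volume and base area agree: this turns statements about
  (d-1)-dimensional measure into statements about \<open>lborel\<close>.\<close>

lemma emeasure_slab_cylinder:
  fixes e :: "'a::euclidean_space"
  assumes e: "e \<in> Basis"
  shows "emeasure lborel {y. c \<le> y \<bullet> e \<and> y \<bullet> e \<le> c + 1 \<and> norm (perp e y) \<le> r} =
         emeasure (perp_lborel e) (cball 0 r)"
proof -
  let ?W = "{y. c \<le> y \<bullet> e \<and> y \<bullet> e \<le> c + 1 \<and> norm (perp e y) \<le> r}"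
  have [measurable]: "?W \<in> sets borel" by measurable
  have "emeasure lborel ?W = (\<integral>\<^sup>+y. indicator ?W y \<partial>lborel)"
    by simp
  also have "\<dots> = (\<integral>\<^sup>+v. (\<integral>\<^sup>+t. indicator ?W (v + t *\<^sub>R e) \<partial>lborel) \<partial>perp_lborel e)"
    by (rule nn_integral_lborel_perp[OF e]) measurable
  also have "\<dots> = (\<integral>\<^sup>+v. (\<integral>\<^sup>+t. indicator (cball 0 r) v * indicator {c..c+1} t \<partial>lborel) \<partial>perp_lborel e)"
  proof (rule nn_integral_cong_AE, use AE_perp_lborel[OF e] in eventually_elim)
    fix v :: 'a assume v: "v \<bullet> e = 0"
    have "perp e (v + t *\<^sub>R e) = v" for t
      using v e by (simp add: perp_def algebra_simps)
    then show "(\<integral>\<^sup>+t. indicator ?W (v + t *\<^sub>R e) \<partial>lborel) = (\<integral>\<^sup>+t. indicator (cball 0 r) v * indicator {c..c+1} t \<partial>lborel)"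
      using v e by (intro nn_integral_cong) (auto simp: indicator_def inner_add_left)
  qed
  also have "\<dots> = emeasure (perp_lborel e) (cball 0 r)"
    by (simp add: nn_integral_cmult)
  finally show ?thesis .
qed

section \<open>Steiner symmetrisation and the isodiametric inequality in a slab\<close>

lemma spread_of_emeasure_gt:
  fixes P :: "real set"
  assumes "ennreal c < emeasure lborel P" "c \<ge> 0"
  obtains p q where "p \<in> P" "q \<in> P" "q - p > c"
proof (rule ccontr)
  assume nt: "\<not> thesis"
  note ex = that
  have le: "q - p \<le> c" if "p \<in> P" "q \<in> P" for p q
    using ex[OF that] nt by force
  have "P \<noteq> {}" using assms by auto
  then obtain p0 where p0: "p0 \<in> P" by auto
  have "bdd_below P"
  proof (rule bdd_belowI[of _ "p0 - c"])
    fix p assume "p \<in> P" then show "p0 - c \<le> p" using le[of p p0] p0 by simp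
  qed
  \<comment> \<open>If no two points were more than c apart, P would fit into an interval of length
    c, contrary to its measure.\<close>
  have "P \<subseteq> {Inf P..Inf P + c}"
  proof
    fix q assume q: "q \<in> P"
    have "q - c \<le> Inf P" using \<open>P \<noteq> {}\<close> le[OF _ q] by (intro cInf_greatest) (auto simp: algebra_simps)
    moreover have "Inf P \<le> q" using q \<open>bdd_below P\<close> by (rule cInf_lower)
    ultimately show "q \<in> {Inf P..Inf P + c}" by simp
  qed
  then have "emeasure lborel P \<le> emeasure lborel {Inf P..Inf P + c}"
    by (rule emeasure_mono) simp
  with assms show False by simp
qed

text \<open>Steiner symmetrisation in direction j: each line parallel to j is given a centred
  interval of the same length as its intersection with W. The strict inequality makes these
  intervals open, so a fibre of measure zero becomes empty and every point of
  \<open>steiner j W\<close> lies over a fibre of W of positive measure.\<close>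

definition steiner :: "'a::euclidean_space \<Rightarrow> 'a set \<Rightarrow> 'a set" where
  "steiner j W = {y. ennreal (2 * \<bar>y \<bullet> j\<bar>) < emeasure lborel {t. perp j y + t *\<^sub>R j \<in> W}}"

definition reflect :: "'a::euclidean_space \<Rightarrow> 'a \<Rightarrow> 'a" where
  "reflect b y = y - (2 * (y \<bullet> b)) *\<^sub>R b"

lemma steiner_measurable:
  assumes [measurable]: "W \<in> sets borel"
  shows "steiner j W \<in> sets borel"
proof -
  have "(\<lambda>y. emeasure lborel {t. perp j y + t *\<^sub>R j \<in> W}) \<in> borel_measurable borel"
    by measurable
  then show ?thesis unfolding steiner_def by measurable
qed

lemma emeasure_centered_interval: "emeasure lborel {t::real. ennreal (2 * \<bar>t\<bar>) < m} = m"
proof (cases m)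
  case (real a)
  then have "{t::real. ennreal (2 * \<bar>t\<bar>) < m} = {-a/2<..<a/2}"
    by (auto simp: ennreal_less_iff)
  with real show ?thesis by simp
qed simp

lemma emeasure_steiner:
  assumes [measurable]: "W \<in> sets borel" and j: "j \<in> Basis"
  shows "emeasure lborel (steiner j W) = emeasure lborel W"
proof -
  have [measurable]: "steiner j W \<in> sets borel" by (rule steiner_measurable) fact
  have "emeasure lborel (steiner j W) = (\<integral>\<^sup>+y. indicator (steiner j W) y \<partial>lborel)"
    by simp
  also have "\<dots> = (\<integral>\<^sup>+v. (\<integral>\<^sup>+t. indicator (steiner j W) (v + t *\<^sub>R j) \<partial>lborel) \<partial>perp_lborel j)"
    by (rule nn_integral_lborel_perp[OF j]) measurable
  also have "\<dots> = (\<integral>\<^sup>+v. (\<integral>\<^sup>+t. indicator W (v + t *\<^sub>R j) \<partial>lborel) \<partial>perp_lborel j)"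
  proof (rule nn_integral_cong_AE, use AE_perp_lborel[OF j] in eventually_elim)
    fix v :: 'a assume v: "v \<bullet> j = 0"
    have p: "perp j (v + t *\<^sub>R j) = v" "(v + t *\<^sub>R j) \<bullet> j = t" for t
      using v j by (simp_all add: perp_def algebra_simps)
    have "(\<integral>\<^sup>+t. indicator (steiner j W) (v + t *\<^sub>R j) \<partial>lborel) =
          (\<integral>\<^sup>+t. indicator {t. ennreal (2 * \<bar>t\<bar>) < emeasure lborel {t. v + t *\<^sub>R j \<in> W}} t \<partial>lborel)"
      by (intro nn_integral_cong) (auto simp: indicator_def steiner_def p)
    also have "\<dots> = emeasure lborel {t. v + t *\<^sub>R j \<in> W}"
      by (subst nn_integral_indicator) (auto simp: emeasure_centered_interval)
    also have "\<dots> = (\<integral>\<^sup>+t. indicator {t. v + t *\<^sub>R j \<in> W} t \<partial>lborel)"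
      by (subst nn_integral_indicator) auto
    also have "\<dots> = (\<integral>\<^sup>+t. indicator W (v + t *\<^sub>R j) \<partial>lborel)"
      by (intro nn_integral_cong) (auto simp: indicator_def)
    finally show "(\<integral>\<^sup>+t. indicator (steiner j W) (v + t *\<^sub>R j) \<partial>lborel) =
      (\<integral>\<^sup>+t. indicator W (v + t *\<^sub>R j) \<partial>lborel)" .
  qed
  also have "\<dots> = (\<integral>\<^sup>+y. indicator W y \<partial>lborel)"
    by (rule nn_integral_lborel_perp[OF j, symmetric]) measurable
  finally show ?thesis by simp
qed

text \<open>Choose p, q in the fibre over y with q - p larger than twice the height of y, and p', q'
  likewise over y'. The differences q - p' and q' - p add up to more than twice the sum of both
  absolute heights, so one of them is at least the difference of the heights.\<close>

lemma steiner_spread: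
  assumes y: "y \<in> steiner j W" and y': "y' \<in> steiner j W"
  obtains a a' where "perp j y + a *\<^sub>R j \<in> W" "perp j y' + a' *\<^sub>R j \<in> W" "\<bar>y \<bullet> j - y' \<bullet> j\<bar> \<le> \<bar>a - a'\<bar>"
proof -
  obtain p q where pq: "perp j y + p *\<^sub>R j \<in> W" "perp j y + q *\<^sub>R j \<in> W" "q - p > 2 * \<bar>y \<bullet> j\<bar>"
    using y unfolding steiner_def by (auto elim!: spread_of_emeasure_gt)
  obtain p' q' where pq': "perp j y' + p' *\<^sub>R j \<in> W" "perp j y' + q' *\<^sub>R j \<in> W" "q' - p' > 2 * \<bar>y' \<bullet> j\<bar>"
    using y' unfolding steiner_def by (auto elim!: spread_of_emeasure_gt)
  consider "\<bar>y \<bullet> j - y' \<bullet> j\<bar> \<le> \<bar>q - p'\<bar>" | "\<bar>y \<bullet> j - y' \<bullet> j\<bar> \<le> \<bar>p - q'\<bar>"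
    using pq(3) pq'(3) by linarith
  then show thesis by cases (use that pq pq' in blast)+
qed

text \<open>Replacing y and y' by the points of W supplied by \<open>steiner_spread\<close> keeps
  the components orthogonal to j and does not shrink the difference along j. Since j is orthogonal
  to e, Pythagoras shows that the distance of the projections along e does not shrink either; so
  symmetrisation cannot enlarge the projected diameter.\<close>

lemma steiner_perp_diam:
  assumes e: "e \<in> Basis" and j: "j \<in> Basis" "j \<noteq> e"
    and W: "\<And>y y'. y \<in> W \<Longrightarrow> y' \<in> W \<Longrightarrow> norm (perp e y - perp e y') \<le> D"
    and y: "y \<in> steiner j W" and y': "y' \<in> steiner j W"
  shows "norm (perp e y - perp e y') \<le> D"
proof -
  obtain a a' where a: "perp j y + a *\<^sub>R j \<in> W" "perp j y' + a' *\<^sub>R j \<in> W" "\<bar>y \<bullet> j - y' \<bullet> j\<bar> \<le> \<bar>a - a'\<bar>"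
    using steiner_spread[OF y y'] .
  let ?u = "perp j y + a *\<^sub>R j" and ?u' = "perp j y' + a' *\<^sub>R j"
  have ej: "e \<bullet> j = 0" "j \<bullet> e = 0" using e j by (auto simp: inner_Basis)
  have 1: "(norm (perp e z))\<^sup>2 = (norm (perp j (perp e z)))\<^sup>2 + (z \<bullet> j)\<^sup>2" for z
    using norm_perp_decomp[OF j(1), of "perp e z"] e j perp_inner_Basis[OF e j(1), of z] by simp
  have 2: "perp j (perp e (?u - ?u')) = perp j (perp e (y - y'))"
    using e j ej by (simp add: perp_def algebra_simps)
  have "(norm (perp e (y - y')))\<^sup>2 \<le> (norm (perp e (?u - ?u')))\<^sup>2"
  proof -
    have "(y \<bullet> j - y' \<bullet> j)\<^sup>2 \<le> (a - a')\<^sup>2"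
      using a(3) by (simp add: abs_le_square_iff)
    moreover have "(?u - ?u') \<bullet> j = a - a'" using j by (simp add: inner_diff_left inner_add_left)
    ultimately show ?thesis
      unfolding 1[of "y - y'"] 1[of "?u - ?u'"] 2 by (simp add: inner_diff_left)
  qed
  then have "norm (perp e (y - y')) \<le> norm (perp e (?u - ?u'))"
    by (simp add: power2_le_iff_abs_le)
  also have "\<dots> \<le> D" using W[OF a(1,2)] by (simp add: perp_diff)
  finally show ?thesis by (simp add: perp_diff)
qed

text \<open>Symmetry in j holds by construction, since only the absolute value of
  \<open>y \<bullet> j\<close> enters. A symmetry in another direction b survives because the
  reflection maps each fibre of W to one of the same measure. Hence successive symmetrisations
  accumulate their symmetries.\<close>

lemma reflect_steiner:
  assumes b: "b \<in> Basis" and j: "j \<in> Basis"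
    and W: "b \<noteq> j \<Longrightarrow> (\<And>y. y \<in> W \<Longrightarrow> reflect b y \<in> W)"
    and y: "y \<in> steiner j W"
  shows "reflect b y \<in> steiner j W"
proof (cases "b = j")
  case True
  have "perp j (reflect j y) = perp j y"
    using j by (simp add: reflect_def perp_diff perp_scaleR)
  moreover have "\<bar>reflect j y \<bullet> j\<bar> = \<bar>y \<bullet> j\<bar>"
    using j by (simp add: reflect_def algebra_simps)
  ultimately show ?thesis using y True by (simp add: steiner_def)
next
  case False
  then have bj: "b \<bullet> j = 0" "j \<bullet> b = 0" using b j by (auto simp: inner_Basis)
  have invol: "reflect b (reflect b z) = z" for z
    using b by (simp add: reflect_def algebra_simps)
  have 1: "perp j (reflect b y) + t *\<^sub>R j = reflect b (perp j y + t *\<^sub>R j)" for t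
    using b j bj by (simp add: perp_def reflect_def algebra_simps)
  have "(perp j (reflect b y) + t *\<^sub>R j \<in> W) \<longleftrightarrow> (perp j y + t *\<^sub>R j \<in> W)" for t
    unfolding 1 using W[OF False] invol by metis
  moreover have "reflect b y \<bullet> j = y \<bullet> j"
    using bj by (simp add: reflect_def algebra_simps)
  ultimately show ?thesis using y by (simp add: steiner_def)
qed

text \<open>The direction e is left out, so the slab condition on the coordinate along e survives
  every step.\<close>

lemma steiner_iterate:
  fixes e :: "'a::euclidean_space"
  assumes e: "e \<in> Basis" and W: "W \<in> sets borel"
    and slab: "W \<subseteq> {y. c \<le> y \<bullet> e \<and> y \<bullet> e \<le> c + 1}"
    and diam: "\<And>y y'. y \<in> W \<Longrightarrow> y' \<in> W \<Longrightarrow> norm (perp e y - perp e y') \<le> D"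
    and J: "finite J" "J \<subseteq> Basis - {e}"
  shows "\<exists>V. V \<in> sets borel \<and> emeasure lborel V = emeasure lborel W \<and>
    V \<subseteq> {y. c \<le> y \<bullet> e \<and> y \<bullet> e \<le> c + 1} \<and>
    (\<forall>y\<in>V. \<forall>y'\<in>V. norm (perp e y - perp e y') \<le> D) \<and> (\<forall>b\<in>J. \<forall>y\<in>V. reflect b y \<in> V)"
  using J
proof (induction J)
  case empty
  then show ?case using W slab diam by (intro exI[of _ W]) auto
next
  case (insert j J)
  then have j: "j \<in> Basis" "j \<noteq> e" by auto
  from insert obtain V where V: "V \<in> sets borel" "emeasure lborel V = emeasure lborel W"
    "V \<subseteq> {y. c \<le> y \<bullet> e \<and> y \<bullet> e \<le> c + 1}"
    "\<forall>y\<in>V. \<forall>y'\<in>V. norm (perp e y - perp e y') \<le> D" "\<forall>b\<in>J. \<forall>y\<in>V. reflect b y \<in> V"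
    by auto
  show ?case
  proof (intro exI[of _ "steiner j V"] conjI ballI)
    show "steiner j V \<in> sets borel" by (rule steiner_measurable) fact
    show "emeasure lborel (steiner j V) = emeasure lborel W"
      using emeasure_steiner[OF V(1) j(1)] V(2) by simp
    show "steiner j V \<subseteq> {y. c \<le> y \<bullet> e \<and> y \<bullet> e \<le> c + 1}"
    proof
      fix y assume y: "y \<in> steiner j V"
      obtain a where a: "perp j y + a *\<^sub>R j \<in> V"
        using steiner_spread[OF y y] by blast
      have "(perp j y + a *\<^sub>R j) \<bullet> e = y \<bullet> e"
        using e j by (simp add: perp_def algebra_simps inner_Basis)
      then show "y \<in> {y. c \<le> y \<bullet> e \<and> y \<bullet> e \<le> c + 1}" using V(3) a by fastforce
    qed
  next
    fix y y' assume "y \<in> steiner j V" "y' \<in> steiner j V"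
    then show "norm (perp e y - perp e y') \<le> D"
      using V(4) steiner_perp_diam[OF e j, of V D] by blast
  next
    fix b y assume b: "b \<in> insert j J" and y: "y \<in> steiner j V"
    show "reflect b y \<in> steiner j V"
      by (rule reflect_steiner[OF _ j(1) _ y]) (use b insert.prems V(5) in auto)
  qed
qed

text \<open>Once V is symmetric in all directions other than e, the composition of these reflections
  sends y to a point of V whose projection is the negative of \<open>perp e y\<close>. The two
  projections are 2 \<open>norm (perp e y)\<close> apart, so V lies over the disc of radius D / 2,
  and V has the volume of W.\<close>

lemma isodiametric_slab:
  fixes e :: "'a::euclidean_space"
  assumes e: "e \<in> Basis" and W: "W \<in> sets borel"
    and slab: "W \<subseteq> {y. c \<le> y \<bullet> e \<and> y \<bullet> e \<le> c + 1}"
    and diam: "\<And>y y'. y \<in> W \<Longrightarrow> y' \<in> W \<Longrightarrow> norm (perp e y - perp e y') \<le> D" and D: "D \<ge> 0"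
  shows "emeasure lborel W \<le> ennreal (unit_ball_vol (real (DIM('a) - 1)) * (D / 2) ^ (DIM('a) - 1))"
proof -
  obtain V where V: "V \<in> sets borel" "emeasure lborel V = emeasure lborel W"
    "V \<subseteq> {y. c \<le> y \<bullet> e \<and> y \<bullet> e \<le> c + 1}"
    "\<forall>y\<in>V. \<forall>y'\<in>V. norm (perp e y - perp e y') \<le> D" "\<forall>b\<in>Basis - {e}. \<forall>y\<in>V. reflect b y \<in> V"
    using steiner_iterate[OF e W slab diam, of "Basis - {e}"] by auto
  have refl: "y - 2 *\<^sub>R (\<Sum>b\<in>J. (y \<bullet> b) *\<^sub>R b) \<in> V" if "finite J" "J \<subseteq> Basis - {e}" "y \<in> V" for J y
    using that
  proof (induction J)
    case (insert b J)
    let ?z = "y - 2 *\<^sub>R (\<Sum>b\<in>J. (y \<bullet> b) *\<^sub>R b)"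
    have "(\<Sum>b\<in>J. (y \<bullet> b) *\<^sub>R b) \<bullet> b = (\<Sum>c\<in>J. 0)"
      unfolding inner_sum_left using insert
      by (intro sum.cong) (auto simp: inner_Basis subset_iff split: if_splits)
    then have "reflect b ?z = y - 2 *\<^sub>R (\<Sum>b\<in>insert b J. (y \<bullet> b) *\<^sub>R b)"
      using insert by (simp add: reflect_def algebra_simps)
    moreover have "reflect b ?z \<in> V" using insert V(5) by auto
    ultimately show ?case by simp
  qed simp
  have "V \<subseteq> {y. c \<le> y \<bullet> e \<and> y \<bullet> e \<le> c + 1 \<and> norm (perp e y) \<le> D / 2}"
  proof
    fix y assume y: "y \<in> V"
    have "y - 2 *\<^sub>R (\<Sum>b\<in>Basis - {e}. (y \<bullet> b) *\<^sub>R b) \<in> V"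
      using y by (intro refl) auto
    moreover have "(\<Sum>b\<in>Basis - {e}. (y \<bullet> b) *\<^sub>R b) = perp e y"
      using e by (subst (2) euclidean_representation[symmetric])
        (simp add: perp_inner_Basis sum.remove[of Basis e])
    ultimately have "norm (perp e y - perp e (y - 2 *\<^sub>R perp e y)) \<le> D"
      using V(4) y by auto
    moreover have "perp e y - perp e (y - 2 *\<^sub>R perp e y) = 2 *\<^sub>R perp e y"
      using e by (simp add: perp_def algebra_simps)
    ultimately show "y \<in> {y. c \<le> y \<bullet> e \<and> y \<bullet> e \<le> c + 1 \<and> norm (perp e y) \<le> D / 2}"
      using V(3) y by auto
  qed
  then have "emeasure lborel V \<le> emeasure lborel {y. c \<le> y \<bullet> e \<and> y \<bullet> e \<le> c + 1 \<and> norm (perp e y) \<le> D / 2}"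
    by (rule emeasure_mono) measurable
  also have "\<dots> \<le> ennreal (unit_ball_vol (real (DIM('a) - 1)) * (D / 2) ^ (DIM('a) - 1))"
    unfolding emeasure_slab_cylinder[OF e] using D by (intro emeasure_perp_lborel_cball[OF e]) auto
  finally show ?thesis using V(2) by simp
qed

section \<open>Hausdorff measure of discs\<close>

text \<open>Slicing the ball by hyperplanes orthogonal to e. The left side has the form in which
  \<open>hausdorff_weight_ball_slice\<close> bounds the weights of slices, so that weights can be
  integrated to a volume.\<close>

lemma nn_integral_cball_slices:
  fixes c e :: "'a::euclidean_space"
  assumes e: "e \<in> Basis" and r: "r \<ge> 0"
  shows "(\<integral>\<^sup>+t. indicator {c \<bullet> e - r..c \<bullet> e + r} t *
             ennreal (unit_ball_vol (real (DIM('a) - 1)) * (sqrt (r\<^sup>2 - (t - c \<bullet> e)\<^sup>2)) ^ (DIM('a) - 1)) \<partial>lborel)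
         = emeasure lborel (cball c r)"
proof -
  let ?k = "DIM('a) - 1"
  let ?w = "\<lambda>t. indicator {-r..r} t * ennreal (unit_ball_vol (real ?k) * (sqrt (r\<^sup>2 - t\<^sup>2)) ^ ?k)"
  have "(\<integral>\<^sup>+t. indicator {c \<bullet> e - r..c \<bullet> e + r} t *
             ennreal (unit_ball_vol (real ?k) * (sqrt (r\<^sup>2 - (t - c \<bullet> e)\<^sup>2)) ^ ?k) \<partial>lborel) = (\<integral>\<^sup>+t. ?w t \<partial>lborel)"
    by (subst nn_integral_real_affine[where t="c \<bullet> e" and c=1])
      (auto intro!: nn_integral_cong simp: indicator_def)
  also have "\<dots> = (\<integral>\<^sup>+t. (\<integral>\<^sup>+v. indicator (cball 0 r) (v + t *\<^sub>R e) \<partial>perp_lborel e) \<partial>lborel)"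
  proof (rule nn_integral_cong_AE)
    \<comment> \<open>The two extreme slices have radius 0, where
      \<open>emeasure_perp_lborel_cball\<close> gives only an inequality; they form a null set of
      heights.\<close>
    have "AE t in lborel. t \<noteq> r \<and> t \<noteq> -r"
      using AE_lborel_singleton[of r] AE_lborel_singleton[of "-r"] by eventually_elim auto
    then show "AE t in lborel. ?w t = (\<integral>\<^sup>+v. indicator (cball 0 r) (v + t *\<^sub>R e) \<partial>perp_lborel e)"
    proof eventually_elim
      fix t :: real assume t: "t \<noteq> r \<and> t \<noteq> -r"
      have eq: "indicator (cball 0 r) (v + t *\<^sub>R e) =
                (if \<bar>t\<bar> \<le> r then indicator (cball 0 (sqrt (r\<^sup>2 - t\<^sup>2))) v else (0::ennreal))" if "v \<bullet> e = 0" for v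
      proof -
        have "perp e (v + t *\<^sub>R e) = v" "(v + t *\<^sub>R e) \<bullet> e = t"
          using that e by (simp_all add: perp_def algebra_simps)
        then have n: "(norm (v + t *\<^sub>R e))\<^sup>2 = (norm v)\<^sup>2 + t\<^sup>2"
          using norm_perp_decomp[OF e, of "v + t *\<^sub>R e"] by simp
        have "norm (v + t *\<^sub>R e) \<le> r \<longleftrightarrow> (norm v)\<^sup>2 + t\<^sup>2 \<le> r\<^sup>2"
          using r n by (metis abs_le_square_iff abs_norm_cancel abs_of_nonneg)
        also have "\<dots> \<longleftrightarrow> \<bar>t\<bar> \<le> r \<and> norm v \<le> sqrt (r\<^sup>2 - t\<^sup>2)"
        proof
          assume *: "(norm v)\<^sup>2 + t\<^sup>2 \<le> r\<^sup>2"
          then have "t\<^sup>2 \<le> r\<^sup>2" using zero_le_power2[of "norm v"] by linarith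
          then have "\<bar>t\<bar> \<le> r" using r by (simp add: abs_le_square_iff[symmetric])
          moreover have "norm v \<le> sqrt (r\<^sup>2 - t\<^sup>2)" using * by (simp add: real_le_rsqrt)
          ultimately show "\<bar>t\<bar> \<le> r \<and> norm v \<le> sqrt (r\<^sup>2 - t\<^sup>2)" by simp
        next
          assume *: "\<bar>t\<bar> \<le> r \<and> norm v \<le> sqrt (r\<^sup>2 - t\<^sup>2)"
          then have "t\<^sup>2 \<le> r\<^sup>2" using r by (simp add: abs_le_square_iff[symmetric])
          then have "(sqrt (r\<^sup>2 - t\<^sup>2))\<^sup>2 = r\<^sup>2 - t\<^sup>2" by simp
          moreover have "(norm v)\<^sup>2 \<le> (sqrt (r\<^sup>2 - t\<^sup>2))\<^sup>2" using * by (intro power_mono) auto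
          ultimately show "(norm v)\<^sup>2 + t\<^sup>2 \<le> r\<^sup>2" by simp
        qed
        finally show ?thesis by (simp add: indicator_def)
      qed
      have "(\<integral>\<^sup>+v. indicator (cball 0 r) (v + t *\<^sub>R e) \<partial>perp_lborel e) =
            (\<integral>\<^sup>+v. (if \<bar>t\<bar> \<le> r then indicator (cball 0 (sqrt (r\<^sup>2 - t\<^sup>2))) v else 0) \<partial>perp_lborel e)"
        by (rule nn_integral_cong_AE, use AE_perp_lborel[OF e] in eventually_elim) (use eq in auto)
      also have "\<dots> = ?w t"
      proof (cases "\<bar>t\<bar> \<le> r")
        case True
        with t have "\<bar>t\<bar> < r" by auto
        then have "t\<^sup>2 < r\<^sup>2" using r abs_square_less_1 by (metis abs_of_nonneg power2_abs power_strict_mono abs_ge_zero zero_less_numeral)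
        then have "sqrt (r\<^sup>2 - t\<^sup>2) > 0" by simp
        then have "emeasure (perp_lborel e) (cball 0 (sqrt (r\<^sup>2 - t\<^sup>2))) =
          ennreal (unit_ball_vol (real ?k) * sqrt (r\<^sup>2 - t\<^sup>2) ^ ?k)"
          by (intro emeasure_perp_lborel_cball[OF e]) auto
        with True show ?thesis by (simp add: abs_le_iff minus_le_iff)
      qed (auto simp: indicator_def)
      finally show "?w t = (\<integral>\<^sup>+v. indicator (cball 0 r) (v + t *\<^sub>R e) \<partial>perp_lborel e)" by simp
    qed
  qed
  also have "\<dots> = (\<integral>\<^sup>+y. indicator (cball (0::'a) r) y \<partial>lborel)"
    by (rule nn_integral_lborel_perp_rev[OF e, symmetric]) (rule borel_measurable_indicator, simp)
  also have "\<dots> = emeasure lborel (cball c r)"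
    using r by (simp add: emeasure_cball)
  finally show ?thesis .
qed

section \<open>Covers by small balls of nearly optimal total volume\<close>

lemma enumerate_countable_cover:
  fixes C :: "('a::euclidean_space \<times> real) set"
  assumes C: "countable C" and pos: "\<And>p. p \<in> C \<Longrightarrow> 0 \<le> snd p \<and> snd p < \<delta>" and \<delta>: "\<delta> > 0"
  obtains c :: "nat \<Rightarrow> 'a" and r where "\<And>n. 0 \<le> r n \<and> r n < \<delta>"
    "(\<Union>p\<in>C. cball (fst p) (snd p)) \<subseteq> (\<Union>n. cball (c n) (r n))"
    "(\<Sum>n. emeasure lborel (cball (c n) (r n))) \<le> (\<integral>\<^sup>+p. emeasure lborel (cball (fst p) (snd p)) \<partial>count_space C)"
proof -
  let ?N = "to_nat_on C ` C"
  define c where "c n = fst (from_nat_into C n)" for n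
  \<comment> \<open>\<open>hausdorff_content\<close> asks for a sequence; indices that do not
    enumerate C get radius 0 and thus cost no volume.\<close>
  define r where "r n = (if n \<in> ?N then snd (from_nat_into C n) else 0)" for n
  have bij: "bij_betw (from_nat_into C) ?N C"
    using C by (auto simp: bij_betw_def inj_on_def image_image)
  show thesis
  proof
    show "0 \<le> r n \<and> r n < \<delta>" for n
      using pos C \<delta> by (auto simp: r_def)
    show "(\<Union>p\<in>C. cball (fst p) (snd p)) \<subseteq> (\<Union>n. cball (c n) (r n))"
    proof
      fix y assume "y \<in> (\<Union>p\<in>C. cball (fst p) (snd p))"
      then obtain p where p: "p \<in> C" "y \<in> cball (fst p) (snd p)" by auto
      then have "y \<in> cball (c (to_nat_on C p)) (r (to_nat_on C p))"
        using C by (simp add: c_def r_def)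
      then show "y \<in> (\<Union>n. cball (c n) (r n))" by blast
    qed
    have "(\<Sum>n. emeasure lborel (cball (c n) (r n))) = (\<integral>\<^sup>+n. emeasure lborel (cball (c n) (r n)) \<partial>count_space UNIV)"
      by (simp add: nn_integral_count_space_nat)
    also have "\<dots> = (\<integral>\<^sup>+n. emeasure lborel (cball (c n) (r n)) * indicator ?N n \<partial>count_space UNIV)"
      by (intro nn_integral_cong) (auto simp: r_def indicator_def emeasure_cball)
    also have "\<dots> = (\<integral>\<^sup>+n. emeasure lborel (cball (c n) (r n)) \<partial>count_space ?N)"
      by (simp add: nn_integral_count_space_indicator)
    also have "\<dots> = (\<integral>\<^sup>+n. emeasure lborel (cball (fst (from_nat_into C n)) (snd (from_nat_into C n))) \<partial>count_space ?N)"
      by (intro nn_integral_cong) (auto simp: c_def r_def)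
    also have "\<dots> = (\<integral>\<^sup>+p. emeasure lborel (cball (fst p) (snd p)) \<partial>count_space C)"
      by (rule nn_integral_bij_count_space[OF bij])
    finally show "(\<Sum>n. emeasure lborel (cball (c n) (r n))) \<le> (\<integral>\<^sup>+p. emeasure lborel (cball (fst p) (snd p)) \<partial>count_space C)"
      by simp
  qed
qed

text \<open>Outer regularity covers N by dyadic cubes of small total volume; each cube is then
  enclosed in a ball at the price of the constant factor \<open>?\<kappa>\<close>.\<close>

lemma negligible_ball_cover:
  fixes N :: "'a::euclidean_space set"
  assumes N: "negligible N" "bounded N" and \<delta>: "\<delta> > 0" and \<eta>: "\<eta> > 0"
  obtains C :: "('a \<times> real) set" where "countable C" "\<And>p. p \<in> C \<Longrightarrow> 0 \<le> snd p \<and> snd p < \<delta>"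
    "N \<subseteq> (\<Union>p\<in>C. cball (fst p) (snd p))"
    "(\<integral>\<^sup>+p. emeasure lborel (cball (fst p) (snd p)) \<partial>count_space C) \<le> ennreal \<eta>"
proof -
  let ?d = "DIM('a)"
  \<comment> \<open>Volume of a ball of radius d \<sigma> divided by that of a cube of side
    \<sigma>: bounding the norm by the sum of coordinates puts the cube into the ball of radius d
    \<sigma> about a corner.\<close>
  let ?\<kappa> = "unit_ball_vol (real ?d) * real ?d ^ ?d"
  have \<kappa>: "?\<kappa> > 0" by simp
  \<comment> \<open>The first entry of the minimum bounds the total volume of the balls by \<eta>.
    The second forces every single ball below radius \<delta>, since each cube alone has volume at
    most \<epsilon>; its factor 1/2 gives the strict inequality.\<close>
  define \<epsilon> where "\<epsilon> = min \<eta> (unit_ball_vol (real ?d) * \<delta> ^ ?d / 2) / ?\<kappa>"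
  have \<epsilon>: "\<epsilon> > 0" unfolding \<epsilon>_def using \<delta> \<eta> \<kappa> by (intro divide_pos_pos) auto
  obtain B where B: "B > 0" "N \<subseteq> cbox (- (B *\<^sub>R One)) (B *\<^sub>R One)"
    using bounded_subset_cbox_symmetric[OF N(2)]
  proof -
    obtain b where b: "b > 0" "\<And>x. x \<in> N \<Longrightarrow> norm x \<le> b"
      using N(2) by (meson bounded_pos)
    have "N \<subseteq> cbox (- (b *\<^sub>R One)) (b *\<^sub>R One)"
    proof
      fix x assume "x \<in> N"
      then have "\<bar>x \<bullet> i\<bar> \<le> b" if "i \<in> Basis" for i
        using b(2) Basis_le_norm[OF that, of x] by fastforce
      then show "x \<in> cbox (- (b *\<^sub>R One)) (b *\<^sub>R One)"
        by (auto simp: mem_box abs_le_iff minus_le_iff)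
    qed
    then show thesis using that b by blast
  qed
  obtain \<D> where D: "countable \<D>"
    "\<And>K. K \<in> \<D> \<Longrightarrow> K \<subseteq> cbox (- (B *\<^sub>R One)) (B *\<^sub>R One :: 'a) \<and> K \<noteq> {} \<and> (\<exists>c d. K = cbox c d)"
    "pairwise (\<lambda>A B. interior A \<inter> interior B = {}) \<D>"
    "\<And>u v. cbox u v \<in> \<D> \<Longrightarrow> \<exists>n. \<forall>i \<in> Basis. v \<bullet> i - u \<bullet> i = ((B *\<^sub>R One) \<bullet> i - (- (B *\<^sub>R One)) \<bullet> i)/2^n"
    "N \<subseteq> \<Union>\<D>" "\<Union>\<D> \<in> lmeasurable" "measure lebesgue (\<Union>\<D>) \<le> measure lebesgue N + \<epsilon>"
    using measurable_outer_intervals_bounded[OF negligible_imp_measurable[OF N(1)] B(2) \<epsilon>] by metis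
  define Q where "Q K p \<longleftrightarrow> 0 \<le> snd p \<and> K \<subseteq> cball (fst p) (snd p) \<and>
    emeasure lborel (cball (fst p) (snd p)) = ennreal ?\<kappa> * emeasure lborel (interior K) \<and>
    emeasure lborel (interior K) = ennreal ((snd p / ?d) ^ ?d)" for K :: "'a set" and p :: "'a \<times> real"
  have "\<exists>p. Q K p"
    if K: "K \<in> \<D>" for K
  proof -
    obtain u v where uv: "K = cbox u v" using D(2)[OF K] by auto
    obtain n where n: "\<forall>i \<in> Basis. v \<bullet> i - u \<bullet> i = 2 * B / 2 ^ n"
      using D(4)[of u v] K uv by auto
    define \<sigma> where "\<sigma> = 2 * B / 2 ^ n"
    have n: "v \<bullet> i - u \<bullet> i = \<sigma>" if "i \<in> Basis" for i using n that by (simp add: \<sigma>_def)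
    have \<sigma>: "\<sigma> > 0" using B by (simp add: \<sigma>_def)
    have le: "u \<bullet> i \<le> v \<bullet> i" if "i \<in> Basis" for i using n \<sigma> that by (smt (verit))
    have em: "emeasure lborel (interior K) = ennreal (\<sigma> ^ ?d)"
    proof -
      have "emeasure lborel (interior K) = ennreal (\<Prod>i\<in>Basis. (v - u) \<bullet> i)"
        unfolding uv interior_cbox using le by (intro emeasure_lborel_box) auto
      also have "(\<Prod>i\<in>Basis. (v - u) \<bullet> i) = (\<Prod>i\<in>(Basis::'a set). \<sigma>)"
        using n by (intro prod.cong) (auto simp: inner_diff_left)
      finally show ?thesis by simp
    qed
    have sub: "K \<subseteq> cball u (real ?d * \<sigma>)"
    proof
      fix y assume y: "y \<in> K"
      have "norm (y - u) \<le> (\<Sum>i\<in>Basis. \<bar>(y - u) \<bullet> i\<bar>)" by (rule norm_le_l1)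
      also have "\<dots> \<le> (\<Sum>i\<in>(Basis::'a set). \<sigma>)"
      proof (rule sum_mono)
        fix i :: 'a assume i: "i \<in> Basis"
        have "u \<bullet> i \<le> y \<bullet> i" "y \<bullet> i \<le> v \<bullet> i" using y i by (auto simp: uv mem_box)
        moreover have "v \<bullet> i - u \<bullet> i = \<sigma>" using n i by simp
        ultimately show "\<bar>(y - u) \<bullet> i\<bar> \<le> \<sigma>" unfolding inner_diff_left by linarith
      qed
      finally show "y \<in> cball u (real ?d * \<sigma>)" by (simp add: dist_norm norm_minus_commute)
    qed
    have "emeasure lborel (cball u (real ?d * \<sigma>)) = ennreal (?\<kappa> * \<sigma> ^ ?d)"
      using \<sigma> by (subst emeasure_cball) (auto simp: power_mult_distrib mult.assoc)
    also have "\<dots> = ennreal ?\<kappa> * ennreal (\<sigma> ^ ?d)" using \<kappa> \<sigma> by (simp add: ennreal_mult)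
    finally have em2: "emeasure lborel (cball u (real ?d * \<sigma>)) = ennreal ?\<kappa> * ennreal (\<sigma> ^ ?d)" .
    have "real ?d * \<sigma> / real ?d = \<sigma>" by simp
    with em em2 sub \<sigma> show ?thesis unfolding Q_def
      by (intro exI[of _ "(u, real ?d * \<sigma>)"]) (simp only: fst_conv snd_conv, simp)
  qed
  then have "\<forall>K\<in>\<D>. \<exists>p. Q K p" by blast
  then obtain p where "\<forall>K\<in>\<D>. Q K (p K)" by (rule bchoice[THEN exE])
  then have p: "\<And>K. K \<in> \<D> \<Longrightarrow> 0 \<le> snd (p K) \<and> K \<subseteq> cball (fst (p K)) (snd (p K)) \<and>
    emeasure lborel (cball (fst (p K)) (snd (p K))) = ennreal ?\<kappa> * emeasure lborel (interior K) \<and>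
    emeasure lborel (interior K) = ennreal ((snd (p K) / ?d) ^ ?d)"
    unfolding Q_def by (rule bspec)
  have Dle: "emeasure lebesgue (\<Union>\<D>) \<le> ennreal \<epsilon>"
    using D(6,7) N(1) by (simp add: emeasure_eq_measure2 negligible_imp_measure0 ennreal_leI)
  have int: "(\<integral>\<^sup>+K. emeasure lborel (interior K) \<partial>count_space \<D>) \<le> ennreal \<epsilon>"
  proof -
    have "(\<integral>\<^sup>+K. emeasure lborel (interior K) \<partial>count_space \<D>) = emeasure lborel (\<Union>K\<in>\<D>. interior K)"
      using D(1,3) by (subst emeasure_UN_countable) (auto simp: disjoint_family_on_def pairwise_def)
    also have "\<dots> = emeasure lebesgue (\<Union>K\<in>\<D>. interior K)"
      by (simp add: open_UN)
    also have "\<dots> \<le> emeasure lebesgue (\<Union>\<D>)"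
      using D(6) interior_subset by (intro emeasure_mono) (auto simp: fmeasurable_def)
    finally show ?thesis using Dle by simp
  qed
  show thesis
  proof
    show "countable (p ` \<D>)" using D(1) by simp
    show "N \<subseteq> (\<Union>q\<in>p ` \<D>. cball (fst q) (snd q))"
    proof
      fix y assume "y \<in> N"
      then obtain K where K: "K \<in> \<D>" "y \<in> K" using D(5) by auto
      then have "y \<in> cball (fst (p K)) (snd (p K))" using p[OF K(1)] by (auto simp del: mem_cball)
      then show "y \<in> (\<Union>q\<in>p ` \<D>. cball (fst q) (snd q))" using K(1) by (simp del: mem_cball) (rule bexI)
    qed
    show "0 \<le> snd q \<and> snd q < \<delta>" if q: "q \<in> p ` \<D>" for q
    proof -
      obtain K where K: "K \<in> \<D>" "q = p K" using q by (rule imageE) blast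
      have "interior K \<subseteq> \<Union>\<D>" using K interior_subset by blast
      then have "emeasure lebesgue (interior K) \<le> emeasure lebesgue (\<Union>\<D>)"
        using D(6) by (intro emeasure_mono) (auto simp: fmeasurable_def)
      then have "emeasure lborel (interior K) \<le> ennreal \<epsilon>" using Dle by simp
      then have "(snd q / ?d) ^ ?d \<le> \<epsilon>"
        using p[OF K(1)] K \<epsilon> by (simp add: ennreal_le_iff)
      then have "?\<kappa> * (snd q / ?d) ^ ?d \<le> ?\<kappa> * \<epsilon>" using \<kappa> by simp
      also have "?\<kappa> * \<epsilon> < unit_ball_vol (real ?d) * \<delta> ^ ?d"
      proof -
        have pos: "unit_ball_vol (real ?d) * \<delta> ^ ?d > 0" using \<delta> by simp
        have "?\<kappa> * \<epsilon> = min \<eta> (unit_ball_vol (real ?d) * \<delta> ^ ?d / 2)"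
          unfolding \<epsilon>_def using \<kappa>
          by (metis less_irrefl nonzero_mult_div_cancel_left times_divide_eq_right)
        also have "\<dots> < unit_ball_vol (real ?d) * \<delta> ^ ?d" using pos by linarith
        finally show ?thesis .
      qed
      finally have "unit_ball_vol (real ?d) * snd q ^ ?d < unit_ball_vol (real ?d) * \<delta> ^ ?d"
        by (simp add: power_divide)
      then have "snd q ^ ?d < \<delta> ^ ?d" by simp
      then show ?thesis using p[OF K(1)] K \<delta> by (auto intro: power_less_imp_less_base)
    qed
    have "(\<integral>\<^sup>+q. emeasure lborel (cball (fst q) (snd q)) \<partial>count_space (p ` \<D>)) \<le>
          (\<integral>\<^sup>+K. emeasure lborel (cball (fst (p K)) (snd (p K))) \<partial>count_space \<D>)"
    proof -
      \<comment> \<open>The choice \<open>p\<close> need not be injective; a set E of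
        representatives makes it a bijection onto the family of balls.\<close>
      obtain E where E: "E \<subseteq> \<D>" "bij_betw p E (p ` \<D>)"
        by (metis subset_image_inj[of "p ` \<D>" p \<D>] bij_betw_def order_refl)
      have "(\<integral>\<^sup>+q. emeasure lborel (cball (fst q) (snd q)) \<partial>count_space (p ` \<D>)) =
            (\<integral>\<^sup>+K. emeasure lborel (cball (fst (p K)) (snd (p K))) \<partial>count_space E)"
        by (rule nn_integral_bij_count_space[OF E(2), symmetric])
      also have "\<dots> \<le> (\<integral>\<^sup>+K. emeasure lborel (cball (fst (p K)) (snd (p K))) \<partial>count_space \<D>)"
        using E(1) by (auto simp: nn_integral_count_space_indicator indicator_def intro!: nn_integral_mono)
      finally show ?thesis .
    qed
    also have "\<dots> = (\<integral>\<^sup>+K. ennreal ?\<kappa> * emeasure lborel (interior K) \<partial>count_space \<D>)"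
      using p by (intro nn_integral_cong) auto
    also have "\<dots> = ennreal ?\<kappa> * (\<integral>\<^sup>+K. emeasure lborel (interior K) \<partial>count_space \<D>)"
      by (rule nn_integral_cmult) auto
    also have "\<dots> \<le> ennreal ?\<kappa> * ennreal \<epsilon>" using int by (rule mult_left_mono) auto
    also have "\<dots> = ennreal (?\<kappa> * \<epsilon>)" using \<kappa> \<epsilon> by (intro ennreal_mult[symmetric]) auto
    also have "\<dots> \<le> ennreal \<eta>" by (intro ennreal_leI) (use \<kappa> in \<open>unfold \<epsilon>_def, metis less_irrefl nonzero_mult_div_cancel_left times_divide_eq_right min.cobounded1\<close>)
    finally show "(\<integral>\<^sup>+q. emeasure lborel (cball (fst q) (snd q)) \<partial>count_space (p ` \<D>)) \<le> ennreal \<eta>" .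
  qed
qed

text \<open>Vitali's theorem fills W up to a null set by disjoint balls inside an open set T
  exceeding W by less than \<eta> / 2, so their volumes add up to at most that of T. The null set
  costs another \<eta> / 2 by \<open>negligible_ball_cover\<close>.\<close>

lemma efficient_ball_cover:
  fixes W :: "'a::euclidean_space set"
  assumes W: "W \<in> sets borel" "bounded W" and \<delta>: "\<delta> > 0" and \<eta>: "\<eta> > 0"
  obtains c :: "nat \<Rightarrow> 'a" and r where "\<And>n. 0 \<le> r n \<and> r n < \<delta>" "W \<subseteq> (\<Union>n. cball (c n) (r n))"
    "(\<Sum>n. emeasure lborel (cball (c n) (r n))) \<le> emeasure lborel W + ennreal \<eta>"
proof -
  have Wl: "W \<in> lmeasurable" using W
    by (intro bounded_set_imp_lmeasurable) auto
  obtain T where T: "open T" "W \<subseteq> T" "(T - W) \<in> lmeasurable" "emeasure lebesgue (T - W) < ennreal (\<eta> / 2)"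
    using sets_lebesgue_outer_open[of W "\<eta> / 2"] W(1) \<eta> by auto
  let ?K = "{p::'a \<times> real. 0 < snd p \<and> snd p < \<delta> \<and> cball (fst p) (snd p) \<subseteq> T}"
  obtain C where C: "countable C" "C \<subseteq> ?K"
     "pairwise (\<lambda>i j. disjnt (cball (fst i) (snd i)) (cball (fst j) (snd j))) C"
     "negligible (W - (\<Union>i \<in> C. cball (fst i) (snd i)))"
  proof (rule Vitali_covering_theorem_cballs[of ?K snd W fst])
    fix x and d :: real assume x: "x \<in> W" and d: "0 < d"
    obtain s where s: "s > 0" "cball x s \<subseteq> T"
      using T(1,2) x by (meson open_contains_cball subsetD)
    let ?r = "min s (min (\<delta> / 2) (d / 2))"
    have "cball x ?r \<subseteq> T" using s(2) by (auto simp: subset_iff)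
    then show "\<exists>i. i \<in> ?K \<and> x \<in> cball (fst i) (snd i) \<and> snd i < d"
      using s(1) d \<delta> by (intro exI[of _ "(x, ?r)"]) auto
  qed auto
  have CT: "(\<integral>\<^sup>+p. emeasure lborel (cball (fst p) (snd p)) \<partial>count_space C) \<le> emeasure lborel W + ennreal (\<eta> / 2)"
  proof -
    have "(\<integral>\<^sup>+p. emeasure lborel (cball (fst p) (snd p)) \<partial>count_space C) = emeasure lborel (\<Union>p\<in>C. cball (fst p) (snd p))"
      using C(1,3) by (subst emeasure_UN_countable) (auto simp: disjoint_family_on_def pairwise_def disjnt_def)
    also have "\<dots> \<le> emeasure lborel T" using C(2) T(1) by (intro emeasure_mono) auto
    also have "\<dots> = emeasure lebesgue (W \<union> (T - W))" using T(1,2) by (simp add: Un_absorb1)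
    also have "\<dots> \<le> emeasure lebesgue W + emeasure lebesgue (T - W)"
      using T(3) W by (intro emeasure_subadditive) auto
    also have "\<dots> \<le> emeasure lborel W + ennreal (\<eta> / 2)"
      using T(4) W(1) by (intro add_mono) auto
    finally show ?thesis .
  qed
  have bd: "bounded (W - (\<Union>i \<in> C. cball (fst i) (snd i)))" using W(2) by (rule bounded_subset) auto
  have \<eta>2: "\<eta> / 2 > 0" using \<eta> by simp
  obtain C' :: "('a \<times> real) set" where C': "countable C'" "\<And>p. p \<in> C' \<Longrightarrow> 0 \<le> snd p \<and> snd p < \<delta>"
    "W - (\<Union>i \<in> C. cball (fst i) (snd i)) \<subseteq> (\<Union>p\<in>C'. cball (fst p) (snd p))"
    "(\<integral>\<^sup>+p. emeasure lborel (cball (fst p) (snd p)) \<partial>count_space C') \<le> ennreal (\<eta> / 2)"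
    by (rule negligible_ball_cover[OF C(4) bd \<delta> \<eta>2]) (rule that)
  have cnt: "countable (C \<union> C')" using C(1) C'(1) by simp
  have rad: "0 \<le> snd p \<and> snd p < \<delta>" if "p \<in> C \<union> C'" for p using that C(2) C'(2) by fastforce
  obtain c :: "nat \<Rightarrow> 'a" and r where cr: "\<And>n. 0 \<le> r n \<and> r n < \<delta>"
    "(\<Union>p\<in>C \<union> C'. cball (fst p) (snd p)) \<subseteq> (\<Union>n. cball (c n) (r n))"
    "(\<Sum>n. emeasure lborel (cball (c n) (r n))) \<le> (\<integral>\<^sup>+p. emeasure lborel (cball (fst p) (snd p)) \<partial>count_space (C \<union> C'))"
    by (rule enumerate_countable_cover[OF cnt _ \<delta>]) (rule rad, assumption, rule that)
  have "(\<integral>\<^sup>+p. emeasure lborel (cball (fst p) (snd p)) \<partial>count_space (C \<union> C')) \<le>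
        (\<integral>\<^sup>+p. emeasure lborel (cball (fst p) (snd p)) \<partial>count_space C) + (\<integral>\<^sup>+p. emeasure lborel (cball (fst p) (snd p)) \<partial>count_space C')"
    by (subst (1 2 3) nn_integral_count_space_indicator, simp_all, subst nn_integral_add[symmetric])
      (auto simp: indicator_def intro!: nn_integral_mono)
  also have "\<dots> \<le> (emeasure lborel W + ennreal (\<eta> / 2)) + ennreal (\<eta> / 2)"
    by (intro add_mono CT C'(4))
  also have "\<dots> = emeasure lborel W + ennreal \<eta>"
    using \<eta> by (simp add: add.assoc ennreal_plus[symmetric] del: ennreal_plus)
  finally have sum: "(\<Sum>n. emeasure lborel (cball (c n) (r n))) \<le> emeasure lborel W + ennreal \<eta>"
    using cr(3) by (rule order_trans[rotated])
  have "W \<subseteq> (\<Union>p\<in>C \<union> C'. cball (fst p) (snd p))"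
  proof
    fix y assume "y \<in> W"
    then have "y \<in> (\<Union>i \<in> C. cball (fst i) (snd i)) \<or> y \<in> (\<Union>p\<in>C'. cball (fst p) (snd p))"
      using subsetD[OF C'(3), of y] by (cases "y \<in> (\<Union>i \<in> C. cball (fst i) (snd i))") simp_all
    then show "y \<in> (\<Union>p\<in>C \<union> C'. cball (fst p) (snd p))" by auto
  qed
  then have "W \<subseteq> (\<Union>n. cball (c n) (r n))" using cr(2) by (rule order_trans)
  then show thesis using cr(1) sum that by blast
qed

lemma emeasure_shifted_slab_cylinder:
  fixes e :: "'a::euclidean_space"
  assumes e: "e \<in> Basis"
  shows "emeasure lborel {y. p \<bullet> e \<le> y \<bullet> e \<and> y \<bullet> e \<le> p \<bullet> e + 1 \<and> norm (perp e (y - p)) \<le> r} =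
         emeasure (perp_lborel e) (cball 0 r)"
proof -
  let ?W = "{y. p \<bullet> e \<le> y \<bullet> e \<and> y \<bullet> e \<le> p \<bullet> e + 1 \<and> norm (perp e (y - p)) \<le> r}"
  have "emeasure lborel ?W = emeasure (distr lborel borel ((+) p)) ?W"
    by (simp add: lborel_distr_plus)
  also have "\<dots> = emeasure lborel ((+) p -` ?W \<inter> space lborel)"
    by (rule emeasure_distr) measurable
  also have "(+) p -` ?W \<inter> space lborel = {y. 0 \<le> y \<bullet> e \<and> y \<bullet> e \<le> 0 + 1 \<and> norm (perp e y) \<le> r}"
    by (auto simp: inner_add_left)
  finally show ?thesis using emeasure_slab_cylinder[OF e, of 0 r] by simp
qed

text \<open>Given a cover of the disc, thicken the trace of each covering set on the hyperplane to
  height 1. The thickened sets cover the cylinder over the disc, and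
  \<open>isodiametric_slab\<close> bounds the volume of each by its weight. One scale, \<delta> = 1,
  is enough because \<open>hausdorff_measure\<close> is a supremum.\<close>

lemma hausdorff_measure_disc_ge:
  fixes e p :: "'a::euclidean_space"
  assumes e: "e \<in> Basis"
  shows "emeasure (perp_lborel e) (cball 0 R) \<le> hausdorff_measure (DIM('a) - 1) (cball p R \<inter> {y. y \<bullet> e = p \<bullet> e})"
proof -
  let ?k = "DIM('a) - 1" and ?S = "cball p R \<inter> {y. y \<bullet> e = p \<bullet> e}"
  let ?W = "{y. p \<bullet> e \<le> y \<bullet> e \<and> y \<bullet> e \<le> p \<bullet> e + 1 \<and> norm (perp e (y - p)) \<le> R}"
  have "emeasure lborel ?W \<le> hausdorff_content ?k 1 ?S"
    unfolding hausdorff_content_def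
  proof (rule INF_greatest)
    fix U :: "nat \<Rightarrow> 'a set"
    assume "U \<in> {U. ?S \<subseteq> (\<Union>n. U n) \<and> (\<forall>n. bounded (U n) \<and> diameter (U n) \<le> 1)}"
    then have cov: "?S \<subseteq> (\<Union>n. U n)" and bd: "\<And>n. bounded (U n)" by auto
    \<comment> \<open>Covering sets are arbitrary; the closure makes the trace Borel and keeps its
      diameter.\<close>
    define C where "C n = closure (U n \<inter> {y. y \<bullet> e = p \<bullet> e})" for n
    define V where "V n = {y. p \<bullet> e \<le> y \<bullet> e \<and> y \<bullet> e \<le> p \<bullet> e + 1 \<and> perp e y + (p \<bullet> e) *\<^sub>R e \<in> C n}" for n
    have [measurable]: "C n \<in> sets borel" for n unfolding C_def by simp
    have V_meas: "V n \<in> sets borel" for n unfolding V_def by measurable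
    have "?W \<subseteq> (\<Union>n. V n)"
    proof
      fix y assume y: "y \<in> ?W"
      let ?z = "perp e y + (p \<bullet> e) *\<^sub>R e"
      have "?z - p = perp e (y - p)" by (simp add: perp_def algebra_simps)
      then have "norm (p - ?z) = norm (perp e (y - p))" by (metis norm_minus_commute)
      then have "norm (p - ?z) \<le> R" using y by simp
      moreover have "?z \<bullet> e = p \<bullet> e" using e by (simp add: inner_add_left)
      ultimately have "?z \<in> ?S" by (simp add: dist_norm)
      then obtain n where "?z \<in> U n" using cov by blast
      with \<open>?z \<in> ?S\<close> have "?z \<in> C n" unfolding C_def by (intro subsetD[OF closure_subset]) simp
      then show "y \<in> (\<Union>n. V n)" using y by (auto simp: V_def)
    qed
    then have "emeasure lborel ?W \<le> emeasure lborel (\<Union>n. V n)"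
      by (rule emeasure_mono) (simp, intro sets.countable_UN, simp add: V_meas image_subset_iff)
    also have "\<dots> \<le> (\<Sum>n. emeasure lborel (V n))"
      by (rule emeasure_subadditive_countably) (simp add: V_meas image_subset_iff)
    also have "\<dots> \<le> (\<Sum>n. hausdorff_weight ?k (U n))"
    proof (intro suminf_le summableI)
      fix n
      show "emeasure lborel (V n) \<le> hausdorff_weight ?k (U n)"
      proof (cases "U n \<inter> {y. y \<bullet> e = p \<bullet> e} = {}")
        case True
        then have "V n = {}" by (simp add: V_def C_def)
        then show ?thesis by simp
      next
        case False
        have bC: "bounded (C n)" unfolding C_def using bd by (intro bounded_closure bounded_Int) auto
        have "emeasure lborel (V n) \<le> ennreal (unit_ball_vol (real ?k) * (diameter (C n) / 2) ^ ?k)"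
        proof (rule isodiametric_slab[OF e V_meas])
          show "V n \<subseteq> {y. p \<bullet> e \<le> y \<bullet> e \<and> y \<bullet> e \<le> p \<bullet> e + 1}" by (auto simp: V_def)
          show "0 \<le> diameter (C n)" by (rule diameter_ge_0[OF bC])
          fix y y' assume "y \<in> V n" "y' \<in> V n"
          then have "dist (perp e y + (p \<bullet> e) *\<^sub>R e) (perp e y' + (p \<bullet> e) *\<^sub>R e) \<le> diameter (C n)"
            using bC by (intro diameter_bounded_bound) (auto simp: V_def)
          then show "norm (perp e y - perp e y') \<le> diameter (C n)" by (simp add: dist_norm)
        qed
        also have "diameter (C n) = diameter (U n \<inter> {y. y \<bullet> e = p \<bullet> e})"
          unfolding C_def using bd by (intro diameter_closure bounded_Int) auto
        also have "ennreal (unit_ball_vol (real ?k) * (diameter (U n \<inter> {y. y \<bullet> e = p \<bullet> e}) / 2) ^ ?k) \<le>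
                   ennreal (unit_ball_vol (real ?k) * (diameter (U n) / 2) ^ ?k)"
          using bd[of n] by (intro ennreal_leI mult_left_mono power_mono divide_right_mono diameter_subset)
            (auto intro!: diameter_ge_0 bounded_Int)
        also have "\<dots> = hausdorff_weight ?k (U n)" using False by (auto simp: hausdorff_weight_def)
        finally show ?thesis .
      qed
    qed
    finally show "emeasure lborel ?W \<le> (\<Sum>n. hausdorff_weight ?k (U n))" .
  qed
  also have "\<dots> \<le> hausdorff_measure ?k ?S"
    unfolding hausdorff_measure_def by (rule SUP_upper) simp
  finally show ?thesis by (simp add: emeasure_shifted_slab_cylinder[OF e])
qed

text \<open>The slice at height t lies in a disc whose radius is the square root in the bound, so
  its diameter is at most twice that; an empty slice has weight 0, whence the indicator. The
  translation by u serves to bring slices of different heights into one hyperplane.\<close>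

lemma hausdorff_weight_ball_slice:
  fixes c e u :: "'a::euclidean_space" and t :: real
  assumes e: "e \<in> Basis" and r: "r \<ge> 0"
  defines "U \<equiv> (\<lambda>y. y + u) ` (cball c r \<inter> {y. y \<bullet> e = t})"
  shows "hausdorff_weight k U \<le> indicator {c \<bullet> e - r..c \<bullet> e + r} t *
             ennreal (unit_ball_vol (real k) * (sqrt (r\<^sup>2 - (t - c \<bullet> e)\<^sup>2)) ^ k)"
    and "bounded U" and "diameter U \<le> 2 * r"
proof -
  let ?\<rho> = "sqrt (r\<^sup>2 - (t - c \<bullet> e)\<^sup>2)"
  have *: "\<bar>t - c \<bullet> e\<bar> \<le> r \<and> norm (perp e (y - c)) \<le> ?\<rho>" if "y \<in> cball c r" "y \<bullet> e = t" for y
  proof -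
    have "norm (y - c) \<le> r" using that by (simp add: dist_norm norm_minus_commute)
    then have "(norm (y - c))\<^sup>2 \<le> r\<^sup>2" by (intro power_mono) auto
    then have 1: "(norm (perp e (y - c)))\<^sup>2 + (t - c \<bullet> e)\<^sup>2 \<le> r\<^sup>2"
      using norm_perp_decomp[OF e, of "y - c"] that by (simp add: inner_diff_left)
    then have "(t - c \<bullet> e)\<^sup>2 \<le> r\<^sup>2" using zero_le_power2[of "norm (perp e (y - c))"] by linarith
    then have "\<bar>t - c \<bullet> e\<bar> \<le> r" using r by (simp add: abs_le_square_iff[symmetric])
    moreover have "norm (perp e (y - c)) \<le> ?\<rho>" using 1 by (simp add: real_le_rsqrt)
    ultimately show ?thesis by simp
  qed
  show bdU: "bounded U" unfolding U_def
    unfolding add.commute[of _ u] by (intro bounded_translation bounded_Int) auto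
  have d: "diameter U \<le> 2 * \<rho>" if "\<rho> \<ge> 0" "\<And>y. y \<in> cball c r \<Longrightarrow> y \<bullet> e = t \<Longrightarrow> norm (perp e (y - c)) \<le> \<rho>" for \<rho>
  proof (rule diameter_le)
    fix x y assume "x \<in> U" "y \<in> U"
    then obtain x' y' where x': "x = x' + u" "x' \<in> cball c r" "x' \<bullet> e = t" and y': "y = y' + u" "y' \<in> cball c r" "y' \<bullet> e = t"
      by (auto simp: U_def)
    have "x - y = perp e (x' - c) - perp e (y' - c)"
      using x' y' by (simp add: perp_def algebra_simps)
    then have "norm (x - y) \<le> norm (perp e (x' - c)) + norm (perp e (y' - c))"
      using norm_triangle_ineq4 by metis
    then show "norm (x - y) \<le> 2 * \<rho>" using that(2)[OF x'(2,3)] that(2)[OF y'(2,3)] by linarith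
  qed (use that in auto)
  have "norm (perp e (y - c)) \<le> r" if "y \<in> cball c r" for y
    using norm_perp_le[OF e, of "y - c"] that by (simp add: dist_norm norm_minus_commute)
  then show "diameter U \<le> 2 * r" using d[of r] r by auto
  show "hausdorff_weight k U \<le> indicator {c \<bullet> e - r..c \<bullet> e + r} t * ennreal (unit_ball_vol (real k) * ?\<rho> ^ k)"
  proof (cases "U = {}")
    case False
    then obtain y where y: "y \<in> cball c r" "y \<bullet> e = t" unfolding U_def by blast
    with * have t: "\<bar>t - c \<bullet> e\<bar> \<le> r" by blast
    then have "(t - c \<bullet> e)\<^sup>2 \<le> r\<^sup>2" using r by (simp add: abs_le_square_iff[symmetric])
    then have "?\<rho> \<ge> 0" by simp
    then have "diameter U / 2 \<le> ?\<rho>" using d[of ?\<rho>] * by auto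
    then have "unit_ball_vol (real k) * (diameter U / 2) ^ k \<le> unit_ball_vol (real k) * ?\<rho> ^ k"
      using diameter_ge_0[OF bdU] by (intro mult_left_mono power_mono) auto
    then have "ennreal (unit_ball_vol (real k) * (diameter U / 2) ^ k) \<le> ennreal (unit_ball_vol (real k) * ?\<rho> ^ k)"
      by (rule ennreal_leI)
    moreover have "t \<in> {c \<bullet> e - r..c \<bullet> e + r}" using t by auto
    ultimately show ?thesis using False by (simp add: hausdorff_weight_def)
  qed (simp add: hausdorff_weight_def)
qed

text \<open>For the upper bound take an efficient ball cover of the cylinder of height 1 over the
  disc. At every height t the slices of the balls, moved to the hyperplane of the disc, cover the
  disc, so their weights dominate its content. Averaging over t turns the sum of weights into the
  total volume of the balls, which is close to the volume of the cylinder.\<close>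

theorem hausdorff_measure_disc:
  fixes e p :: "'a::euclidean_space"
  assumes e: "e \<in> Basis" and R: "R > 0"
  shows "hausdorff_measure (DIM('a) - 1) (cball p R \<inter> {y. y \<bullet> e = p \<bullet> e}) =
         ennreal (unit_ball_vol (real (DIM('a) - 1)) * R ^ (DIM('a) - 1))"
proof (rule antisym)
  let ?k = "DIM('a) - 1" and ?S = "cball p R \<inter> {y. y \<bullet> e = p \<bullet> e}"
  let ?m = "ennreal (unit_ball_vol (real (DIM('a) - 1)) * R ^ (DIM('a) - 1))"
  have K: "emeasure (perp_lborel e) (cball 0 R) = ?m"
    using R by (intro emeasure_perp_lborel_cball[OF e]) auto
  show "?m \<le> hausdorff_measure ?k ?S" using hausdorff_measure_disc_ge[OF e, of R p] K by simp
  let ?W = "{y. p \<bullet> e \<le> y \<bullet> e \<and> y \<bullet> e \<le> p \<bullet> e + 1 \<and> norm (perp e (y - p)) \<le> R}"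
  have vW: "emeasure lborel ?W = ?m" using emeasure_shifted_slab_cylinder[OF e] K by simp
  have W: "?W \<in> sets borel" by measurable
  have bW: "bounded ?W"
  proof (rule boundedI)
    fix y assume y: "y \<in> ?W"
    have "y = p + perp e (y - p) + ((y - p) \<bullet> e) *\<^sub>R e" using perp_decomp[of e "y - p"] by (simp add: algebra_simps)
    then have "norm y \<le> norm (p + perp e (y - p)) + norm (((y - p) \<bullet> e) *\<^sub>R e)"
      using norm_triangle_ineq by metis
    also have "\<dots> \<le> norm p + norm (perp e (y - p)) + \<bar>(y - p) \<bullet> e\<bar>"
      using e by (intro add_mono norm_triangle_ineq) auto
    also have "\<dots> \<le> norm p + R + 1" using y by (auto simp: inner_diff_left)
    finally show "norm y \<le> norm p + R + 1" .
  qed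
  show "hausdorff_measure ?k ?S \<le> ?m"
    unfolding hausdorff_measure_def
  proof (rule SUP_least, rule ennreal_le_epsilon)
    fix \<delta> \<eta> :: real assume "\<delta> \<in> {0<..}" and \<eta>: "\<eta> > 0"
    then have \<delta>: "\<delta> / 2 > 0" by simp
    obtain c :: "nat \<Rightarrow> 'a" and r where r: "\<And>n. 0 \<le> r n \<and> r n < \<delta> / 2" and cov: "?W \<subseteq> (\<Union>n. cball (c n) (r n))"
      and vol: "(\<Sum>n. emeasure lborel (cball (c n) (r n))) \<le> emeasure lborel ?W + ennreal \<eta>"
      by (rule efficient_ball_cover[OF W bW \<delta> \<eta>]) (rule that)
    let ?w = "\<lambda>n t. indicator {c n \<bullet> e - r n..c n \<bullet> e + r n} t *
             ennreal (unit_ball_vol (real ?k) * (sqrt ((r n)\<^sup>2 - (t - c n \<bullet> e)\<^sup>2)) ^ ?k)"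
    have slice: "hausdorff_content ?k \<delta> ?S \<le> (\<Sum>n. ?w n t)" if t: "t \<in> {p \<bullet> e..p \<bullet> e + 1}" for t
    proof -
      define U where "U n = (\<lambda>y. y + (p \<bullet> e - t) *\<^sub>R e) ` (cball (c n) (r n) \<inter> {y. y \<bullet> e = t})" for n
      have "?S \<subseteq> (\<Union>n. U n)"
      proof
        fix y assume y: "y \<in> ?S"
        let ?z = "y + (t - p \<bullet> e) *\<^sub>R e"
        have ze: "?z \<bullet> e = t" using y e by (simp add: inner_add_left)
        have "norm (perp e (?z - p)) \<le> norm (y - p)"
          using norm_perp_le[OF e, of "y - p"] e by (simp add: perp_add perp_diff perp_scaleR)
        then have "?z \<in> ?W" using y t ze by (auto simp: dist_norm norm_minus_commute)
        then obtain n where "?z \<in> cball (c n) (r n)" using cov by blast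
        then have "?z + (p \<bullet> e - t) *\<^sub>R e \<in> U n" using ze by (auto simp: U_def)
        then show "y \<in> (\<Union>n. U n)" by (auto simp: algebra_simps)
      qed
      moreover have "bounded (U n)" "diameter (U n) \<le> \<delta>" for n
        using hausdorff_weight_ball_slice(2,3)[OF e, of "r n" "(p \<bullet> e - t) *\<^sub>R e" "c n" t] r[of n] by (auto simp: U_def)
      ultimately have "hausdorff_content ?k \<delta> ?S \<le> (\<Sum>n. hausdorff_weight ?k (U n))"
        unfolding hausdorff_content_def by (intro INF_lower) auto
      also have "\<dots> \<le> (\<Sum>n. ?w n t)"
        unfolding U_def using r by (intro suminf_le hausdorff_weight_ball_slice(1)[OF e]) auto
      finally show ?thesis .
    qed
    \<comment> \<open>The interval of heights has length 1, so integrating the constant over it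
      changes nothing.\<close>
    have "hausdorff_content ?k \<delta> ?S = (\<integral>\<^sup>+t. hausdorff_content ?k \<delta> ?S * indicator {p \<bullet> e..p \<bullet> e + 1} t \<partial>lborel)"
      by (simp add: nn_integral_cmult)
    also have "\<dots> \<le> (\<integral>\<^sup>+t. (\<Sum>n. ?w n t) \<partial>lborel)"
      using slice by (intro nn_integral_mono) (auto simp: indicator_def)
    also have "\<dots> = (\<Sum>n. (\<integral>\<^sup>+t. ?w n t \<partial>lborel))"
      by (rule nn_integral_suminf) measurable
    also have "\<dots> = (\<Sum>n. emeasure lborel (cball (c n) (r n)))"
      using nn_integral_cball_slices[OF e] r by simp
    also have "\<dots> \<le> ?m + ennreal \<eta>" using vol vW by simp
    finally show "hausdorff_content ?k \<delta> ?S \<le> ?m + ennreal \<eta>" .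
  qed
qed

section \<open>Random sums over point processes\<close>

lemma locally_finite_finite: "locally_finite \<phi> \<Longrightarrow> bounded \<phi> \<Longrightarrow> finite \<phi>"
  unfolding locally_finite_def by (metis Int_absorb)

lemma space_configs: "space configs = {\<phi>. locally_finite \<phi>}"
  unfolding configs_def by (rule space_measure_of) auto

lemma sets_configs:
  "sets configs = sigma_sets {\<phi>. locally_finite \<phi>}
     {{\<phi>. locally_finite \<phi> \<and> card (\<phi> \<inter> B) = n} | B n. B \<in> sets borel \<and> bounded B}"
  unfolding configs_def by (rule sets_measure_of) auto

lemma measurable_card_configs:
  assumes "B \<in> sets borel" "bounded B"
  shows "(\<lambda>\<phi>. card (\<phi> \<inter> B)) \<in> measurable configs (count_space UNIV)"
  unfolding measurable_count_space_eq2_countable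
proof (intro conjI ballI)
  fix n
  have "(\<lambda>\<phi>. card (\<phi> \<inter> B)) -` {n} \<inter> space configs = {\<phi>. locally_finite \<phi> \<and> card (\<phi> \<inter> B) = n}"
    by (auto simp: space_configs)
  also have "\<dots> \<in> sets configs"
    unfolding sets_configs using assms by (intro sigma_sets.Basic) auto
  finally show "(\<lambda>\<phi>. card (\<phi> \<inter> B)) -` {n} \<inter> space configs \<in> sets configs" .
qed simp

lemma measurable_into_configs:
  fixes X :: "'w \<Rightarrow> 'a::euclidean_space set"
  assumes lf: "\<And>\<omega>. \<omega> \<in> space N \<Longrightarrow> locally_finite (X \<omega>)"
    and card: "\<And>B. B \<in> sets borel \<Longrightarrow> bounded B \<Longrightarrow> (\<lambda>\<omega>. card (X \<omega> \<inter> B)) \<in> measurable N (count_space UNIV)"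
  shows "X \<in> measurable N configs"
  unfolding configs_def
proof (rule measurable_measure_of)
  fix S :: "'a set set" assume "S \<in> {{\<phi>. locally_finite \<phi> \<and> card (\<phi> \<inter> B) = n} | B n. B \<in> sets borel \<and> bounded B}"
  then obtain B n where S: "S = {\<phi>. locally_finite \<phi> \<and> card (\<phi> \<inter> B) = n}" and B: "B \<in> sets borel" "bounded B"
    by auto
  have "X -` S \<inter> space N = (\<lambda>\<omega>. card (X \<omega> \<inter> B)) -` {n} \<inter> space N" using lf by (auto simp: S)
  also have "\<dots> \<in> sets N" using card[OF B] by (rule measurable_sets) simp
  finally show "X -` S \<inter> space N \<in> sets N" .
qed (use lf in auto)

lemma measurable_configs_locally_finite:
  "X \<in> measurable N configs \<Longrightarrow> \<omega> \<in> space N \<Longrightarrow> locally_finite (X \<omega>)"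
  using measurable_space[of X N configs \<omega>] by (simp add: space_configs)

lemma nn_integral_point_indicator:
  assumes "finite (\<phi> \<inter> B)"
  shows "(\<integral>\<^sup>+y. indicator B y \<partial>count_space \<phi>) = of_nat (card (\<phi> \<inter> B))"
proof -
  have "(\<integral>\<^sup>+y. indicator B y \<partial>count_space \<phi>) = (\<integral>\<^sup>+y. indicator (\<phi> \<inter> B) y \<partial>count_space \<phi>)"
    by (intro nn_integral_cong) (auto simp: indicator_def)
  also have "\<dots> = emeasure (count_space \<phi>) (\<phi> \<inter> B)"
    by (rule nn_integral_indicator) simp
  also have "\<dots> = of_nat (card (\<phi> \<inter> B))"
    using assms by (intro emeasure_count_space_finite) auto
  finally show ?thesis .
qed

text \<open>Dynkin's argument from rectangles, where the sum reduces to a count. The bounded window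
  W keeps all values finite, which the subtraction in the complement step requires. Sums over a
  configuration are written as integrals over \<open>count_space\<close>, so that convergence
  theorems apply to them.\<close>

lemma measurable_random_count:
  fixes \<Phi> :: "'w \<Rightarrow> 'a::euclidean_space set"
  assumes \<Phi>: "\<Phi> \<in> measurable N configs" and W: "W \<in> sets borel" "bounded W"
    and G: "G \<in> sets (borel \<Otimes>\<^sub>M N)"
  shows "(\<lambda>\<omega>. \<integral>\<^sup>+y. indicator W y * indicator G (y, \<omega>) \<partial>count_space (\<Phi> \<omega>)) \<in> borel_measurable N"
proof -
  let ?I = "\<lambda>G \<omega>. \<integral>\<^sup>+y. indicator W y * indicator G (y, \<omega>) \<partial>count_space (\<Phi> \<omega>) :: ennreal"
  have fin: "finite (\<Phi> \<omega> \<inter> B)" if "\<omega> \<in> space N" "bounded B" for \<omega> B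
    using measurable_configs_locally_finite[OF \<Phi> that(1)] that(2) by (simp add: locally_finite_def)
  have card: "(\<lambda>\<omega>. \<integral>\<^sup>+y. indicator B y \<partial>count_space (\<Phi> \<omega>) :: ennreal) \<in> borel_measurable N"
    if "B \<in> sets borel" "bounded B" for B
  proof (subst measurable_cong)
    show "(\<integral>\<^sup>+y. indicator B y \<partial>count_space (\<Phi> \<omega>)) = ennreal (real (card (\<Phi> \<omega> \<inter> B)))" if "\<omega> \<in> space N" for \<omega>
      using fin[OF that \<open>bounded B\<close>] by (simp add: nn_integral_point_indicator ennreal_of_nat_eq_real_of_nat)
    have "(\<lambda>\<omega>. card (\<Phi> \<omega> \<inter> B)) \<in> measurable N (count_space UNIV)"
      using measurable_compose[OF \<Phi> measurable_card_configs[OF that]] .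
    then show "(\<lambda>\<omega>. ennreal (real (card (\<Phi> \<omega> \<inter> B)))) \<in> borel_measurable N" by measurable
  qed
  have "Int_stable {a \<times> b |a b. a \<in> sets (borel :: 'a measure) \<and> b \<in> sets N}"
    by (rule Int_stable_pair_measure_generator)
  moreover have "{a \<times> b |a b. a \<in> sets (borel :: 'a measure) \<and> b \<in> sets N} \<subseteq> Pow (space borel \<times> space N)"
    by (rule pair_measure_closed)
  moreover have "G \<in> sigma_sets (space borel \<times> space N) {a \<times> b |a b. a \<in> sets (borel :: 'a measure) \<and> b \<in> sets N}"
    using G by (simp add: sets_pair_measure)
  ultimately show "?I G \<in> borel_measurable N"
  proof (induction rule: sigma_sets_induct_disjoint)
    case (basic A)
    then obtain a b where ab: "A = a \<times> b" "a \<in> sets borel" "b \<in> sets N" by auto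
    have "?I A \<omega> = (\<integral>\<^sup>+y. indicator (W \<inter> a) y \<partial>count_space (\<Phi> \<omega>)) * indicator b \<omega>" for \<omega>
      by (subst nn_integral_multc[symmetric]) (auto simp: ab indicator_def intro!: nn_integral_cong)
    moreover have "(\<lambda>\<omega>. \<integral>\<^sup>+y. indicator (W \<inter> a) y \<partial>count_space (\<Phi> \<omega>) :: ennreal) \<in> borel_measurable N"
      using W ab by (intro card) (auto intro: bounded_Int)
    ultimately show ?case using ab(3) by simp
  next
    case empty
    show ?case by simp
  next
    case (compl A)
    have "?I (space borel \<times> space N - A) \<omega> = (\<integral>\<^sup>+y. indicator W y \<partial>count_space (\<Phi> \<omega>)) - ?I A \<omega>"
      if \<omega>: "\<omega> \<in> space N" for \<omega>
    proof -
      have le: "?I A \<omega> \<le> (\<integral>\<^sup>+y. indicator W y \<partial>count_space (\<Phi> \<omega>))"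
        by (intro nn_integral_mono) (auto simp: indicator_def)
      moreover have "(\<integral>\<^sup>+y. indicator W y \<partial>count_space (\<Phi> \<omega>)) < \<infinity>"
        using fin[OF \<omega> W(2)] by (simp add: nn_integral_point_indicator of_nat_less_top)
      ultimately have "?I A \<omega> < \<infinity>" by (rule le_less_trans)
      then have "?I A \<omega> \<noteq> \<infinity>" by simp
      moreover have "?I (space borel \<times> space N - A) \<omega> = (\<integral>\<^sup>+y. indicator W y - indicator W y * indicator A (y, \<omega>) \<partial>count_space (\<Phi> \<omega>))"
        using \<omega> by (intro nn_integral_cong) (auto simp: indicator_def)
      ultimately show ?thesis
        by (subst nn_integral_diff[symmetric]) (auto simp: indicator_def intro!: AE_I2)
    qed
    moreover have "(\<lambda>\<omega>. (\<integral>\<^sup>+y. indicator W y \<partial>count_space (\<Phi> \<omega>)) - ?I A \<omega>) \<in> borel_measurable N"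
      using compl card[OF W] by measurable
    ultimately show ?case by (subst measurable_cong) auto
  next
    case (union A)
    have "?I (\<Union>i. A i) \<omega> = (\<Sum>i. ?I (A i) \<omega>)" for \<omega>
    proof -
      have "indicator W y * indicator (\<Union>i. A i) (y, \<omega>) = (\<Sum>i. indicator W y * indicator (A i) (y, \<omega>) :: ennreal)" for y
        using union(1) by (subst ennreal_suminf_cmult) (simp add: suminf_indicator)
      then have "?I (\<Union>i. A i) \<omega> = (\<integral>\<^sup>+y. (\<Sum>i. indicator W y * indicator (A i) (y, \<omega>)) \<partial>count_space (\<Phi> \<omega>))"
        by (rule nn_integral_cong)
      also have "\<dots> = (\<Sum>i. ?I (A i) \<omega>)" by (rule nn_integral_suminf) simp
      finally show ?thesis .
    qed
    then show ?case using union by simp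
  qed
qed

text \<open>The window is removed by exhausting the space with balls of integer radius.\<close>

lemma measurable_random_sum_indicator:
  fixes \<Phi> :: "'w \<Rightarrow> 'a::euclidean_space set"
  assumes \<Phi>: "\<Phi> \<in> measurable N configs" and G: "G \<in> sets (borel \<Otimes>\<^sub>M N)"
  shows "(\<lambda>\<omega>. \<integral>\<^sup>+y. indicator G (y, \<omega>) \<partial>count_space (\<Phi> \<omega>)) \<in> borel_measurable N"
proof -
  have "(\<integral>\<^sup>+y. indicator G (y, \<omega>) \<partial>count_space (\<Phi> \<omega>)) =
        (SUP n. \<integral>\<^sup>+y. indicator (cball 0 (real n)) y * indicator G (y, \<omega>) \<partial>count_space (\<Phi> \<omega>) :: ennreal)" for \<omega>
  proof -
    have "(\<integral>\<^sup>+y. indicator G (y, \<omega>) \<partial>count_space (\<Phi> \<omega>)) =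
          (\<integral>\<^sup>+y. (SUP n. indicator (cball 0 (real n)) y * indicator G (y, \<omega>)) \<partial>count_space (\<Phi> \<omega>) :: ennreal)"
    proof (intro nn_integral_cong antisym)
      fix y :: 'a
      obtain n where "norm y \<le> real n" using real_arch_simple by blast
      then have "indicator G (y, \<omega>) = indicator (cball 0 (real n)) y * (indicator G (y, \<omega>) :: ennreal)" by simp
      also have "\<dots> \<le> (SUP n. indicator (cball 0 (real n)) y * indicator G (y, \<omega>))" by (rule SUP_upper) simp
      finally show "indicator G (y, \<omega>) \<le> (SUP n. indicator (cball 0 (real n)) y * indicator G (y, \<omega>) :: ennreal)" .
    next
      fix y :: 'a
      show "(SUP n. indicator (cball 0 (real n)) y * indicator G (y, \<omega>) :: ennreal) \<le> indicator G (y, \<omega>)"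
        by (rule SUP_least) (auto simp: indicator_def)
    qed
    also have "\<dots> = (SUP n. \<integral>\<^sup>+y. indicator (cball 0 (real n)) y * indicator G (y, \<omega>) \<partial>count_space (\<Phi> \<omega>))"
      by (rule nn_integral_monotone_convergence_SUP) (auto simp: incseq_def le_fun_def indicator_def)
    finally show ?thesis .
  qed
  then show ?thesis
    using measurable_random_count[OF \<Phi> _ _ G] by simp
qed

lemma measurable_random_sum:
  fixes \<Phi> :: "'w \<Rightarrow> 'a::euclidean_space set" and f :: "'a \<times> 'w \<Rightarrow> ennreal"
  assumes \<Phi>: "\<Phi> \<in> measurable N configs" and f: "f \<in> borel_measurable (borel \<Otimes>\<^sub>M N)"
  shows "(\<lambda>\<omega>. \<integral>\<^sup>+y. f (y, \<omega>) \<partial>count_space (\<Phi> \<omega>)) \<in> borel_measurable N"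
  using f
proof (induction rule: borel_measurable_induct)
  case (cong f g)
  have "(\<integral>\<^sup>+y. f (y, \<omega>) \<partial>count_space (\<Phi> \<omega>)) = (\<integral>\<^sup>+y. g (y, \<omega>) \<partial>count_space (\<Phi> \<omega>))" if "\<omega> \<in> space N" for \<omega>
    using cong(3) that by (intro nn_integral_cong) (auto simp: space_pair_measure)
  then show ?case using cong(4) by (subst measurable_cong) auto
next
  case (set A)
  then show ?case by (rule measurable_random_sum_indicator[OF \<Phi>])
next
  case (mult u c)
  then show ?case by (simp add: nn_integral_cmult)
next
  case (add u v)
  then show ?case by (simp add: nn_integral_add)
next
  case (seq U)
  have "(\<integral>\<^sup>+y. (SUP i. U i) (y, \<omega>) \<partial>count_space (\<Phi> \<omega>)) = (SUP i. \<integral>\<^sup>+y. U i (y, \<omega>) \<partial>count_space (\<Phi> \<omega>))" for \<omega>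
    unfolding SUP_apply using seq.hyps(3)
    by (intro nn_integral_monotone_convergence_SUP) (auto simp: incseq_def le_fun_def)
  then show ?case using seq.IH by simp
qed

lemma measurable_random_finite_sum:
  fixes \<Phi> :: "'w \<Rightarrow> 'a::euclidean_space set" and f :: "'a \<Rightarrow> 'w \<Rightarrow> real"
  assumes \<Phi>: "\<Phi> \<in> measurable N configs" and f: "(\<lambda>(y, \<omega>). f y \<omega>) \<in> borel_measurable (borel \<Otimes>\<^sub>M N)"
    and nonneg: "\<And>y \<omega>. f y \<omega> \<ge> 0" and fin: "\<And>\<omega>. \<omega> \<in> space N \<Longrightarrow> finite (\<Phi> \<omega>)"
  shows "(\<lambda>\<omega>. \<Sum>y\<in>\<Phi> \<omega>. f y \<omega>) \<in> borel_measurable N"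
proof (subst measurable_cong)
  show "(\<Sum>y\<in>\<Phi> \<omega>. f y \<omega>) = enn2real (\<integral>\<^sup>+y. (\<lambda>(y, \<omega>). ennreal (f y \<omega>)) (y, \<omega>) \<partial>count_space (\<Phi> \<omega>))" if "\<omega> \<in> space N" for \<omega>
    using fin[OF that] nonneg by (simp add: nn_integral_count_space_finite sum_nonneg sum_ennreal)
  have "(\<lambda>p. ennreal ((\<lambda>(y, \<omega>). f y \<omega>) p)) \<in> borel_measurable (borel \<Otimes>\<^sub>M N)" using f by measurable
  then have "(\<lambda>(y, \<omega>). ennreal (f y \<omega>)) \<in> borel_measurable (borel \<Otimes>\<^sub>M N)" by (simp add: case_prod_beta)
  from measurable_random_sum[OF \<Phi> this]
  show "(\<lambda>\<omega>. enn2real (\<integral>\<^sup>+y. (\<lambda>(y, \<omega>). ennreal (f y \<omega>)) (y, \<omega>) \<partial>count_space (\<Phi> \<omega>))) \<in> borel_measurable N" by measurable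
qed

lemma measurable_point_sum:
  fixes f :: "'a::euclidean_space \<Rightarrow> ennreal"
  assumes X: "X \<in> measurable M configs" and f: "f \<in> borel_measurable borel"
  shows "(\<lambda>\<omega>. \<integral>\<^sup>+y. f y \<partial>count_space (X \<omega>)) \<in> borel_measurable M"
proof -
  have "(\<lambda>p. f (fst p)) \<in> borel_measurable (borel \<Otimes>\<^sub>M M)" using f by measurable
  from measurable_random_sum[OF X this] show ?thesis by simp
qed

text \<open>For indicators this is the definition of the intensity; the rest is linearity and
  monotone convergence. The density is cut off by \<open>indicator S\<close> because
  \<open>l\<close> is only constrained on S.\<close>

lemma campbell:
  fixes f :: "'a::euclidean_space \<Rightarrow> ennreal"
  assumes X: "point_process_on M S X" and int: "has_intensity_on M S X l"
    and S: "S \<in> sets borel" "bounded S"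
    and l: "(\<lambda>y. ennreal (l y) * indicator S y) \<in> borel_measurable borel"
    and f: "f \<in> borel_measurable borel"
  shows "(\<integral>\<^sup>+\<omega>. (\<integral>\<^sup>+y. f y \<partial>count_space (X \<omega>)) \<partial>M) = (\<integral>\<^sup>+y. f y * (ennreal (l y) * indicator S y) \<partial>lborel)"
  using f
proof (induction rule: borel_measurable_induct)
  case (cong f g)
  then have "f = g" by auto
  then show ?case using cong(4) by simp
next
  case (set A)
  have Xm: "X \<in> measurable M configs" and XS: "\<And>\<omega>. \<omega> \<in> space M \<Longrightarrow> X \<omega> \<subseteq> S"
    using X by (auto simp: point_process_on_def)
  have "(\<integral>\<^sup>+\<omega>. (\<integral>\<^sup>+y. indicator A y \<partial>count_space (X \<omega>)) \<partial>M) = (\<integral>\<^sup>+\<omega>. of_nat (card (X \<omega> \<inter> (A \<inter> S))) \<partial>M)"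
  proof (rule nn_integral_cong)
    fix \<omega> assume \<omega>: "\<omega> \<in> space M"
    have "finite (X \<omega>)"
      using locally_finite_finite[OF measurable_configs_locally_finite[OF Xm \<omega>]] XS[OF \<omega>] S(2) bounded_subset by blast
    moreover have "X \<omega> \<inter> A = X \<omega> \<inter> (A \<inter> S)" using XS[OF \<omega>] by auto
    ultimately show "(\<integral>\<^sup>+y. indicator A y \<partial>count_space (X \<omega>)) = of_nat (card (X \<omega> \<inter> (A \<inter> S)))"
      by (simp add: nn_integral_point_indicator)
  qed
  also have "\<dots> = (\<integral>\<^sup>+y\<in>A \<inter> S. ennreal (l y) \<partial>lborel)"
    using int set S by (auto simp: has_intensity_on_def bounded_Int)
  also have "\<dots> = (\<integral>\<^sup>+y. indicator A y * (ennreal (l y) * indicator S y) \<partial>lborel)"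
    by (intro nn_integral_cong) (auto simp: indicator_def)
  finally show ?case .
next
  case (mult u c)
  have Xm: "X \<in> measurable M configs" using X by (auto simp: point_process_on_def)
  have "(\<integral>\<^sup>+\<omega>. (\<integral>\<^sup>+y. c * u y \<partial>count_space (X \<omega>)) \<partial>M) = c * (\<integral>\<^sup>+\<omega>. (\<integral>\<^sup>+y. u y \<partial>count_space (X \<omega>)) \<partial>M)"
    using measurable_point_sum[OF Xm mult(2)] by (simp add: nn_integral_cmult)
  then show ?case using mult l by (simp add: nn_integral_cmult[symmetric] mult.assoc)
next
  case (add u v)
  have Xm: "X \<in> measurable M configs" using X by (auto simp: point_process_on_def)
  have "(\<integral>\<^sup>+\<omega>. (\<integral>\<^sup>+y. v y + u y \<partial>count_space (X \<omega>)) \<partial>M) =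
        (\<integral>\<^sup>+\<omega>. (\<integral>\<^sup>+y. v y \<partial>count_space (X \<omega>)) \<partial>M) + (\<integral>\<^sup>+\<omega>. (\<integral>\<^sup>+y. u y \<partial>count_space (X \<omega>)) \<partial>M)"
    using measurable_point_sum[OF Xm add(1)] measurable_point_sum[OF Xm add.hyps(3)] by (simp add: nn_integral_add)
  moreover have "(\<integral>\<^sup>+y. (v y + u y) * (ennreal (l y) * indicator S y) \<partial>lborel) =
     (\<integral>\<^sup>+y. v y * (ennreal (l y) * indicator S y) \<partial>lborel) + (\<integral>\<^sup>+y. u y * (ennreal (l y) * indicator S y) \<partial>lborel)"
    unfolding distrib_right
    using borel_measurable_times_ennreal[OF add.hyps(1) l] borel_measurable_times_ennreal[OF add.hyps(3) l]
    by (intro nn_integral_add) simp_all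
  ultimately show ?case using add by simp
next
  case (seq U)
  have Xm: "X \<in> measurable M configs" using X by (auto simp: point_process_on_def)
  have "(\<integral>\<^sup>+\<omega>. (\<integral>\<^sup>+y. (SUP i. U i) y \<partial>count_space (X \<omega>)) \<partial>M) = (\<integral>\<^sup>+\<omega>. (SUP i. \<integral>\<^sup>+y. U i y \<partial>count_space (X \<omega>)) \<partial>M)"
    unfolding SUP_apply using seq.hyps(3)
    by (intro nn_integral_cong nn_integral_monotone_convergence_SUP) (auto simp: incseq_def le_fun_def)
  also have "\<dots> = (SUP i. \<integral>\<^sup>+\<omega>. (\<integral>\<^sup>+y. U i y \<partial>count_space (X \<omega>)) \<partial>M)"
    using seq.hyps(3) measurable_point_sum[OF Xm seq(1)]
    by (intro nn_integral_monotone_convergence_SUP) (auto simp: incseq_def le_fun_def intro!: nn_integral_mono)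
  also have "\<dots> = (SUP i. \<integral>\<^sup>+y. U i y * (ennreal (l y) * indicator S y) \<partial>lborel)"
    using seq.IH by simp
  also have "\<dots> = (\<integral>\<^sup>+y. (SUP i. U i y * (ennreal (l y) * indicator S y)) \<partial>lborel)"
    using seq.hyps(1,3) l by (intro nn_integral_monotone_convergence_SUP[symmetric]) (auto simp: incseq_def le_fun_def intro!: mult_right_mono)
  also have "\<dots> = (\<integral>\<^sup>+y. (SUP i. U i) y * (ennreal (l y) * indicator S y) \<partial>lborel)"
    by (simp only: SUP_apply SUP_mult_right_ennreal)
  finally show ?case .
qed

section \<open>Variance of Poisson sums\<close>

text \<open>Both follow from the exponential series by an index shift: a factor n cancels against n!
  and leaves m times the shifted series.\<close>

lemma poisson_moment_series:
  fixes m :: real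
  shows "(\<lambda>n. real n * (m ^ n / fact n * exp (- m))) sums m"
    and "(\<lambda>n. (real n)\<^sup>2 * (m ^ n / fact n * exp (- m))) sums (m + m\<^sup>2)"
proof -
  have e0: "(\<lambda>n. m ^ n / fact n) sums exp m"
    using exp_converges[of m] by (simp add: divide_inverse mult.commute)
  have shift: "f sums s" if "(\<lambda>n. f (Suc n)) sums s" "f 0 = 0" for f :: "nat \<Rightarrow> real" and s
    using that by (simp add: sums_Suc_iff)
  have e1: "(\<lambda>n. real n * (m ^ n / fact n)) sums (m * exp m)"
  proof (rule shift)
    have "real (Suc n) * (m ^ Suc n / fact (Suc n)) = m * (m ^ n / fact n)" for n
      by (simp add: field_simps del: of_nat_Suc)
    then show "(\<lambda>n. real (Suc n) * (m ^ Suc n / fact (Suc n))) sums (m * exp m)"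
      using sums_mult[OF e0, of m] by simp
  qed simp
  have e2: "(\<lambda>n. real n * (real n * (m ^ n / fact n))) sums (m * (m * exp m + exp m))"
  proof (rule shift)
    have "real (Suc n) * (real (Suc n) * (m ^ Suc n / fact (Suc n))) = m * (real n * (m ^ n / fact n) + m ^ n / fact n)" for n
    proof -
      have "real (Suc n) * (m ^ Suc n / fact (Suc n)) = m * (m ^ n / fact n)"
        by (simp add: field_simps del: of_nat_Suc)
      then have "real (Suc n) * (real (Suc n) * (m ^ Suc n / fact (Suc n))) = real (Suc n) * (m * (m ^ n / fact n))"
        by (simp only:)
      then show ?thesis by (simp add: algebra_simps add_divide_distrib)
    qed
    then show "(\<lambda>n. real (Suc n) * (real (Suc n) * (m ^ Suc n / fact (Suc n)))) sums (m * (m * exp m + exp m))"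
      using sums_mult[OF sums_add[OF e1 e0], of m] by simp
  qed simp
  have ee: "exp m * exp (- m) = 1" by (simp add: exp_minus)
  have m1: "m * exp m * exp (- m) = m" using ee by (simp add: mult.assoc)
  show "(\<lambda>n. real n * (m ^ n / fact n * exp (- m))) sums m"
    using sums_mult2[OF e1, of "exp (- m)"] unfolding m1 by (simp only: mult.assoc)
  have "m * (m * exp m + exp m) * exp (- m) = m * (m * (exp m * exp (- m)) + exp m * exp (- m))"
    by (simp add: algebra_simps)
  then have m2: "m * (m * exp m + exp m) * exp (- m) = m + m\<^sup>2"
    using ee by (simp add: power2_eq_square algebra_simps)
  show "(\<lambda>n. (real n)\<^sup>2 * (m ^ n / fact n * exp (- m))) sums (m + m\<^sup>2)"
    using sums_mult2[OF e2, of "exp (- m)"] unfolding m2 power2_eq_square[of "real _"] by (simp only: mult.assoc)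
qed

lemma nn_integral_nat_valued:
  assumes N: "N \<in> measurable M (count_space UNIV)"
  shows "(\<integral>\<^sup>+\<omega>. F (N \<omega>) \<partial>M) = (\<Sum>n. F n * emeasure M {\<omega> \<in> space M. N \<omega> = n})"
proof -
  have [measurable]: "{\<omega> \<in> space M. N \<omega> = n} \<in> sets M" for n
    using N by measurable
  have "F (N \<omega>) = (\<Sum>n. F n * indicator {\<omega> \<in> space M. N \<omega> = n} \<omega>)" if "\<omega> \<in> space M" for \<omega>
    using that by (subst suminf_finite[of "{N \<omega>}"]) (auto simp: indicator_def)
  then have "(\<integral>\<^sup>+\<omega>. F (N \<omega>) \<partial>M) = (\<integral>\<^sup>+\<omega>. (\<Sum>n. F n * indicator {\<omega> \<in> space M. N \<omega> = n} \<omega>) \<partial>M)"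
    by (intro nn_integral_cong) auto
  also have "\<dots> = (\<Sum>n. F n * emeasure M {\<omega> \<in> space M. N \<omega> = n})"
    by (subst nn_integral_suminf) (auto simp: nn_integral_cmult)
  finally show ?thesis .
qed

locale poisson_setting =
  fixes M :: "'w measure" and S :: "'a::euclidean_space set" and X :: "'w \<Rightarrow> 'a set" and l :: "'a \<Rightarrow> real"
  assumes prob: "prob_space M"
    and poisson: "poisson_process_on M S X l"
    and intensity: "has_intensity_on M S X l"
    and S: "S \<in> sets borel" "bounded S"
    and l: "(\<lambda>y. ennreal (l y) * indicator S y) \<in> borel_measurable borel"
    and l_nonneg: "\<And>y. y \<in> S \<Longrightarrow> l y \<ge> 0" and l_set: "set_integrable lborel S l"
begin

text \<open>The integral of f with respect to the intensity measure; \<open>U f\<close> below is the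
  corresponding sum over the random points.\<close>

definition \<Lambda> :: "('a \<Rightarrow> ennreal) \<Rightarrow> ennreal" where
  "\<Lambda> f = (\<integral>\<^sup>+y. f y * (ennreal (l y) * indicator S y) \<partial>lborel)"

definition U :: "('a \<Rightarrow> ennreal) \<Rightarrow> 'w \<Rightarrow> ennreal" where
  "U f \<omega> = (\<integral>\<^sup>+y. f y \<partial>count_space (X \<omega>))"

lemma X_measurable: "X \<in> measurable M configs" and X_subset: "\<omega> \<in> space M \<Longrightarrow> X \<omega> \<subseteq> S"
  and point_process: "point_process_on M S X"
  using poisson by (auto simp: poisson_process_on_def point_process_on_def)

lemma X_finite: "\<omega> \<in> space M \<Longrightarrow> finite (X \<omega>)"
  using measurable_configs_locally_finite[OF X_measurable] X_subset S(2) bounded_subset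
    locally_finite_finite by metis

lemma U_measurable [measurable]: "f \<in> borel_measurable borel \<Longrightarrow> U f \<in> borel_measurable M"
  unfolding U_def by (rule measurable_point_sum[OF X_measurable])

lemma card_measurable:
  assumes "B \<in> sets borel" "B \<subseteq> S"
  shows "(\<lambda>\<omega>. card (X \<omega> \<inter> B)) \<in> measurable M (count_space UNIV)"
  using measurable_compose[OF X_measurable measurable_card_configs[OF assms(1) bounded_subset[OF S(2) assms(2)]]] .

lemma \<Lambda>_indicator:
  assumes B: "B \<in> sets borel" "B \<subseteq> S"
  shows "\<Lambda> (indicator B) = ennreal (LINT y:B|lborel. l y)" and "(LINT y:B|lborel. l y) \<ge> 0"
proof -
  have "set_integrable lborel B l"
    using l_set by (rule set_integrable_subset) (use B in auto)
  then have "ennreal (LINT y:B|lborel. l y) = (\<integral>\<^sup>+y. ennreal (indicator B y *\<^sub>R l y) \<partial>lborel)"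
    unfolding set_integrable_def set_lebesgue_integral_def using B l_nonneg
    by (intro nn_integral_eq_integral[symmetric]) (auto simp: indicator_def)
  also have "\<dots> = \<Lambda> (indicator B)"
    unfolding \<Lambda>_def using B by (intro nn_integral_cong) (auto simp: indicator_def)
  finally show "\<Lambda> (indicator B) = ennreal (LINT y:B|lborel. l y)" by simp
  show "(LINT y:B|lborel. l y) \<ge> 0"
    unfolding set_lebesgue_integral_def using B l_nonneg
    by (intro integral_nonneg_AE AE_I2) (auto simp: indicator_def)
qed

lemma count_moments:
  assumes B: "B \<in> sets borel" "B \<subseteq> S"
  shows "(\<integral>\<^sup>+\<omega>. of_nat (card (X \<omega> \<inter> B)) \<partial>M) = \<Lambda> (indicator B)"
    and "(\<integral>\<^sup>+\<omega>. of_nat (card (X \<omega> \<inter> B)) * of_nat (card (X \<omega> \<inter> B)) \<partial>M) =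
           \<Lambda> (indicator B) + \<Lambda> (indicator B) * \<Lambda> (indicator B)"
proof -
  interpret prob_space M by (rule prob)
  let ?m = "LINT y:B|lborel. l y"
  have pr: "emeasure M {\<omega> \<in> space M. card (X \<omega> \<inter> B) = n} = ennreal (?m ^ n / fact n * exp (- ?m))" for n
    using poisson B bounded_subset[OF S(2) B(2)]
    by (simp add: poisson_process_on_def emeasure_eq_measure)
  note m = \<Lambda>_indicator[OF B]
  have "(\<integral>\<^sup>+\<omega>. of_nat (card (X \<omega> \<inter> B)) \<partial>M) = (\<Sum>n. ennreal (real n * (?m ^ n / fact n * exp (- ?m))))"
    using nn_integral_nat_valued[OF card_measurable[OF B], of of_nat] m(2)
    by (simp add: pr ennreal_of_nat_eq_real_of_nat ennreal_mult[symmetric] del: ennreal_plus)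
  also have "\<dots> = ennreal ?m"
    using m(2) by (intro suminf_ennreal_eq poisson_moment_series) auto
  finally show "(\<integral>\<^sup>+\<omega>. of_nat (card (X \<omega> \<inter> B)) \<partial>M) = \<Lambda> (indicator B)" using m by simp
  have "(\<integral>\<^sup>+\<omega>. of_nat (card (X \<omega> \<inter> B)) * of_nat (card (X \<omega> \<inter> B)) \<partial>M) =
        (\<Sum>n. ennreal ((real n)\<^sup>2 * (?m ^ n / fact n * exp (- ?m))))"
    using nn_integral_nat_valued[OF card_measurable[OF B], of "\<lambda>n. of_nat n * of_nat n"] m(2)
    by (simp add: pr ennreal_of_nat_eq_real_of_nat ennreal_mult[symmetric] power2_eq_square)
  also have "\<dots> = ennreal (?m + ?m\<^sup>2)"
    using m(2) by (intro suminf_ennreal_eq poisson_moment_series) auto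
  finally show "(\<integral>\<^sup>+\<omega>. of_nat (card (X \<omega> \<inter> B)) * of_nat (card (X \<omega> \<inter> B)) \<partial>M) =
           \<Lambda> (indicator B) + \<Lambda> (indicator B) * \<Lambda> (indicator B)"
    using m by (simp add: ennreal_mult[symmetric] power2_eq_square)
qed

lemma count_disjoint:
  assumes B: "B \<in> sets borel" "B \<subseteq> S" and C: "C \<in> sets borel" "C \<subseteq> S" and disj: "B \<inter> C = {}"
  shows "(\<integral>\<^sup>+\<omega>. of_nat (card (X \<omega> \<inter> B)) * of_nat (card (X \<omega> \<inter> C)) \<partial>M) =
           \<Lambda> (indicator B) * \<Lambda> (indicator C)"
proof -
  interpret prob_space M by (rule prob)
  let ?F = "\<lambda>i::nat. if i = 0 then B else C"
  have lt2: "{..<2} = {0, 1::nat}" by auto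
  have "indep_vars (\<lambda>_. count_space UNIV) (\<lambda>i \<omega>. card (X \<omega> \<inter> ?F i)) {..<2}"
  proof -
    have "\<forall>i<2. ?F i \<in> sets borel \<and> bounded (?F i) \<and> ?F i \<subseteq> S"
      using B C bounded_subset[OF S(2)] by auto
    moreover have "disjoint_family_on ?F {..<2}"
      using disj by (auto simp: disjoint_family_on_def lt2)
    ultimately show ?thesis
      by (intro poisson[unfolded poisson_process_on_def, THEN conjunct2, THEN conjunct2,
          THEN spec[of _ ?F], THEN spec[of _ 2], THEN mp] conjI)
  qed
  then have "indep_vars (\<lambda>_. borel) (\<lambda>i \<omega>. (of_nat (card (X \<omega> \<inter> ?F i)) :: ennreal)) {..<2}"
    by (rule indep_vars_compose2[where Y="\<lambda>_ n. of_nat n"]) simp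
  from indep_vars_nn_integral[OF _ this] have
    "(\<integral>\<^sup>+\<omega>. (\<Prod>i<2. of_nat (card (X \<omega> \<inter> ?F i))) \<partial>M) = (\<Prod>i<2. \<integral>\<^sup>+\<omega>. of_nat (card (X \<omega> \<inter> ?F i)) \<partial>M)"
    by simp
  then show ?thesis using count_moments(1)[OF B] count_moments(1)[OF C] by (simp add: lt2)
qed

lemma \<Lambda>_union:
  assumes "A \<in> sets borel" "B \<in> sets borel" "A \<inter> B = {}"
  shows "\<Lambda> (indicator (A \<union> B)) = \<Lambda> (indicator A) + \<Lambda> (indicator B)"
proof -
  have "\<Lambda> (indicator (A \<union> B)) = (\<integral>\<^sup>+y. indicator A y * (ennreal (l y) * indicator S y) +
      indicator B y * (ennreal (l y) * indicator S y) \<partial>lborel)"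
    unfolding \<Lambda>_def using assms(3) by (intro nn_integral_cong) (auto simp: indicator_def)
  also have "\<dots> = \<Lambda> (indicator A) + \<Lambda> (indicator B)"
    unfolding \<Lambda>_def using assms borel_measurable_times_ennreal[OF borel_measurable_indicator l]
    by (intro nn_integral_add) auto
  finally show ?thesis .
qed

text \<open>Split A and B into the common part C and the remainders P and Q. The product of counts
  has four terms; three are products over disjoint sets and factorise by independence, and only the
  square of the count of C contributes the additional variance term.\<close>

lemma count_covariance:
  assumes A: "A \<in> sets borel" "A \<subseteq> S" and B: "B \<in> sets borel" "B \<subseteq> S"
  shows "(\<integral>\<^sup>+\<omega>. of_nat (card (X \<omega> \<inter> A)) * of_nat (card (X \<omega> \<inter> B)) \<partial>M) =
           \<Lambda> (indicator (A \<inter> B)) + \<Lambda> (indicator A) * \<Lambda> (indicator B)"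
proof -
  let ?C = "A \<inter> B" and ?P = "A - B" and ?Q = "B - A"
  let ?N = "\<lambda>E \<omega>. of_nat (card (X \<omega> \<inter> E)) :: ennreal"
  have s: "?C \<in> sets borel" "?C \<subseteq> S" "?P \<in> sets borel" "?P \<subseteq> S" "?Q \<in> sets borel" "?Q \<subseteq> S"
    using A B by auto
  have [measurable]: "?N E \<in> borel_measurable M" if "E \<in> sets borel" "E \<subseteq> S" for E
    using measurable_compose[OF card_measurable[OF that], of of_nat borel] by simp
  have m: "?N ?C \<in> borel_measurable M" "?N ?P \<in> borel_measurable M" "?N ?Q \<in> borel_measurable M"
    using s by measurable
  have "(\<integral>\<^sup>+\<omega>. ?N A \<omega> * ?N B \<omega> \<partial>M) =
        (\<integral>\<^sup>+\<omega>. ?N ?C \<omega> * ?N ?C \<omega> + ?N ?C \<omega> * ?N ?Q \<omega> + (?N ?P \<omega> * ?N ?C \<omega> + ?N ?P \<omega> * ?N ?Q \<omega>) \<partial>M)"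
  proof (rule nn_integral_cong)
    fix \<omega> assume "\<omega> \<in> space M"
    then have f: "finite (X \<omega>)" by (rule X_finite)
    have "?N A \<omega> = ?N ?C \<omega> + ?N ?P \<omega>" "?N B \<omega> = ?N ?C \<omega> + ?N ?Q \<omega>"
      unfolding of_nat_add[symmetric] using f
      by (subst card_Un_disjoint[symmetric]; auto intro!: arg_cong[where f=card])+
    then show "?N A \<omega> * ?N B \<omega> = ?N ?C \<omega> * ?N ?C \<omega> + ?N ?C \<omega> * ?N ?Q \<omega> + (?N ?P \<omega> * ?N ?C \<omega> + ?N ?P \<omega> * ?N ?Q \<omega>)"
      by (simp add: algebra_simps)
  qed
  also have "\<dots> = (\<integral>\<^sup>+\<omega>. ?N ?C \<omega> * ?N ?C \<omega> \<partial>M) + (\<integral>\<^sup>+\<omega>. ?N ?C \<omega> * ?N ?Q \<omega> \<partial>M) +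
      ((\<integral>\<^sup>+\<omega>. ?N ?P \<omega> * ?N ?C \<omega> \<partial>M) + (\<integral>\<^sup>+\<omega>. ?N ?P \<omega> * ?N ?Q \<omega> \<partial>M))"
    using m by (simp add: nn_integral_add)
  also have "\<dots> = (\<Lambda> (indicator ?C) + \<Lambda> (indicator ?C) * \<Lambda> (indicator ?C)) + \<Lambda> (indicator ?C) * \<Lambda> (indicator ?Q) +
      (\<Lambda> (indicator ?P) * \<Lambda> (indicator ?C) + \<Lambda> (indicator ?P) * \<Lambda> (indicator ?Q))"
  proof -
    have d: "?C \<inter> ?Q = {}" "?P \<inter> ?C = {}" "?P \<inter> ?Q = {}" by auto
    show ?thesis
      by (simp only: count_moments(2)[OF s(1,2)] count_disjoint[OF s(1,2,5,6) d(1)]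
        count_disjoint[OF s(3,4,1,2) d(2)] count_disjoint[OF s(3-6) d(3)])
  qed
  also have "\<dots> = \<Lambda> (indicator ?C) + (\<Lambda> (indicator ?C) + \<Lambda> (indicator ?P)) * (\<Lambda> (indicator ?C) + \<Lambda> (indicator ?Q))"
    by (simp add: algebra_simps)
  also have "\<Lambda> (indicator ?C) + \<Lambda> (indicator ?P) = \<Lambda> (indicator A)"
    using s by (subst \<Lambda>_union[symmetric]) (auto intro!: arg_cong[where f=\<Lambda>] arg_cong[where f=indicator])
  also have "\<Lambda> (indicator ?C) + \<Lambda> (indicator ?Q) = \<Lambda> (indicator B)"
    using s by (subst \<Lambda>_union[symmetric]) (auto intro!: arg_cong[where f=\<Lambda>] arg_cong[where f=indicator])
  finally show ?thesis .
qed

lemma U_indicator: "\<omega> \<in> space M \<Longrightarrow> U (indicator A) \<omega> = of_nat (card (X \<omega> \<inter> (A \<inter> S)))"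
proof -
  assume \<omega>: "\<omega> \<in> space M"
  have "X \<omega> \<inter> (A \<inter> S) = X \<omega> \<inter> A" using X_subset[OF \<omega>] by auto
  then show ?thesis unfolding U_def using X_finite[OF \<omega>] by (simp add: nn_integral_point_indicator)
qed

lemma \<Lambda>_indicator_Int: "\<Lambda> (\<lambda>y. indicator (A \<inter> S) y * f y) = \<Lambda> (\<lambda>y. indicator A y * f y)"
  unfolding \<Lambda>_def by (intro nn_integral_cong) (auto simp: indicator_def)

lemma U_cmult: "f \<in> borel_measurable borel \<Longrightarrow> U (\<lambda>y. c * f y) \<omega> = c * U f \<omega>"
  and U_add: "U (\<lambda>y. f y + g y) \<omega> = U f \<omega> + U g \<omega>"
  and U_SUP: "incseq F \<Longrightarrow> U (SUP i. F i) \<omega> = (SUP i. U (F i) \<omega>)"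
  unfolding U_def SUP_apply by (simp_all add: nn_integral_cmult nn_integral_add
    nn_integral_monotone_convergence_SUP)

lemma \<Lambda>_cmult: "f \<in> borel_measurable borel \<Longrightarrow> \<Lambda> (\<lambda>y. c * f y) = c * \<Lambda> f"
  unfolding \<Lambda>_def using l by (simp add: nn_integral_cmult mult.assoc)

lemma \<Lambda>_add: "f \<in> borel_measurable borel \<Longrightarrow> g \<in> borel_measurable borel \<Longrightarrow> \<Lambda> (\<lambda>y. f y + g y) = \<Lambda> f + \<Lambda> g"
  unfolding \<Lambda>_def distrib_right
  using borel_measurable_times_ennreal[of f borel, OF _ l] borel_measurable_times_ennreal[of g borel, OF _ l]
  by (intro nn_integral_add) simp_all

lemma \<Lambda>_SUP:
  assumes "incseq F" "\<And>i. F i \<in> borel_measurable borel"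
  shows "\<Lambda> (SUP i. F i) = (SUP i. \<Lambda> (F i))"
proof -
  have "\<Lambda> (SUP i. F i) = (\<integral>\<^sup>+y. (SUP i. F i y * (ennreal (l y) * indicator S y)) \<partial>lborel)"
    unfolding \<Lambda>_def by (simp only: SUP_apply SUP_mult_right_ennreal)
  also have "\<dots> = (SUP i. \<Lambda> (F i))"
    unfolding \<Lambda>_def using assms borel_measurable_times_ennreal[of _ borel, OF assms(2) l]
    by (intro nn_integral_monotone_convergence_SUP)
      (auto simp: incseq_def le_fun_def intro!: mult_right_mono)
  finally show ?thesis .
qed

lemma U_mono: "f \<le> g \<Longrightarrow> U f \<omega> \<le> U g \<omega>"
  unfolding U_def by (intro nn_integral_mono) (auto simp: le_fun_def)

text \<open>For fixed \<open>g\<close> both sides are additive and continuous under increasing limits in \<open>f\<close>.\<close>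

lemma covariance_extend:
  assumes g: "g \<in> borel_measurable borel" and f: "f \<in> borel_measurable borel"
    and base: "\<And>A. A \<in> sets borel \<Longrightarrow>
       (\<integral>\<^sup>+\<omega>. U (indicator A) \<omega> * U g \<omega> \<partial>M) = \<Lambda> (\<lambda>y. indicator A y * g y) + \<Lambda> (indicator A) * \<Lambda> g"
  shows "(\<integral>\<^sup>+\<omega>. U f \<omega> * U g \<omega> \<partial>M) = \<Lambda> (\<lambda>y. f y * g y) + \<Lambda> f * \<Lambda> g"
  using f
proof (induction rule: borel_measurable_induct)
  case (cong f h)
  then have "f = h" by auto
  then show ?case using cong(4) by simp
next
  case (set A)
  then show ?case by (intro base) auto
next
  case (mult u c)
  then show ?case using g
    by (simp add: U_cmult \<Lambda>_cmult mult.assoc nn_integral_cmult distrib_left)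
next
  case (add u v)
  then show ?case using g
    by (simp add: U_add \<Lambda>_add distrib_right nn_integral_add)
next
  case (seq F)
  have "(\<integral>\<^sup>+\<omega>. U (SUP i. F i) \<omega> * U g \<omega> \<partial>M) = (\<integral>\<^sup>+\<omega>. (SUP i. U (F i) \<omega> * U g \<omega>) \<partial>M)"
    using seq.hyps by (simp add: U_SUP SUP_mult_right_ennreal)
  also have "\<dots> = (SUP i. \<integral>\<^sup>+\<omega>. U (F i) \<omega> * U g \<omega> \<partial>M)"
    using seq.hyps g
    by (intro nn_integral_monotone_convergence_SUP borel_measurable_times_ennreal U_measurable)
       (auto simp: incseq_def le_fun_def intro!: mult_right_mono U_mono)
  also have "\<dots> = (SUP i. \<Lambda> (\<lambda>y. F i y * g y) + \<Lambda> (F i) * \<Lambda> g)"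
    using seq.IH by simp
  also have "\<dots> = (SUP i. \<Lambda> (\<lambda>y. F i y * g y)) + (SUP i. \<Lambda> (F i) * \<Lambda> g)"
    using seq.hyps(3) by (intro ennreal_SUP_add)
      (auto simp: incseq_def le_fun_def \<Lambda>_def intro!: mult_right_mono nn_integral_mono)
  also have "(SUP i. \<Lambda> (\<lambda>y. F i y * g y)) = \<Lambda> (SUP i. (\<lambda>y. F i y * g y))"
    using seq.hyps g by (intro \<Lambda>_SUP[symmetric])
      (auto simp: incseq_def le_fun_def intro!: mult_right_mono)
  also have "(SUP i. (\<lambda>y. F i y * g y)) = (\<lambda>y. (SUP i. F i) y * g y)"
    by (rule ext) (simp only: SUP_apply SUP_mult_right_ennreal)
  also have "(SUP i. \<Lambda> (F i) * \<Lambda> g) = \<Lambda> (SUP i. F i) * \<Lambda> g"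
    using seq.hyps by (simp add: \<Lambda>_SUP SUP_mult_right_ennreal)
  finally show ?case .
qed

text \<open>\<open>covariance_extend\<close> is applied twice: first with an indicator in the fixed
  slot, to pass from indicators to g, then with g in the fixed slot, to pass from indicators to
  f.\<close>

lemma second_moment:
  assumes f: "f \<in> borel_measurable borel" and g: "g \<in> borel_measurable borel"
  shows "(\<integral>\<^sup>+\<omega>. U f \<omega> * U g \<omega> \<partial>M) = \<Lambda> (\<lambda>y. f y * g y) + \<Lambda> f * \<Lambda> g"
proof (rule covariance_extend[OF g f])
  fix A :: "'a set" assume A: "A \<in> sets borel"
  have iA: "indicator A \<in> borel_measurable borel" using A by simp
  have "(\<integral>\<^sup>+\<omega>. U g \<omega> * U (indicator A) \<omega> \<partial>M) = \<Lambda> (\<lambda>y. g y * indicator A y) + \<Lambda> g * \<Lambda> (indicator A)"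
  proof (rule covariance_extend[OF iA g])
    fix B :: "'a set" assume B: "B \<in> sets borel"
    have "(\<integral>\<^sup>+\<omega>. U (indicator B) \<omega> * U (indicator A) \<omega> \<partial>M) =
      (\<integral>\<^sup>+\<omega>. of_nat (card (X \<omega> \<inter> (B \<inter> S))) * of_nat (card (X \<omega> \<inter> (A \<inter> S))) \<partial>M)"
      by (intro nn_integral_cong) (simp add: U_indicator)
    also have "\<dots> = \<Lambda> (indicator ((B \<inter> S) \<inter> (A \<inter> S))) + \<Lambda> (indicator (B \<inter> S)) * \<Lambda> (indicator (A \<inter> S))"
      using A B S by (intro count_covariance) auto
    also have "\<Lambda> (indicator ((B \<inter> S) \<inter> (A \<inter> S))) = \<Lambda> (\<lambda>y. indicator B y * indicator A y)"
      unfolding \<Lambda>_def by (intro nn_integral_cong) (auto simp: indicator_def)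
    also have "\<Lambda> (indicator (B \<inter> S)) = \<Lambda> (indicator B)" using \<Lambda>_indicator_Int[of B "\<lambda>_. 1"] by simp
    also have "\<Lambda> (indicator (A \<inter> S)) = \<Lambda> (indicator A)" using \<Lambda>_indicator_Int[of A "\<lambda>_. 1"] by simp
    finally show "(\<integral>\<^sup>+\<omega>. U (indicator B) \<omega> * U (indicator A) \<omega> \<partial>M) =
      \<Lambda> (\<lambda>y. indicator B y * indicator A y) + \<Lambda> (indicator B) * \<Lambda> (indicator A)" .
  qed
  then show "(\<integral>\<^sup>+\<omega>. U (indicator A) \<omega> * U g \<omega> \<partial>M) = \<Lambda> (\<lambda>y. indicator A y * g y) + \<Lambda> (indicator A) * \<Lambda> g"
    by (simp add: mult.commute)
qed

end

text \<open>By \<open>second_moment\<close> the variance is the integral of f^2 against the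
  intensity measure, which is at most C times the mean. A variance of the order of the mean is what
  makes relative fluctuations vanish when the mean grows.\<close>

lemma poisson_chebyshev:
  fixes f :: "'a::euclidean_space \<Rightarrow> real"
  assumes ps: "poisson_setting M S X l" and f: "f \<in> borel_measurable borel" and fb: "\<And>y. 0 \<le> f y \<and> f y \<le> C"
    and a: "a > 0"
  defines "m \<equiv> LINT y|lborel. f y * (l y * indicator S y)"
  shows "measure M {\<omega> \<in> space M. \<bar>(\<Sum>y\<in>X \<omega>. f y) - m\<bar> \<ge> a} \<le> C * m / a\<^sup>2"
proof -
  interpret poisson_setting M S X l by (rule ps)
  interpret prob_space M by (rule prob)
  have C: "C \<ge> 0" using fb[of undefined] by linarith
  let ?Z = "\<lambda>\<omega>. \<Sum>y\<in>X \<omega>. f y"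
  let ?f = "\<lambda>y. ennreal (f y)"
  have mf: "?f \<in> borel_measurable borel" using f by measurable
  have UZ: "U ?f \<omega> = ennreal (?Z \<omega>)" if "\<omega> \<in> space M" for \<omega>
    unfolding U_def using X_finite[OF that] fb by (simp add: nn_integral_count_space_finite sum_ennreal)
  have Z0: "?Z \<omega> \<ge> 0" for \<omega> using fb by (intro sum_nonneg) auto
  have Zm: "?Z \<in> borel_measurable M"
  proof (subst measurable_cong)
    show "?Z \<omega> = enn2real (U ?f \<omega>)" if "\<omega> \<in> space M" for \<omega> using UZ[OF that] Z0 by simp
    show "(\<lambda>\<omega>. enn2real (U ?f \<omega>)) \<in> borel_measurable M" using U_measurable[OF mf] by measurable
  qed
  have li: "integrable lborel (\<lambda>y. l y * indicator S y)"
    using l_set by (simp add: set_integrable_def mult.commute)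
  have fl: "integrable lborel (\<lambda>y. f y * (l y * indicator S y))"
  proof (rule Bochner_Integration.integrable_bound)
    show "integrable lborel (\<lambda>y. C * (l y * indicator S y))" using li by simp
    show "AE y in lborel. norm (f y * (l y * indicator S y)) \<le> norm (C * (l y * indicator S y))"
      using fb C by (intro AE_I2) (auto simp: abs_mult intro!: mult_right_mono)
    show "(\<lambda>y. f y * (l y * indicator S y)) \<in> borel_measurable lborel"
      using f borel_measurable_integrable[OF li] by simp
  qed
  have m0: "m \<ge> 0" unfolding m_def using fb l_nonneg by (intro integral_nonneg_AE AE_I2) (auto simp: indicator_def)
  have \<Lambda>m: "\<Lambda> ?f = ennreal m"
  proof -
    have "\<Lambda> ?f = (\<integral>\<^sup>+y. ennreal (f y * (l y * indicator S y)) \<partial>lborel)"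
      unfolding \<Lambda>_def using fb l_nonneg by (intro nn_integral_cong) (auto simp: indicator_def ennreal_mult)
    also have "\<dots> = ennreal m" unfolding m_def
      using fl fb l_nonneg by (intro nn_integral_eq_integral) (auto simp: indicator_def)
    finally show ?thesis .
  qed
  have EZ: "(\<integral>\<^sup>+\<omega>. ennreal (?Z \<omega>) \<partial>M) = ennreal m"
  proof -
    have "(\<integral>\<^sup>+\<omega>. ennreal (?Z \<omega>) \<partial>M) = (\<integral>\<^sup>+\<omega>. U ?f \<omega> \<partial>M)" by (intro nn_integral_cong) (simp add: UZ)
    also have "\<dots> = \<Lambda> ?f" unfolding U_def \<Lambda>_def by (rule campbell[OF point_process intensity S l mf])
    finally show ?thesis using \<Lambda>m by simp
  qed
  have EZ2: "(\<integral>\<^sup>+\<omega>. ennreal ((?Z \<omega>)\<^sup>2) \<partial>M) \<le> ennreal (C * m + m\<^sup>2)"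
  proof -
    have "(\<integral>\<^sup>+\<omega>. ennreal ((?Z \<omega>)\<^sup>2) \<partial>M) = (\<integral>\<^sup>+\<omega>. U ?f \<omega> * U ?f \<omega> \<partial>M)"
      using Z0 by (intro nn_integral_cong) (simp add: UZ ennreal_mult[symmetric] power2_eq_square)
    also have "\<dots> = \<Lambda> (\<lambda>y. ?f y * ?f y) + \<Lambda> ?f * \<Lambda> ?f" by (rule second_moment[OF mf mf])
    also have "\<Lambda> (\<lambda>y. ?f y * ?f y) \<le> \<Lambda> (\<lambda>y. ennreal C * ?f y)"
      unfolding \<Lambda>_def using fb by (intro nn_integral_mono mult_right_mono ennreal_leI) auto
    also have "\<dots> = ennreal C * ennreal m" using mf by (simp add: \<Lambda>_cmult \<Lambda>m)
    also have "ennreal C * ennreal m + \<Lambda> ?f * \<Lambda> ?f = ennreal (C * m + m\<^sup>2)"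
      using C m0 by (simp add: \<Lambda>m ennreal_mult[symmetric] power2_eq_square)
    finally show ?thesis by simp
  qed
  have exp: "expectation ?Z = m"
    using EZ Z0 Zm m0 by (subst integral_eq_nn_integral) auto
  have intZ: "integrable M ?Z"
    using Zm EZ Z0 by (intro integrableI_nonneg) auto
  have intZ2: "integrable M (\<lambda>\<omega>. (?Z \<omega>)\<^sup>2)"
    using Zm EZ2 by (intro integrableI_nonneg) (auto intro: le_less_trans)
  have E2: "expectation (\<lambda>\<omega>. (?Z \<omega>)\<^sup>2) \<le> C * m + m\<^sup>2"
    using EZ2 nn_integral_eq_integral[OF intZ2] C m0 by (simp add: ennreal_le_iff del: ennreal_plus)
  have "prob {\<omega> \<in> space M. \<bar>?Z \<omega> - expectation ?Z\<bar> \<ge> a} \<le> variance ?Z / a\<^sup>2"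
    by (rule Chebyshev_inequality[OF Zm intZ2 a])
  also have "variance ?Z = expectation (\<lambda>\<omega>. (?Z \<omega>)\<^sup>2) - m\<^sup>2"
    using variance_eq[OF intZ intZ2] exp by simp
  also have "(expectation (\<lambda>\<omega>. (?Z \<omega>)\<^sup>2) - m\<^sup>2) / a\<^sup>2 \<le> C * m / a\<^sup>2"
    using E2 by (intro divide_right_mono) auto
  finally show ?thesis unfolding exp .
qed

section \<open>Deterministic navigation\<close>

definition dilate :: "'a::real_vector \<Rightarrow> real \<Rightarrow> 'a set \<Rightarrow> 'a set" where
  "dilate x c D = (\<lambda>y. x + c *\<^sub>R (y - x)) ` D"

text \<open>The offset \<open>a\<close> is 0 in the bounds for the flow; a fixed nonzero value
  occurs when a region is enlarged or shrunk by a bounded distance.\<close>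

definition halfcyl :: "'a::euclidean_space \<Rightarrow> 'a \<Rightarrow> real \<Rightarrow> real \<Rightarrow> 'a set" where
  "halfcyl e p \<rho> a = {z. (z - p) \<bullet> e \<le> a \<and> norm (perp e (z - p)) \<le> \<rho>}"

lemma nth_eq_inner: "(y::real^'n::finite) $ i = y \<bullet> axis i 1"
  by (simp add: inner_axis)

lemma axis_Basis: "axis i (1::real) \<in> Basis"
  by (simp add: axis_in_Basis_iff)

lemma dilate_1 [simp]: "dilate x 1 D = D"
  by (simp add: dilate_def)

lemma mem_dilate_iff:
  fixes x :: "'a::real_vector"
  assumes "c > 0"
  shows "y \<in> dilate x c D \<longleftrightarrow> x + (1 / c) *\<^sub>R (y - x) \<in> D"
proof
  assume "y \<in> dilate x c D"
  then obtain w where w: "w \<in> D" "y = x + c *\<^sub>R (w - x)" by (auto simp: dilate_def)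
  then have "x + (1 / c) *\<^sub>R (y - x) = w" using assms by simp
  then show "x + (1 / c) *\<^sub>R (y - x) \<in> D" using w by simp
next
  assume *: "x + (1 / c) *\<^sub>R (y - x) \<in> D"
  have "y = x + c *\<^sub>R ((x + (1 / c) *\<^sub>R (y - x)) - x)" using assms by simp
  then show "y \<in> dilate x c D" unfolding dilate_def using * by (rule image_eqI)
qed

lemma mem_scaled_iff: "s > 0 \<Longrightarrow> y \<in> scaled s D \<longleftrightarrow> y /\<^sub>R s \<in> D" for y :: "'a::real_vector"
proof
  assume s: "s > 0"
  show "y /\<^sub>R s \<in> D" if "y \<in> scaled s D" using that s by (auto simp: scaled_def)
  assume "y /\<^sub>R s \<in> D"
  then show "y \<in> scaled s D" unfolding scaled_def by (rule image_eqI[rotated]) (use s in simp)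
qed

lemma scaled_mono: "D \<subseteq> E \<Longrightarrow> scaled s D \<subseteq> scaled s E"
  by (auto simp: scaled_def)

lemma open_scaled:
  fixes D :: "'a::real_normed_vector set"
  shows "s > 0 \<Longrightarrow> open D \<Longrightarrow> open (scaled s D)"
  unfolding scaled_def by (rule open_scaling) auto

lemma bounded_scaled:
  fixes D :: "'a::real_normed_vector set"
  shows "bounded D \<Longrightarrow> bounded (scaled s D)"
  unfolding scaled_def by (rule bounded_scaling)

lemma convex_scaled: "convex D \<Longrightarrow> convex (scaled s D)"
  unfolding scaled_def by (rule convex_scaling)

lemma dilate_eq: "dilate x c D = (+) ((1 - c) *\<^sub>R x) ` scaled c D"
  unfolding dilate_def scaled_def image_image by (intro image_cong) (auto simp: algebra_simps)

lemma open_dilate: "c > 0 \<Longrightarrow> open D \<Longrightarrow> open (dilate x c D)" for D :: "'a::real_normed_vector set"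
  unfolding dilate_eq by (intro open_translation open_scaled)

lemma bounded_dilate: "bounded D \<Longrightarrow> bounded (dilate x c D)" for D :: "'a::real_normed_vector set"
  unfolding dilate_eq by (intro bounded_translation bounded_scaled)

lemma convex_dilate: "convex D \<Longrightarrow> convex (dilate x c D)"
  unfolding dilate_eq by (intro convex_translation convex_scaled)

lemma dilate_center: "x \<in> D \<Longrightarrow> x \<in> dilate x c D"
  unfolding dilate_def by (rule image_eqI[of _ _ x]) auto

text \<open>Write y = x + c (w - x) and z - y = (c' - c) (u - x) with w in D and u in the ball about
  x. Then (z - x) / c' is a convex combination of w - x and u - x. Thus nested dilates keep a
  distance proportional to c' - c, which is the room used by paths and by boundary
  corrections.\<close>

lemma cball_dilate_subset:
  fixes D :: "'a::real_normed_vector set"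
  assumes D: "convex D" and ball: "cball x \<rho> \<subseteq> D" and c: "0 \<le> c" "c < c'"
    and y: "y \<in> dilate x c D"
  shows "cball y ((c' - c) * \<rho>) \<subseteq> dilate x c' D"
proof
  fix z assume z: "z \<in> cball y ((c' - c) * \<rho>)"
  obtain w where w: "w \<in> D" "y = x + c *\<^sub>R (w - x)" using y by (auto simp: dilate_def)
  let ?u = "x + (1 / (c' - c)) *\<^sub>R (z - y)"
  have "norm (z - y) \<le> (c' - c) * \<rho>" using z by (simp add: dist_norm norm_minus_commute)
  then have "norm (z - y) / (c' - c) \<le> \<rho>" using c by (simp add: field_simps)
  then have "norm ((1 / (c' - c)) *\<^sub>R (z - y)) \<le> \<rho>" using c by simp
  then have u: "?u \<in> D" using ball by (auto simp: dist_norm)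
  have "(c / c') *\<^sub>R w + (1 - c / c') *\<^sub>R ?u \<in> D"
    using c by (intro convexD[OF D w(1) u]) auto
  moreover have "z = x + c' *\<^sub>R ((c / c') *\<^sub>R w + (1 - c / c') *\<^sub>R ?u - x)"
  proof -
    have "c' *\<^sub>R ((c / c') *\<^sub>R w + (1 - c / c') *\<^sub>R ?u - x) =
       c *\<^sub>R w + (c' - c) *\<^sub>R ?u - c' *\<^sub>R x"
      using c by (simp add: scaleR_diff_right scaleR_add_right right_diff_distrib)
    also have "(c' - c) *\<^sub>R ?u = (c' - c) *\<^sub>R x + (z - y)"
      using c by (simp add: scaleR_add_right)
    finally show ?thesis by (simp add: w(2) algebra_simps)
  qed
  ultimately show "z \<in> dilate x c' D" unfolding dilate_def by (rule image_eqI[rotated])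
qed

lemma scaled_cball_subset:
  fixes D :: "'a::real_normed_vector set"
  assumes s: "s > 0" and sub: "\<And>y. y \<in> E \<Longrightarrow> cball y r \<subseteq> D" and z: "z \<in> scaled s E"
  shows "cball z (s * r) \<subseteq> scaled s D"
proof
  fix w assume "w \<in> cball z (s * r)"
  then have "norm (w - z) \<le> s * r" by (simp add: dist_norm norm_minus_commute)
  moreover have "norm (w /\<^sub>R s - z /\<^sub>R s) = norm (w - z) / s"
    using s by (simp add: scaleR_diff_right[symmetric] divide_inverse mult.commute)
  moreover have "norm (w - z) / s \<le> r" using calculation(1) s by (simp add: field_simps)
  ultimately have "w /\<^sub>R s \<in> cball (z /\<^sub>R s) r"
    by (simp only: mem_cball dist_norm norm_minus_commute[of "z /\<^sub>R s"])
  then show "w \<in> scaled s D" using sub[of "z /\<^sub>R s"] z s by (auto simp: mem_scaled_iff)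
qed

text \<open>The complement is the Minkowski sum of the closed set \<open>- S\<close> and a compact
  ball, hence closed. Openness is used through \<open>segment_stays\<close>.\<close>

lemma open_inner_part:
  fixes S :: "'a::euclidean_space set"
  assumes S: "open S" and \<epsilon>: "\<epsilon> \<ge> 0"
  shows "open (inner_part \<epsilon> S)"
proof -
  have "inner_part \<epsilon> S = - (\<Union>w\<in>- S. \<Union>v\<in>cball 0 \<epsilon>. {w + v})"
  proof (intro set_eqI iffI)
    fix y assume y: "y \<in> inner_part \<epsilon> S"
    show "y \<in> - (\<Union>w\<in>- S. \<Union>v\<in>cball 0 \<epsilon>. {w + v})"
    proof
      assume "y \<in> (\<Union>w\<in>- S. \<Union>v\<in>cball 0 \<epsilon>. {w + v})"
      then obtain w v where "w \<notin> S" "norm v \<le> \<epsilon>" "y = w + v" by auto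
      then have "w \<in> cball y \<epsilon>" by (simp add: dist_norm norm_minus_commute)
      then show False using y \<open>w \<notin> S\<close> by (auto simp: inner_part_def)
    qed
  next
    fix y assume y: "y \<in> - (\<Union>w\<in>- S. \<Union>v\<in>cball 0 \<epsilon>. {w + v})"
    have "w \<in> S" if "w \<in> cball y \<epsilon>" for w
    proof (rule ccontr)
      assume "w \<notin> S"
      moreover have "y - w \<in> cball 0 \<epsilon>" using that by (simp add: dist_norm norm_minus_commute)
      moreover have "y = w + (y - w)" by simp
      ultimately show False using y by blast
    qed
    then show "y \<in> inner_part \<epsilon> S" using \<epsilon> by (auto simp: inner_part_def)
  qed
  moreover have "closed (\<Union>w\<in>- S. \<Union>v\<in>cball 0 \<epsilon>. {w + v})"
    using S by (intro closed_compact_sums) auto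
  ultimately show ?thesis by (simp only: open_Compl)
qed

lemma nav_iter_0 [simp]: "nav_iter A \<phi> 0 y = y"
  and nav_iter_Suc: "nav_iter A \<phi> (Suc k) y = A (nav_iter A \<phi> k y) \<phi>"
  and nav_iter_add: "nav_iter A \<phi> (j + k) y = nav_iter A \<phi> j (nav_iter A \<phi> k y)"
  by (simp_all add: nav_iter_def funpow_add)

locale navigation =
  fixes i :: "'n::finite" and A :: "real ^ 'n \<Rightarrow> (real ^ 'n) set \<Rightarrow> real ^ 'n" and \<phi> :: "(real ^ 'n) set"
  assumes finite: "finite \<phi>"
    and nav: "\<And>y. y \<in> \<phi> \<Longrightarrow> A y \<phi> \<in> \<phi>" "\<And>y. y \<in> \<phi> \<Longrightarrow> A y \<phi> $ i \<ge> y $ i"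
begin

abbreviation "e \<equiv> axis i (1::real) :: real ^ 'n"

lemma nav_iter_in: "z \<in> \<phi> \<Longrightarrow> nav_iter A \<phi> k z \<in> \<phi>"
  by (induction k) (auto simp: nav_iter_Suc nav)

lemma nav_iter_mono: "z \<in> \<phi> \<Longrightarrow> j \<le> k \<Longrightarrow> nav_iter A \<phi> j z $ i \<le> nav_iter A \<phi> k z $ i"
proof (induction k)
  case (Suc k)
  then show ?case using nav(2)[OF nav_iter_in[of z k]] by (cases "j = Suc k") (auto simp: nav_iter_Suc)
qed auto

lemma segment_coordinate:
  fixes u v w :: "real ^ 'n"
  assumes "w \<in> closed_segment u v" "u $ i \<le> v $ i"
  shows "u $ i \<le> w $ i" "w $ i \<le> v $ i"
proof -
  obtain t where t: "0 \<le> t" "t \<le> 1" "w = (1 - t) *\<^sub>R u + t *\<^sub>R v"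
    using assms(1) by (auto simp: closed_segment_def)
  have "w $ i = u $ i + t * (v $ i - u $ i)" by (simp add: t(3) algebra_simps)
  moreover have "0 \<le> t * (v $ i - u $ i)" "t * (v $ i - u $ i) \<le> 1 * (v $ i - u $ i)"
    using t assms(2) by (simp, intro mult_right_mono) auto
  ultimately show "u $ i \<le> w $ i" "w $ i \<le> v $ i" by auto
qed

text \<open>As no node lies on the hyperplane, a crossing node is strictly before it and its
  successor strictly beyond. The coordinate never decreases along a trajectory, so this can happen
  at one step only.\<close>

lemma crossing_unique:
  assumes gen: "\<And>y. y \<in> \<phi> \<Longrightarrow> y $ i \<noteq> (s *\<^sub>R x) $ i" and z: "z \<in> \<phi>"
    and y: "y \<in> crossing_nodes i g A s x \<phi>" "y \<in> trajectory A \<phi> z"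
    and y': "y' \<in> crossing_nodes i g A s x \<phi>" "y' \<in> trajectory A \<phi> z"
  shows "y = y'"
proof -
  let ?c = "(s *\<^sub>R x) $ i"
  have strict: "w $ i < ?c \<and> ?c < A w \<phi> $ i" if w: "w \<in> crossing_nodes i g A s x \<phi>" for w
  proof -
    obtain p where p: "p \<in> closed_segment w (A w \<phi>)" "p $ i = ?c" and "w \<in> \<phi>"
      using w by (auto simp: crossing_nodes_def link_window_def)
    then have "w $ i \<le> ?c" "?c \<le> A w \<phi> $ i"
      using segment_coordinate[OF p(1) nav(2)] by auto
    then show ?thesis using gen \<open>w \<in> \<phi>\<close> nav(1)[of w] by (metis order_le_less)
  qed
  have le: False if "j < k" "nav_iter A \<phi> j z \<in> crossing_nodes i g A s x \<phi>"
      "nav_iter A \<phi> k z \<in> crossing_nodes i g A s x \<phi>" for j k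
    using nav_iter_mono[OF z, of "Suc j" k] strict[OF that(2)] strict[OF that(3)] that(1)
    by (simp add: nav_iter_Suc)
  obtain j k where "y = nav_iter A \<phi> j z" "y' = nav_iter A \<phi> k z"
    using y(2) y'(2) by (auto simp: trajectory_def)
  then show ?thesis using le[of j k] le[of k j] y(1) y'(1) by (metis nat_neq_iff)
qed

text \<open>Exchange the two sums: a node z is counted once for every crossing node on its
  trajectory, and there is at most one.\<close>

lemma sum_traffic:
  assumes gen: "\<And>y. y \<in> \<phi> \<Longrightarrow> y $ i \<noteq> (s *\<^sub>R x) $ i"
  shows "(\<Sum>y\<in>crossing_nodes i g A s x \<phi>. traffic mu A s \<phi> y) =
         (\<Sum>z | z \<in> \<phi> \<and> crossing_nodes i g A s x \<phi> \<inter> trajectory A \<phi> z \<noteq> {}. mu (z /\<^sub>R s))"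
proof -
  let ?\<Xi> = "crossing_nodes i g A s x \<phi>"
  have fin\<Xi>: "finite ?\<Xi>" using finite by (auto simp: crossing_nodes_def)
  have "(\<Sum>y\<in>?\<Xi>. traffic mu A s \<phi> y) = (\<Sum>y\<in>?\<Xi>. \<Sum>z\<in>\<phi>. if y \<in> trajectory A \<phi> z then mu (z /\<^sub>R s) else 0)"
    unfolding traffic_def using finite
    by (intro sum.cong refl sum.inter_filter)
  also have "\<dots> = (\<Sum>z\<in>\<phi>. \<Sum>y\<in>?\<Xi>. if y \<in> trajectory A \<phi> z then mu (z /\<^sub>R s) else 0)"
    by (rule sum.swap)
  also have "\<dots> = (\<Sum>z\<in>\<phi>. if ?\<Xi> \<inter> trajectory A \<phi> z \<noteq> {} then mu (z /\<^sub>R s) else 0)"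
  proof (rule sum.cong[OF refl])
    fix z assume z: "z \<in> \<phi>"
    have "(\<Sum>y\<in>?\<Xi>. if y \<in> trajectory A \<phi> z then mu (z /\<^sub>R s) else 0) = (\<Sum>y\<in>?\<Xi> \<inter> trajectory A \<phi> z. mu (z /\<^sub>R s))"
      by (rule sum.inter_restrict[OF fin\<Xi>, symmetric])
    also have "\<dots> = (if ?\<Xi> \<inter> trajectory A \<phi> z \<noteq> {} then mu (z /\<^sub>R s) else 0)"
    proof (cases "?\<Xi> \<inter> trajectory A \<phi> z = {}")
      case False
      then obtain y where y: "y \<in> ?\<Xi>" "y \<in> trajectory A \<phi> z" by auto
      then have "?\<Xi> \<inter> trajectory A \<phi> z = {y}"
        using crossing_unique[where g=g, OF gen z] by blast
      then show ?thesis by simp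
    qed simp
    finally show "(\<Sum>y\<in>?\<Xi>. if y \<in> trajectory A \<phi> z then mu (z /\<^sub>R s) else 0) =
      (if ?\<Xi> \<inter> trajectory A \<phi> z \<noteq> {} then mu (z /\<^sub>R s) else 0)" .
  qed
  also have "\<dots> = (\<Sum>z | z \<in> \<phi> \<and> ?\<Xi> \<inter> trajectory A \<phi> z \<noteq> {}. mu (z /\<^sub>R s))"
    using finite by (simp add: sum.inter_filter)
  finally show ?thesis .
qed

lemma cylinder_perp:
  assumes "p \<in> horizontal_cylinder i r z"
  shows "norm (perp e (p - z)) \<le> r"
proof -
  obtain t v where tv: "p = z + t *\<^sub>R e + v" "v $ i = 0" "norm v \<le> r"
    using assms by (auto simp: horizontal_cylinder_def)
  have "perp e (p - z) = perp e (t *\<^sub>R e) + perp e v" by (simp add: tv(1) flip: perp_add)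
  also have "\<dots> = v" using tv(2) axis_Basis[of i]
    by (simp add: perp_scaleR) (simp add: perp_def nth_eq_inner)
  finally show ?thesis using tv(3) by simp
qed

lemma link_window_perp:
  assumes "p \<in> link_window i g s x"
  shows "norm (perp e (p - s *\<^sub>R x)) \<le> g s" "p $ i = (s *\<^sub>R x) $ i"
proof -
  have "norm (p - s *\<^sub>R x) \<le> g s" using assms by (simp add: link_window_def dist_norm norm_minus_commute)
  then show "norm (perp e (p - s *\<^sub>R x)) \<le> g s" using norm_perp_le[OF axis_Basis, of i "p - s *\<^sub>R x"] by simp
  show "p $ i = (s *\<^sub>R x) $ i" using assms by (simp add: link_window_def)
qed

lemma link_windowI:
  assumes "norm (perp e (p - s *\<^sub>R x)) \<le> g s" "p $ i = (s *\<^sub>R x) $ i"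
  shows "p \<in> link_window i g s x"
proof -
  have "(p - s *\<^sub>R x) \<bullet> e = 0" using assms(2) by (simp add: nth_eq_inner inner_diff_left)
  then have "perp e (p - s *\<^sub>R x) = p - s *\<^sub>R x" by (simp add: perp_def)
  then show ?thesis using assms by (simp add: link_window_def dist_norm norm_minus_commute)
qed

text \<open>The crossing point p lies in the inner part, where the path of z is confined to the
  cylinder of radius h about z, so radially z is within h of a point of the window; monotonicity
  places z behind it.\<close>

lemma crossing_upper:
  assumes sb: "sub_ballistic i D h A s \<epsilon> \<phi>" and z: "z \<in> \<phi>"
    and win: "link_window i g s x \<subseteq> inner_part (\<epsilon> * s) (scaled s D)"
    and cr: "crossing_nodes i g A s x \<phi> \<inter> trajectory A \<phi> z \<noteq> {}"
  shows "z \<in> halfcyl e (s *\<^sub>R x) (g s + h s) 0"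
proof -
  obtain k p where k: "nav_iter A \<phi> k z \<in> \<phi>" "p \<in> closed_segment (nav_iter A \<phi> k z) (A (nav_iter A \<phi> k z) \<phi>)"
      "p \<in> link_window i g s x"
    using cr by (auto simp: crossing_nodes_def trajectory_def)
  have "p \<in> trajectory_path A \<phi> z"
    using k(2) by (auto simp: trajectory_path_def nav_iter_Suc)
  then have "p \<in> horizontal_cylinder i (h s) z"
    using sb z k(3) win by (auto simp: sub_ballistic_def)
  then have 1: "norm (perp e (p - z)) \<le> h s" by (rule cylinder_perp)
  have "z $ i \<le> nav_iter A \<phi> k z $ i" using nav_iter_mono[OF z, of 0 k] by simp
  also have "\<dots> \<le> p $ i" using segment_coordinate[OF k(2) nav(2)[OF k(1)]] by simp
  also have "\<dots> = (s *\<^sub>R x) $ i" by (rule link_window_perp[OF k(3)])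
  finally have 2: "(z - s *\<^sub>R x) \<bullet> e \<le> 0" by (simp add: nth_eq_inner inner_diff_left)
  have "perp e (z - s *\<^sub>R x) = perp e (p - s *\<^sub>R x) - perp e (p - z)"
    by (simp add: perp_diff)
  then have "norm (perp e (z - s *\<^sub>R x)) \<le> norm (perp e (p - s *\<^sub>R x)) + norm (perp e (p - z))"
    by (simp add: norm_triangle_ineq4)
  then show ?thesis using 1 2 link_window_perp(1)[OF k(3)] by (simp add: halfcyl_def)
qed

text \<open>On the segment the closed cylinder condition and the open condition of lying in \<open>N\<close> coincide,
  so connectedness of the segment propagates them.\<close>

lemma segment_stays:
  fixes u v z :: "real ^ 'n"
  assumes N: "open N" and u: "u \<in> N"
    and iff: "\<And>w. w \<in> closed_segment u v \<Longrightarrow> w \<in> N \<longleftrightarrow> norm (perp e (w - z)) \<le> r"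
    and w: "w \<in> closed_segment u v"
  shows "w \<in> N"
proof -
  let ?S = "closed_segment u v"
  let ?C = "{w. norm (perp e (w - z)) \<le> r}"
  have "continuous_on UNIV (\<lambda>w. norm (perp e (w - z)))"
    unfolding perp_def by (intro continuous_intros)
  then have "closed ?C" by (intro closed_Collect_le continuous_on_const)
  have eq: "?S \<inter> N = ?S \<inter> ?C" using iff by auto
  have "openin (top_of_set ?S) (?S \<inter> N)" using N by (rule openin_open_Int)
  moreover have "closedin (top_of_set ?S) (?S \<inter> N)"
    unfolding eq using \<open>closed ?C\<close> by (rule closedin_closed_Int)
  ultimately have "?S \<inter> N = {} \<or> ?S \<inter> N = ?S"
    using connected_segment(1)[of u v] unfolding connected_clopen by blast
  then show ?thesis using u w by auto
qed

text \<open>As long as the path has not passed the hyperplane it stays in the corridor around the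
  axis of z: inside the inner part the event confines it to radius h, and radius h keeps it inside
  the inner part. It must pass the hyperplane, for otherwise it would visit only finitely many
  nodes, all in the inner part; a repeated node would be a fixed point by \<open>acyclic\<close>,
  against the first clause of sub-ballisticity. The passing point is within h + (g - h) of the axis
  of the window.\<close>

lemma crossing_lower:
  assumes sb: "sub_ballistic i D h A s \<epsilon> \<phi>" and z: "z \<in> \<phi>"
    and acyclic: "\<And>y k. y \<in> \<phi> \<Longrightarrow> k \<ge> 1 \<Longrightarrow> nav_iter A \<phi> k y = y \<Longrightarrow> A y \<phi> = y"
    and N: "open (inner_part (\<epsilon> * s) (scaled s D))"
    and cyl: "z \<in> halfcyl e (s *\<^sub>R x) (g s - h s) 0" and h: "h s \<ge> 0"
    and corridor: "\<And>q. z $ i \<le> q $ i \<Longrightarrow> q $ i \<le> (s *\<^sub>R x) $ i \<Longrightarrow> norm (perp e (q - z)) \<le> h s \<Longrightarrow>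
       q \<in> inner_part (\<epsilon> * s) (scaled s D)"
  shows "crossing_nodes i g A s x \<phi> \<inter> trajectory A \<phi> z \<noteq> {}"
proof -
  let ?c = "(s *\<^sub>R x) $ i" and ?N = "inner_part (\<epsilon> * s) (scaled s D)"
  let ?a = "\<lambda>k. nav_iter A \<phi> k z"
  have zc: "z $ i \<le> ?c" using cyl by (simp add: halfcyl_def nth_eq_inner inner_diff_left)
  have a: "?a k \<in> \<phi>" for k by (rule nav_iter_in[OF z])
  have az: "z $ i \<le> ?a k $ i" for k using nav_iter_mono[OF z, of 0 k] by simp
  have stay: "w \<in> ?N" if k: "?a k \<in> ?N" and w: "w \<in> closed_segment (?a k) (?a (Suc k))" "w $ i \<le> ?c" for k w
  proof (rule segment_stays[OF N k, of w z "h s"])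
    fix q assume "q \<in> closed_segment (?a k) w"
    moreover have sub: "closed_segment (?a k) w \<subseteq> closed_segment (?a k) (?a (Suc k))"
      using w(1) by (simp add: subset_closed_segment)
    ultimately have q: "q \<in> closed_segment (?a k) (?a (Suc k))" "q \<in> closed_segment (?a k) w" by auto
    have "?a k $ i \<le> w $ i" using segment_coordinate[OF w(1)] nav_iter_mono[OF z, of k "Suc k"] by simp
    then have "?a k $ i \<le> q $ i" "q $ i \<le> w $ i" using segment_coordinate[OF q(2)] by auto
    then have qi: "z $ i \<le> q $ i" "q $ i \<le> ?c" using az[of k] w(2) by auto
    have "q \<in> trajectory_path A \<phi> z" using q(1) by (auto simp: trajectory_path_def)
    then have "q \<in> ?N \<Longrightarrow> norm (perp e (q - z)) \<le> h s"
      using sb z by (intro cylinder_perp) (auto simp: sub_ballistic_def)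
    then show "q \<in> ?N \<longleftrightarrow> norm (perp e (q - z)) \<le> h s" using corridor[OF qi] by blast
  qed simp
  have "\<exists>k. ?a k $ i > ?c"
  proof (rule ccontr)
    assume "\<not> (\<exists>k. ?a k $ i > ?c)"
    then have le: "?a k $ i \<le> ?c" for k by (simp add: not_less)
    have inN: "?a k \<in> ?N" for k
    proof (induction k)
      case 0
      show ?case using corridor[of z] zc h by (simp add: perp_def)
    next
      case (Suc k)
      show ?case by (rule stay[OF Suc _ le]) simp
    qed
    have "\<not> inj ?a"
      using a finite by (meson finite_imageD finite_subset image_subsetI infinite_UNIV_nat)
    then obtain j k where jk: "j < k" "?a j = ?a k"
      by (metis injI nat_neq_iff)
    have "nav_iter A \<phi> (k - j) (?a j) = ?a (k - j + j)" by (simp only: nav_iter_add)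
    then have "nav_iter A \<phi> (k - j) (?a j) = ?a j" using jk by simp
    then have "A (?a j) \<phi> = ?a j" using jk by (intro acyclic[OF a]) auto
    moreover have "A (?a j) \<phi> \<noteq> ?a j" using sb a inN by (auto simp: sub_ballistic_def)
    ultimately show False by simp
  qed
  then obtain k where k: "?a k $ i > ?c" "\<And>j. j < k \<Longrightarrow> ?a j $ i \<le> ?c"
    using exists_least_iff[of "\<lambda>k. ?a k $ i > ?c"] by (auto simp: not_less)
  then obtain m where m: "k = Suc m" using zc by (cases k) auto
  have inN: "?a j \<in> ?N" if "j \<le> m" for j
    using that
  proof (induction j)
    case 0
    show ?case using corridor[of z] zc h by (simp add: perp_def)
  next
    case (Suc j)
    have 1: "?a j \<in> ?N" using Suc by simp
    have 2: "?a (Suc j) $ i \<le> ?c" using k(2)[of "Suc j"] m Suc.prems by simp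
    show ?case by (rule stay[OF 1 _ 2]) simp
  qed
  have lt: "?a m $ i \<le> ?c" "?c < ?a (Suc m) $ i" using k m by auto
  \<comment> \<open>The parameter at which the segment leaving the last node behind the hyperplane
    meets it.\<close>
  define t where "t = (?c - ?a m $ i) / (?a (Suc m) $ i - ?a m $ i)"
  define p where "p = (1 - t) *\<^sub>R ?a m + t *\<^sub>R ?a (Suc m)"
  have t: "0 \<le> t" "t \<le> 1" using lt by (auto simp: t_def field_simps)
  have pseg: "p \<in> closed_segment (?a m) (?a (Suc m))" using t by (auto simp: closed_segment_def p_def)
  have "t * (?a (Suc m) $ i - ?a m $ i) = ?c - ?a m $ i" using lt by (simp add: t_def)
  then have pc: "p $ i = ?c" by (simp add: p_def algebra_simps)
  have "p \<in> ?N" using stay[OF inN[of m] pseg] pc by simp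
  moreover have "p \<in> trajectory_path A \<phi> z" using pseg by (auto simp: trajectory_path_def)
  ultimately have "p \<in> horizontal_cylinder i (h s) z" using sb z by (auto simp: sub_ballistic_def)
  then have 1: "norm (perp e (p - z)) \<le> h s" by (rule cylinder_perp)
  have "perp e (p - s *\<^sub>R x) = perp e (p - z) + perp e (z - s *\<^sub>R x)" by (simp add: perp_diff)
  then have "norm (perp e (p - s *\<^sub>R x)) \<le> norm (perp e (p - z)) + norm (perp e (z - s *\<^sub>R x))"
    by (simp add: norm_triangle_ineq)
  also have "\<dots> \<le> h s + (g s - h s)" using 1 cyl by (intro add_mono) (auto simp: halfcyl_def)
  finally have "p \<in> link_window i g s x" using pc by (intro link_windowI) auto
  then have "?a m \<in> crossing_nodes i g A s x \<phi>"
    using pseg a[of m] by (auto simp: crossing_nodes_def nav_iter_Suc)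
  then show ?thesis by (auto simp: trajectory_def)
qed

end

lemma scaled_dilate_cball:
  fixes D :: "'a::real_normed_vector set"
  assumes D: "convex D" and ball: "cball x \<rho> \<subseteq> D" and c: "0 \<le> c" "c < c'" and s: "s > 0"
    and z: "z \<in> scaled s (dilate x c D)"
  shows "cball z (s * ((c' - c) * \<rho>)) \<subseteq> scaled s (dilate x c' D)"
  using scaled_cball_subset[OF s, of "dilate x c D" "(c' - c) * \<rho>" "dilate x c' D" z]
    cball_dilate_subset[OF D ball c] z by blast

lemma cball_scaled_center:
  fixes D :: "'a::real_normed_vector set"
  assumes "cball x \<rho> \<subseteq> D" "s > 0"
  shows "cball (s *\<^sub>R x) (s * \<rho>) \<subseteq> scaled s D"
  using scaled_cball_subset[OF assms(2), of "{x}" \<rho> D "s *\<^sub>R x"] assms by (auto simp: scaled_def)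

text \<open>Project q to \<open>?q\<close> on the line through z parallel to e, and z to
  \<open>?zz\<close> on the hyperplane of \<open>s *\<^sub>R x\<close>. Both z and
  \<open>?zz\<close> lie in the dilated domain, so by convexity \<open>?q\<close> does too. The gap
  between that dilate and D allows radius s (1 - c) \<rho> about \<open>?q\<close>: one half is
  spent on the distance from q to \<open>?q\<close>, the other is the margin that defines the inner
  part.\<close>

lemma corridor_subset:
  fixes D :: "(real ^ 'n::finite) set" and z q x :: "real ^ 'n" and i :: 'n
  defines "e \<equiv> axis i (1::real) :: real ^ 'n"
  assumes D: "convex D" and x: "x \<in> D" and ball: "cball x \<rho> \<subseteq> D" and c: "0 < c" "c < 1" and s: "s > 0"
    and z: "z \<in> scaled s (dilate x c D)" and zc: "norm (perp e (z - s *\<^sub>R x)) \<le> s * (c * \<rho>)"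
    and q: "z $ i \<le> q $ i" "q $ i \<le> (s *\<^sub>R x) $ i" and qz: "norm (perp e (q - z)) \<le> s * ((1 - c) * \<rho> / 2)"
  shows "q \<in> inner_part ((1 - c) * \<rho> / 2 * s) (scaled s D)"
proof -
  have e: "e \<in> Basis" unfolding e_def by (rule axis_Basis)
  let ?zz = "s *\<^sub>R x + perp e (z - s *\<^sub>R x)" and ?q = "q - perp e (q - z)"
  have "cball x (c * \<rho>) \<subseteq> dilate x c D"
    using cball_dilate_subset[OF D ball, of 0 c x] c dilate_center[OF x, of 0] by simp
  then have "cball (s *\<^sub>R x) (s * (c * \<rho>)) \<subseteq> scaled s (dilate x c D)" by (rule cball_scaled_center[OF _ s])
  then have zz: "?zz \<in> scaled s (dilate x c D)" using zc by (auto simp: dist_norm)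
  have cv: "convex (scaled s (dilate x c D))" by (intro convex_scaled convex_dilate D)
  have zz_eq: "?zz = z + ((s *\<^sub>R x - z) \<bullet> e) *\<^sub>R e"
    by (simp add: perp_def algebra_simps)
  have q_eq: "?q = z + ((q - z) \<bullet> e) *\<^sub>R e" by (simp add: perp_def algebra_simps)
  have q': "0 \<le> (q - z) \<bullet> e" "(q - z) \<bullet> e \<le> (s *\<^sub>R x - z) \<bullet> e"
    using q by (simp_all add: e_def nth_eq_inner inner_diff_left)
  have "?q \<in> closed_segment z ?zz"
  proof (cases "(s *\<^sub>R x - z) \<bullet> e = 0")
    case True
    then have "?q = z" using q' q_eq by simp
    then show ?thesis by simp
  next
    case False
    let ?t = "((q - z) \<bullet> e) / ((s *\<^sub>R x - z) \<bullet> e)"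
    have "?q = (1 - ?t) *\<^sub>R z + ?t *\<^sub>R ?zz"
      unfolding q_eq zz_eq using False by (simp add: scaleR_add_right scaleR_left_diff_distrib)
    moreover have "0 \<le> ?t" "?t \<le> 1" using q' False by (auto simp: field_simps)
    ultimately show ?thesis unfolding closed_segment_def by blast
  qed
  then have qD: "?q \<in> scaled s (dilate x c D)"
    using closed_segment_subset[OF z zz cv] by blast
  have "cball ?q (s * ((1 - c) * \<rho>)) \<subseteq> scaled s (dilate x 1 D)"
    using c by (intro scaled_dilate_cball[OF D ball _ _ s qD]) auto
  moreover have "cball q ((1 - c) * \<rho> / 2 * s) \<subseteq> cball ?q (s * ((1 - c) * \<rho>))"
  proof
    fix w assume "w \<in> cball q ((1 - c) * \<rho> / 2 * s)"
    then have "dist q w \<le> s * ((1 - c) * \<rho> / 2)" by (simp add: mult.commute)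
    moreover have "dist ?q q \<le> s * ((1 - c) * \<rho> / 2)" using qz by (simp add: dist_norm)
    ultimately have "dist ?q w \<le> s * ((1 - c) * \<rho> / 2) + s * ((1 - c) * \<rho> / 2)"
      using dist_triangle[of ?q w q] by linarith
    then show "w \<in> cball ?q (s * ((1 - c) * \<rho>))" by (simp add: field_simps)
  qed
  ultimately have sub: "cball q ((1 - c) * \<rho> / 2 * s) \<subseteq> scaled s D" by auto
  have "0 \<le> s * ((1 - c) * \<rho> / 2)" using qz norm_ge_zero order_trans by blast
  then have "q \<in> cball q ((1 - c) * \<rho> / 2 * s)" by (simp add: mult.commute)
  then show ?thesis using sub by (auto simp: inner_part_def)
qed

section \<open>Integrals over thin half-cylinders\<close>

lemma ennreal_mult3: "0 \<le> a \<Longrightarrow> 0 \<le> b \<Longrightarrow> 0 \<le> c \<Longrightarrow> ennreal (a * b * c) = ennreal a * ennreal c * ennreal b"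
  by (simp add: ennreal_mult mult_ac)

text \<open>After division by s, a half-cylinder about \<open>s *\<^sub>R x\<close> becomes a bundle
  of rays, displaced by the radial part divided by s and ending at \<tau> = a / s. The limit of
  interest is the joint one at (0, 0).\<close>

definition ray_integral :: "'a::euclidean_space \<Rightarrow> 'a \<Rightarrow> ('a \<Rightarrow> real) \<Rightarrow> real \<Rightarrow> 'a \<Rightarrow> real" where
  "ray_integral e x G \<tau> v = (LINT r|lborel. indicator {..\<tau>} r * G (x + r *\<^sub>R e + v))"

text \<open>Continuity of G is required only at almost all points of the open ray, because densities
  cut off outside D jump where the ray leaves D.\<close>

locale ray_setting =
  fixes e x :: "'a::euclidean_space" and G :: "'a \<Rightarrow> real" and B R :: real
  assumes e: "e \<in> Basis"
    and G_measurable [measurable]: "G \<in> borel_measurable borel"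
    and G_bounds: "\<And>y. 0 \<le> G y \<and> G y \<le> B"
    and G_support: "\<And>y. G y \<noteq> 0 \<Longrightarrow> norm y \<le> R"
    and G_cont: "AE r in lborel. r < 0 \<longrightarrow> isCont G (x + r *\<^sub>R e)"
begin

text \<open>For displacements of norm at most 1 the integrand vanishes when the absolute value of r
  exceeds this number, which yields one integrable majorant for all of them.\<close>

definition "R1 = norm x + \<bar>R\<bar> + 1"

lemma ray_support: "norm v \<le> 1 \<Longrightarrow> G (x + r *\<^sub>R e + v) \<noteq> 0 \<Longrightarrow> \<bar>r\<bar> \<le> R1"
proof -
  assume v: "norm v \<le> 1" and "G (x + r *\<^sub>R e + v) \<noteq> 0"
  then have n: "norm (x + r *\<^sub>R e + v) \<le> R" using G_support by blast
  have "r *\<^sub>R e = (x + r *\<^sub>R e + v) - x - v" by simp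
  then have "norm (r *\<^sub>R e) \<le> norm (x + r *\<^sub>R e + v) + norm x + norm v"
    using norm_triangle_ineq4[of "x + r *\<^sub>R e + v - x" v] norm_triangle_ineq4[of "x + r *\<^sub>R e + v" x]
    by simp
  then show ?thesis using n v e by (simp add: R1_def)
qed

lemma B_nonneg: "B \<ge> 0"
  using G_bounds[of 0] by linarith

lemma ray_integrand_bound:
  "norm v \<le> 1 \<Longrightarrow> norm (indicator {..\<tau>} r * G (x + r *\<^sub>R e + v)) \<le> B * indicator {-R1..R1} r"
  using ray_support[of v r] G_bounds[of "x + r *\<^sub>R e + v"] B_nonneg
  by (cases "G (x + r *\<^sub>R e + v) = 0") (auto simp: indicator_def abs_le_iff)

lemma bound_integrable: "integrable lborel (\<lambda>r. B * indicator {-R1..R1} r)"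
  by (intro integrable_mult_right integrable_real_indicator) (auto simp: emeasure_lborel_Icc_eq)

lemma ray_integrable: "norm v \<le> 1 \<Longrightarrow> integrable lborel (\<lambda>r. indicator {..\<tau>} r * G (x + r *\<^sub>R e + v))"
proof (rule Bochner_Integration.integrable_bound[OF bound_integrable])
  assume "norm v \<le> 1"
  then show "AE r in lborel. norm (indicator {..\<tau>} r * G (x + r *\<^sub>R e + v)) \<le> norm (B * indicator {-R1..R1} r)"
    using ray_integrand_bound[of v \<tau>] B_nonneg by (intro AE_I2) (auto simp: indicator_def)
qed measurable

lemma ray_integral_nonneg: "ray_integral e x G \<tau> v \<ge> 0"
  unfolding ray_integral_def using G_bounds by (intro integral_nonneg_AE AE_I2) auto

text \<open>Dominated convergence. At r < 0 the cut-off is eventually inactive and G is continuous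
  for almost every r; at r > 0 the integrand is eventually 0; the point r = 0 is null.\<close>

lemma ray_integral_tendsto:
  "((\<lambda>p. ray_integral e x G (fst p) (snd p)) \<longlongrightarrow> ray_integral e x G 0 0) (at (0, 0) within UNIV \<times> cball 0 1)"
  unfolding tendsto_at_iff_sequentially comp_def
proof (intro allI impI)
  fix P :: "nat \<Rightarrow> real \<times> 'a"
  assume P: "\<forall>i. P i \<in> UNIV \<times> cball 0 1 - {(0, 0)}" "P \<longlonglongrightarrow> (0, 0)"
  have f: "(\<lambda>n. fst (P n)) \<longlonglongrightarrow> 0" and g: "(\<lambda>n. snd (P n)) \<longlonglongrightarrow> 0"
    using tendsto_fst[OF P(2)] tendsto_snd[OF P(2)] by auto
  have v: "norm (snd (P n)) \<le> 1" for n using P(1) by (metis DiffD1 mem_Times_iff mem_cball_0)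
  show "(\<lambda>n. ray_integral e x G (fst (P n)) (snd (P n))) \<longlonglongrightarrow> ray_integral e x G 0 0"
    unfolding ray_integral_def
  proof (rule integral_dominated_convergence[OF _ _ bound_integrable])
    show "AE r in lborel. norm (indicator {..fst (P n)} r * G (x + r *\<^sub>R e + snd (P n))) \<le> B * indicator {-R1..R1} r" for n
      using ray_integrand_bound[OF v] by (intro AE_I2) auto
    show "AE r in lborel. (\<lambda>n. indicator {..fst (P n)} r * G (x + r *\<^sub>R e + snd (P n))) \<longlonglongrightarrow> indicator {..0} r * G (x + r *\<^sub>R e + 0)"
      using G_cont AE_lborel_singleton[of 0]
    proof eventually_elim
      fix r :: real assume r: "r < 0 \<longrightarrow> isCont G (x + r *\<^sub>R e)" "r \<noteq> 0"
      show "(\<lambda>n. indicator {..fst (P n)} r * G (x + r *\<^sub>R e + snd (P n))) \<longlonglongrightarrow> indicator {..0} r * G (x + r *\<^sub>R e + 0)"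
      proof (cases "r < 0")
        case True
        have "(\<lambda>n. x + r *\<^sub>R e + snd (P n)) \<longlonglongrightarrow> x + r *\<^sub>R e + 0"
          by (intro tendsto_intros g)
        then have "(\<lambda>n. G (x + r *\<^sub>R e + snd (P n))) \<longlonglongrightarrow> G (x + r *\<^sub>R e + 0)"
          using r True by (intro isCont_tendsto_compose[of _ G]) auto
        moreover have "\<forall>\<^sub>F n in sequentially. indicator {..fst (P n)} r * G (x + r *\<^sub>R e + snd (P n)) = G (x + r *\<^sub>R e + snd (P n))"
          using order_tendstoD(1)[OF f True] by eventually_elim auto
        ultimately show ?thesis using True by (subst tendsto_cong) auto
      next
        case False
        then have "r > 0" using r by simp
        have "\<forall>\<^sub>F n in sequentially. indicator {..fst (P n)} r * G (x + r *\<^sub>R e + snd (P n)) = 0"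
          using order_tendstoD(2)[OF f \<open>r > 0\<close>] by eventually_elim auto
        then show ?thesis using \<open>r > 0\<close> by (subst tendsto_cong) auto
      qed
    qed
  qed measurable
qed

lemma ray_integral_near:
  assumes "\<eta> > 0"
  obtains \<theta> where "\<theta> > 0" "\<And>\<tau> v. \<bar>\<tau>\<bar> < \<theta> \<Longrightarrow> norm v < \<theta> \<Longrightarrow> norm v \<le> 1 \<Longrightarrow>
    \<bar>ray_integral e x G \<tau> v - ray_integral e x G 0 0\<bar> < \<eta>"
proof -
  have "\<forall>\<^sub>F p in at (0, 0) within UNIV \<times> cball 0 1.
      dist (ray_integral e x G (fst p) (snd p)) (ray_integral e x G 0 0) < \<eta>"
    using ray_integral_tendsto assms by (rule tendstoD)
  then obtain d where d: "d > 0" "\<And>p. p \<in> UNIV \<times> cball 0 1 \<Longrightarrow> p \<noteq> (0, 0) \<Longrightarrow> dist p (0, 0) < d \<Longrightarrow>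
      dist (ray_integral e x G (fst p) (snd p)) (ray_integral e x G 0 0) < \<eta>"
    unfolding eventually_at by blast
  show thesis
  proof (rule that[of "d / 2"])
    fix \<tau> :: real and v :: 'a assume tv: "\<bar>\<tau>\<bar> < d / 2" "norm v < d / 2" "norm v \<le> 1"
    show "\<bar>ray_integral e x G \<tau> v - ray_integral e x G 0 0\<bar> < \<eta>"
    proof (cases "(\<tau>, v) = (0, 0)")
      case False
      have "norm (\<tau>, v) \<le> norm \<tau> + norm v" by (rule norm_Pair_le)
      then have "dist (\<tau>, v) (0, 0) < d" using tv by (simp add: dist_norm zero_prod_def[symmetric])
      then show ?thesis using d(2)[of "(\<tau>, v)"] False tv by (auto simp: dist_real_def)
    qed (use assms in auto)
  qed (use d in auto)
qed

text \<open>Move the end point of the axis to the origin, slice along e and substitute t = s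
  r.\<close>

lemma nn_integral_halfcyl:
  assumes s: "s > 0"
  shows "(\<integral>\<^sup>+z. indicator (halfcyl e (s *\<^sub>R x) \<rho> a) z * ennreal (G (z /\<^sub>R s)) \<partial>lborel) =
    (\<integral>\<^sup>+v. indicator (cball 0 \<rho>) v * (ennreal s * (\<integral>\<^sup>+r. ennreal (indicator {..a / s} r * G (x + r *\<^sub>R e + v /\<^sub>R s)) \<partial>lborel)) \<partial>perp_lborel e)"
proof -
  have [measurable]: "halfcyl e p \<rho> a \<in> sets borel" for p unfolding halfcyl_def by measurable
  have "(\<integral>\<^sup>+z. indicator (halfcyl e (s *\<^sub>R x) \<rho> a) z * ennreal (G (z /\<^sub>R s)) \<partial>lborel) =
        (\<integral>\<^sup>+z. indicator (halfcyl e (s *\<^sub>R x) \<rho> a) z * ennreal (G (z /\<^sub>R s)) \<partial>distr lborel borel ((+) (s *\<^sub>R x)))"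
    by (simp add: lborel_distr_plus)
  also have "\<dots> = (\<integral>\<^sup>+z. indicator (halfcyl e 0 \<rho> a) z * ennreal (G (x + z /\<^sub>R s)) \<partial>lborel)"
    using s by (subst nn_integral_distr) (auto intro!: nn_integral_cong simp: halfcyl_def indicator_def scaleR_add_right)
  also have "\<dots> = (\<integral>\<^sup>+v. (\<integral>\<^sup>+t. indicator (halfcyl e 0 \<rho> a) (v + t *\<^sub>R e) * ennreal (G (x + (v + t *\<^sub>R e) /\<^sub>R s)) \<partial>lborel) \<partial>perp_lborel e)"
    by (rule nn_integral_lborel_perp[OF e]) measurable
  also have "\<dots> = (\<integral>\<^sup>+v. indicator (cball 0 \<rho>) v * (ennreal s * (\<integral>\<^sup>+r. ennreal (indicator {..a / s} r * G (x + r *\<^sub>R e + v /\<^sub>R s)) \<partial>lborel)) \<partial>perp_lborel e)"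
  proof (rule nn_integral_cong_AE, use AE_perp_lborel[OF e] in eventually_elim)
    fix v :: 'a assume v: "v \<bullet> e = 0"
    have p: "perp e (v + t *\<^sub>R e) = v" "(v + t *\<^sub>R e) \<bullet> e = t" for t
      using v e by (simp_all add: perp_def algebra_simps)
    have "(\<integral>\<^sup>+t. indicator (halfcyl e 0 \<rho> a) (v + t *\<^sub>R e) * ennreal (G (x + (v + t *\<^sub>R e) /\<^sub>R s)) \<partial>lborel) =
      (\<integral>\<^sup>+t. indicator (cball 0 \<rho>) v * ennreal (indicator {..a} t * G (x + (v + t *\<^sub>R e) /\<^sub>R s)) \<partial>lborel)"
      by (intro nn_integral_cong) (auto simp: halfcyl_def p indicator_def)
    also have "\<dots> = indicator (cball 0 \<rho>) v * (\<integral>\<^sup>+t. ennreal (indicator {..a} t * G (x + (v + t *\<^sub>R e) /\<^sub>R s)) \<partial>lborel)"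
      by (rule nn_integral_cmult) measurable
    also have "(\<integral>\<^sup>+t. ennreal (indicator {..a} t * G (x + (v + t *\<^sub>R e) /\<^sub>R s)) \<partial>lborel) =
       ennreal \<bar>s\<bar> * (\<integral>\<^sup>+r. ennreal (indicator {..a} (0 + s * r) * G (x + (v + (0 + s * r) *\<^sub>R e) /\<^sub>R s)) \<partial>lborel)"
      using s by (intro nn_integral_real_affine) auto
    also have "(\<integral>\<^sup>+r. ennreal (indicator {..a} (0 + s * r) * G (x + (v + (0 + s * r) *\<^sub>R e) /\<^sub>R s)) \<partial>lborel) =
       (\<integral>\<^sup>+r. ennreal (indicator {..a / s} r * G (x + r *\<^sub>R e + v /\<^sub>R s)) \<partial>lborel)"
    proof (rule nn_integral_cong)
      fix r :: real
      have eq: "x + (v + (0 + s * r) *\<^sub>R e) /\<^sub>R s = x + r *\<^sub>R e + v /\<^sub>R s"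
        using s by (simp add: scaleR_add_right)
      have "s * r \<le> a \<longleftrightarrow> r \<le> a / s" using s by (simp add: field_simps)
      then show "ennreal (indicator {..a} (0 + s * r) * G (x + (v + (0 + s * r) *\<^sub>R e) /\<^sub>R s)) =
        ennreal (indicator {..a / s} r * G (x + r *\<^sub>R e + v /\<^sub>R s))" unfolding eq by (simp add: indicator_def)
    qed
    finally show "(\<integral>\<^sup>+t. indicator (halfcyl e 0 \<rho> a) (v + t *\<^sub>R e) * ennreal (G (x + (v + t *\<^sub>R e) /\<^sub>R s)) \<partial>lborel) =
      indicator (cball 0 \<rho>) v * (ennreal s * (\<integral>\<^sup>+r. ennreal (indicator {..a / s} r * G (x + r *\<^sub>R e + v /\<^sub>R s)) \<partial>lborel))"
      using s by simp
  qed
  finally show ?thesis .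
qed

text \<open>By \<open>nn_integral_halfcyl\<close> the quotient is the mean of the ray integrals
  \<open>?\<Phi> (a s / s) (v /\<^sub>R s)\<close> over the disc of radius \<open>\<rho> s\<close>.
  Their arguments tend to (0, 0) uniformly in v, since \<open>\<rho> s / s\<close> and
  \<open>a s / s\<close> vanish.\<close>

lemma halfcyl_integral_tendsto:
  assumes \<rho>: "\<forall>\<^sub>F s in at_top. \<rho> s > 0" "((\<lambda>s. \<rho> s / s) \<longlongrightarrow> 0) at_top" and a: "((\<lambda>s. a s / s) \<longlongrightarrow> 0) at_top"
  shows "((\<lambda>s. (LINT z|lborel. indicator (halfcyl e (s *\<^sub>R x) (\<rho> s) (a s)) z * G (z /\<^sub>R s)) /
            (s * (unit_ball_vol (real (DIM('a) - 1)) * \<rho> s ^ (DIM('a) - 1))))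
         \<longlongrightarrow> ray_integral e x G 0 0) at_top"
proof (rule tendstoI)
  fix \<eta> :: real assume \<eta>: "\<eta> > 0"
  let ?\<Phi> = "ray_integral e x G" and ?\<omega> = "unit_ball_vol (real (DIM('a) - 1))"
  obtain \<theta> where \<theta>: "\<theta> > 0" "\<And>\<tau> v. \<bar>\<tau>\<bar> < \<theta> \<Longrightarrow> norm v < \<theta> \<Longrightarrow> norm v \<le> 1 \<Longrightarrow> \<bar>?\<Phi> \<tau> v - ?\<Phi> 0 0\<bar> < \<eta> / 2"
    using ray_integral_near[of "\<eta> / 2"] \<eta> by (metis half_gt_zero)
  have [measurable]: "halfcyl e p r b \<in> sets borel" for p r b unfolding halfcyl_def by measurable
  have "\<forall>\<^sub>F s in at_top. \<bar>\<rho> s / s\<bar> < min \<theta> 1" "\<forall>\<^sub>F s in at_top. \<bar>a s / s\<bar> < \<theta>"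
    using tendstoD[OF \<rho>(2), of "min \<theta> 1"] tendstoD[OF a, of \<theta>] \<theta>(1) by (simp_all add: dist_real_def)
  then show "\<forall>\<^sub>F s in at_top. dist ((LINT z|lborel. indicator (halfcyl e (s *\<^sub>R x) (\<rho> s) (a s)) z * G (z /\<^sub>R s)) /
            (s * (?\<omega> * \<rho> s ^ (DIM('a) - 1)))) (?\<Phi> 0 0) < \<eta>"
    using \<rho>(1) eventually_gt_at_top[of 0]
  proof eventually_elim
    fix s :: real assume A: "\<bar>\<rho> s / s\<bar> < min \<theta> 1" "\<bar>a s / s\<bar> < \<theta>" "\<rho> s > 0" "s > 0"
    let ?J = "LINT z|lborel. indicator (halfcyl e (s *\<^sub>R x) (\<rho> s) (a s)) z * G (z /\<^sub>R s)"
    let ?V = "?\<omega> * \<rho> s ^ (DIM('a) - 1)"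
    let ?in = "\<lambda>v. \<integral>\<^sup>+r. ennreal (indicator {..a s / s} r * G (x + r *\<^sub>R e + v /\<^sub>R s)) \<partial>lborel"
    have V: "?V > 0" "emeasure (perp_lborel e) (cball 0 (\<rho> s)) = ennreal ?V"
      using A emeasure_perp_lborel_cball(2)[OF e, of "\<rho> s"] by auto
    have cb: "cball 0 (\<rho> s) \<in> sets (perp_lborel e)" by simp
    \<comment> \<open>Truncation at 0 keeps the lower bound meaningful as an \<open>ennreal\<close>
      when the limit is smaller than \<eta> / 2.\<close>
    let ?lo = "max 0 (?\<Phi> 0 0 - \<eta> / 2)" and ?hi = "?\<Phi> 0 0 + \<eta> / 2"
    have inner: "ennreal ?lo \<le> ?in v \<and> ?in v \<le> ennreal ?hi" if v: "v \<in> cball 0 (\<rho> s)" for v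
    proof -
      have nv: "norm (v /\<^sub>R s) \<le> \<rho> s / s" using v A by (simp add: field_simps)
      then have n1: "norm (v /\<^sub>R s) \<le> 1" and n2: "norm (v /\<^sub>R s) < \<theta>" using A(1) by linarith+
      have "?in v = ennreal (?\<Phi> (a s / s) (v /\<^sub>R s))"
        unfolding ray_integral_def using G_bounds by (intro nn_integral_eq_integral ray_integrable[OF n1] AE_I2) auto
      moreover have "\<bar>?\<Phi> (a s / s) (v /\<^sub>R s) - ?\<Phi> 0 0\<bar> < \<eta> / 2" by (rule \<theta>(2)[OF A(2) n2 n1])
      then have "?\<Phi> 0 0 - \<eta> / 2 \<le> ?\<Phi> (a s / s) (v /\<^sub>R s)" "?\<Phi> (a s / s) (v /\<^sub>R s) \<le> ?hi"
        by linarith+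
      ultimately show ?thesis using ray_integral_nonneg[of "a s / s" "v /\<^sub>R s"]
        by (simp del: ennreal_plus)
    qed
    have nn: "(\<integral>\<^sup>+z. ennreal (indicator (halfcyl e (s *\<^sub>R x) (\<rho> s) (a s)) z * G (z /\<^sub>R s)) \<partial>lborel) =
      (\<integral>\<^sup>+v. indicator (cball 0 (\<rho> s)) v * (ennreal s * ?in v) \<partial>perp_lborel e)"
      unfolding nn_integral_halfcyl[OF A(4), symmetric] using G_bounds
      by (intro nn_integral_cong) (auto simp: indicator_def)
    have up: "(\<integral>\<^sup>+v. indicator (cball 0 (\<rho> s)) v * (ennreal s * ?in v) \<partial>perp_lborel e) \<le> ennreal (s * ?V * ?hi)"
    proof -
      have "(\<integral>\<^sup>+v. indicator (cball 0 (\<rho> s)) v * (ennreal s * ?in v) \<partial>perp_lborel e) \<le>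
            (\<integral>\<^sup>+v. (ennreal s * ennreal ?hi) * indicator (cball 0 (\<rho> s)) v \<partial>perp_lborel e)"
        using inner by (intro nn_integral_mono) (auto simp: indicator_def intro!: mult_left_mono)
      also have "\<dots> = ennreal s * ennreal ?hi * ennreal ?V" by (simp only: nn_integral_cmult_indicator[OF cb] V(2))
      also have "\<dots> = ennreal (s * ?V * ?hi)"
        using A V \<eta> ray_integral_nonneg[of 0 0] by (intro ennreal_mult3[symmetric]) auto
      finally show ?thesis .
    qed
    have low: "ennreal (s * ?V * ?lo) \<le> (\<integral>\<^sup>+v. indicator (cball 0 (\<rho> s)) v * (ennreal s * ?in v) \<partial>perp_lborel e)"
    proof -
      have "ennreal (s * ?V * ?lo) = ennreal s * ennreal ?lo * ennreal ?V"
        using A V by (intro ennreal_mult3) auto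
      also have "\<dots> = (\<integral>\<^sup>+v. (ennreal s * ennreal ?lo) * indicator (cball 0 (\<rho> s)) v \<partial>perp_lborel e)"
        by (simp only: nn_integral_cmult_indicator[OF cb] V(2))
      also have "\<dots> \<le> (\<integral>\<^sup>+v. indicator (cball 0 (\<rho> s)) v * (ennreal s * ?in v) \<partial>perp_lborel e)"
        using inner by (intro nn_integral_mono) (auto simp: indicator_def intro!: mult_left_mono)
      finally show ?thesis .
    qed
    have J: "?J = enn2real (\<integral>\<^sup>+z. ennreal (indicator (halfcyl e (s *\<^sub>R x) (\<rho> s) (a s)) z * G (z /\<^sub>R s)) \<partial>lborel)"
      using G_bounds by (intro integral_eq_nn_integral) auto
    have hi0: "0 \<le> s * ?V * ?hi" using A V \<eta> ray_integral_nonneg[of 0 0] by auto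
    have "?J \<le> s * ?V * ?hi" unfolding J nn by (rule enn2real_leI[OF hi0 up])
    moreover have "s * ?V * ?lo \<le> ?J"
    proof -
      have "(\<integral>\<^sup>+v. indicator (cball 0 (\<rho> s)) v * (ennreal s * ?in v) \<partial>perp_lborel e) < top"
        using up by (rule le_less_trans) simp
      then have "enn2real (ennreal (s * ?V * ?lo)) \<le> ?J"
        unfolding J nn using low by (intro enn2real_mono)
      then show ?thesis using A V by simp
    qed
    moreover have "s * ?V > 0" using A V by simp
    ultimately have "?lo \<le> ?J / (s * ?V)" "?J / (s * ?V) \<le> ?hi"
      by (simp_all only: pos_le_divide_eq pos_divide_le_eq mult.commute[of _ "s * ?V"])
    then show "dist (?J / (s * ?V)) (?\<Phi> 0 0) < \<eta>"
      using \<eta> unfolding dist_real_def by linarith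
  qed
qed

lemma halfcyl_integral_tendsto':
  assumes \<rho>: "\<forall>\<^sub>F s in at_top. \<rho> s > 0" "((\<lambda>s. \<rho> s / s) \<longlongrightarrow> 0) at_top" and a: "((\<lambda>s. a s / s) \<longlongrightarrow> 0) at_top"
    and g: "((\<lambda>s. \<rho> s / g s) \<longlongrightarrow> 1) at_top" "\<forall>\<^sub>F s in at_top. g s > 0"
  shows "((\<lambda>s. (LINT z|lborel. indicator (halfcyl e (s *\<^sub>R x) (\<rho> s) (a s)) z * G (z /\<^sub>R s)) /
            (s * (unit_ball_vol (real (DIM('a) - 1)) * g s ^ (DIM('a) - 1))))
         \<longlongrightarrow> ray_integral e x G 0 0) at_top"
proof -
  let ?k = "DIM('a) - 1" and ?\<omega> = "unit_ball_vol (real (DIM('a) - 1))"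
  let ?J = "\<lambda>s. LINT z|lborel. indicator (halfcyl e (s *\<^sub>R x) (\<rho> s) (a s)) z * G (z /\<^sub>R s)"
  have "((\<lambda>s. ?J s / (s * (?\<omega> * \<rho> s ^ ?k)) * (\<rho> s / g s) ^ ?k) \<longlongrightarrow> ray_integral e x G 0 0 * 1 ^ ?k) at_top"
    by (intro tendsto_intros halfcyl_integral_tendsto assms)
  moreover have "\<forall>\<^sub>F s in at_top. ?J s / (s * (?\<omega> * \<rho> s ^ ?k)) * (\<rho> s / g s) ^ ?k = ?J s / (s * (?\<omega> * g s ^ ?k))"
    using \<rho>(1) g(2) by eventually_elim (simp add: power_divide)
  ultimately show ?thesis by (simp add: tendsto_cong)
qed

end

text \<open>The ray starts at the interior point x of a convex set. A frontier point strictly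
  between x and another frontier point would be interior, so the ray meets the frontier at most
  once, and G is continuous elsewhere on the ray.\<close>

lemma ray_setting_indicator:
  fixes e x :: "'a::euclidean_space" and F :: "'a \<Rightarrow> real"
  assumes e: "e \<in> Basis" and U: "open U" "convex U" "bounded U" "x \<in> U"
    and F: "continuous_on U F" "\<And>y. y \<in> U \<Longrightarrow> 0 \<le> F y \<and> F y \<le> B"
    and G: "\<And>y. G y = (if y \<in> U then F y else 0)"
  shows "\<exists>R. ray_setting e x G B R"
proof -
  obtain R where R: "\<And>y. y \<in> U \<Longrightarrow> norm y \<le> R" using U(3) by (auto simp: bounded_iff)
  have B: "B \<ge> 0" using F(2)[OF U(4)] by linarith
  have "ray_setting e x G B R"
  proof
    have "(\<lambda>y. indicator U y *\<^sub>R F y) \<in> borel_measurable borel"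
      using U F by (intro borel_measurable_continuous_on_indicator) auto
    moreover have "(\<lambda>y. indicator U y *\<^sub>R F y) = G" by (auto simp: G)
    ultimately show "G \<in> borel_measurable borel" by simp
    show "0 \<le> G y \<and> G y \<le> B" for y using F(2)[of y] B by (auto simp: G)
    show "norm y \<le> R" if "G y \<noteq> 0" for y using that R[of y] by (auto simp: G split: if_splits)
    let ?N = "{r. r < 0 \<and> x + r *\<^sub>R e \<in> frontier U}"
    have uniq: "\<not> (r1 < r2 \<and> r1 \<in> ?N \<and> r2 \<in> ?N)" for r1 r2
    proof
      assume r: "r1 < r2 \<and> r1 \<in> ?N \<and> r2 \<in> ?N"
      have "x + r2 *\<^sub>R e \<in> open_segment x (x + r1 *\<^sub>R e)"
      proof -
        have "x + r2 *\<^sub>R e = (1 - r2 / r1) *\<^sub>R x + (r2 / r1) *\<^sub>R (x + r1 *\<^sub>R e)"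
          using r by (simp add: algebra_simps)
        moreover have "0 < r2 / r1" "r2 / r1 < 1" using r by (auto simp: field_simps zero_less_divide_iff)
        moreover have "x \<noteq> x + r1 *\<^sub>R e" using r e by auto
        ultimately show ?thesis unfolding in_segment by blast
      qed
      also have "open_segment x (x + r1 *\<^sub>R e) \<subseteq> interior U"
        using r U by (intro in_interior_closure_convex_segment) (auto simp: interior_open frontier_def)
      finally show False using r by (simp add: frontier_def)
    qed
    have "finite ?N"
    proof (cases "?N = {}")
      case False
      then obtain r where "r \<in> ?N" by blast
      then have "?N \<subseteq> {r}" using uniq by (metis (no_types, lifting) insertCI linorder_neqE_linordered_idom subsetI singletonI)
      then show ?thesis by (rule finite_subset) simp
    next
      case True
      then show ?thesis by (simp only: finite.emptyI)
    qed
    then have "AE r in lborel. r \<notin> ?N"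
      by (intro AE_not_in finite_imp_null_set_lborel)
    then show "AE r in lborel. r < 0 \<longrightarrow> isCont G (x + r *\<^sub>R e)"
    proof eventually_elim
      fix r assume r: "r \<notin> ?N"
      show "r < 0 \<longrightarrow> isCont G (x + r *\<^sub>R e)"
      proof
        assume "r < 0"
        then consider "x + r *\<^sub>R e \<in> U" | "x + r *\<^sub>R e \<notin> closure U"
          using r U(1) by (auto simp: frontier_def interior_open)
        then show "isCont G (x + r *\<^sub>R e)"
        proof cases
          case 1
          have "continuous_on U G" using F(1) by (rule continuous_on_eq) (simp add: G)
          then show ?thesis using 1 U(1) by (simp add: continuous_on_eq_continuous_at)
        next
          case 2
          have "continuous_on (- closure U) G"
            using continuous_on_const[of "- closure U" "0::real"]
            by (rule continuous_on_eq) (use closure_subset in \<open>auto simp: G\<close>)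
          then show ?thesis using 2 by (simp add: continuous_on_eq_continuous_at open_Compl)
        qed
      qed
    qed
  qed (rule e)
  then show ?thesis ..
qed

lemma ray_integral_dilate:
  fixes e x :: "'a::euclidean_space"
  assumes c: "c > 0"
  shows "ray_integral e x (\<lambda>y. if y \<in> dilate x c D then B else 0) 0 0 =
         c * ray_integral e x (\<lambda>y. if y \<in> D then B else 0) 0 0"
proof -
  have "ray_integral e x (\<lambda>y. if y \<in> dilate x c D then B else 0) 0 0 =
     \<bar>c\<bar> *\<^sub>R (LINT r|lborel. indicator {..0} (0 + c * r) * (if x + (0 + c * r) *\<^sub>R e + 0 \<in> dilate x c D then B else 0))"
    unfolding ray_integral_def using c by (intro lborel_integral_real_affine) auto
  also have "(LINT r|lborel. indicator {..0} (0 + c * r) * (if x + (0 + c * r) *\<^sub>R e + 0 \<in> dilate x c D then B else 0)) =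
    ray_integral e x (\<lambda>y. if y \<in> D then B else 0) 0 0"
    unfolding ray_integral_def
  proof (rule Bochner_Integration.integral_cong[OF refl])
    fix r :: real
    have "x + (c * r) *\<^sub>R e \<in> dilate x c D \<longleftrightarrow> x + r *\<^sub>R e \<in> D"
      using c by (simp add: mem_dilate_iff)
    moreover have "c * r \<le> 0 \<longleftrightarrow> r \<le> 0" using c by (simp add: mult_le_0_iff)
    ultimately show "indicator {..0} (0 + c * r) * (if x + (0 + c * r) *\<^sub>R e + 0 \<in> dilate x c D then B else 0) =
       indicator {..0} r * (if x + r *\<^sub>R e + 0 \<in> D then B else 0)"
      by (simp add: indicator_def)
  qed
  finally show ?thesis using c by simp
qed

text \<open>The two integrands differ only on the part of the ray in D outside the dilate, and there
  by at most B. By \<open>ray_integral_dilate\<close> this part is the fraction 1 - c of the ray in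
  D. This makes the limit continuous in c at 1.\<close>

lemma ray_integral_restrict:
  fixes e x :: "'a::euclidean_space" and F :: "'a \<Rightarrow> real"
  assumes e: "e \<in> Basis" and D: "open D" "convex D" "bounded D" "x \<in> D"
    and F: "continuous_on D F" "\<And>y. y \<in> D \<Longrightarrow> 0 \<le> F y \<and> F y \<le> B" and c: "0 < c" "c \<le> 1"
  shows "\<bar>ray_integral e x (\<lambda>y. if y \<in> dilate x c D then F y else 0) 0 0 - ray_integral e x (\<lambda>y. if y \<in> D then F y else 0) 0 0\<bar>
     \<le> (1 - c) * ray_integral e x (\<lambda>y. if y \<in> D then B else 0) 0 0"
proof -
  let ?Dc = "dilate x c D"
  have sub: "?Dc \<subseteq> D"
  proof
    fix y assume "y \<in> ?Dc"
    then obtain w where w: "w \<in> D" "y = x + c *\<^sub>R (w - x)" by (auto simp: dilate_def)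
    then have "y = (1 - c) *\<^sub>R x + c *\<^sub>R w" by (simp add: algebra_simps)
    then show "y \<in> D" using convexD[OF D(2,4) w(1), of "1 - c" c] c by simp
  qed
  have Dc: "open ?Dc" "convex ?Dc" "bounded ?Dc" "x \<in> ?Dc"
    using D c by (auto intro: open_dilate convex_dilate bounded_dilate dilate_center)
  have Fc: "continuous_on ?Dc F" using F(1) sub by (rule continuous_on_subset)
  have B0: "B \<ge> 0" using F(2)[OF D(4)] by linarith
  have bc: "0 \<le> F y \<and> F y \<le> B" if "y \<in> ?Dc" for y using F(2) sub that by blast
  have bB: "0 \<le> B \<and> B \<le> B" using B0 by simp
  obtain R1 where 1: "ray_setting e x (\<lambda>y. if y \<in> ?Dc then F y else 0) B R1"
    using ray_setting_indicator[OF e Dc Fc bc, of "\<lambda>y. if y \<in> ?Dc then F y else 0"] by auto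
  obtain R2 where 2: "ray_setting e x (\<lambda>y. if y \<in> D then F y else 0) B R2"
    using ray_setting_indicator[OF e D F, of "\<lambda>y. if y \<in> D then F y else 0"] by auto
  obtain R3 where 3: "ray_setting e x (\<lambda>y. if y \<in> ?Dc then B else 0) B R3"
    using ray_setting_indicator[OF e Dc continuous_on_const bB, of "\<lambda>y. if y \<in> ?Dc then B else 0"] by auto
  obtain R4 where 4: "ray_setting e x (\<lambda>y. if y \<in> D then B else 0) B R4"
    using ray_setting_indicator[OF e D continuous_on_const bB, of "\<lambda>y. if y \<in> D then B else 0"] by auto
  note i = ray_setting.ray_integrable[OF 1, of 0 0] ray_setting.ray_integrable[OF 2, of 0 0]
    ray_setting.ray_integrable[OF 3, of 0 0] ray_setting.ray_integrable[OF 4, of 0 0]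
  let ?I = "\<lambda>G. ray_integral e x G 0 0"
  have "\<bar>?I (\<lambda>y. if y \<in> ?Dc then F y else 0) - ?I (\<lambda>y. if y \<in> D then F y else 0)\<bar> =
     \<bar>LINT r|lborel. indicator {..0} r * (if x + r *\<^sub>R e + 0 \<in> ?Dc then F (x + r *\<^sub>R e + 0) else 0) -
       indicator {..0} r * (if x + r *\<^sub>R e + 0 \<in> D then F (x + r *\<^sub>R e + 0) else 0)\<bar>"
    unfolding ray_integral_def using i by (subst Bochner_Integration.integral_diff) auto
  also have "\<dots> \<le> (LINT r|lborel. \<bar>indicator {..0} r * (if x + r *\<^sub>R e + 0 \<in> ?Dc then F (x + r *\<^sub>R e + 0) else 0) -
       indicator {..0} r * (if x + r *\<^sub>R e + 0 \<in> D then F (x + r *\<^sub>R e + 0) else 0)\<bar>)"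
    by (rule integral_abs_bound)
  also have "\<dots> \<le> (LINT r|lborel. indicator {..0} r * (if x + r *\<^sub>R e + 0 \<in> D then B else 0) -
       indicator {..0} r * (if x + r *\<^sub>R e + 0 \<in> ?Dc then B else 0))"
    using i F(2) sub B0 by (intro integral_mono integrable_abs Bochner_Integration.integrable_diff)
      (auto simp: indicator_def)
  also have "\<dots> = ?I (\<lambda>y. if y \<in> D then B else 0) - ?I (\<lambda>y. if y \<in> ?Dc then B else 0)"
    unfolding ray_integral_def using i by (subst Bochner_Integration.integral_diff) auto
  also have "\<dots> = (1 - c) * ?I (\<lambda>y. if y \<in> D then B else 0)"
    using ray_integral_dilate[OF c(1), of e x D B] by (simp add: algebra_simps)
  finally show ?thesis .
qed

section \<open>Averages of translated counts\<close>

definition translate :: "'a::ab_group_add \<Rightarrow> 'a set \<Rightarrow> 'a set" where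
  "translate u \<phi> = (+) u ` \<phi>"

text \<open>Half-open, so that its lattice translates partition the space.\<close>

definition unit_cube :: "'a::euclidean_space set" where
  "unit_cube = {z. \<forall>b\<in>Basis. 0 \<le> z \<bullet> b \<and> z \<bullet> b < 1}"

definition lattice :: "'a::euclidean_space set" where
  "lattice = {k. \<forall>b\<in>Basis. k \<bullet> b \<in> \<int>}"

lemma translate_add: "translate u (translate v \<phi>) = translate (u + v) \<phi>"
  by (auto simp: translate_def image_image add.assoc)

lemma card_translate_Int: "card (translate u \<phi> \<inter> B) = card (\<phi> \<inter> translate (- u) B)"
proof -
  have "translate u \<phi> \<inter> B = (+) u ` (\<phi> \<inter> translate (- u) B)"
    unfolding translate_def by force
  then show ?thesis by (simp add: card_image)
qed

lemma translate_borel: "B \<in> sets borel \<Longrightarrow> translate u B \<in> sets borel" for B :: "'a::euclidean_space set"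
proof -
  assume B: "B \<in> sets borel"
  have "translate u B = (\<lambda>y. y - u) -` B \<inter> space borel" unfolding translate_def by (force simp: image_iff)
  also have "\<dots> \<in> sets borel" using B by measurable
  finally show ?thesis .
qed

lemma translate_bounded: "bounded B \<Longrightarrow> bounded (translate u B)" for B :: "'a::euclidean_space set"
  unfolding translate_def by (rule bounded_translation)

lemma emeasure_translate: "B \<in> sets borel \<Longrightarrow> emeasure lborel (translate u B) = emeasure lborel B" for B :: "'a::euclidean_space set"
proof -
  assume B: "B \<in> sets borel"
  have "emeasure lborel B = emeasure (distr lborel borel ((+) (- u))) B" by (simp add: lborel_distr_plus)
  also have "\<dots> = emeasure lborel ((+) (- u) -` B \<inter> space lborel)" using B by (intro emeasure_distr) auto
  also have "(+) (- u) -` B \<inter> space lborel = translate u B" unfolding translate_def by (force simp: image_iff)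
  finally show ?thesis by simp
qed

lemma locally_finite_translate: "locally_finite \<phi> \<Longrightarrow> locally_finite (translate u \<phi>)" for \<phi> :: "'a::euclidean_space set"
  unfolding locally_finite_def
proof safe
  fix B :: "'a set" assume *: "\<forall>B. bounded B \<longrightarrow> finite (\<phi> \<inter> B)" "bounded B"
  have "translate u \<phi> \<inter> B = (+) u ` (\<phi> \<inter> translate (- u) B)" unfolding translate_def by force
  then show "finite (translate u \<phi> \<inter> B)" using * translate_bounded[of B "- u"] by simp
qed

lemma translate_measurable [measurable]: "translate u \<in> measurable configs (configs :: 'a::euclidean_space set measure)"
proof (rule measurable_into_configs)
  show "locally_finite (translate u \<phi>)" if "\<phi> \<in> space configs" for \<phi> :: "'a set"
    using that by (simp add: space_configs locally_finite_translate)
  show "(\<lambda>\<phi>. card (translate u \<phi> \<inter> B)) \<in> measurable configs (count_space UNIV)"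
    if "B \<in> sets borel" "bounded B" for B :: "'a set"
    unfolding card_translate_Int using that by (intro measurable_card_configs translate_borel translate_bounded)
qed

lemma unit_cube_borel: "unit_cube \<in> sets borel"
  unfolding unit_cube_def by measurable

lemma unit_cube_norm: "z \<in> unit_cube \<Longrightarrow> norm z \<le> real DIM('a)" for z :: "'a::euclidean_space"
proof -
  assume z: "z \<in> unit_cube"
  have "norm z \<le> (\<Sum>b\<in>Basis. \<bar>z \<bullet> b\<bar>)" by (rule norm_le_l1)
  also have "\<dots> \<le> (\<Sum>b\<in>(Basis :: 'a set). 1)" using z by (intro sum_mono) (force simp: unit_cube_def)
  finally show ?thesis by simp
qed

lemma unit_cube_bounded: "bounded (unit_cube :: 'a::euclidean_space set)"
  using unit_cube_norm by (auto simp: bounded_iff)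

lemma emeasure_unit_cube: "emeasure lborel (unit_cube :: 'a::euclidean_space set) = 1"
proof -
  have "(indicator unit_cube :: 'a \<Rightarrow> ennreal) = (\<lambda>z. \<Prod>b\<in>Basis. indicator {0..<1} (z \<bullet> b))"
    by (rule ext) (auto simp: unit_cube_def indicator_def prod_zero_iff intro!: prod.neutral[symmetric])
  then have "emeasure lborel (unit_cube :: 'a set) = (\<integral>\<^sup>+z. (\<Prod>b\<in>Basis. indicator {0..<1} (z \<bullet> b)) \<partial>(lborel :: 'a measure))"
    using unit_cube_borel by (metis nn_integral_indicator sets_lborel)
  also have "\<dots> = (\<Prod>b\<in>(Basis :: 'a set). (\<integral>\<^sup>+t. indicator {0..<1::real} t \<partial>lborel))"
    by (rule nn_integral_lborel_prod) auto
  finally show ?thesis by simp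
qed

lemma lattice_part_exists: "\<exists>k\<in>lattice. z - k \<in> unit_cube" for z :: "'a::euclidean_space"
proof -
  let ?k = "\<Sum>b\<in>Basis. of_int \<lfloor>z \<bullet> b\<rfloor> *\<^sub>R b :: 'a"
  have k: "?k \<bullet> b = of_int \<lfloor>z \<bullet> b\<rfloor>" if "b \<in> Basis" for b using that by simp
  have "z - ?k \<in> unit_cube" unfolding unit_cube_def using k by (auto simp: inner_diff_left) linarith
  moreover have "?k \<in> lattice" unfolding lattice_def using k by auto
  ultimately show ?thesis by blast
qed

lemma lattice_part_unique:
  fixes k k' z :: "'a::euclidean_space"
  assumes "k \<in> lattice" "k' \<in> lattice" "z - k \<in> unit_cube" "z - k' \<in> unit_cube"
  shows "k = k'"
proof (rule euclidean_eqI)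
  fix b :: 'a assume b: "b \<in> Basis"
  have "k \<bullet> b \<in> \<int>" "k' \<bullet> b \<in> \<int>" using assms(1,2) b by (simp_all add: lattice_def)
  then obtain m n where mn: "k \<bullet> b = of_int m" "k' \<bullet> b = of_int n" by (elim Ints_cases)
  have "0 \<le> z \<bullet> b - of_int m" "z \<bullet> b - of_int m < 1" "0 \<le> z \<bullet> b - of_int n" "z \<bullet> b - of_int n < 1"
    using assms(3,4) b mn by (auto simp: unit_cube_def inner_diff_left)
  then have "m = n" by linarith
  then show "k \<bullet> b = k' \<bullet> b" using mn by simp
qed

lemma lattice_cubes_volume:
  fixes K :: "'a::euclidean_space set"
  assumes K: "finite K" "K \<subseteq> lattice"
  shows "emeasure lborel (\<Union>k\<in>K. translate k unit_cube) = of_nat (card K)"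
proof -
  have "disjoint_family_on (\<lambda>k. translate k unit_cube) K"
    unfolding disjoint_family_on_def
  proof (intro ballI impI)
    fix k k' assume k: "k \<in> K" "k' \<in> K" "k \<noteq> k'"
    show "translate k unit_cube \<inter> translate k' unit_cube = {}"
    proof (rule ccontr)
      assume "translate k unit_cube \<inter> translate k' unit_cube \<noteq> {}"
      then obtain z where "z - k \<in> unit_cube" "z - k' \<in> unit_cube" by (auto simp: translate_def) (metis add_diff_cancel_left')
      then show False using lattice_part_unique[of k k' z] k K by blast
    qed
  qed
  then have "emeasure lborel (\<Union>k\<in>K. translate k unit_cube) = (\<Sum>k\<in>K. emeasure lborel (translate k unit_cube))"
    using K(1) translate_borel[OF unit_cube_borel] by (intro sum_emeasure[symmetric]) auto
  also have "\<dots> = of_nat (card K)"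
    by (simp add: emeasure_translate[OF unit_cube_borel] emeasure_unit_cube)
  finally show ?thesis .
qed

text \<open>Infinitely many lattice points in a bounded set would give disjoint unit cubes of
  arbitrarily large total volume inside one ball.\<close>

lemma lattice_finite:
  fixes S :: "'a::euclidean_space set"
  assumes "bounded S"
  shows "finite (lattice \<inter> S)"
proof (rule ccontr)
  assume inf: "infinite (lattice \<inter> S)"
  obtain r where r: "\<And>z. z \<in> S \<Longrightarrow> norm z \<le> r" using assms by (auto simp: bounded_iff)
  let ?b = "cball (0::'a) (r + real DIM('a))"
  have fin: "emeasure lborel ?b < \<infinity>" by (rule emeasure_lborel_cball_finite)
  then obtain N :: nat where N: "emeasure lborel ?b < of_nat N"
  proof -
    obtain m where m: "emeasure lborel ?b = ennreal m" "m \<ge> 0"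
      using fin by (cases "emeasure lborel ?b") auto
    obtain N :: nat where "m < real N" using reals_Archimedean2 by blast
    then show thesis using m that[of N] by (simp add: ennreal_of_nat_eq_real_of_nat ennreal_less_iff)
  qed
  obtain K where K: "K \<subseteq> lattice \<inter> S" "finite K" "card K = N"
    using infinite_arbitrarily_large[OF inf] by blast
  have "(\<Union>k\<in>K. translate k unit_cube) \<subseteq> ?b"
  proof
    fix z assume "z \<in> (\<Union>k\<in>K. translate k unit_cube)"
    then obtain k w where "k \<in> K" "w \<in> unit_cube" "z = k + w" by (auto simp: translate_def)
    then show "z \<in> ?b" using r[of k] K(1) unit_cube_norm[of w] norm_triangle_ineq[of k w] by auto
  qed
  then have "emeasure lborel (\<Union>k\<in>K. translate k unit_cube) \<le> emeasure lborel ?b"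
    by (intro emeasure_mono) auto
  then show False using lattice_cubes_volume[of K] K N by auto
qed

text \<open>Midpoints of translates suffice for the parallelogram argument; general convex combinations
  are not needed.\<close>

inductive avg :: "('a::euclidean_space set \<Rightarrow> real) \<Rightarrow> bool" where
  avg_base: "avg (\<lambda>\<phi>. real (card (\<phi> \<inter> translate u unit_cube)))"
| avg_mid: "avg F \<Longrightarrow> avg G \<Longrightarrow> avg (\<lambda>\<phi>. (F \<phi> + G \<phi>) / 2)"

lemma avg_nonneg: "avg F \<Longrightarrow> F \<phi> \<ge> 0"
  by (induction rule: avg.induct) auto

lemma avg_measurable: "avg F \<Longrightarrow> F \<in> borel_measurable configs"
proof (induction rule: avg.induct)
  case (avg_base u)
  have "(\<lambda>\<phi>. card (\<phi> \<inter> translate u unit_cube)) \<in> measurable configs (count_space UNIV)"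
    by (intro measurable_card_configs translate_borel translate_bounded unit_cube_borel unit_cube_bounded)
  then show ?case by measurable
next
  case (avg_mid F G)
  then show ?case by measurable
qed

lemma avg_translate: "avg F \<Longrightarrow> avg (\<lambda>\<phi>. F (translate u \<phi>))"
proof (induction rule: avg.induct)
  case (avg_base v)
  have "(\<lambda>\<phi>. real (card (translate u \<phi> \<inter> translate v unit_cube))) = (\<lambda>\<phi>. real (card (\<phi> \<inter> translate (- u + v) unit_cube)))"
    by (simp add: card_translate_Int translate_add)
  then show ?case using avg.avg_base by metis
next
  case (avg_mid F G)
  show ?case by (rule avg.avg_mid) fact+
qed

text \<open>Joint measurability in the configuration and the translation is what allows Fubini over
  translations in \<open>invariant_function_constant\<close>.\<close>

lemma avg_joint_measurable:
  "avg F \<Longrightarrow> (\<lambda>p. F (translate (snd p) (fst p))) \<in> borel_measurable (configs \<Otimes>\<^sub>M (borel :: 'a::euclidean_space measure))"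
proof (induction rule: avg.induct)
  case (avg_base v)
  let ?N = "configs \<Otimes>\<^sub>M (borel :: 'a measure)"
  let ?Q = "translate v unit_cube :: 'a set"
  have Q: "?Q \<in> sets borel" by (intro translate_borel unit_cube_borel)
  have [measurable]: "Measurable.pred borel (\<lambda>z. z \<in> ?Q)" using Q by measurable
  have "(\<lambda>q. indicator ?Q (fst q + snd (snd q)) :: ennreal) \<in> borel_measurable (borel \<Otimes>\<^sub>M ?N)"
    using Q by measurable
  from measurable_random_sum[OF measurable_fst this]
  have m: "(\<lambda>p. \<integral>\<^sup>+y. indicator ?Q (y + snd p) \<partial>count_space (fst p) :: ennreal) \<in> borel_measurable ?N" by simp
  show ?case
  proof (subst measurable_cong)
    show "(\<lambda>p. enn2real (\<integral>\<^sup>+y. indicator ?Q (y + snd p) \<partial>count_space (fst p))) \<in> borel_measurable ?N"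
      using m by measurable
    fix p :: "'a set \<times> 'a" assume "p \<in> space ?N"
    then have lf: "locally_finite (fst p)" by (auto simp: space_pair_measure space_configs)
    have "(\<integral>\<^sup>+y. indicator ?Q (y + snd p) \<partial>count_space (fst p)) = (\<integral>\<^sup>+y. indicator (translate (- snd p) ?Q) y \<partial>count_space (fst p) :: ennreal)"
      by (intro nn_integral_cong) (force simp: indicator_def translate_def image_iff algebra_simps)
    also have "\<dots> = of_nat (card (fst p \<inter> translate (- snd p) ?Q))"
      using lf translate_bounded[OF translate_bounded[OF unit_cube_bounded]]
      by (intro nn_integral_point_indicator) (auto simp: locally_finite_def)
    finally show "real (card (translate (snd p) (fst p) \<inter> ?Q)) = enn2real (\<integral>\<^sup>+y. indicator ?Q (y + snd p) \<partial>count_space (fst p))"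
      by (simp add: card_translate_Int ennreal_of_nat_eq_real_of_nat)
  qed
next
  case (avg_mid F G)
  then show ?case by measurable
qed

text \<open>F acts as a count per lattice cell with range R. Summed over all lattice points within R
  of S, its translates count at least the points in S; summed over lattice points whose R-ball is
  inside S, they count at most these. This is how averages control counts in large regions up to the
  boundary.\<close>

definition compares :: "('a::euclidean_space set \<Rightarrow> real) \<Rightarrow> real \<Rightarrow> bool" where
  "compares F R \<longleftrightarrow> (\<forall>\<phi> S K. locally_finite \<phi> \<longrightarrow> bounded S \<longrightarrow> finite K \<longrightarrow> K \<subseteq> lattice \<longrightarrow>
    ((\<forall>k\<in>lattice. (\<exists>z\<in>S. norm (z - k) \<le> R) \<longrightarrow> k \<in> K) \<longrightarrow> real (card (\<phi> \<inter> S)) \<le> (\<Sum>k\<in>K. F (translate (- k) \<phi>))) \<and>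
    ((\<forall>k\<in>K. cball k R \<subseteq> S) \<longrightarrow> (\<Sum>k\<in>K. F (translate (- k) \<phi>)) \<le> real (card (\<phi> \<inter> S))))"

lemma comparesD:
  assumes "compares F R" "locally_finite \<phi>" "bounded S" "finite K" "K \<subseteq> lattice"
  shows "(\<And>k z. k \<in> lattice \<Longrightarrow> z \<in> S \<Longrightarrow> norm (z - k) \<le> R \<Longrightarrow> k \<in> K) \<Longrightarrow>
      real (card (\<phi> \<inter> S)) \<le> (\<Sum>k\<in>K. F (translate (- k) \<phi>))"
    and "(\<And>k. k \<in> K \<Longrightarrow> cball k R \<subseteq> S) \<Longrightarrow> (\<Sum>k\<in>K. F (translate (- k) \<phi>)) \<le> real (card (\<phi> \<inter> S))"
proof -
  note * = assms(1)[unfolded compares_def, THEN spec[of _ \<phi>], THEN spec[of _ S], THEN spec[of _ K],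
      THEN mp, THEN mp, THEN mp, THEN mp, OF assms(2-5)]
  show "real (card (\<phi> \<inter> S)) \<le> (\<Sum>k\<in>K. F (translate (- k) \<phi>))"
    if "\<And>k z. k \<in> lattice \<Longrightarrow> z \<in> S \<Longrightarrow> norm (z - k) \<le> R \<Longrightarrow> k \<in> K"
    by (rule conjunct1[OF *, THEN mp]) (intro ballI impI, elim bexE, rule that)
  show "(\<Sum>k\<in>K. F (translate (- k) \<phi>)) \<le> real (card (\<phi> \<inter> S))" if "\<And>k. k \<in> K \<Longrightarrow> cball k R \<subseteq> S"
    by (rule conjunct2[OF *, THEN mp]) (intro ballI that)
qed

text \<open>For a single cube translated by u, the lattice translates tile the space, so the sum
  over K is the exact count in a union of cells; \<open>norm u\<close> plus the dimension bounds the
  distance from a lattice point to the points of its cell. Both bounds pass to midpoints, with the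
  larger range.\<close>

lemma avg_compare: "avg F \<Longrightarrow> \<exists>R\<ge>0. compares F R" for F :: "'a::euclidean_space set \<Rightarrow> real"
proof (induction rule: avg.induct)
  case (avg_base u)
  let ?R = "norm u + real DIM('a)"
  let ?Q = "\<lambda>k. translate (k + u) unit_cube :: 'a set"
  show ?case
    unfolding compares_def
  proof (intro exI[of _ ?R] conjI allI impI)
    fix \<phi> S K :: "'a set"
    assume lf: "locally_finite \<phi>" and S: "bounded S" and K: "finite K" "K \<subseteq> lattice"
    have fin: "finite (\<phi> \<inter> B)" if "bounded B" for B using lf that by (auto simp: locally_finite_def)
    have finQ: "finite (\<phi> \<inter> ?Q k)" for k by (intro fin translate_bounded unit_cube_bounded)
    have near: "norm (z - k) \<le> ?R" if z: "z \<in> ?Q k" for z k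
    proof -
      obtain w where w: "w \<in> unit_cube" "z = k + u + w" using z by (auto simp: translate_def)
      then show ?thesis using unit_cube_norm[OF w(1)] norm_triangle_ineq[of u w] by (simp add: add.assoc)
    qed
    have "real (card (translate (- k) \<phi> \<inter> translate u unit_cube)) = real (card (\<phi> \<inter> ?Q k))" for k
      by (simp add: card_translate_Int translate_add)
    moreover have "(\<Sum>k\<in>K. real (card (\<phi> \<inter> ?Q k))) = real (card (\<Union>k\<in>K. \<phi> \<inter> ?Q k))"
    proof -
      have "(\<phi> \<inter> ?Q k) \<inter> (\<phi> \<inter> ?Q k') = {}" if "k \<in> K" "k' \<in> K" "k \<noteq> k'" for k k'
      proof (rule ccontr)
        assume "\<not> ?thesis"
        then obtain w w' where w: "w \<in> unit_cube" "w' \<in> unit_cube" "k + u + w = k' + u + w'"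
          by (auto simp: translate_def)
        then have "k + w = k' + w'" by (simp add: algebra_simps)
        then have eqs: "(k + w) - k = w" "(k + w) - k' = w'" by (metis add_diff_cancel_left')+
        have "(k + w) - k \<in> unit_cube" "(k + w) - k' \<in> unit_cube" unfolding eqs by (rule w)+
        then have "k = k'" using lattice_part_unique[of k k' "k + w"] that K(2) by auto
        then show False using that(3) by simp
      qed
      then show ?thesis using K(1) finQ by (subst card_UN_disjoint) auto
    qed
    ultimately have sum: "(\<Sum>k\<in>K. real (card (translate (- k) \<phi> \<inter> translate u unit_cube))) = real (card (\<Union>k\<in>K. \<phi> \<inter> ?Q k))"
      by simp
    have finU: "finite (\<Union>k\<in>K. \<phi> \<inter> ?Q k)" by (rule finite_UN_I[OF K(1)]) (rule finQ)
    show "real (card (\<phi> \<inter> S)) \<le> (\<Sum>k\<in>K. real (card (translate (- k) \<phi> \<inter> translate u unit_cube)))"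
      if cov: "\<forall>k\<in>lattice. (\<exists>z\<in>S. norm (z - k) \<le> ?R) \<longrightarrow> k \<in> K"
    proof -
      have "\<phi> \<inter> S \<subseteq> (\<Union>k\<in>K. \<phi> \<inter> ?Q k)"
      proof
        fix z assume z: "z \<in> \<phi> \<inter> S"
        obtain k where k: "k \<in> lattice" "z - u - k \<in> unit_cube" using lattice_part_exists by blast
        have "z = k + u + (z - u - k)" by simp
        then have zQ: "z \<in> ?Q k" unfolding translate_def using k(2) by (rule image_eqI)
        then have "k \<in> K" using cov k(1) near[OF zQ] z by blast
        then show "z \<in> (\<Union>k\<in>K. \<phi> \<inter> ?Q k)" using zQ z by blast
      qed
      then show ?thesis unfolding sum using finU by (simp add: card_mono)
    qed
    show "(\<Sum>k\<in>K. real (card (translate (- k) \<phi> \<inter> translate u unit_cube))) \<le> real (card (\<phi> \<inter> S))"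
      if sub: "\<forall>k\<in>K. cball k ?R \<subseteq> S"
    proof -
      have "(\<Union>k\<in>K. \<phi> \<inter> ?Q k) \<subseteq> \<phi> \<inter> S"
      proof
        fix z assume "z \<in> (\<Union>k\<in>K. \<phi> \<inter> ?Q k)"
        then obtain k where k: "k \<in> K" "z \<in> ?Q k" "z \<in> \<phi>" by blast
        have "z \<in> cball k ?R" using near[OF k(2)] by (simp add: dist_norm norm_minus_commute)
        then show "z \<in> \<phi> \<inter> S" using sub k by blast
      qed
      then show ?thesis unfolding sum using fin[OF S] by (simp add: card_mono)
    qed
  qed simp
next
  case (avg_mid F G)
  obtain R1 where R1: "R1 \<ge> 0" "compares F R1" using avg_mid.IH(1) by auto
  obtain R2 where R2: "R2 \<ge> 0" "compares G R2" using avg_mid.IH(2) by auto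
  have mid: "a \<le> b \<Longrightarrow> a \<le> c \<Longrightarrow> a \<le> (b + c) / 2" "b \<le> a \<Longrightarrow> c \<le> a \<Longrightarrow> (b + c) / 2 \<le> a" for a b c :: real
    by simp_all
  let ?R = "max R1 R2"
  show ?case
    unfolding compares_def
  proof (intro exI[of _ ?R] conjI allI impI)
    fix \<phi> S K :: "'a set"
    assume h: "locally_finite \<phi>" "bounded S" "finite K" "K \<subseteq> lattice"
    have sum: "(\<Sum>k\<in>K. (F (translate (- k) \<phi>) + G (translate (- k) \<phi>)) / 2) =
      ((\<Sum>k\<in>K. F (translate (- k) \<phi>)) + (\<Sum>k\<in>K. G (translate (- k) \<phi>))) / 2"
      by (simp add: sum_divide_distrib[symmetric] sum.distrib)
    show "real (card (\<phi> \<inter> S)) \<le> (\<Sum>k\<in>K. (F (translate (- k) \<phi>) + G (translate (- k) \<phi>)) / 2)"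
      if H: "\<forall>k\<in>lattice. (\<exists>z\<in>S. norm (z - k) \<le> ?R) \<longrightarrow> k \<in> K"
    proof -
      have "k \<in> K" if "k \<in> lattice" "z \<in> S" "norm (z - k) \<le> R1 \<or> norm (z - k) \<le> R2" for k z
      proof -
        have "norm (z - k) \<le> ?R" using that(3) by (simp add: le_max_iff_disj)
        then show ?thesis using H that(1,2) by auto
      qed
      then have "real (card (\<phi> \<inter> S)) \<le> (\<Sum>k\<in>K. F (translate (- k) \<phi>))"
        "real (card (\<phi> \<inter> S)) \<le> (\<Sum>k\<in>K. G (translate (- k) \<phi>))"
        using comparesD(1)[OF R1(2) h] comparesD(1)[OF R2(2) h] by auto
      then show ?thesis unfolding sum by (rule mid(1))
    qed
    show "(\<Sum>k\<in>K. (F (translate (- k) \<phi>) + G (translate (- k) \<phi>)) / 2) \<le> real (card (\<phi> \<inter> S))"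
      if H: "\<forall>k\<in>K. cball k ?R \<subseteq> S"
    proof -
      have "cball k R1 \<subseteq> S" "cball k R2 \<subseteq> S" if "k \<in> K" for k
        using H that subset_cball[of R1 ?R k] subset_cball[of R2 ?R k] by auto
      then have "(\<Sum>k\<in>K. F (translate (- k) \<phi>)) \<le> real (card (\<phi> \<inter> S))"
        "(\<Sum>k\<in>K. G (translate (- k) \<phi>)) \<le> real (card (\<phi> \<inter> S))"
        using comparesD(2)[OF R1(2) h] comparesD(2)[OF R2(2) h] by auto
      then show ?thesis unfolding sum by (rule mid(2))
    qed
  qed (use R1 in auto)
qed

section \<open>Mean ergodic theorem for counts\<close>

lemma AE_summable_of_nn_integral:
  fixes f :: "nat \<Rightarrow> 'a \<Rightarrow> real"
  assumes f: "\<And>n. f n \<in> borel_measurable N" "\<And>n x. f n x \<ge> 0"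
    and le: "\<And>n. (\<integral>\<^sup>+x. ennreal (f n x) \<partial>N) \<le> ennreal (C * (1 / 2) ^ n)" and C: "C \<ge> 0"
  shows "AE x in N. summable (\<lambda>n. f n x)" and "(\<integral>\<^sup>+x. (\<Sum>n. ennreal (f n x)) \<partial>N) < \<infinity>"
proof -
  have [measurable]: "f n \<in> borel_measurable N" for n by (rule f)
  have "(\<integral>\<^sup>+x. (\<Sum>n. ennreal (f n x)) \<partial>N) = (\<Sum>n. \<integral>\<^sup>+x. ennreal (f n x) \<partial>N)"
    by (rule nn_integral_suminf) measurable
  also have "\<dots> \<le> (\<Sum>n. ennreal (C * (1 / 2) ^ n))" using le by (intro suminf_le) auto
  also have "\<dots> = ennreal (C * 2)"
    using C geometric_sums[of "1 / 2 :: real"] sums_mult[of "\<lambda>n. (1 / 2) ^ n" 2 C]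
    by (intro suminf_ennreal_eq) auto
  finally show fin: "(\<integral>\<^sup>+x. (\<Sum>n. ennreal (f n x)) \<partial>N) < \<infinity>"
    by (rule le_less_trans) simp
  have "AE x in N. (\<Sum>n. ennreal (f n x)) \<noteq> \<infinity>"
    using fin by (intro nn_integral_PInf_AE) auto
  then show "AE x in N. summable (\<lambda>n. f n x)"
  proof eventually_elim
    fix x assume "(\<Sum>n. ennreal (f n x)) \<noteq> \<infinity>"
    then show "summable (\<lambda>n. f n x)" by (intro summable_suminf_not_top f(2)) simp
  qed
qed

locale ergodic_setting =
  fixes M :: "'w measure" and Y :: "'w \<Rightarrow> 'a::euclidean_space set" and \<kappa> :: real
  assumes prob: "prob_space M" and ergodic: "ergodic_process M Y"
    and \<kappa>: "\<kappa> \<ge> 0"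
    and mean: "\<And>B. B \<in> sets borel \<Longrightarrow> bounded B \<Longrightarrow>
      (\<integral>\<^sup>+\<omega>. of_nat (card (Y \<omega> \<inter> B)) \<partial>M) = ennreal \<kappa> * emeasure lborel B"
    and square: "\<And>B. B \<in> sets borel \<Longrightarrow> bounded B \<Longrightarrow>
      (\<integral>\<^sup>+\<omega>. ennreal ((real (card (Y \<omega> \<inter> B)))\<^sup>2) \<partial>M) < \<infinity>"
begin

definition "P = distr M configs Y"

lemma Y_measurable [measurable]: "Y \<in> measurable M configs"
  using ergodic by (simp add: ergodic_process_def stationary_process_def point_process_on_def)

sublocale P: prob_space P
  unfolding P_def by (intro prob_space.prob_space_distr prob) simp

lemma sets_P [simp, measurable_cong]: "sets P = sets configs"
  and space_P [simp]: "space P = space configs"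
  by (simp_all add: P_def)

lemma P_translate: "distr P P (translate u) = P"
proof -
  have "distr P P (translate u) = distr M configs (translate u \<circ> Y)"
    unfolding P_def by (subst distr_distr[symmetric]) (auto intro: distr_cong)
  also have "\<dots> = distr M configs (\<lambda>\<omega>. (+) u ` Y \<omega>)" by (simp add: comp_def translate_def)
  also have "\<dots> = P" using ergodic by (simp add: ergodic_process_def stationary_process_def P_def)
  finally show ?thesis .
qed

lemma avg_moments:
  assumes "avg F"
  shows "(\<integral>\<^sup>+\<phi>. ennreal (F \<phi>) \<partial>P) = ennreal \<kappa>" and "(\<integral>\<^sup>+\<phi>. ennreal ((F \<phi>)\<^sup>2) \<partial>P) < \<infinity>"
  using assms
proof (induction rule: avg.induct)
  case (avg_base u)
  let ?Q = "translate u unit_cube :: 'a set"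
  have Q: "?Q \<in> sets borel" "bounded ?Q"
    by (intro translate_borel translate_bounded unit_cube_borel unit_cube_bounded)+
  have m: "(\<lambda>\<phi>. card (\<phi> \<inter> ?Q)) \<in> measurable configs (count_space UNIV)"
    by (rule measurable_card_configs[OF Q])
  {
    case 1
    have "(\<integral>\<^sup>+\<phi>. ennreal (real (card (\<phi> \<inter> ?Q))) \<partial>P) = (\<integral>\<^sup>+\<omega>. of_nat (card (Y \<omega> \<inter> ?Q)) \<partial>M)"
      unfolding P_def using m by (subst nn_integral_distr) (auto simp: ennreal_of_nat_eq_real_of_nat)
    also have "\<dots> = ennreal \<kappa>"
      using mean[OF Q] by (simp add: emeasure_translate[OF unit_cube_borel] emeasure_unit_cube)
    finally show ?case .
  next
    case 2
    have "(\<integral>\<^sup>+\<phi>. ennreal ((real (card (\<phi> \<inter> ?Q)))\<^sup>2) \<partial>P) = (\<integral>\<^sup>+\<omega>. ennreal ((real (card (Y \<omega> \<inter> ?Q)))\<^sup>2) \<partial>M)"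
      unfolding P_def using m by (subst nn_integral_distr) auto
    then show ?case using square[OF Q] by simp
  }
next
  case (avg_mid F G)
  have [measurable]: "F \<in> borel_measurable configs" "G \<in> borel_measurable configs"
    using avg_mid.hyps by (auto intro: avg_measurable)
  have nn: "0 \<le> F \<phi>" "0 \<le> G \<phi>" for \<phi> using avg_mid.hyps avg_nonneg by auto
  {
    case 1
    have "ennreal ((F \<phi> + G \<phi>) / 2) = ennreal (1 / 2) * ennreal (F \<phi>) + ennreal (1 / 2) * ennreal (G \<phi>)" for \<phi>
    proof -
      have "ennreal ((F \<phi> + G \<phi>) / 2) = ennreal (1 / 2 * F \<phi> + 1 / 2 * G \<phi>)"
        by (simp add: add_divide_distrib)
      also have "\<dots> = ennreal (1 / 2 * F \<phi>) + ennreal (1 / 2 * G \<phi>)"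
        using nn by (intro ennreal_plus) auto
      also have "\<dots> = ennreal (1 / 2) * ennreal (F \<phi>) + ennreal (1 / 2) * ennreal (G \<phi>)"
        by (subst (1 2) ennreal_mult') simp_all
      finally show ?thesis .
    qed
    then have "(\<integral>\<^sup>+\<phi>. ennreal ((F \<phi> + G \<phi>) / 2) \<partial>P) = (\<integral>\<^sup>+\<phi>. ennreal (1 / 2) * ennreal (F \<phi>) + ennreal (1 / 2) * ennreal (G \<phi>) \<partial>P)"
      by (simp only:)
    also have "\<dots> = ennreal (1 / 2) * ennreal \<kappa> + ennreal (1 / 2) * ennreal \<kappa>"
      using avg_mid.IH(1,3) by (simp add: nn_integral_add nn_integral_cmult)
    also have "ennreal (1 / 2) * ennreal \<kappa> = ennreal (1 / 2 * \<kappa>)"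
      by (rule ennreal_mult'[symmetric]) simp
    also have "ennreal (1 / 2 * \<kappa>) + ennreal (1 / 2 * \<kappa>) = ennreal \<kappa>"
      using \<kappa> by (subst ennreal_plus[symmetric]) simp_all
    finally show ?case .
  next
    case 2
    have "(\<integral>\<^sup>+\<phi>. ennreal (((F \<phi> + G \<phi>) / 2)\<^sup>2) \<partial>P) \<le> (\<integral>\<^sup>+\<phi>. ennreal ((F \<phi>)\<^sup>2) + ennreal ((G \<phi>)\<^sup>2) \<partial>P)"
    proof (rule nn_integral_mono)
      fix \<phi>
      have "((F \<phi> + G \<phi>) / 2)\<^sup>2 \<le> (F \<phi>)\<^sup>2 + (G \<phi>)\<^sup>2"
      proof -
        have "((F \<phi> + G \<phi>) / 2)\<^sup>2 = (F \<phi> + G \<phi>)\<^sup>2 / 4" by (simp add: power_divide)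
        then show ?thesis
          using sum_squares_bound[of "F \<phi>" "G \<phi>"] zero_le_power2[of "F \<phi>"] zero_le_power2[of "G \<phi>"]
            power2_sum[of "F \<phi>" "G \<phi>"] by linarith
      qed
      then show "ennreal (((F \<phi> + G \<phi>) / 2)\<^sup>2) \<le> ennreal ((F \<phi>)\<^sup>2) + ennreal ((G \<phi>)\<^sup>2)"
        by (simp add: ennreal_plus[symmetric] ennreal_leI del: ennreal_plus)
    qed
    also have "\<dots> = (\<integral>\<^sup>+\<phi>. ennreal ((F \<phi>)\<^sup>2) \<partial>P) + (\<integral>\<^sup>+\<phi>. ennreal ((G \<phi>)\<^sup>2) \<partial>P)"
      by (rule nn_integral_add) auto
    also have "\<dots> < \<infinity>" using avg_mid.IH(2,4) by simp
    finally show ?case .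
  }
qed

definition q :: "('a set \<Rightarrow> real) \<Rightarrow> real" where
  "q F = (LINT \<phi>|P. (F \<phi>)\<^sup>2)"

lemma avg_integrable:
  assumes F: "avg F"
  shows "integrable P F" "(LINT \<phi>|P. F \<phi>) = \<kappa>" "integrable P (\<lambda>\<phi>. (F \<phi>)\<^sup>2)"
proof -
  have [measurable]: "F \<in> borel_measurable configs" using F by (rule avg_measurable)
  note m = avg_moments[OF F]
  show "integrable P F" using m(1) avg_nonneg[OF F] by (intro integrableI_nonneg) auto
  show "(LINT \<phi>|P. F \<phi>) = \<kappa>" using m(1) avg_nonneg[OF F] \<kappa> by (subst integral_eq_nn_integral) auto
  show "integrable P (\<lambda>\<phi>. (F \<phi>)\<^sup>2)" using m(2) by (intro integrableI_nonneg) auto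
qed

lemma q_nonneg: "q F \<ge> 0"
  unfolding q_def by (rule Bochner_Integration.integral_nonneg) simp

lemma q_translate: "avg F \<Longrightarrow> q (\<lambda>\<phi>. F (translate u \<phi>)) = q F"
proof -
  assume F: "avg F"
  have [measurable]: "F \<in> borel_measurable configs" using F by (rule avg_measurable)
  have "(LINT \<phi>|distr P P (translate u). (F \<phi>)\<^sup>2) = (LINT \<phi>|P. (F (translate u \<phi>))\<^sup>2)"
    by (intro integral_distr) auto
  then show ?thesis by (simp add: q_def P_translate)
qed

text \<open>In von Neumann's ergodic theorem this is the squared norm of the projection onto the
  invariant functions: that projection is the element of least norm in the closed convex hull of the
  translates.\<close>

definition "qinf = Inf (q ` Collect avg)"

lemma qinf_le: "avg F \<Longrightarrow> qinf \<le> q F"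
  unfolding qinf_def using q_nonneg by (intro cInf_lower) (auto intro!: bdd_belowI[of _ 0])

text \<open>The parallelogram identity, applied to the midpoint of \<open>F\<close> and \<open>G\<close>.\<close>

lemma near_minimizers:
  assumes F: "avg F" "q F \<le> qinf + \<epsilon>" and G: "avg G" "q G \<le> qinf + \<epsilon>" and \<epsilon>: "\<epsilon> \<ge> 0"
  shows "(LINT \<phi>|P. \<bar>F \<phi> - G \<phi>\<bar>) \<le> 2 * sqrt \<epsilon>"
proof -
  note iF = avg_integrable[OF F(1)] and iG = avg_integrable[OF G(1)]
  let ?H = "\<lambda>\<phi>. (F \<phi> + G \<phi>) / 2"
  have H: "avg ?H" using F(1) G(1) by (rule avg_mid)
  note iH = avg_integrable[OF H]
  have eq: "(F \<phi> - G \<phi>)\<^sup>2 = 2 * (F \<phi>)\<^sup>2 + 2 * (G \<phi>)\<^sup>2 - 4 * (?H \<phi>)\<^sup>2" for \<phi>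
    by (simp add: power2_eq_square field_simps)
  have i2: "integrable P (\<lambda>\<phi>. (F \<phi> - G \<phi>)\<^sup>2)"
    unfolding eq using iF(3) iG(3) iH(3) by (intro Bochner_Integration.integrable_diff Bochner_Integration.integrable_add integrable_mult_right)
  have "(LINT \<phi>|P. (F \<phi> - G \<phi>)\<^sup>2) = 2 * q F + 2 * q G - 4 * q ?H"
    unfolding eq q_def using iF(3) iG(3) iH(3) by (simp add: Bochner_Integration.integral_diff Bochner_Integration.integral_add)
  also have "\<dots> \<le> 4 * \<epsilon>" using F(2) G(2) qinf_le[OF H] by linarith
  finally have le: "(LINT \<phi>|P. (F \<phi> - G \<phi>)\<^sup>2) \<le> 4 * \<epsilon>" .
  have iabs: "integrable P (\<lambda>\<phi>. \<bar>F \<phi> - G \<phi>\<bar>)" using iF(1) iG(1) by auto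
  have "(LINT \<phi>|P. \<bar>F \<phi> - G \<phi>\<bar>)\<^sup>2 \<le> (LINT \<phi>|P. (F \<phi> - G \<phi>)\<^sup>2)"
    using P.variance_positive[of "\<lambda>\<phi>. \<bar>F \<phi> - G \<phi>\<bar>"] P.variance_eq[OF iabs] i2 by simp
  also have "\<dots> \<le> (2 * sqrt \<epsilon>)\<^sup>2" using le \<epsilon> by (simp add: power_mult_distrib)
  finally show ?thesis by (rule power2_le_imp_le) (use \<epsilon> in simp)
qed

text \<open>The rate 1/4 becomes 1/2 under the square root in \<open>near_minimizers\<close>, so
  that consecutive L1 distances are summable.\<close>

lemma minimizing_sequence:
  obtains F where "\<And>n. avg (F n)" "\<And>n. q (F n) \<le> qinf + (1 / 4) ^ n"
proof -
  have "\<exists>F. avg F \<and> q F \<le> qinf + (1 / 4) ^ n" for n :: nat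
  proof -
    have "q ` Collect avg \<noteq> {}" using avg_base by auto
    moreover have "Inf (q ` Collect avg) < qinf + (1 / 4) ^ n" by (simp flip: qinf_def)
    ultimately have "\<exists>y\<in>q ` Collect avg. y < qinf + (1 / 4) ^ n" by (rule cInf_lessD)
    then show ?thesis by force
  qed
  then have "\<forall>n. \<exists>F. avg F \<and> q F \<le> qinf + (1 / 4) ^ n" by (rule allI)
  then obtain F where "\<forall>n. avg (F n) \<and> q (F n) \<le> qinf + (1 / 4) ^ n" by (rule choice[THEN exE])
  then show thesis by (intro that[of F]) simp_all
qed

lemma invariant_zero_one:
  assumes S: "S \<in> sets configs" "\<And>z \<phi>. locally_finite \<phi> \<Longrightarrow> translate z \<phi> \<in> S \<longleftrightarrow> \<phi> \<in> S"
  shows "measure P S = 0 \<or> measure P S = 1"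
proof -
  have "\<forall>z \<phi>. locally_finite \<phi> \<longrightarrow> ((+) z ` \<phi> \<in> S \<longleftrightarrow> \<phi> \<in> S)"
    using S(2) by (simp add: translate_def)
  then have "measure M {\<omega> \<in> space M. Y \<omega> \<in> S} \<in> {0, 1}"
    using ergodic S(1) unfolding ergodic_process_def by blast
  moreover have "measure P S = measure M {\<omega> \<in> space M. Y \<omega> \<in> S}"
    unfolding P_def using S(1) by (subst measure_distr) (auto simp: vimage_def Int_def conj_commute)
  ultimately show ?thesis by auto
qed

text \<open>Invariance holds only almost surely, with a null set depending on u, whereas ergodicity
  speaks of strictly invariant sets. The set S of configurations with
  \<open>\<Psi> (translate u \<phi>) > t\<close> for almost every u is strictly invariant because
  Lebesgue measure is, and by Fubini it agrees almost surely with the event that \<Psi> exceeds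
  t.\<close>

lemma invariant_function_constant:
  fixes \<Psi> :: "'a set \<Rightarrow> ereal"
  assumes m: "(\<lambda>p. \<Psi> (translate (snd p) (fst p))) \<in> borel_measurable (configs \<Otimes>\<^sub>M (borel :: 'a measure))"
    and m0: "\<Psi> \<in> borel_measurable configs"
    and inv: "\<And>u. AE \<phi> in P. \<Psi> (translate u \<phi>) = \<Psi> \<phi>"
  shows "(AE \<phi> in P. \<Psi> \<phi> > t) \<or> (AE \<phi> in P. \<not> \<Psi> \<phi> > t)"
proof -
  define S where "S = {\<phi> \<in> space configs. emeasure lborel {u. \<not> \<Psi> (translate u \<phi>) > t} = 0}"
  have [measurable]: "\<Psi> \<in> borel_measurable configs" by (rule m0)
  have m': "(\<lambda>p. \<Psi> (translate (snd p) (fst p))) \<in> borel_measurable (configs \<Otimes>\<^sub>M (lborel :: 'a measure))"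
    using m by (simp cong: measurable_cong_sets)
  have S_sets: "S \<in> sets configs"
  proof -
    have G: "{p \<in> space (configs \<Otimes>\<^sub>M (lborel :: 'a measure)). \<not> \<Psi> (translate (snd p) (fst p)) > t} \<in> sets (configs \<Otimes>\<^sub>M lborel)"
      using m' by measurable
    have "(\<lambda>\<phi>. emeasure lborel (Pair \<phi> -` {p \<in> space (configs \<Otimes>\<^sub>M (lborel :: 'a measure)). \<not> \<Psi> (translate (snd p) (fst p)) > t})) \<in> borel_measurable configs"
      by (rule lborel.measurable_emeasure_Pair[OF G])
    then have "{\<phi> \<in> space configs. emeasure lborel (Pair \<phi> -` {p \<in> space (configs \<Otimes>\<^sub>M (lborel :: 'a measure)). \<not> \<Psi> (translate (snd p) (fst p)) > t}) = 0} \<in> sets configs"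
      by measurable
    also have "{\<phi> \<in> space configs. emeasure lborel (Pair \<phi> -` {p \<in> space (configs \<Otimes>\<^sub>M (lborel :: 'a measure)). \<not> \<Psi> (translate (snd p) (fst p)) > t}) = 0} = S"
      unfolding S_def by (intro Collect_cong conj_cong refl) (simp add: vimage_def space_pair_measure)
    finally show ?thesis .
  qed
  have section_borel: "{u. \<not> \<Psi> (translate u \<phi>) > t} \<in> sets borel" if "\<phi> \<in> space configs" for \<phi>
  proof -
    have "(\<lambda>u. \<Psi> (translate (snd (\<phi>, u)) (fst (\<phi>, u)))) \<in> borel_measurable borel"
      using that by (intro measurable_compose[OF measurable_Pair1' m])
    then have "(\<lambda>u. \<Psi> (translate u \<phi>)) \<in> borel_measurable borel" by simp
    then have "{u \<in> space borel. \<not> \<Psi> (translate u \<phi>) > t} \<in> sets borel" by measurable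
    then show ?thesis by simp
  qed
  have S_inv: "translate z \<phi> \<in> S \<longleftrightarrow> \<phi> \<in> S" if lf: "locally_finite \<phi>" for z \<phi>
  proof -
    have "{u. \<not> \<Psi> (translate u (translate z \<phi>)) > t} = translate (- z) {u. \<not> \<Psi> (translate u \<phi>) > t}"
      unfolding translate_add by (force simp: translate_def image_iff)
    then have "emeasure lborel {u. \<not> \<Psi> (translate u (translate z \<phi>)) > t} = emeasure lborel {u. \<not> \<Psi> (translate u \<phi>) > t}"
      using emeasure_translate[OF section_borel] lf by (simp add: space_configs)
    then show ?thesis using lf by (simp add: S_def space_configs locally_finite_translate)
  qed
  interpret PL: pair_sigma_finite P "lborel :: 'a measure" ..
  have "AE u in lborel. AE \<phi> in P. \<Psi> (translate u \<phi>) = \<Psi> \<phi>" using inv by simp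
  then have "AE \<phi> in P. AE u in lborel. \<Psi> (translate u \<phi>) = \<Psi> \<phi>"
  proof (subst PL.AE_commute)
    have "(\<lambda>p. \<Psi> (translate (snd p) (fst p))) \<in> borel_measurable (P \<Otimes>\<^sub>M (lborel :: 'a measure))"
      using m' by (simp cong: measurable_cong_sets)
    moreover have "(\<lambda>p. \<Psi> (fst p)) \<in> borel_measurable (P \<Otimes>\<^sub>M (lborel :: 'a measure))"
      by measurable
    ultimately show "{p \<in> space (P \<Otimes>\<^sub>M (lborel :: 'a measure)). \<Psi> (translate (snd p) (fst p)) = \<Psi> (fst p)} \<in> sets (P \<Otimes>\<^sub>M lborel)"
      by measurable
  qed
  then have S_iff: "AE \<phi> in P. \<phi> \<in> S \<longleftrightarrow> \<Psi> \<phi> > t"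
    using AE_space
  proof eventually_elim
    fix \<phi> assume ae: "AE u in lborel. \<Psi> (translate u \<phi>) = \<Psi> \<phi>" and sp: "\<phi> \<in> space P"
    let ?N = "{u. \<not> \<Psi> (translate u \<phi>) > t}"
    have N: "?N \<in> sets lborel" using section_borel sp by simp
    have "emeasure lborel ?N = 0 \<longleftrightarrow> (AE u in lborel. \<Psi> (translate u \<phi>) > t)"
      using N by (simp add: AE_iff_measurable[OF N])
    also have "\<dots> \<longleftrightarrow> (AE u in lborel :: 'a measure. \<Psi> \<phi> > t)"
    proof
      assume "AE u in lborel. \<Psi> (translate u \<phi>) > t"
      with ae show "AE u in lborel :: 'a measure. \<Psi> \<phi> > t" by eventually_elim simp
    next
      assume "AE u in lborel :: 'a measure. \<Psi> \<phi> > t"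
      with ae show "AE u in lborel. \<Psi> (translate u \<phi>) > t" by eventually_elim simp
    qed
    \<comment> \<open>\<open>lborel\<close> has nonzero total mass, so a condition that does not
      involve u holds almost everywhere only if it holds.\<close>
    also have "\<dots> \<longleftrightarrow> \<Psi> \<phi> > t"
      by (cases "\<Psi> \<phi> > t") (simp_all add: eventually_False ae_filter_eq_bot_iff emeasure_lborel_UNIV)
    finally show "\<phi> \<in> S \<longleftrightarrow> \<Psi> \<phi> > t" using sp by (simp add: S_def)
  qed
  from invariant_zero_one[OF S_sets S_inv] show ?thesis
  proof
    assume "measure P S = 0"
    then have "AE \<phi> in P. \<phi> \<notin> S"
      using S_sets by (intro AE_not_in) (simp add: null_sets_def P.emeasure_eq_measure)
    with S_iff have "AE \<phi> in P. \<not> \<Psi> \<phi> > t" by eventually_elim simp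
    then show ?thesis ..
  next
    assume "measure P S = 1"
    then have "AE \<phi> in P. \<phi> \<in> S"
      using S_sets P.prob_eq_1[of S] by simp
    with S_iff have "AE \<phi> in P. \<Psi> \<phi> > t" by eventually_elim simp
    then show ?thesis ..
  qed
qed

text \<open>A minimising sequence has summable L1 increments, so it converges almost surely and in
  mean. Its translates minimise as well and are therefore L1-close to it, so the limit is invariant.
  An invariant limit is almost surely above \<kappa> or almost surely not, and having mean \<kappa>
  it must equal \<kappa>.\<close>

lemma ergodic_average:
  assumes \<eta>: "\<eta> > 0"
  obtains F where "avg F" "(LINT \<phi>|P. \<bar>F \<phi> - \<kappa>\<bar>) < \<eta>"
proof -
  obtain F where F: "\<And>n. avg (F n)" and qF: "\<And>n. q (F n) \<le> qinf + (1 / 4) ^ n"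
    using minimizing_sequence by blast
  have Fm [measurable]: "F n \<in> borel_measurable configs" for n by (rule avg_measurable[OF F])
  have sq: "sqrt ((1 / 4) ^ n) = (1 / 2 :: real) ^ n" for n
    by (simp add: real_sqrt_power real_sqrt_divide)
  have step: "(\<integral>\<^sup>+\<phi>. ennreal \<bar>F (Suc n) \<phi> - F n \<phi>\<bar> \<partial>P) \<le> ennreal (2 * (1 / 2) ^ n)" for n
  proof -
    have "q (F (Suc n)) \<le> qinf + (1 / 4) ^ n"
    proof -
      have "(1 / 4 :: real) ^ Suc n \<le> (1 / 4) ^ n" by (intro power_decreasing) auto
      then show ?thesis using qF[of "Suc n"] by linarith
    qed
    then have "(LINT \<phi>|P. \<bar>F (Suc n) \<phi> - F n \<phi>\<bar>) \<le> 2 * (1 / 2) ^ n"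
      using near_minimizers[OF F _ F qF, of "Suc n" n] by (simp add: sq)
    moreover have "(\<integral>\<^sup>+\<phi>. ennreal \<bar>F (Suc n) \<phi> - F n \<phi>\<bar> \<partial>P) = ennreal (LINT \<phi>|P. \<bar>F (Suc n) \<phi> - F n \<phi>\<bar>)"
      using avg_integrable(1)[OF F] by (intro nn_integral_eq_integral) auto
    ultimately show ?thesis by (simp add: ennreal_leI)
  qed
  have sum_m: "(\<lambda>\<phi>. \<bar>F (Suc n) \<phi> - F n \<phi>\<bar>) \<in> borel_measurable P" for n by measurable
  have summ: "AE \<phi> in P. summable (\<lambda>n. \<bar>F (Suc n) \<phi> - F n \<phi>\<bar>)"
    by (rule AE_summable_of_nn_integral(1)[OF sum_m _ step]) simp_all
  have fin: "(\<integral>\<^sup>+\<phi>. (\<Sum>n. ennreal \<bar>F (Suc n) \<phi> - F n \<phi>\<bar>) \<partial>P) < \<infinity>"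
    by (rule AE_summable_of_nn_integral(2)[OF sum_m _ step]) simp_all
  have tel: "F n \<phi> = F 0 \<phi> + (\<Sum>k<n. F (Suc k) \<phi> - F k \<phi>)" for n \<phi>
    using sum_lessThan_telescope[of "\<lambda>k. F k \<phi>" n] by simp
  have conv: "AE \<phi> in P. convergent (\<lambda>n. F n \<phi>)"
    using summ
  proof eventually_elim
    fix \<phi> assume "summable (\<lambda>n. \<bar>F (Suc n) \<phi> - F n \<phi>\<bar>)"
    then have "summable (\<lambda>n. F (Suc n) \<phi> - F n \<phi>)" by (rule summable_rabs_cancel)
    then have "(\<lambda>n. F 0 \<phi> + (\<Sum>k<n. F (Suc k) \<phi> - F k \<phi>)) \<longlonglongrightarrow> F 0 \<phi> + (\<Sum>k. F (Suc k) \<phi> - F k \<phi>)"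
      by (intro tendsto_intros summable_LIMSEQ)
    then have "(\<lambda>n. F n \<phi>) \<longlonglongrightarrow> F 0 \<phi> + (\<Sum>k. F (Suc k) \<phi> - F k \<phi>)" by (simp only: tel[symmetric])
    then show "convergent (\<lambda>n. F n \<phi>)" by (rule convergentI)
  qed
  have cong: "AE \<phi> in P. (\<lambda>n. F n (translate u \<phi>) - F n \<phi>) \<longlonglongrightarrow> 0" for u
  proof -
    have "(\<integral>\<^sup>+\<phi>. ennreal \<bar>F n (translate u \<phi>) - F n \<phi>\<bar> \<partial>P) \<le> ennreal (2 * (1 / 2) ^ n)" for n
    proof -
      have "(LINT \<phi>|P. \<bar>F n (translate u \<phi>) - F n \<phi>\<bar>) \<le> 2 * (1 / 2) ^ n"
        using near_minimizers[OF avg_translate[OF F] _ F qF, of n u] q_translate[OF F] qF[of n] by (simp add: sq)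
      moreover have "(\<integral>\<^sup>+\<phi>. ennreal \<bar>F n (translate u \<phi>) - F n \<phi>\<bar> \<partial>P) = ennreal (LINT \<phi>|P. \<bar>F n (translate u \<phi>) - F n \<phi>\<bar>)"
        using avg_integrable(1)[OF F] avg_integrable(1)[OF avg_translate[OF F]] by (intro nn_integral_eq_integral) auto
      ultimately show ?thesis by (simp add: ennreal_leI)
    qed
    moreover have "(\<lambda>\<phi>. \<bar>F n (translate u \<phi>) - F n \<phi>\<bar>) \<in> borel_measurable P" for n by measurable
    ultimately have "AE \<phi> in P. summable (\<lambda>n. \<bar>F n (translate u \<phi>) - F n \<phi>\<bar>)"
      by (intro AE_summable_of_nn_integral(1)[where C=2]) auto
    then show ?thesis
      by eventually_elim (auto dest!: summable_LIMSEQ_zero intro: tendsto_rabs_zero_cancel)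
  qed
  \<comment> \<open>An extended real upper limit makes sense at every configuration, including
    translated ones, whether or not the sequence converges there.\<close>
  define \<Psi> where "\<Psi> \<phi> = limsup (\<lambda>n. ereal (F n \<phi>))" for \<phi>
  have "(AE \<phi> in P. \<Psi> \<phi> > \<kappa>) \<or> (AE \<phi> in P. \<not> \<Psi> \<phi> > \<kappa>)"
  proof (rule invariant_function_constant)
    show "\<Psi> \<in> borel_measurable configs" unfolding \<Psi>_def by measurable
    have [measurable]: "(\<lambda>p. F n (translate (snd p) (fst p))) \<in> borel_measurable (configs \<Otimes>\<^sub>M (borel :: 'a measure))" for n
      by (rule avg_joint_measurable[OF F])
    show "(\<lambda>p. \<Psi> (translate (snd p) (fst p))) \<in> borel_measurable (configs \<Otimes>\<^sub>M (borel :: 'a measure))"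
      unfolding \<Psi>_def by measurable
    fix u
    show "AE \<phi> in P. \<Psi> (translate u \<phi>) = \<Psi> \<phi>"
      using conv cong[of u]
    proof eventually_elim
      fix \<phi> assume "convergent (\<lambda>n. F n \<phi>)" and d: "(\<lambda>n. F n (translate u \<phi>) - F n \<phi>) \<longlonglongrightarrow> 0"
      then obtain L where L: "(\<lambda>n. F n \<phi>) \<longlonglongrightarrow> L" by (auto simp: convergent_def)
      then have "(\<lambda>n. F n (translate u \<phi>)) \<longlonglongrightarrow> L" using tendsto_add[OF d L] by simp
      then show "\<Psi> (translate u \<phi>) = \<Psi> \<phi>" unfolding \<Psi>_def using L
        by (metis lim_imp_Limsup sequentially_bot tendsto_ereal)
    qed
  qed
  define \<psi> where "\<psi> \<phi> = lim (\<lambda>n. F n \<phi>)" for \<phi>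
  have \<psi>_lim: "AE \<phi> in P. (\<lambda>n. F n \<phi>) \<longlonglongrightarrow> \<psi> \<phi>"
    using conv by eventually_elim (simp add: \<psi>_def convergent_LIMSEQ_iff)
  have \<psi>m [measurable]: "\<psi> \<in> borel_measurable configs" unfolding \<psi>_def by measurable
  have \<Psi>\<psi>: "AE \<phi> in P. \<Psi> \<phi> = ereal (\<psi> \<phi>)"
    using \<psi>_lim by eventually_elim (auto simp: \<Psi>_def intro!: lim_imp_Limsup tendsto_ereal)
  \<comment> \<open>Telescoping from \<open>F 0\<close> bounds all \<open>F n\<close> by this
    function, which is integrable because the increments are summable in mean; it serves as majorant
    for dominated convergence.\<close>
  define W where "W \<phi> = F 0 \<phi> + enn2real (\<Sum>n. ennreal \<bar>F (Suc n) \<phi> - F n \<phi>\<bar>)" for \<phi>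
  have W_int: "integrable P W"
  proof -
    have "integrable P (\<lambda>\<phi>. enn2real (\<Sum>n. ennreal \<bar>F (Suc n) \<phi> - F n \<phi>\<bar>))"
    proof (rule integrableI_nonneg)
      have "(\<integral>\<^sup>+\<phi>. ennreal (enn2real (\<Sum>n. ennreal \<bar>F (Suc n) \<phi> - F n \<phi>\<bar>)) \<partial>P) \<le> (\<integral>\<^sup>+\<phi>. (\<Sum>n. ennreal \<bar>F (Suc n) \<phi> - F n \<phi>\<bar>) \<partial>P)"
        by (intro nn_integral_mono) (simp add: ennreal_enn2real_if)
      then show "(\<integral>\<^sup>+\<phi>. ennreal (enn2real (\<Sum>n. ennreal \<bar>F (Suc n) \<phi> - F n \<phi>\<bar>)) \<partial>P) < \<infinity>"
        using fin by (rule le_less_trans)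
    qed auto
    then show ?thesis unfolding W_def using avg_integrable(1)[OF F] by auto
  qed
  have dom: "AE \<phi> in P. norm (F n \<phi>) \<le> W \<phi>" for n
    using summ
  proof eventually_elim
    fix \<phi> assume s: "summable (\<lambda>n. \<bar>F (Suc n) \<phi> - F n \<phi>\<bar>)"
    have "(\<Sum>n. ennreal \<bar>F (Suc n) \<phi> - F n \<phi>\<bar>) = ennreal (\<Sum>n. \<bar>F (Suc n) \<phi> - F n \<phi>\<bar>)"
      using s by (intro suminf_ennreal2) auto
    then have W: "W \<phi> = F 0 \<phi> + (\<Sum>n. \<bar>F (Suc n) \<phi> - F n \<phi>\<bar>)"
      using s by (simp add: W_def suminf_nonneg)
    have "(\<Sum>k<n. F (Suc k) \<phi> - F k \<phi>) \<le> (\<Sum>k<n. \<bar>F (Suc k) \<phi> - F k \<phi>\<bar>)" by (intro sum_mono) auto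
    also have "\<dots> \<le> (\<Sum>k. \<bar>F (Suc k) \<phi> - F k \<phi>\<bar>)" using s by (intro sum_le_suminf) auto
    finally have "F n \<phi> \<le> W \<phi>" using tel[of n \<phi>] W by simp
    then show "norm (F n \<phi>) \<le> W \<phi>" using avg_nonneg[OF F, of n \<phi>] by simp
  qed
  have \<psi>_int: "integrable P \<psi>"
    by (rule integrable_dominated_convergence[OF _ _ W_int \<psi>_lim dom]) measurable
  have "(\<lambda>n. LINT \<phi>|P. F n \<phi>) \<longlonglongrightarrow> (LINT \<phi>|P. \<psi> \<phi>)"
    by (rule integral_dominated_convergence[OF _ _ W_int \<psi>_lim dom]) measurable
  then have \<psi>_mean: "(LINT \<phi>|P. \<psi> \<phi>) = \<kappa>"
    using avg_integrable(2)[OF F] LIMSEQ_unique[of "\<lambda>_. \<kappa>"] by simp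
  have \<psi>_eq: "AE \<phi> in P. \<psi> \<phi> = \<kappa>"
  proof -
    have di: "integrable P (\<lambda>\<phi>. \<psi> \<phi> - \<kappa>)" "integrable P (\<lambda>\<phi>. \<kappa> - \<psi> \<phi>)" using \<psi>_int by auto
    have d0: "(LINT \<phi>|P. \<psi> \<phi> - \<kappa>) = 0" "(LINT \<phi>|P. \<kappa> - \<psi> \<phi>) = 0"
      using \<psi>_int \<psi>_mean by (simp_all add: P.prob_space[unfolded space_P])
    consider "AE \<phi> in P. \<Psi> \<phi> > \<kappa>" | "AE \<phi> in P. \<not> \<Psi> \<phi> > \<kappa>"
      using \<open>(AE \<phi> in P. \<Psi> \<phi> > \<kappa>) \<or> (AE \<phi> in P. \<not> \<Psi> \<phi> > \<kappa>)\<close> by blast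
    then show ?thesis
    proof cases
      case 1
      with \<Psi>\<psi> have "AE \<phi> in P. 0 \<le> \<psi> \<phi> - \<kappa>" by eventually_elim simp
      then have "AE \<phi> in P. \<psi> \<phi> - \<kappa> = 0" using d0(1) integral_nonneg_eq_0_iff_AE[OF di(1)] by simp
      then show ?thesis by eventually_elim simp
    next
      case 2
      with \<Psi>\<psi> have "AE \<phi> in P. 0 \<le> \<kappa> - \<psi> \<phi>" by eventually_elim simp
      then have "AE \<phi> in P. \<kappa> - \<psi> \<phi> = 0" using d0(2) integral_nonneg_eq_0_iff_AE[OF di(2)] by simp
      then show ?thesis by eventually_elim simp
    qed
  qed
  have "(\<lambda>n. LINT \<phi>|P. \<bar>F n \<phi> - \<kappa>\<bar>) \<longlonglongrightarrow> (LINT \<phi>|P. 0)"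
  proof (rule integral_dominated_convergence)
    show "integrable P (\<lambda>\<phi>. W \<phi> + \<kappa>)" using W_int by auto
    show "AE \<phi> in P. (\<lambda>n. \<bar>F n \<phi> - \<kappa>\<bar>) \<longlonglongrightarrow> 0"
      using \<psi>_lim \<psi>_eq by eventually_elim (metis LIM_zero tendsto_rabs_zero)
    show "AE \<phi> in P. norm \<bar>F n \<phi> - \<kappa>\<bar> \<le> W \<phi> + \<kappa>" for n
      using dom[of n]
    proof eventually_elim
      fix \<phi> assume "norm (F n \<phi>) \<le> W \<phi>"
      then have "\<bar>F n \<phi> - \<kappa>\<bar> \<le> W \<phi> + \<kappa>" using avg_nonneg[OF F, of n \<phi>] \<kappa> unfolding real_norm_def by linarith
      then show "norm \<bar>F n \<phi> - \<kappa>\<bar> \<le> W \<phi> + \<kappa>" by simp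
    qed
  qed measurable
  then have "\<forall>\<^sub>F n in sequentially. (LINT \<phi>|P. \<bar>F n \<phi> - \<kappa>\<bar>) < \<eta>"
    using \<eta> by (intro order_tendstoD) auto
  then obtain n where "(LINT \<phi>|P. \<bar>F n \<phi> - \<kappa>\<bar>) < \<eta>"
    using eventually_happens'[OF sequentially_bot] by blast
  then show thesis using that F by blast
qed

text \<open>Let K be the lattice points within R of S and K' those whose R-ball lies in S. By
  \<open>compares\<close>, sums of translates of F over K and K' enclose the count in S. Each term
  is at the same L1 distance from \<kappa> by stationarity. The cells at K fit into Out and those at
  K' cover In, which compares the cardinalities with volumes.\<close>

lemma count_deviation:
  assumes F: "avg F"
  obtains R' where "\<And>S Out In. S \<in> sets borel \<Longrightarrow> bounded S \<Longrightarrow> Out \<in> sets borel \<Longrightarrow> bounded Out \<Longrightarrow> In \<in> sets borel \<Longrightarrow>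
      (\<And>z. z \<in> S \<Longrightarrow> cball z R' \<subseteq> Out) \<Longrightarrow> (\<And>z. z \<in> In \<Longrightarrow> cball z R' \<subseteq> S) \<Longrightarrow> In \<subseteq> S \<Longrightarrow> S \<subseteq> Out \<Longrightarrow>
      (LINT \<omega>|M. \<bar>real (card (Y \<omega> \<inter> S)) - \<kappa> * measure lborel S\<bar>) \<le>
        2 * (LINT \<phi>|P. \<bar>F \<phi> - \<kappa>\<bar>) * measure lborel Out + \<kappa> * (measure lborel Out - measure lborel In)"
proof -
  obtain R where R: "R \<ge> 0" and cmp: "compares F R"
    using avg_compare[OF F] by auto
  let ?d = "real DIM('a)"
  show thesis
  \<comment> \<open>The range R of F plus a bound for the norm of points of the unit cube.\<close>
  proof (rule that[of "R + ?d"])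
    fix S Out In :: "'a set"
    assume S: "S \<in> sets borel" "bounded S" and Out: "Out \<in> sets borel" "bounded Out" and In: "In \<in> sets borel"
      and SOut: "\<And>z. z \<in> S \<Longrightarrow> cball z (R + ?d) \<subseteq> Out" and InS: "\<And>z. z \<in> In \<Longrightarrow> cball z (R + ?d) \<subseteq> S"
      and sub: "In \<subseteq> S" "S \<subseteq> Out"
    interpret M: prob_space M by (rule prob)
    have [measurable]: "F \<in> borel_measurable configs" by (rule avg_measurable[OF F])
    define K where "K = {k \<in> lattice. \<exists>z\<in>S. norm (z - k) \<le> R}"
    define K' where "K' = {k \<in> lattice. cball k R \<subseteq> S}"
    have KO: "translate k unit_cube \<subseteq> Out" if kK: "k \<in> K" for k
    proof
      fix y assume "y \<in> translate k unit_cube"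
      then obtain w where w: "w \<in> unit_cube" "y = k + w" by (auto simp: translate_def)
      obtain z where z: "z \<in> S" "norm (z - k) \<le> R" using kK by (auto simp: K_def)
      have "norm (z - y) \<le> norm (z - k) + norm w"
        using norm_triangle_ineq4[of "z - k" w] by (simp add: w(2) algebra_simps)
      then have "y \<in> cball z (R + ?d)" using z(2) unit_cube_norm[OF w(1)] by (simp add: dist_norm)
      then show "y \<in> Out" using SOut[OF z(1)] by blast
    qed
    have K'K: "K' \<subseteq> K"
    proof
      fix k assume "k \<in> K'"
      then have "k \<in> lattice" "k \<in> S" using R by (auto simp: K'_def)
      then show "k \<in> K" using R by (auto simp: K_def intro!: bexI[of _ k])
    qed
    have "K \<subseteq> lattice \<inter> Out"
    proof
      fix k assume k: "k \<in> K"
      have "0 \<in> (unit_cube :: 'a set)" by (simp add: unit_cube_def)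
      then have "k \<in> translate k unit_cube" unfolding translate_def by (rule image_eqI[rotated]) simp
      then show "k \<in> lattice \<inter> Out" using KO[OF k] k by (auto simp: K_def)
    qed
    then have finK: "finite K" using lattice_finite[OF Out(2)] by (rule finite_subset)
    have finK': "finite K'" using K'K finK by (rule finite_subset)
    have Kl: "K \<subseteq> lattice" "K' \<subseteq> lattice" by (auto simp: K_def K'_def)
    have cube[simp]: "translate k unit_cube \<in> sets borel" for k :: 'a by (intro translate_borel unit_cube_borel)
    have meas: "emeasure lborel B = ennreal (measure lborel B)" if "bounded B" "B \<in> sets borel" for B :: "'a set"
      using emeasure_bounded_finite[OF that(1)] by (simp add: emeasure_eq_ennreal_measure less_top)
    have cardK: "real (card K) \<le> measure lborel Out"
    proof -
      have "emeasure lborel (\<Union>k\<in>K. translate k unit_cube) \<le> emeasure lborel Out"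
        using KO Out by (intro emeasure_mono) auto
      then have "ennreal (real (card K)) \<le> ennreal (measure lborel Out)"
        using lattice_cubes_volume[OF finK Kl(1)] meas[OF Out(2,1)] by (simp add: ennreal_of_nat_eq_real_of_nat)
      then show ?thesis by (simp add: ennreal_le_iff)
    qed
    have cardK': "measure lborel In \<le> real (card K')"
    proof -
      have "In \<subseteq> (\<Union>k\<in>K'. translate k unit_cube)"
      proof
        fix z assume z: "z \<in> In"
        obtain k where k: "k \<in> lattice" "z - k \<in> unit_cube" using lattice_part_exists by blast
        have "cball k R \<subseteq> cball z (R + ?d)"
          using unit_cube_norm[OF k(2)] by (intro cball_subset_cball_iff[THEN iffD2] disjI1) (simp add: dist_norm norm_minus_commute)
        then have "k \<in> K'" using InS[OF z] k(1) by (auto simp: K'_def)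
        moreover have "z \<in> translate k unit_cube" unfolding translate_def using k(2) by (rule image_eqI[rotated]) simp
        ultimately show "z \<in> (\<Union>k\<in>K'. translate k unit_cube)" by blast
      qed
      then have "emeasure lborel In \<le> emeasure lborel (\<Union>k\<in>K'. translate k unit_cube)"
        using finK' by (intro emeasure_mono) auto
      then have "ennreal (measure lborel In) \<le> ennreal (real (card K'))"
        using lattice_cubes_volume[OF finK' Kl(2)] meas[of In] In bounded_subset[OF S(2) sub(1)]
        by (simp add: ennreal_of_nat_eq_real_of_nat)
      then show ?thesis by (simp add: ennreal_le_iff)
    qed
    have mono: "measure lborel In \<le> measure lborel S" "measure lborel S \<le> measure lborel Out"
      using sub S Out In bounded_subset[OF S(2) sub(1)]
      by (auto intro!: measure_mono_fmeasurable fmeasurableI emeasure_bounded_finite)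
    let ?D = "\<lambda>k \<phi>. \<bar>F (translate (- k) \<phi>) - \<kappa>\<bar>"
    let ?c = "\<kappa> * (measure lborel Out - measure lborel In)"
    have arith: "c \<le> a + u \<Longrightarrow> l \<le> b + c \<Longrightarrow> 0 \<le> a \<Longrightarrow> 0 \<le> b \<Longrightarrow> l \<le> m \<Longrightarrow> m \<le> u \<Longrightarrow> \<bar>c - m\<bar> \<le> a + b + (u - l)"
      for a b c u l m :: real by linarith
    have pw: "\<bar>real (card (\<phi> \<inter> S)) - \<kappa> * measure lborel S\<bar> \<le> (\<Sum>k\<in>K. ?D k \<phi>) + (\<Sum>k\<in>K'. ?D k \<phi>) + ?c"
      if lf: "locally_finite \<phi>" for \<phi>
    proof -
      have "real (card (\<phi> \<inter> S)) \<le> (\<Sum>k\<in>K. F (translate (- k) \<phi>))"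
        by (rule comparesD(1)[OF cmp lf S(2) finK Kl(1)]) (auto simp: K_def)
      also have "\<dots> \<le> (\<Sum>k\<in>K. ?D k \<phi> + \<kappa>)" by (intro sum_mono) linarith
      also have "\<dots> = (\<Sum>k\<in>K. ?D k \<phi>) + \<kappa> * real (card K)" by (simp add: sum.distrib mult.commute)
      also have "\<kappa> * real (card K) \<le> \<kappa> * measure lborel Out" using cardK \<kappa> by (rule mult_left_mono)
      finally have up: "real (card (\<phi> \<inter> S)) \<le> (\<Sum>k\<in>K. ?D k \<phi>) + \<kappa> * measure lborel Out" by simp
      have "\<kappa> * measure lborel In \<le> \<kappa> * real (card K')" using cardK' \<kappa> by (rule mult_left_mono)
      also have "\<dots> = (\<Sum>k\<in>K'. \<kappa>)" by simp
      also have "\<dots> \<le> (\<Sum>k\<in>K'. ?D k \<phi> + F (translate (- k) \<phi>))" by (intro sum_mono) linarith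
      also have "\<dots> = (\<Sum>k\<in>K'. ?D k \<phi>) + (\<Sum>k\<in>K'. F (translate (- k) \<phi>))" by (rule sum.distrib)
      also have "(\<Sum>k\<in>K'. F (translate (- k) \<phi>)) \<le> real (card (\<phi> \<inter> S))"
        by (rule comparesD(2)[OF cmp lf S(2) finK' Kl(2)]) (auto simp: K'_def)
      finally have low: "\<kappa> * measure lborel In \<le> (\<Sum>k\<in>K'. ?D k \<phi>) + real (card (\<phi> \<inter> S))" by simp
      have nn: "(\<Sum>k\<in>K. ?D k \<phi>) \<ge> 0" "(\<Sum>k\<in>K'. ?D k \<phi>) \<ge> 0" by (auto intro: sum_nonneg)
      have "\<kappa> * measure lborel In \<le> \<kappa> * measure lborel S" "\<kappa> * measure lborel S \<le> \<kappa> * measure lborel Out"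
        using mono \<kappa> by (auto intro: mult_left_mono)
      with up low nn show ?thesis unfolding right_diff_distrib by (intro arith)
    qed
    have intD: "integrable P (?D k)" for k
      using avg_integrable(1)[OF avg_translate[OF F, of "- k"]] by auto
    have ED: "(LINT \<phi>|P. ?D k \<phi>) = (LINT \<phi>|P. \<bar>F \<phi> - \<kappa>\<bar>)" for k
    proof -
      have "(LINT \<phi>|distr P P (translate (- k)). \<bar>F \<phi> - \<kappa>\<bar>) = (LINT \<phi>|P. ?D k \<phi>)"
        by (intro integral_distr) auto
      then show ?thesis by (simp add: P_translate)
    qed
    have E0: "(LINT \<phi>|P. \<bar>F \<phi> - \<kappa>\<bar>) \<ge> 0" by (rule Bochner_Integration.integral_nonneg) simp
    let ?B = "\<lambda>\<phi>. (\<Sum>k\<in>K. ?D k \<phi>) + (\<Sum>k\<in>K'. ?D k \<phi>) + ?c"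
    have intB: "integrable P ?B" using intD by auto
    have cm: "(\<lambda>\<phi>. card (\<phi> \<inter> S)) \<in> measurable configs (count_space UNIV)" by (rule measurable_card_configs[OF S])
    have cm': "(\<lambda>\<phi>. \<bar>real (card (\<phi> \<inter> S)) - \<kappa> * measure lborel S\<bar>) \<in> borel_measurable P" using cm by measurable
    have intS: "integrable P (\<lambda>\<phi>. \<bar>real (card (\<phi> \<inter> S)) - \<kappa> * measure lborel S\<bar>)"
    proof (rule Bochner_Integration.integrable_bound[OF intB cm'])
      show "AE \<phi> in P. norm \<bar>real (card (\<phi> \<inter> S)) - \<kappa> * measure lborel S\<bar> \<le> norm (?B \<phi>)"
        using pw by (intro AE_I2) (fastforce simp: space_configs)
    qed
    have "(LINT \<omega>|M. \<bar>real (card (Y \<omega> \<inter> S)) - \<kappa> * measure lborel S\<bar>) =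
          (LINT \<phi>|P. \<bar>real (card (\<phi> \<inter> S)) - \<kappa> * measure lborel S\<bar>)"
      unfolding P_def using cm' by (subst integral_distr) auto
    also have "\<dots> \<le> (LINT \<phi>|P. ?B \<phi>)"
      using pw by (intro integral_mono[OF intS intB]) (simp add: space_configs)
    also have "\<dots> = real (card K) * (LINT \<phi>|P. \<bar>F \<phi> - \<kappa>\<bar>) + real (card K') * (LINT \<phi>|P. \<bar>F \<phi> - \<kappa>\<bar>) + ?c"
      using intD by (simp add: ED P.prob_space[unfolded space_P])
    also have "\<dots> \<le> measure lborel Out * (LINT \<phi>|P. \<bar>F \<phi> - \<kappa>\<bar>) + measure lborel Out * (LINT \<phi>|P. \<bar>F \<phi> - \<kappa>\<bar>) + ?c"
    proof -
      have "real (card K') \<le> measure lborel Out" using cardK card_mono[OF finK K'K] by linarith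
      then show ?thesis using cardK E0 by (intro add_right_mono add_mono mult_right_mono)
    qed
    finally show "(LINT \<omega>|M. \<bar>real (card (Y \<omega> \<inter> S)) - \<kappa> * measure lborel S\<bar>) \<le>
        2 * (LINT \<phi>|P. \<bar>F \<phi> - \<kappa>\<bar>) * measure lborel Out + ?c" by (simp add: algebra_simps)
  qed
qed

end

section \<open>Sandwiching the flow through a link\<close>

text \<open>The set is the projection of a closed relation along the compact factor of segment
  parameters and points of I, hence closed. It yields measurability of the event that a node's link
  crosses the window.\<close>

lemma closed_segment_meets:
  fixes I :: "'a::euclidean_space set"
  assumes I: "compact I"
  shows "{p :: 'a \<times> 'a. closed_segment (fst p) (snd p) \<inter> I \<noteq> {}} \<in> sets borel"
proof -
  let ?T = "{q :: (real \<times> 'a) \<times> ('a \<times> 'a). snd (fst q) = (1 - fst (fst q)) *\<^sub>R fst (snd q) + fst (fst q) *\<^sub>R snd (snd q)}"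
  have "closed ?T" by (intro closed_Collect_eq continuous_intros)
  then have "closed {p. \<exists>w. w \<in> {0..1} \<times> I \<and> (w, p) \<in> ?T}"
    using I by (intro closed_compact_projection compact_Times) auto
  also have "{p. \<exists>w. w \<in> {0..1} \<times> I \<and> (w, p) \<in> ?T} = {p :: 'a \<times> 'a. closed_segment (fst p) (snd p) \<inter> I \<noteq> {}}"
    by (auto simp: closed_segment_def)
  finally show ?thesis by simp
qed

lemma compact_link_window:
  fixes i :: "'n::finite" and x :: "real ^ 'n"
  shows "compact (link_window i g s x)"
proof -
  have "closed {y :: real ^ 'n. y $ i = (s *\<^sub>R x) $ i}"
    by (intro closed_Collect_eq continuous_intros)
  then show ?thesis unfolding link_window_def by (intro compact_Int_closed compact_cball)
qed

lemma enn2real_hausdorff_link_window: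
  fixes x :: "real ^ 'n::finite"
  assumes "g s > 0"
  shows "enn2real (hausdorff_measure (CARD('n) - 1) (link_window i g s x)) =
         unit_ball_vol (real (CARD('n) - 1)) * g s ^ (CARD('n) - 1)"
proof -
  have "link_window i g s x = cball (s *\<^sub>R x) (g s) \<inter> {y. y \<bullet> axis i 1 = (s *\<^sub>R x) \<bullet> axis i 1}"
    unfolding link_window_def nth_eq_inner ..
  then show ?thesis
    using hausdorff_measure_disc[OF axis_Basis, of "g s" "s *\<^sub>R x" i] assms
    by (simp add: enn2real_ennreal)
qed

lemma nav_iter_measurable:
  fixes A :: "real ^ 'n::finite \<Rightarrow> (real ^ 'n) set \<Rightarrow> real ^ 'n"
  assumes A: "(\<lambda>(y, \<phi>). A y \<phi>) \<in> borel_measurable (borel \<Otimes>\<^sub>M configs)"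
    and \<Phi>: "\<Phi> \<in> measurable N configs" and Z: "Z \<in> measurable N borel"
  shows "(\<lambda>p. nav_iter A (\<Phi> p) k (Z p)) \<in> borel_measurable N"
proof (induction k)
  case 0
  show ?case using Z by simp
next
  case (Suc k)
  have "(\<lambda>p. (nav_iter A (\<Phi> p) k (Z p), \<Phi> p)) \<in> measurable N (borel \<Otimes>\<^sub>M configs)"
    using Suc \<Phi> by (rule measurable_Pair)
  from measurable_compose[OF this A] show ?case by (simp add: nav_iter_Suc)
qed

locale network = prob_space M
  for M :: "'w measure" +
  fixes i :: "'n::finite" and D :: "(real ^ 'n) set" and lam mu :: "real ^ 'n \<Rightarrow> real"
    and X :: "real \<Rightarrow> 'w \<Rightarrow> (real ^ 'n) set"
    and A :: "real ^ 'n \<Rightarrow> (real ^ 'n) set \<Rightarrow> real ^ 'n"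
    and g h :: "real \<Rightarrow> real" and x :: "real ^ 'n"
  assumes D: "open D" "bounded D" "convex D" and x: "x \<in> D"
    and lam: "continuous_on D lam" "bounded (lam ` D)" "\<And>y. y \<in> D \<Longrightarrow> lam y \<ge> 0"
    and mu: "continuous_on D mu" "bounded (mu ` D)" "\<And>y. y \<in> D \<Longrightarrow> mu y \<ge> 0"
    and process: "\<And>s. s \<ge> 1 \<Longrightarrow> point_process_on M (scaled s D) (X s)"
    and intensity: "\<And>s. s \<ge> 1 \<Longrightarrow> has_intensity_on M (scaled s D) (X s) (\<lambda>y. lam (y /\<^sub>R s))"
    and A: "directed_navigation i A"
    and no_cycles: "\<And>s. s \<ge> 1 \<Longrightarrow> AE \<omega> in M. \<forall>y \<in> X s \<omega>. \<forall>k\<ge>1.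
           nav_iter A (X s \<omega>) k y = y \<longrightarrow> A y (X s \<omega>) = y"
    and g: "admissible_scale g" and h: "admissible_scale h" and hg: "h \<in> o[at_top](g)"
    and D2: "\<And>\<epsilon>. \<epsilon> > 0 \<Longrightarrow> (\<lambda>s. 1 - measure M {\<omega> \<in> space M. sub_ballistic i D h A s \<epsilon> (X s \<omega>)})
               \<in> O[at_top](\<lambda>s. 1 / s ^ (2 * CARD('n)))"
    and sq_int: "\<forall>\<^sub>F s in at_top. integrable M (\<lambda>\<omega>. (real (card (X s \<omega>)))\<^sup>2)"
    and sq_bound: "(\<lambda>s. expectation (\<lambda>\<omega>. (real (card (X s \<omega>)))\<^sup>2)) \<in> O[at_top](\<lambda>s. s ^ (2 * CARD('n)))"
begin

abbreviation "e1 \<equiv> axis i (1::real) :: real ^ 'n"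

lemma e1: "e1 \<in> Basis" by (rule axis_Basis)

lemma X_measurable: "s \<ge> 1 \<Longrightarrow> X s \<in> measurable M configs"
  and X_subset: "s \<ge> 1 \<Longrightarrow> \<omega> \<in> space M \<Longrightarrow> X s \<omega> \<subseteq> scaled s D"
  using process[of s] by (auto simp: point_process_on_def)

lemma X_locally_finite: "s \<ge> 1 \<Longrightarrow> \<omega> \<in> space M \<Longrightarrow> locally_finite (X s \<omega>)"
  using measurable_configs_locally_finite[OF X_measurable] by blast

lemma X_finite: "s \<ge> 1 \<Longrightarrow> \<omega> \<in> space M \<Longrightarrow> finite (X s \<omega>)"
  using locally_finite_finite[OF X_locally_finite] X_subset bounded_subset[OF bounded_scaled[OF D(2)]]
  by metis

lemma nav: "s \<ge> 1 \<Longrightarrow> \<omega> \<in> space M \<Longrightarrow> navigation i A (X s \<omega>)"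
  using A X_finite X_locally_finite by unfold_locales (auto simp: directed_navigation_def)

definition mu0 :: "real ^ 'n \<Rightarrow> real" where "mu0 y = zero_ext D mu y"
definition lam0 :: "real ^ 'n \<Rightarrow> real" where "lam0 y = zero_ext D lam y"

lemma zero_ext_measurable: "continuous_on D f \<Longrightarrow> zero_ext D f \<in> borel_measurable borel" for f :: "real ^ 'n \<Rightarrow> real"
proof -
  assume "continuous_on D f"
  then have "(\<lambda>y. indicator D y *\<^sub>R f y) \<in> borel_measurable borel"
    using D by (intro borel_measurable_continuous_on_indicator) auto
  moreover have "(\<lambda>y. indicator D y *\<^sub>R f y) = zero_ext D f" by (auto simp: zero_ext_def)
  ultimately show ?thesis by simp
qed

lemma mu0_measurable [measurable]: "mu0 \<in> borel_measurable borel"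
  and lam0_measurable [measurable]: "lam0 \<in> borel_measurable borel"
  using zero_ext_measurable[OF mu(1)] zero_ext_measurable[OF lam(1)] by (simp_all add: mu0_def[abs_def] lam0_def[abs_def])

lemma mu0_nonneg: "mu0 y \<ge> 0" and lam0_nonneg: "lam0 y \<ge> 0"
  using mu lam by (auto simp: mu0_def lam0_def zero_ext_def)

definition "mumax = (SOME B. \<forall>y. mu0 y \<le> B)"
definition "lammax = (SOME B. \<forall>y. lam0 y \<le> B)"

lemma zero_ext_bounded: "bounded (f ` D) \<Longrightarrow> \<exists>B. \<forall>y. zero_ext D f y \<le> B" for f :: "real ^ 'n \<Rightarrow> real"
proof -
  assume "bounded (f ` D)"
  then obtain B where "\<And>y. y \<in> D \<Longrightarrow> \<bar>f y\<bar> \<le> B" by (auto simp: bounded_iff)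
  then have "zero_ext D f y \<le> \<bar>B\<bar>" for y by (fastforce simp: zero_ext_def)
  then show ?thesis by blast
qed

lemma mu0_le: "mu0 y \<le> mumax"
proof -
  have "\<exists>B. \<forall>y. mu0 y \<le> B" using zero_ext_bounded[OF mu(2)] by (simp add: mu0_def)
  then have "\<forall>y. mu0 y \<le> mumax" unfolding mumax_def by (rule someI_ex)
  then show ?thesis by simp
qed

lemma lam0_le: "lam0 y \<le> lammax"
proof -
  have "\<exists>B. \<forall>y. lam0 y \<le> B" using zero_ext_bounded[OF lam(2)] by (simp add: lam0_def)
  then have "\<forall>y. lam0 y \<le> lammax" unfolding lammax_def by (rule someI_ex)
  then show ?thesis by simp
qed

lemma mumax_nonneg: "mumax \<ge> 0" and lammax_nonneg: "lammax \<ge> 0"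
  using mu0_le[of x] mu0_nonneg[of x] lam0_le[of x] lam0_nonneg[of x] by linarith+

lemma mem_scaled_D: "s \<ge> 1 \<Longrightarrow> z \<in> scaled s D \<longleftrightarrow> z /\<^sub>R s \<in> D"
  by (rule mem_scaled_iff) simp

lemma mu0_X: "s \<ge> 1 \<Longrightarrow> \<omega> \<in> space M \<Longrightarrow> z \<in> X s \<omega> \<Longrightarrow> mu (z /\<^sub>R s) = mu0 (z /\<^sub>R s)"
  using X_subset mem_scaled_D by (fastforce simp: mu0_def zero_ext_def)

lemma scaled_D_borel: "s \<ge> 1 \<Longrightarrow> scaled s D \<in> sets borel"
  using open_scaled[of s D] D by simp

lemma l_eq: "s \<ge> 1 \<Longrightarrow> ennreal (lam (y /\<^sub>R s)) * indicator (scaled s D) y = ennreal (lam0 (y /\<^sub>R s))"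
  by (auto simp: indicator_def mem_scaled_D lam0_def zero_ext_def)

lemma campbell_X:
  assumes s: "s \<ge> 1" and f: "f \<in> borel_measurable borel"
  shows "(\<integral>\<^sup>+\<omega>. (\<integral>\<^sup>+y. f y \<partial>count_space (X s \<omega>)) \<partial>M) = (\<integral>\<^sup>+y. f y * ennreal (lam0 (y /\<^sub>R s)) \<partial>lborel)"
proof -
  have "(\<lambda>y. ennreal (lam (y /\<^sub>R s)) * indicator (scaled s D) y) \<in> borel_measurable borel"
    unfolding l_eq[OF s] by measurable
  from campbell[OF process[OF s] intensity[OF s] scaled_D_borel[OF s] bounded_scaled[OF D(2)] this f]
  show ?thesis unfolding l_eq[OF s] .
qed

lemma campbell_real:
  assumes s: "s \<ge> 1" and f: "f \<in> borel_measurable borel" and fb: "\<And>y. 0 \<le> f y \<and> f y \<le> B"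
  shows "integrable M (\<lambda>\<omega>. \<Sum>y\<in>X s \<omega>. f y)"
    and "expectation (\<lambda>\<omega>. \<Sum>y\<in>X s \<omega>. f y) = (LINT y|lborel. f y * lam0 (y /\<^sub>R s))"
proof -
  let ?Z = "\<lambda>\<omega>. \<Sum>y\<in>X s \<omega>. f y"
  have Zm: "?Z \<in> borel_measurable M"
  proof -
    have "(\<lambda>(y, \<omega>). f y) \<in> borel_measurable (borel \<Otimes>\<^sub>M M)" using f by measurable
    from measurable_random_finite_sum[OF X_measurable[OF s] this _ X_finite[OF s]] fb show ?thesis by auto
  qed
  have Z0: "?Z \<omega> \<ge> 0" for \<omega> using fb by (intro sum_nonneg) auto
  have "(\<integral>\<^sup>+\<omega>. ennreal (?Z \<omega>) \<partial>M) = (\<integral>\<^sup>+\<omega>. (\<integral>\<^sup>+y. ennreal (f y) \<partial>count_space (X s \<omega>)) \<partial>M)"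
    using fb by (intro nn_integral_cong) (simp add: nn_integral_count_space_finite X_finite[OF s] sum_ennreal)
  also have "\<dots> = (\<integral>\<^sup>+y. ennreal (f y) * ennreal (lam0 (y /\<^sub>R s)) \<partial>lborel)"
    using f by (intro campbell_X[OF s]) auto
  also have "\<dots> = (\<integral>\<^sup>+y. ennreal (f y * lam0 (y /\<^sub>R s)) \<partial>lborel)"
    using fb lam0_nonneg by (intro nn_integral_cong) (simp add: ennreal_mult)
  finally have E: "(\<integral>\<^sup>+\<omega>. ennreal (?Z \<omega>) \<partial>M) = (\<integral>\<^sup>+y. ennreal (f y * lam0 (y /\<^sub>R s)) \<partial>lborel)" .
  have B: "B \<ge> 0" using fb[of 0] by linarith
  have "(\<integral>\<^sup>+y. ennreal (f y * lam0 (y /\<^sub>R s)) \<partial>lborel) \<le> (\<integral>\<^sup>+y. ennreal (B * lammax) * indicator (scaled s D) y \<partial>lborel)"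
  proof (rule nn_integral_mono)
    fix y
    have "f y * lam0 (y /\<^sub>R s) \<le> B * lammax" using fb lam0_le lam0_nonneg B by (intro mult_mono) auto
    then show "ennreal (f y * lam0 (y /\<^sub>R s)) \<le> ennreal (B * lammax) * indicator (scaled s D) y"
      by (auto simp: indicator_def mem_scaled_D[OF s] lam0_def zero_ext_def ennreal_leI)
  qed
  also have "\<dots> < \<infinity>"
    using scaled_D_borel[OF s] emeasure_bounded_finite[OF bounded_scaled[OF D(2)], of s]
    by (simp add: nn_integral_cmult_indicator ennreal_mult_less_top)
  finally have fin: "(\<integral>\<^sup>+\<omega>. ennreal (?Z \<omega>) \<partial>M) < \<infinity>" using E by simp
  show "integrable M ?Z" using Zm Z0 fin by (intro integrableI_nonneg) auto
  have "expectation ?Z = enn2real (\<integral>\<^sup>+\<omega>. ennreal (?Z \<omega>) \<partial>M)"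
    using Zm Z0 by (intro integral_eq_nn_integral) auto
  also have "\<dots> = (LINT y|lborel. f y * lam0 (y /\<^sub>R s))"
    unfolding E using f fb lam0_nonneg by (intro integral_eq_nn_integral[symmetric]) auto
  finally show "expectation ?Z = (LINT y|lborel. f y * lam0 (y /\<^sub>R s))" .
qed

definition "T s \<omega> = (\<Sum>y \<in> crossing_nodes i g A s x (X s \<omega>). traffic mu A s (X s \<omega>) y)"

text \<open>Sums over random index sets are nested here: the traffic at y is a sum over z with (y,
  \<omega>) as parameter, and the outer sum runs over y. Joint measurability of A makes membership
  in a trajectory and crossing of the window measurable, and \<open>mu0\<close> replaces
  \<open>mu\<close>, which is only controlled on D.\<close>

lemma T_measurable:
  assumes s: "s \<ge> 1"
  shows "T s \<in> borel_measurable M"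
proof -
  have Am: "(\<lambda>(y, \<phi>). A y \<phi>) \<in> borel_measurable (borel \<Otimes>\<^sub>M configs)"
    using A by (simp add: directed_navigation_def)
  note Xm [measurable] = X_measurable[OF s]
  let ?N = "borel \<Otimes>\<^sub>M M :: ((real ^ 'n) \<times> 'w) measure"
  have it: "(\<lambda>q. nav_iter A (X s (snd (snd q))) k (fst q)) \<in> borel_measurable (borel \<Otimes>\<^sub>M ?N)" for k
    by (rule nav_iter_measurable[OF Am]) measurable
  have "{q \<in> space (borel \<Otimes>\<^sub>M ?N). \<exists>k. nav_iter A (X s (snd (snd q))) k (fst q) = fst (snd q)} \<in> sets (borel \<Otimes>\<^sub>M ?N)"
    using it by measurable
  then have tr: "Measurable.pred (borel \<Otimes>\<^sub>M ?N) (\<lambda>q. fst (snd q) \<in> trajectory A (X s (snd (snd q))) (fst q))"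
    unfolding pred_def trajectory_def by (simp add: image_iff eq_commute)
  let ?f = "\<lambda>z p. if fst p \<in> trajectory A (X s (snd p)) z then mu0 (z /\<^sub>R s) else 0"
  have fm: "(\<lambda>(z, p). ?f z p) \<in> borel_measurable (borel \<Otimes>\<^sub>M ?N)"
    using tr unfolding case_prod_beta by measurable
  have X2: "(\<lambda>p. X s (snd p)) \<in> measurable ?N configs" by measurable
  have flow: "(\<lambda>p. \<Sum>z\<in>X s (snd p). ?f z p) \<in> borel_measurable ?N"
    using measurable_random_finite_sum[OF X2 fm] mu0_nonneg X_finite[OF s] by (auto simp: space_pair_measure)
  have "(\<lambda>p. (fst p, A (fst p) (X s (snd p)))) \<in> measurable ?N (borel \<Otimes>\<^sub>M borel)"
    using nav_iter_measurable[OF Am X2 measurable_fst, of 1] by (auto simp: nav_iter_Suc[of _ _ 0, simplified] intro!: measurable_Pair)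
  then have "(\<lambda>p. (fst p, A (fst p) (X s (snd p)))) -` {p. closed_segment (fst p) (snd p) \<inter> link_window i g s x \<noteq> {}} \<inter> space ?N \<in> sets ?N"
    using closed_segment_meets[OF compact_link_window] by (intro measurable_sets) (auto simp: borel_prod)
  then have cr: "Measurable.pred ?N (\<lambda>p. closed_segment (fst p) (A (fst p) (X s (snd p))) \<inter> link_window i g s x \<noteq> {})"
    unfolding pred_def by (simp add: vimage_def Int_def conj_commute)
  let ?F = "\<lambda>y \<omega>. if closed_segment y (A y (X s \<omega>)) \<inter> link_window i g s x \<noteq> {} then (\<Sum>z\<in>X s \<omega>. ?f z (y, \<omega>)) else 0"
  have "(\<lambda>p. if closed_segment (fst p) (A (fst p) (X s (snd p))) \<inter> link_window i g s x \<noteq> {}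
      then (\<Sum>z\<in>X s (snd p). ?f z p) else 0) \<in> borel_measurable ?N"
    by (rule measurable_If[OF flow _ cr[unfolded pred_def]]) simp
  then have Fm: "(\<lambda>(y, \<omega>). ?F y \<omega>) \<in> borel_measurable ?N"
    by (simp only: case_prod_beta' fst_conv snd_conv prod.collapse)
  have "(\<lambda>\<omega>. \<Sum>y\<in>X s \<omega>. ?F y \<omega>) \<in> borel_measurable M"
    by (rule measurable_random_finite_sum[OF Xm Fm]) (simp_all add: X_finite[OF s] mu0_nonneg sum_nonneg)
  moreover have "T s \<omega> = (\<Sum>y\<in>X s \<omega>. ?F y \<omega>)" if \<omega>: "\<omega> \<in> space M" for \<omega>
  proof -
    have tf: "traffic mu A s (X s \<omega>) y = (\<Sum>z\<in>X s \<omega>. ?f z (y, \<omega>))" for y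
    proof -
      have "traffic mu A s (X s \<omega>) y = (\<Sum>z | z \<in> X s \<omega> \<and> y \<in> trajectory A (X s \<omega>) z. mu0 (z /\<^sub>R s))"
        unfolding traffic_def using mu0_X[OF s \<omega>] by (intro sum.cong) auto
      also have "\<dots> = (\<Sum>z\<in>X s \<omega>. ?f z (y, \<omega>))"
        using X_finite[OF s \<omega>] by (simp add: sum.inter_filter)
      finally show ?thesis .
    qed
    show ?thesis unfolding T_def crossing_nodes_def tf
      using X_finite[OF s \<omega>] by (rule sum.inter_filter)
  qed
  ultimately show ?thesis by (simp cong: measurable_cong)
qed

text \<open>The (d-1)-dimensional measure of the link window, by
  \<open>enn2real_hausdorff_link_window\<close>; it does not depend on x.\<close>

definition "V s = unit_ball_vol (real (CARD('n) - 1)) * g s ^ (CARD('n) - 1)"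

lemma V_ge: "s \<ge> 1 \<Longrightarrow> V s \<ge> unit_ball_vol (real (CARD('n) - 1))"
proof -
  assume "s \<ge> 1"
  then have "g s \<ge> 1" using g by (simp add: admissible_scale_def)
  then have "g s ^ (CARD('n) - 1) \<ge> 1" by (rule one_le_power)
  moreover have "unit_ball_vol (real (CARD('n) - 1)) \<ge> 0" by simp
  ultimately have "unit_ball_vol (real (CARD('n) - 1)) * 1 \<le> V s"
    unfolding V_def by (rule mult_left_mono)
  then show ?thesis by simp
qed

lemma V_pos: "s \<ge> 1 \<Longrightarrow> V s > 0"
  using V_ge[of s] unit_ball_vol_pos[of "real (CARD('n) - 1)"] by linarith

lemma sV_at_top: "filterlim (\<lambda>s. s * V s) at_top at_top"
proof (rule filterlim_at_top_mono)
  let ?u = "unit_ball_vol (real (CARD('n) - 1))"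
  have u: "?u > 0" by simp
  show "filterlim (\<lambda>s. s * ?u) at_top at_top"
    using filterlim_tendsto_pos_mult_at_top[OF tendsto_const u filterlim_ident] by (simp add: mult.commute)
  show "\<forall>\<^sub>F s in at_top. s * ?u \<le> s * V s"
    using eventually_ge_at_top[of 1] by eventually_elim (use V_ge in \<open>auto intro!: mult_left_mono\<close>)
qed

lemma const_over_sV: "((\<lambda>s. C / (s * V s)) \<longlongrightarrow> 0) at_top"
  by (rule tendsto_divide_0[OF tendsto_const]) (rule filterlim_at_top_imp_at_infinity[OF sV_at_top])

lemma halfcyl_borel [measurable]: "halfcyl e1 p r a \<in> sets borel"
  unfolding halfcyl_def by measurable

lemma dilate_open: "c > 0 \<Longrightarrow> open (dilate x c D)"
  by (rule open_dilate) (use D in auto)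

lemma dilate_subset: "0 < c \<Longrightarrow> c \<le> 1 \<Longrightarrow> dilate x c D \<subseteq> D"
proof
  fix y assume c: "0 < c" "c \<le> 1" and "y \<in> dilate x c D"
  then obtain w where w: "w \<in> D" "y = x + c *\<^sub>R (w - x)" by (auto simp: dilate_def)
  then have "y = (1 - c) *\<^sub>R x + c *\<^sub>R w" by (simp add: algebra_simps)
  then show "y \<in> D" using convexD[OF D(3) x w(1), of "1 - c" c] c by simp
qed

definition "f c r s z = indicator (halfcyl e1 (s *\<^sub>R x) r 0) z * (indicator (dilate x c D) (z /\<^sub>R s) * mu0 (z /\<^sub>R s))"

text \<open>With c = 1 and r = g + h this is the upper bound for the flow, with c < 1 and r = g - h
  the lower one.\<close>

definition "cs c r s \<omega> = (\<Sum>z\<in>X s \<omega>. f c r s z)"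

definition "G c y = (if y \<in> dilate x c D then lam0 y * mu0 y else 0)"

text \<open>Limit of the mean of \<open>cs c (r s) s\<close> divided by \<open>s * V s\<close>, for
  every radius asymptotic to g; at c = 1 it is the integral in the theorem.\<close>

definition "J c = ray_integral e1 x (G c) 0 0"

lemma f_measurable: "c > 0 \<Longrightarrow> f c r s \<in> borel_measurable borel"
proof -
  assume "c > 0"
  then have [measurable]: "dilate x c D \<in> sets borel" using dilate_open by simp
  show ?thesis unfolding f_def[abs_def] by measurable
qed

lemma f_bounds: "0 \<le> f c r s z \<and> f c r s z \<le> mumax"
  using mu0_nonneg[of "z /\<^sub>R s"] mu0_le[of "z /\<^sub>R s"] mumax_nonneg by (auto simp: f_def indicator_def)

lemma cs_expectation:
  assumes s: "s \<ge> 1" and c: "c > 0"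
  shows "integrable M (cs c r s)"
    and "expectation (cs c r s) = (LINT z|lborel. indicator (halfcyl e1 (s *\<^sub>R x) r 0) z * G c (z /\<^sub>R s))"
proof -
  note cr = campbell_real[OF s f_measurable[OF c, of r s] f_bounds]
  show "integrable M (cs c r s)" using cr(1) by (simp add: cs_def[abs_def])
  have "expectation (cs c r s) = (LINT z|lborel. f c r s z * lam0 (z /\<^sub>R s))"
    using cr(2) by (simp add: cs_def[abs_def])
  also have "\<dots> = (LINT z|lborel. indicator (halfcyl e1 (s *\<^sub>R x) r 0) z * G c (z /\<^sub>R s))"
    by (intro Bochner_Integration.integral_cong) (auto simp: f_def G_def indicator_def)
  finally show "expectation (cs c r s) = (LINT z|lborel. indicator (halfcyl e1 (s *\<^sub>R x) r 0) z * G c (z /\<^sub>R s))" .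
qed

lemma G_setting:
  assumes c: "0 < c" "c \<le> 1"
  shows "\<exists>R. ray_setting e1 x (G c) (lammax * mumax) R"
proof (rule ray_setting_indicator[OF e1, of "dilate x c D" x "\<lambda>y. lam y * mu y"])
  note sub = dilate_subset[OF c]
  show "open (dilate x c D)" by (rule dilate_open[OF c(1)])
  show "convex (dilate x c D)" "bounded (dilate x c D)" "x \<in> dilate x c D"
    using D x by (auto intro: convex_dilate bounded_dilate dilate_center)
  show "continuous_on (dilate x c D) (\<lambda>y. lam y * mu y)"
    using continuous_on_subset[OF lam(1) sub] continuous_on_subset[OF mu(1) sub] by (rule continuous_on_mult)
  have eq: "lam y = lam0 y" "mu y = mu0 y" if "y \<in> dilate x c D" for y
    using that sub by (auto simp: lam0_def mu0_def zero_ext_def)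
  show "0 \<le> lam y * mu y \<and> lam y * mu y \<le> lammax * mumax" if "y \<in> dilate x c D" for y
    unfolding eq[OF that] using lam0_nonneg mu0_nonneg lam0_le mu0_le lammax_nonneg by (simp add: mult_mono)
  show "G c y = (if y \<in> dilate x c D then lam y * mu y else 0)" for y
    using eq by (simp add: G_def)
qed

lemma g_pos: "\<forall>\<^sub>F s in at_top. g s > 0"
  using eventually_ge_at_top[of 1] by eventually_elim (use g in \<open>force simp: admissible_scale_def\<close>)

lemma h_pos: "s \<ge> 1 \<Longrightarrow> h s \<ge> 0"
  using h by (force simp: admissible_scale_def)

lemma h_over_g: "((\<lambda>s. h s / g s) \<longlongrightarrow> 0) at_top"
  using hg by (rule smalloD_tendsto)

lemma scale_limits: "((\<lambda>s. g s / s) \<longlongrightarrow> 0) at_top" "((\<lambda>s. h s / s) \<longlongrightarrow> 0) at_top"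
  using g h by (simp_all add: admissible_scale_def)

text \<open>Radii asymptotic to g. This covers g + h, g - h and, in the ergodic case, shifts of such
  radii by constants.\<close>

definition "radius r \<longleftrightarrow> (\<forall>\<^sub>F s in at_top. r s > 0) \<and> ((\<lambda>s. r s / s) \<longlongrightarrow> 0) at_top \<and> ((\<lambda>s. r s / g s) \<longlongrightarrow> 1) at_top"

lemma radiusI:
  assumes r1: "((\<lambda>s. r s / g s) \<longlongrightarrow> 1) at_top"
  shows "radius r"
  unfolding radius_def
proof (intro conjI r1)
  have "\<forall>\<^sub>F s in at_top. r s / g s > 0" using order_tendstoD(1)[OF r1, of 0] by simp
  then show "\<forall>\<^sub>F s in at_top. r s > 0"
    using g_pos by eventually_elim (simp add: zero_less_divide_iff)
  have lim: "((\<lambda>s. (r s / g s) * (g s / s)) \<longlongrightarrow> 1 * 0) at_top" by (intro tendsto_mult r1 scale_limits)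
  have ev: "\<forall>\<^sub>F s in at_top. (r s / g s) * (g s / s) = r s / s" using g_pos by eventually_elim simp
  show "((\<lambda>s. r s / s) \<longlongrightarrow> 0) at_top"
    using tendsto_cong[THEN iffD1, OF ev lim] by (simp only: mult_zero_right)
qed

lemma radius_add:
  assumes a: "((\<lambda>s. a s / g s) \<longlongrightarrow> 0) at_top" and r: "((\<lambda>s. r s / g s) \<longlongrightarrow> 1) at_top"
  shows "((\<lambda>s. (r s + a s) / g s) \<longlongrightarrow> 1) at_top"
  using tendsto_add[OF r a] by (simp add: add_divide_distrib)

lemma radius_g: "((\<lambda>s. g s / g s) \<longlongrightarrow> 1) at_top"
  by (rule tendsto_eventually) (use g_pos in \<open>eventually_elim, simp\<close>)

lemma radius_plus: "radius (\<lambda>s. g s + h s)"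
  by (intro radiusI radius_add h_over_g radius_g)

lemma radius_minus: "radius (\<lambda>s. g s - h s)"
proof (rule radiusI)
  have "((\<lambda>s. (- h s) / g s) \<longlongrightarrow> 0) at_top" using tendsto_minus[OF h_over_g] by simp
  from radius_add[OF this radius_g] show "((\<lambda>s. (g s - h s) / g s) \<longlongrightarrow> 1) at_top" by simp
qed

lemma mean_limit:
  assumes c: "0 < c" "c \<le> 1" and r: "radius r"
  shows "((\<lambda>s. expectation (cs c (r s) s) / (s * V s)) \<longlongrightarrow> J c) at_top"
proof -
  obtain R where R: "ray_setting e1 x (G c) (lammax * mumax) R" using G_setting[OF c] by auto
  have lim: "((\<lambda>s. (LINT z|lborel. indicator (halfcyl e1 (s *\<^sub>R x) (r s) 0) z * G c (z /\<^sub>R s)) / (s * V s)) \<longlongrightarrow> J c) at_top"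
    using ray_setting.halfcyl_integral_tendsto'[OF R, of r "\<lambda>_. 0" g] r g_pos
    by (simp add: radius_def V_def J_def)
  have ev: "\<forall>\<^sub>F s in at_top. expectation (cs c (r s) s) / (s * V s) =
      (LINT z|lborel. indicator (halfcyl e1 (s *\<^sub>R x) (r s) 0) z * G c (z /\<^sub>R s)) / (s * V s)"
    using eventually_ge_at_top[of 1] by eventually_elim (simp add: cs_expectation c)
  show ?thesis by (rule tendsto_cong[THEN iffD2, OF ev lim])
qed

lemma J_near:
  assumes \<delta>: "\<delta> > 0"
  obtains c where "0 < c" "c < 1" "\<bar>J c - J 1\<bar> < \<delta>"
proof -
  let ?L = "ray_integral e1 x (\<lambda>y. if y \<in> D then lammax * mumax else 0) 0 0"
  have L: "?L \<ge> 0" unfolding ray_integral_def using lammax_nonneg mumax_nonneg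
    by (intro Bochner_Integration.integral_nonneg) (simp add: indicator_def)
  have bound: "\<bar>J c - J 1\<bar> \<le> (1 - c) * ?L" if c: "0 < c" "c \<le> 1" for c
  proof -
    let ?F = "\<lambda>y. lam y * mu y"
    have Gc: "G c = (\<lambda>y. if y \<in> dilate x c D then ?F y else 0)" if "0 < c" "c \<le> 1" for c
      using dilate_subset[OF that] by (auto simp: G_def lam0_def mu0_def zero_ext_def fun_eq_iff)
    have FB: "0 \<le> ?F y \<and> ?F y \<le> lammax * mumax" if "y \<in> D" for y
    proof -
      have "lam y = lam0 y" "mu y = mu0 y" using that by (auto simp: lam0_def mu0_def zero_ext_def)
      then show ?thesis using lam0_nonneg mu0_nonneg lam0_le mu0_le lammax_nonneg by (simp add: mult_mono)
    qed
    have "continuous_on D ?F" by (intro continuous_on_mult lam mu)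
    from ray_integral_restrict[OF e1 D(1,3,2) x this FB c] show ?thesis
      unfolding J_def Gc[OF c] using Gc[of 1] by simp
  qed
  \<comment> \<open>The second entry brings (1 - c) times \<open>?L\<close> below \<delta>, with + 1
    guarding against \<open>?L\<close> = 0; the entry 1/2 keeps c positive.\<close>
  define c where "c = max (1 / 2) (1 - \<delta> / (2 * (?L + 1)))"
  have "\<delta> / (2 * (?L + 1)) > 0" using \<delta> L by simp
  then have c: "0 < c" "c < 1" by (auto simp: c_def)
  have "\<bar>J c - J 1\<bar> \<le> (1 - c) * ?L" using c by (intro bound) auto
  also have "\<dots> \<le> \<delta> / (2 * (?L + 1)) * ?L" using L by (intro mult_right_mono) (auto simp: c_def)
  also have "\<dots> < \<delta>" using \<delta> L by (simp add: field_simps add_pos_nonneg)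
  finally show thesis using that c by blast
qed

lemma J_1: "J 1 = (LINT r:{..0}|lborel. zero_ext D lam (x + r *\<^sub>R axis i 1) * zero_ext D mu (x + r *\<^sub>R axis i 1))"
  unfolding J_def ray_integral_def set_lebesgue_integral_def
  by (intro Bochner_Integration.integral_cong) (auto simp: G_def lam0_def mu0_def zero_ext_def)

lemma cs_nonneg: "cs c r s \<omega> \<ge> 0"
  unfolding cs_def using f_bounds by (intro sum_nonneg) auto

lemma cs_le: "cs c r s \<omega> \<le> mumax * real (card (X s \<omega>))"
proof -
  have "cs c r s \<omega> \<le> (\<Sum>z\<in>X s \<omega>. mumax)" unfolding cs_def using f_bounds by (intro sum_mono) auto
  then show ?thesis by (simp add: mult.commute)
qed

definition "generic s \<omega> \<longleftrightarrow> (\<forall>y\<in>X s \<omega>. y $ i \<noteq> (s *\<^sub>R x) $ i) \<and>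
  (\<forall>y \<in> X s \<omega>. \<forall>k\<ge>1. nav_iter A (X s \<omega>) k y = y \<longrightarrow> A y (X s \<omega>) = y)"

text \<open>A hyperplane is a null set, so by Campbell's formula the expected number of nodes on it
  is 0.\<close>

lemma AE_generic:
  assumes s: "s \<ge> 1"
  shows "AE \<omega> in M. generic s \<omega>"
proof -
  let ?H = "{y :: real ^ 'n. y \<bullet> e1 = (s *\<^sub>R x) \<bullet> e1}"
  have Hb [measurable]: "?H \<in> sets borel" by measurable
  have "?H \<in> null_sets lebesgue"
    using negligible_standard_hyperplane[OF e1] by (simp add: negligible_iff_null_sets)
  then have Hn: "?H \<in> null_sets lborel" using Hb by (simp add: null_sets_completion_iff)
  have "(\<integral>\<^sup>+\<omega>. (\<integral>\<^sup>+y. indicator ?H y \<partial>count_space (X s \<omega>)) \<partial>M) = (\<integral>\<^sup>+y. indicator ?H y * ennreal (lam0 (y /\<^sub>R s)) \<partial>lborel)"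
    by (rule campbell_X[OF s]) simp
  also have "\<dots> = (\<integral>\<^sup>+y. 0 \<partial>(lborel :: (real ^ 'n) measure))"
    by (rule nn_integral_cong_AE, use AE_not_in[OF Hn] in eventually_elim) (simp add: indicator_def)
  finally have "(\<integral>\<^sup>+\<omega>. (\<integral>\<^sup>+y. indicator ?H y \<partial>count_space (X s \<omega>)) \<partial>M) = 0" by simp
  moreover have "(\<lambda>\<omega>. \<integral>\<^sup>+y. indicator ?H y \<partial>count_space (X s \<omega>)) \<in> borel_measurable M"
    by (rule measurable_point_sum[OF X_measurable[OF s]]) simp
  ultimately have "AE \<omega> in M. (\<integral>\<^sup>+y. indicator ?H y \<partial>count_space (X s \<omega>)) = 0"
    by (simp add: nn_integral_0_iff_AE)
  then show ?thesis
    using no_cycles[OF s] AE_space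
  proof eventually_elim
    fix \<omega> assume 0: "(\<integral>\<^sup>+y. indicator ?H y \<partial>count_space (X s \<omega>)) = 0"
      and nc: "\<forall>y \<in> X s \<omega>. \<forall>k\<ge>1. nav_iter A (X s \<omega>) k y = y \<longrightarrow> A y (X s \<omega>) = y" and \<omega>: "\<omega> \<in> space M"
    have "card (X s \<omega> \<inter> ?H) = 0"
      using 0 X_finite[OF s \<omega>] by (simp add: nn_integral_point_indicator)
    then have "X s \<omega> \<inter> ?H = {}" using X_finite[OF s \<omega>] by simp
    then show "generic s \<omega>" using nc by (auto simp: generic_def nth_eq_inner)
  qed
qed

lemma T_generic:
  assumes s: "s \<ge> 1" and \<omega>: "\<omega> \<in> space M" and gen: "generic s \<omega>"
  shows "T s \<omega> = (\<Sum>z\<in>X s \<omega>. if crossing_nodes i g A s x (X s \<omega>) \<inter> trajectory A (X s \<omega>) z \<noteq> {} then mu0 (z /\<^sub>R s) else 0)"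
proof -
  interpret navigation i A "X s \<omega>" by (rule nav[OF s \<omega>])
  have "T s \<omega> = (\<Sum>z | z \<in> X s \<omega> \<and> crossing_nodes i g A s x (X s \<omega>) \<inter> trajectory A (X s \<omega>) z \<noteq> {}. mu (z /\<^sub>R s))"
    unfolding T_def using gen by (intro sum_traffic) (simp add: generic_def)
  also have "\<dots> = (\<Sum>z | z \<in> X s \<omega> \<and> crossing_nodes i g A s x (X s \<omega>) \<inter> trajectory A (X s \<omega>) z \<noteq> {}. mu0 (z /\<^sub>R s))"
    using mu0_X[OF s \<omega>] by (intro sum.cong) auto
  also have "\<dots> = (\<Sum>z\<in>X s \<omega>. if crossing_nodes i g A s x (X s \<omega>) \<inter> trajectory A (X s \<omega>) z \<noteq> {} then mu0 (z /\<^sub>R s) else 0)"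
    using X_finite[OF s \<omega>] by (rule sum.inter_filter)
  finally show ?thesis .
qed

lemma T_bounds:
  assumes s: "s \<ge> 1" and \<omega>: "\<omega> \<in> space M" and gen: "generic s \<omega>"
  shows "0 \<le> T s \<omega>" "T s \<omega> \<le> mumax * real (card (X s \<omega>))"
proof -
  show "0 \<le> T s \<omega>" unfolding T_generic[OF assms] by (intro sum_nonneg) (simp add: mu0_nonneg)
  have "T s \<omega> \<le> (\<Sum>z\<in>X s \<omega>. mumax)"
    unfolding T_generic[OF assms] by (intro sum_mono) (simp add: mu0_le mumax_nonneg)
  then show "T s \<omega> \<le> mumax * real (card (X s \<omega>))" by (simp add: mult.commute)
qed

lemma sandwich:
  assumes c: "0 < c" "c < 1"
  obtains \<epsilon> where "\<epsilon> > 0" "\<forall>\<^sub>F s in at_top. \<forall>\<omega>\<in>space M. generic s \<omega> \<longrightarrow> sub_ballistic i D h A s \<epsilon> (X s \<omega>) \<longrightarrow>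
     cs c (g s - h s) s \<omega> \<le> T s \<omega> \<and> T s \<omega> \<le> cs 1 (g s + h s) s \<omega>"
proof -
  obtain \<rho> where \<rho>: "\<rho> > 0" "cball x \<rho> \<subseteq> D" using D(1) x open_contains_cball by blast
  \<comment> \<open>The margin left by \<open>corridor_subset\<close> between the corridor and the
    boundary of D, before scaling by s.\<close>
  define \<epsilon> where "\<epsilon> = (1 - c) * \<rho> / 2"
  have \<epsilon>: "\<epsilon> > 0" using c \<rho> by (simp add: \<epsilon>_def)
  have "\<forall>\<^sub>F s in at_top. g s / s < min (c * \<rho>) \<epsilon>" "\<forall>\<^sub>F s in at_top. h s / s < \<epsilon>"
    using order_tendstoD(2)[OF scale_limits(1), of "min (c * \<rho>) \<epsilon>"] order_tendstoD(2)[OF scale_limits(2), of \<epsilon>] c \<rho> \<epsilon>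
    by auto
  then have "\<forall>\<^sub>F s in at_top. \<forall>\<omega>\<in>space M. generic s \<omega> \<longrightarrow> sub_ballistic i D h A s \<epsilon> (X s \<omega>) \<longrightarrow>
     cs c (g s - h s) s \<omega> \<le> T s \<omega> \<and> T s \<omega> \<le> cs 1 (g s + h s) s \<omega>"
    using eventually_ge_at_top[of 1]
  proof eventually_elim
    fix s :: real assume gs: "g s / s < min (c * \<rho>) \<epsilon>" and hs: "h s / s < \<epsilon>" and s: "1 \<le> s"
    have g1: "g s \<le> s * (c * \<rho>)" and g2: "g s \<le> s * ((1 - c) * \<rho> / 2)" and h1: "h s \<le> s * ((1 - c) * \<rho> / 2)"
      using gs hs s by (simp_all add: divide_less_eq \<epsilon>_def mult.commute)
    note corr = corridor_subset[OF D(3) x \<rho>(2) c, of s _ i, folded \<epsilon>_def]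
    have sx: "s *\<^sub>R x \<in> scaled s (dilate x c D)"
      using dilate_center[OF x] by (auto simp: scaled_def)
    have win: "link_window i g s x \<subseteq> inner_part (\<epsilon> * s) (scaled s D)"
    proof
      fix p assume p: "p \<in> link_window i g s x"
      \<comment> \<open>Formal instance with no nodes, used for the geometry of the window
        alone.\<close>
      interpret navigation i "\<lambda>y \<phi>. y" "{}" by unfold_locales auto
      note lw = link_window_perp[OF p]
      \<comment> \<open>The corridor that starts at \<open>s *\<^sub>R x\<close> itself, with g in
        the role of h: it degenerates to the window.\<close>
      show "p \<in> inner_part (\<epsilon> * s) (scaled s D)"
        by (rule corr[OF _ sx]) (use s lw g2 c \<rho> in \<open>auto simp: \<epsilon>_def perp_def[of _ 0] simp del: vector_scaleR_component\<close>)
    qed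
    show "\<forall>\<omega>\<in>space M. generic s \<omega> \<longrightarrow> sub_ballistic i D h A s \<epsilon> (X s \<omega>) \<longrightarrow>
       cs c (g s - h s) s \<omega> \<le> T s \<omega> \<and> T s \<omega> \<le> cs 1 (g s + h s) s \<omega>"
    proof (intro ballI impI)
      fix \<omega> assume \<omega>: "\<omega> \<in> space M" and gen: "generic s \<omega>" and sb: "sub_ballistic i D h A s \<epsilon> (X s \<omega>)"
      interpret navigation i A "X s \<omega>" by (rule nav[OF s \<omega>])
      let ?cr = "\<lambda>z. crossing_nodes i g A s x (X s \<omega>) \<inter> trajectory A (X s \<omega>) z \<noteq> {}"
      have XD: "z /\<^sub>R s \<in> D" if "z \<in> X s \<omega>" for z
        using X_subset[OF s \<omega>] that mem_scaled_D[OF s] by blast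
      have up: "(if ?cr z then mu0 (z /\<^sub>R s) else 0) \<le> f 1 (g s + h s) s z" if z: "z \<in> X s \<omega>" for z
      proof (cases "?cr z")
        case True
        have "z \<in> halfcyl e1 (s *\<^sub>R x) (g s + h s) 0" by (rule crossing_upper[OF sb z win True])
        then show ?thesis using True XD[OF z] by (simp add: f_def)
      next
        case False
        then show ?thesis using f_bounds by simp
      qed
      have op: "open (inner_part (\<epsilon> * s) (scaled s D))"
        using s \<epsilon> D(1) by (intro open_inner_part open_scaled) auto
      have low: "f c (g s - h s) s z \<le> (if ?cr z then mu0 (z /\<^sub>R s) else 0)" if z: "z \<in> X s \<omega>" for z
      proof (cases "z \<in> halfcyl e1 (s *\<^sub>R x) (g s - h s) 0 \<and> z /\<^sub>R s \<in> dilate x c D")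
        case True
        then have zD: "z \<in> scaled s (dilate x c D)" using s by (simp add: mem_scaled_iff)
        have zc: "norm (perp e1 (z - s *\<^sub>R x)) \<le> s * (c * \<rho>)"
          using True g1 h_pos[OF s] by (simp add: halfcyl_def)
        have acyc: "A y (X s \<omega>) = y" if "y \<in> X s \<omega>" "k \<ge> 1" "nav_iter A (X s \<omega>) k y = y" for y k
          using gen that by (auto simp: generic_def)
        have "?cr z"
        proof (rule crossing_lower[OF sb z acyc op])
          show "z \<in> halfcyl e1 (s *\<^sub>R x) (g s - h s) 0" using True by simp
          show "h s \<ge> 0" by (rule h_pos[OF s])
          fix q assume q: "z $ i \<le> q $ i" "q $ i \<le> (s *\<^sub>R x) $ i" "norm (perp e1 (q - z)) \<le> h s"
          show "q \<in> inner_part (\<epsilon> * s) (scaled s D)"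
            by (rule corr[OF _ zD zc q(1,2)]) (use s q(3) h1 in \<open>auto simp: \<epsilon>_def\<close>)
        qed
        then show ?thesis using True by (simp add: f_def)
      next
        case False
        then have "f c (g s - h s) s z = 0" by (auto simp: f_def indicator_def)
        then show ?thesis by (simp add: mu0_nonneg)
      qed
      show "cs c (g s - h s) s \<omega> \<le> T s \<omega> \<and> T s \<omega> \<le> cs 1 (g s + h s) s \<omega>"
        unfolding T_generic[OF s \<omega> gen] cs_def by (intro conjI sum_mono up low)
    qed
  qed
  then show thesis using that \<epsilon> by blast
qed

abbreviation "ballistic s \<epsilon> \<equiv> {\<omega> \<in> space M. sub_ballistic i D h A s \<epsilon> (X s \<omega>)}"

lemma power_at_top: "filterlim (\<lambda>s::real. s ^ (2 * CARD('n))) at_top at_top"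
  by (intro filterlim_pow_at_top filterlim_ident) simp

text \<open>Measurability of the event comes out of the bound. A non-measurable set has
  \<open>measure\<close> 0, so 1 - prob would equal 1 and the bound would force s^(2d) \<le> C,
  which fails for large s.\<close>

lemma bad_event:
  assumes \<epsilon>: "\<epsilon> > 0"
  obtains C where "C \<ge> 0" "\<forall>\<^sub>F s in at_top. ballistic s \<epsilon> \<in> events \<and> prob (space M - ballistic s \<epsilon>) \<le> C / s ^ (2 * CARD('n))"
proof -
  obtain C where C: "C > 0" and ev: "\<forall>\<^sub>F s in at_top. norm (1 - prob (ballistic s \<epsilon>)) \<le> C * norm (1 / s ^ (2 * CARD('n)))"
    using landau_o.bigE[OF D2[OF \<epsilon>]] by blast
  have "\<forall>\<^sub>F s in at_top. C < s ^ (2 * CARD('n))"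
    using power_at_top by (simp add: filterlim_at_top_dense)
  with ev have "\<forall>\<^sub>F s in at_top. ballistic s \<epsilon> \<in> events \<and> prob (space M - ballistic s \<epsilon>) \<le> C / s ^ (2 * CARD('n))"
    using eventually_ge_at_top[of 1]
  proof eventually_elim
    fix s :: real assume b: "norm (1 - prob (ballistic s \<epsilon>)) \<le> C * norm (1 / s ^ (2 * CARD('n)))"
      and Cs: "C < s ^ (2 * CARD('n))" and s: "1 \<le> s"
    have pos: "s ^ (2 * CARD('n)) > 0" using s by simp
    have b': "1 - prob (ballistic s \<epsilon>) \<le> C / s ^ (2 * CARD('n))" using b s by simp
    have m: "ballistic s \<epsilon> \<in> events"
    proof (rule ccontr)
      assume "ballistic s \<epsilon> \<notin> events"
      then have "prob (ballistic s \<epsilon>) = 0" by (rule measure_notin_sets)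
      then have "s ^ (2 * CARD('n)) \<le> C" using b' pos by (simp add: le_divide_eq)
      then show False using Cs by simp
    qed
    then show "ballistic s \<epsilon> \<in> events \<and> prob (space M - ballistic s \<epsilon>) \<le> C / s ^ (2 * CARD('n))"
      using b' prob_compl[OF m] by simp
  qed
  then show thesis by (rule that[OF less_imp_le[OF C]])
qed

lemma card_measurable: "s \<ge> 1 \<Longrightarrow> (\<lambda>\<omega>. real (card (X s \<omega>))) \<in> borel_measurable M"
  and card_integrable: "s \<ge> 1 \<Longrightarrow> integrable M (\<lambda>\<omega>. real (card (X s \<omega>)))"
proof -
  assume s: "s \<ge> 1"
  have "integrable M (\<lambda>\<omega>. \<Sum>y\<in>X s \<omega>. 1 :: real)"
    by (rule campbell_real(1)[OF s, of "\<lambda>_. 1" 1]) auto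
  then show "integrable M (\<lambda>\<omega>. real (card (X s \<omega>)))" by simp
  then show "(\<lambda>\<omega>. real (card (X s \<omega>))) \<in> borel_measurable M" by simp
qed

text \<open>With \<open>p = s\<^sup>2\<^sup>d\<close>, the inequality \<open>N 1\<^sub>B \<le> N\<^sup>2 / p + p 1\<^sub>B\<close> balances the second moment of the
  number \<open>N\<close> of nodes against the probability of the bad event \<open>B\<close>.\<close>

lemma bad_contribution:
  assumes \<epsilon>: "\<epsilon> > 0"
  obtains C where "\<forall>\<^sub>F s in at_top. ballistic s \<epsilon> \<in> events \<and>
    expectation (\<lambda>\<omega>. real (card (X s \<omega>)) * indicator (space M - ballistic s \<epsilon>) \<omega>) \<le> C"
proof -
  obtain C1 where C1: "C1 \<ge> 0" "\<forall>\<^sub>F s in at_top. ballistic s \<epsilon> \<in> events \<and> prob (space M - ballistic s \<epsilon>) \<le> C1 / s ^ (2 * CARD('n))"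
    by (rule bad_event[OF \<epsilon>])
  obtain C2 where C2: "C2 > 0" "\<forall>\<^sub>F s in at_top. norm (expectation (\<lambda>\<omega>. (real (card (X s \<omega>)))\<^sup>2)) \<le> C2 * norm (s ^ (2 * CARD('n)))"
    using landau_o.bigE[OF sq_bound] by blast
  have "\<forall>\<^sub>F s in at_top. ballistic s \<epsilon> \<in> events \<and>
    expectation (\<lambda>\<omega>. real (card (X s \<omega>)) * indicator (space M - ballistic s \<epsilon>) \<omega>) \<le> C2 + C1"
    using C1(2) C2(2) sq_int eventually_ge_at_top[of 1]
  proof eventually_elim
    fix s :: real
    assume b: "ballistic s \<epsilon> \<in> events \<and> prob (space M - ballistic s \<epsilon>) \<le> C1 / s ^ (2 * CARD('n))"
      and E2: "norm (expectation (\<lambda>\<omega>. (real (card (X s \<omega>)))\<^sup>2)) \<le> C2 * norm (s ^ (2 * CARD('n)))"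
      and i2: "integrable M (\<lambda>\<omega>. (real (card (X s \<omega>)))\<^sup>2)" and s: "1 \<le> s"
    let ?B = "space M - ballistic s \<epsilon>" and ?N = "\<lambda>\<omega>. real (card (X s \<omega>))" and ?p = "s ^ (2 * CARD('n))"
    have p: "?p > 0" using s by simp
    have B: "?B \<in> events" using b by auto
    have iN: "integrable M (\<lambda>\<omega>. ?N \<omega> * indicator ?B \<omega>)"
      using integrable_mult_indicator[OF B card_integrable[OF s]] by (simp add: mult.commute)
    have pw: "?N \<omega> * indicator ?B \<omega> \<le> (?N \<omega>)\<^sup>2 / ?p + ?p * indicator ?B \<omega>" for \<omega>
    proof (cases "\<omega> \<in> ?B")
      case True
      have "?N \<omega> * ?p \<le> (?N \<omega>)\<^sup>2 + ?p\<^sup>2"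
      proof -
        have "2 * (?N \<omega> * ?p) \<le> (?N \<omega>)\<^sup>2 + ?p\<^sup>2"
          using sum_squares_bound[of "?N \<omega>" ?p] by (simp only: mult.assoc)
        moreover have "0 \<le> ?N \<omega> * ?p" using p by simp
        ultimately show ?thesis by linarith
      qed
      then have "?N \<omega> \<le> ((?N \<omega>)\<^sup>2 + ?p\<^sup>2) / ?p" using p by (simp add: le_divide_eq)
      also have "\<dots> = (?N \<omega>)\<^sup>2 / ?p + ?p" using p by (simp add: add_divide_distrib power2_eq_square)
      finally show ?thesis using True by simp
    next
      case False
      then show ?thesis using p by simp
    qed
    have iB: "integrable M (\<lambda>\<omega>. ?p * indicator ?B \<omega>)"
      using B by (intro integrable_mult_right integrable_real_indicator) (auto simp: emeasure_eq_measure)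
    have i2p: "integrable M (\<lambda>\<omega>. (?N \<omega>)\<^sup>2 / ?p)" using i2 by auto
    have "expectation (\<lambda>\<omega>. ?N \<omega> * indicator ?B \<omega>) \<le> expectation (\<lambda>\<omega>. (?N \<omega>)\<^sup>2 / ?p + ?p * indicator ?B \<omega>)"
      using iB i2p by (intro integral_mono[OF iN] pw) auto
    also have "\<dots> = expectation (\<lambda>\<omega>. (?N \<omega>)\<^sup>2) / ?p + ?p * prob ?B"
      using iB i2p B by simp
    also have "\<dots> \<le> C2 + C1"
    proof (rule add_mono)
      show "expectation (\<lambda>\<omega>. (?N \<omega>)\<^sup>2) / ?p \<le> C2" using E2 p by (simp add: divide_le_eq)
      have "?p * prob ?B \<le> ?p * (C1 / ?p)" using b p by (intro mult_left_mono) auto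
      then show "?p * prob ?B \<le> C1" using s by simp
    qed
    finally show "ballistic s \<epsilon> \<in> events \<and> expectation (\<lambda>\<omega>. ?N \<omega> * indicator ?B \<omega>) \<le> C2 + C1"
      using b by simp
  qed
  then show thesis using that by blast
qed

end

section \<open>Convergence of the flow\<close>

context network
begin

lemma T_integrable:
  assumes s: "s \<ge> 1"
  shows "integrable M (T s)"
proof (rule Bochner_Integration.integrable_bound)
  show "integrable M (\<lambda>\<omega>. mumax * real (card (X s \<omega>)))" using card_integrable[OF s] by simp
  show "T s \<in> borel_measurable M" by (rule T_measurable[OF s])
  show "AE \<omega> in M. norm (T s \<omega>) \<le> norm (mumax * real (card (X s \<omega>)))"
    using AE_generic[OF s] AE_space
  proof eventually_elim
    fix \<omega> assume "generic s \<omega>" "\<omega> \<in> space M"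
    from T_bounds[OF s this(2,1)] show "norm (T s \<omega>) \<le> norm (mumax * real (card (X s \<omega>)))" by simp
  qed
qed

text \<open>For given \<delta>, c is fixed before s grows: replacing \<open>J c\<close> by
  \<open>J 1\<close> costs \<delta> / 2, the convergence of the means \<delta> / 4, and the bad
  event another \<delta> / 4.\<close>

theorem flow_mean_limit: "((\<lambda>s. expectation (T s) / (s * V s)) \<longlongrightarrow> J 1) at_top"
proof (rule tendstoI)
  fix \<delta> :: real assume \<delta>: "\<delta> > 0"
  then have \<delta>2: "\<delta> / 2 > 0" by simp
  obtain c where c: "0 < c" "c < 1" "\<bar>J c - J 1\<bar> < \<delta> / 2" by (rule J_near[OF \<delta>2])
  obtain \<epsilon> where \<epsilon>: "\<epsilon> > 0" and sw: "\<forall>\<^sub>F s in at_top. \<forall>\<omega>\<in>space M. generic s \<omega> \<longrightarrow> sub_ballistic i D h A s \<epsilon> (X s \<omega>) \<longrightarrow>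
     cs c (g s - h s) s \<omega> \<le> T s \<omega> \<and> T s \<omega> \<le> cs 1 (g s + h s) s \<omega>"
    by (rule sandwich[OF c(1,2)])
  obtain C where C: "\<forall>\<^sub>F s in at_top. ballistic s \<epsilon> \<in> events \<and>
    expectation (\<lambda>\<omega>. real (card (X s \<omega>)) * indicator (space M - ballistic s \<epsilon>) \<omega>) \<le> C"
    by (rule bad_contribution[OF \<epsilon>])
  have l1: "((\<lambda>s. expectation (cs c (g s - h s) s) / (s * V s)) \<longlongrightarrow> J c) at_top"
    using c by (intro mean_limit radius_minus) auto
  have l2: "((\<lambda>s. expectation (cs 1 (g s + h s) s) / (s * V s)) \<longlongrightarrow> J 1) at_top"
    by (intro mean_limit radius_plus) auto
  have \<delta>4: "\<delta> / 4 > 0" using \<delta> by simp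
  have e1: "\<forall>\<^sub>F s in at_top. \<bar>expectation (cs c (g s - h s) s) / (s * V s) - J c\<bar> < \<delta> / 4"
    using tendstoD[OF l1 \<delta>4] by (simp add: dist_real_def)
  have e2: "\<forall>\<^sub>F s in at_top. \<bar>expectation (cs 1 (g s + h s) s) / (s * V s) - J 1\<bar> < \<delta> / 4"
    using tendstoD[OF l2 \<delta>4] by (simp add: dist_real_def)
  have e3: "\<forall>\<^sub>F s in at_top. mumax * C / (s * V s) < \<delta> / 4"
    using order_tendstoD(2)[OF const_over_sV \<delta>4] .
  show "\<forall>\<^sub>F s in at_top. dist (expectation (T s) / (s * V s)) (J 1) < \<delta>"
    using sw C e1 e2 e3 eventually_ge_at_top[of 1]
  proof eventually_elim
    fix s :: real
    assume sw: "\<forall>\<omega>\<in>space M. generic s \<omega> \<longrightarrow> sub_ballistic i D h A s \<epsilon> (X s \<omega>) \<longrightarrow>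
       cs c (g s - h s) s \<omega> \<le> T s \<omega> \<and> T s \<omega> \<le> cs 1 (g s + h s) s \<omega>"
      and C: "ballistic s \<epsilon> \<in> events \<and>
        expectation (\<lambda>\<omega>. real (card (X s \<omega>)) * indicator (space M - ballistic s \<epsilon>) \<omega>) \<le> C"
      and e1: "\<bar>expectation (cs c (g s - h s) s) / (s * V s) - J c\<bar> < \<delta> / 4"
      and e2: "\<bar>expectation (cs 1 (g s + h s) s) / (s * V s) - J 1\<bar> < \<delta> / 4"
      and e3: "mumax * C / (s * V s) < \<delta> / 4" and s: "1 \<le> s"
    \<comment> \<open>Correction on the bad event: there it dominates the flow by
      \<open>T_bounds\<close> and the lower bound by \<open>cs_le\<close>, so that both inequalities
      of the sandwich hold almost surely up to this term.\<close>
    let ?R = "\<lambda>\<omega>. mumax * (real (card (X s \<omega>)) * indicator (space M - ballistic s \<epsilon>) \<omega>)"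
    let ?L = "cs c (g s - h s) s" and ?U = "cs 1 (g s + h s) s"
    have B: "space M - ballistic s \<epsilon> \<in> events" using C by auto
    have iR: "integrable M ?R"
      using integrable_mult_indicator[OF B card_integrable[OF s]] by (simp add: mult.commute)
    have iL: "integrable M ?L" and iU: "integrable M ?U" using cs_expectation(1)[OF s] c by auto
    have ER: "expectation ?R \<le> mumax * C"
      using C mumax_nonneg by (simp add: mult_left_mono)
    have up: "AE \<omega> in M. T s \<omega> \<le> ?U \<omega> + ?R \<omega>" and low: "AE \<omega> in M. ?L \<omega> \<le> T s \<omega> + ?R \<omega>"
    proof -
      have both: "T s \<omega> \<le> ?U \<omega> + ?R \<omega> \<and> ?L \<omega> \<le> T s \<omega> + ?R \<omega>" if gen: "generic s \<omega>" and \<omega>: "\<omega> \<in> space M" for \<omega>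
      proof (cases "\<omega> \<in> ballistic s \<epsilon>")
        case True
        then show ?thesis using sw gen by simp
      next
        case False
        then have R: "?R \<omega> = mumax * real (card (X s \<omega>))" using \<omega> by simp
        show ?thesis unfolding R
          using T_bounds[OF s \<omega> gen] cs_nonneg[of 1 "g s + h s" s \<omega>] cs_le[of c "g s - h s" s \<omega>] by linarith
      qed
      show "AE \<omega> in M. T s \<omega> \<le> ?U \<omega> + ?R \<omega>" "AE \<omega> in M. ?L \<omega> \<le> T s \<omega> + ?R \<omega>"
        using AE_generic[OF s] AE_space by (eventually_elim, use both in blast)+
    qed
    have "expectation (T s) \<le> expectation (\<lambda>\<omega>. ?U \<omega> + ?R \<omega>)"
      using T_integrable[OF s] iU iR up by (intro integral_mono_AE) auto
    then have 1: "expectation (T s) \<le> expectation ?U + mumax * C"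
      using Bochner_Integration.integral_add[OF iU iR] ER by simp
    have "expectation ?L \<le> expectation (\<lambda>\<omega>. T s \<omega> + ?R \<omega>)"
      using T_integrable[OF s] iL iR low by (intro integral_mono_AE) auto
    then have 2: "expectation ?L \<le> expectation (T s) + mumax * C"
      using Bochner_Integration.integral_add[OF T_integrable[OF s] iR] ER by simp
    have sV: "s * V s > 0" using s V_pos[OF s] by simp
    have "expectation (T s) / (s * V s) \<le> expectation ?U / (s * V s) + mumax * C / (s * V s)"
      unfolding add_divide_distrib[symmetric] using 1 sV by (intro divide_right_mono) auto
    moreover have "expectation ?L / (s * V s) \<le> expectation (T s) / (s * V s) + mumax * C / (s * V s)"
      unfolding add_divide_distrib[symmetric] using 2 sV by (intro divide_right_mono) auto
    ultimately show "dist (expectation (T s) / (s * V s)) (J 1) < \<delta>"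
      using e1 e2 e3 c(3) unfolding dist_real_def by linarith
  qed
qed

text \<open>The probabilistic input of the second assertion, isolated so that the Poisson and the
  ergodic case feed the same argument. Deviations are measured on the scale \<open>s * V s\<close>
  of the means.\<close>

definition "concentration \<longleftrightarrow> (\<forall>c r a. 0 < c \<longrightarrow> c \<le> 1 \<longrightarrow> radius r \<longrightarrow> a > 0 \<longrightarrow>
  ((\<lambda>s. prob {\<omega> \<in> space M. \<bar>cs c (r s) s \<omega> - expectation (cs c (r s) s)\<bar> \<ge> a * (s * V s)}) \<longlongrightarrow> 0) at_top)"

lemma cs_measurable: "s \<ge> 1 \<Longrightarrow> c > 0 \<Longrightarrow> cs c r s \<in> borel_measurable M"
  using cs_expectation(1) by blast

lemma concentration_limit:
  assumes conc: concentration and c: "0 < c" "c \<le> 1" and r: "radius r" and \<delta>: "\<delta> > 0"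
  shows "((\<lambda>s. prob {\<omega> \<in> space M. \<bar>cs c (r s) s \<omega> / (s * V s) - J c\<bar> \<ge> \<delta>}) \<longlongrightarrow> 0) at_top"
proof (rule tendsto_sandwich[OF _ _ tendsto_const])
  have \<delta>2: "\<delta> / 2 > 0" using \<delta> by simp
  show "((\<lambda>s. prob {\<omega> \<in> space M. \<bar>cs c (r s) s \<omega> - expectation (cs c (r s) s)\<bar> \<ge> \<delta> / 2 * (s * V s)}) \<longlongrightarrow> 0) at_top"
    using conc c r \<delta>2 unfolding concentration_def by blast
  show "\<forall>\<^sub>F s in at_top. 0 \<le> prob {\<omega> \<in> space M. \<bar>cs c (r s) s \<omega> / (s * V s) - J c\<bar> \<ge> \<delta>}" by simp
  have "\<forall>\<^sub>F s in at_top. \<bar>expectation (cs c (r s) s) / (s * V s) - J c\<bar> < \<delta> / 2"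
    using tendstoD[OF mean_limit[OF c r] \<delta>2] by (simp add: dist_real_def)
  then show "\<forall>\<^sub>F s in at_top. prob {\<omega> \<in> space M. \<bar>cs c (r s) s \<omega> / (s * V s) - J c\<bar> \<ge> \<delta>} \<le>
      prob {\<omega> \<in> space M. \<bar>cs c (r s) s \<omega> - expectation (cs c (r s) s)\<bar> \<ge> \<delta> / 2 * (s * V s)}"
    using eventually_ge_at_top[of 1]
  proof eventually_elim
    fix s :: real assume m: "\<bar>expectation (cs c (r s) s) / (s * V s) - J c\<bar> < \<delta> / 2" and s: "1 \<le> s"
    have [measurable]: "cs c (r s) s \<in> borel_measurable M" by (rule cs_measurable[OF s c(1)])
    have sV: "s * V s > 0" using s V_pos[OF s] by simp
    show "prob {\<omega> \<in> space M. \<bar>cs c (r s) s \<omega> / (s * V s) - J c\<bar> \<ge> \<delta>} \<le>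
      prob {\<omega> \<in> space M. \<bar>cs c (r s) s \<omega> - expectation (cs c (r s) s)\<bar> \<ge> \<delta> / 2 * (s * V s)}"
    proof (rule finite_measure_mono)
      show "{\<omega> \<in> space M. \<bar>cs c (r s) s \<omega> / (s * V s) - J c\<bar> \<ge> \<delta>} \<subseteq>
        {\<omega> \<in> space M. \<bar>cs c (r s) s \<omega> - expectation (cs c (r s) s)\<bar> \<ge> \<delta> / 2 * (s * V s)}"
      proof clarify
        have tri: "\<delta> \<le> \<bar>p - j\<bar> \<Longrightarrow> \<bar>m - j\<bar> < \<delta> / 2 \<Longrightarrow> \<delta> / 2 \<le> \<bar>p - m\<bar>" for p j m :: real by linarith
        fix \<omega> assume "\<delta> \<le> \<bar>cs c (r s) s \<omega> / (s * V s) - J c\<bar>"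
        then have "\<delta> / 2 \<le> \<bar>cs c (r s) s \<omega> / (s * V s) - expectation (cs c (r s) s) / (s * V s)\<bar>"
          using m by (rule tri)
        also have "\<dots> = \<bar>cs c (r s) s \<omega> - expectation (cs c (r s) s)\<bar> / (s * V s)"
          using sV by (simp add: diff_divide_distrib[symmetric])
        finally show "\<delta> / 2 * (s * V s) \<le> \<bar>cs c (r s) s \<omega> - expectation (cs c (r s) s)\<bar>"
          using sV by (simp only: pos_le_divide_eq)
      qed
    qed measurable
  qed
qed

text \<open>Outside the bad event and the two deviation events, the normalised flow exceeds
  \<open>J c\<close> - \<delta> / 2 and stays below \<open>J 1\<close> + \<delta>, while
  \<open>J c\<close> is within \<delta> / 2 of \<open>J 1\<close>. The three probabilities vanish by
  \<open>concentration_limit\<close> and \<open>bad_event\<close>.\<close>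

theorem flow_limit_in_prob:
  assumes conc: concentration
  shows "tendsto_in_prob M (\<lambda>s \<omega>. T s \<omega> / (s * V s)) (J 1)"
  unfolding tendsto_in_prob_def
proof (intro allI impI)
  fix \<delta> :: real assume \<delta>: "\<delta> > 0"
  then have \<delta>2: "\<delta> / 2 > 0" by simp
  obtain c where c: "0 < c" "c < 1" "\<bar>J c - J 1\<bar> < \<delta> / 2" by (rule J_near[OF \<delta>2])
  obtain \<epsilon> where \<epsilon>: "\<epsilon> > 0" and sw: "\<forall>\<^sub>F s in at_top. \<forall>\<omega>\<in>space M. generic s \<omega> \<longrightarrow> sub_ballistic i D h A s \<epsilon> (X s \<omega>) \<longrightarrow>
     cs c (g s - h s) s \<omega> \<le> T s \<omega> \<and> T s \<omega> \<le> cs 1 (g s + h s) s \<omega>"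
    by (rule sandwich[OF c(1,2)])
  obtain C where C: "C \<ge> 0" and bad: "\<forall>\<^sub>F s in at_top. ballistic s \<epsilon> \<in> events \<and> prob (space M - ballistic s \<epsilon>) \<le> C / s ^ (2 * CARD('n))"
    by (rule bad_event[OF \<epsilon>])
  let ?L = "\<lambda>s. {\<omega> \<in> space M. \<bar>cs c (g s - h s) s \<omega> / (s * V s) - J c\<bar> \<ge> \<delta> / 2}"
  let ?U = "\<lambda>s. {\<omega> \<in> space M. \<bar>cs 1 (g s + h s) s \<omega> / (s * V s) - J 1\<bar> \<ge> \<delta>}"
  let ?E = "\<lambda>s. {\<omega> \<in> space M. \<bar>T s \<omega> / (s * V s) - J 1\<bar> > \<delta>}"
  have "((\<lambda>s. prob (?L s) + prob (?U s) + C / s ^ (2 * CARD('n))) \<longlongrightarrow> 0 + 0 + 0) at_top"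
  proof (intro tendsto_add)
    show "((\<lambda>s. prob (?L s)) \<longlongrightarrow> 0) at_top"
      using c \<delta>2 by (intro concentration_limit[OF conc] radius_minus) auto
    show "((\<lambda>s. prob (?U s)) \<longlongrightarrow> 0) at_top"
      using \<delta> by (intro concentration_limit[OF conc] radius_plus) auto
    show "((\<lambda>s::real. C / s ^ (2 * CARD('n))) \<longlongrightarrow> 0) at_top"
      by (rule tendsto_divide_0[OF tendsto_const]) (rule filterlim_at_top_imp_at_infinity[OF power_at_top])
  qed
  then have lim: "((\<lambda>s. prob (?L s) + prob (?U s) + C / s ^ (2 * CARD('n))) \<longlongrightarrow> 0) at_top" by simp
  show "((\<lambda>s. prob (?E s)) \<longlongrightarrow> 0) at_top"
  proof (rule tendsto_sandwich[OF _ _ tendsto_const lim])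
    show "\<forall>\<^sub>F s in at_top. 0 \<le> prob (?E s)" by simp
    show "\<forall>\<^sub>F s in at_top. prob (?E s) \<le> prob (?L s) + prob (?U s) + C / s ^ (2 * CARD('n))"
      using sw bad eventually_ge_at_top[of 1]
    proof eventually_elim
      fix s :: real
      assume sw: "\<forall>\<omega>\<in>space M. generic s \<omega> \<longrightarrow> sub_ballistic i D h A s \<epsilon> (X s \<omega>) \<longrightarrow>
         cs c (g s - h s) s \<omega> \<le> T s \<omega> \<and> T s \<omega> \<le> cs 1 (g s + h s) s \<omega>"
        and bad: "ballistic s \<epsilon> \<in> events \<and> prob (space M - ballistic s \<epsilon>) \<le> C / s ^ (2 * CARD('n))"
        and s: "1 \<le> s"
      have [measurable]: "cs c (g s - h s) s \<in> borel_measurable M" "cs 1 (g s + h s) s \<in> borel_measurable M"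
        using cs_measurable[OF s] c by auto
      have m: "?L s \<in> events" "?U s \<in> events" by measurable
      have sV: "s * V s > 0" using s V_pos[OF s] by simp
      have B: "space M - ballistic s \<epsilon> \<in> events" using bad by auto
      have "prob (?E s) \<le> prob (?L s \<union> ?U s \<union> (space M - ballistic s \<epsilon>))"
      proof (rule finite_measure_mono_AE)
        show "AE \<omega> in M. \<omega> \<in> ?E s \<longrightarrow> \<omega> \<in> ?L s \<union> ?U s \<union> (space M - ballistic s \<epsilon>)"
          using AE_generic[OF s] AE_space
        proof eventually_elim
          fix \<omega> assume gen: "generic s \<omega>" and \<omega>: "\<omega> \<in> space M"
          show "\<omega> \<in> ?E s \<longrightarrow> \<omega> \<in> ?L s \<union> ?U s \<union> (space M - ballistic s \<epsilon>)"
          proof (intro impI, rule ccontr)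
            assume E: "\<omega> \<in> ?E s" and n: "\<omega> \<notin> ?L s \<union> ?U s \<union> (space M - ballistic s \<epsilon>)"
            then have "cs c (g s - h s) s \<omega> \<le> T s \<omega>" "T s \<omega> \<le> cs 1 (g s + h s) s \<omega>"
              using sw gen \<omega> by auto
            then have "cs c (g s - h s) s \<omega> / (s * V s) \<le> T s \<omega> / (s * V s)"
              "T s \<omega> / (s * V s) \<le> cs 1 (g s + h s) s \<omega> / (s * V s)"
              using sV by (auto intro: divide_right_mono)
            moreover have "\<bar>cs c (g s - h s) s \<omega> / (s * V s) - J c\<bar> < \<delta> / 2"
              "\<bar>cs 1 (g s + h s) s \<omega> / (s * V s) - J 1\<bar> < \<delta>" using n \<omega> by auto
            moreover have "\<bar>T s \<omega> / (s * V s) - J 1\<bar> > \<delta>" using E by simp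
            ultimately show False using c(3) by linarith
          qed
        qed
        show "?L s \<union> ?U s \<union> (space M - ballistic s \<epsilon>) \<in> events" using m B by auto
      qed
      also have "\<dots> \<le> prob (?L s \<union> ?U s) + prob (space M - ballistic s \<epsilon>)"
        using m B by (intro measure_Un_le) auto
      also have "\<dots> \<le> prob (?L s) + prob (?U s) + C / s ^ (2 * CARD('n))"
        using m bad by (intro add_mono measure_Un_le) auto
      finally show "prob (?E s) \<le> prob (?L s) + prob (?U s) + C / s ^ (2 * CARD('n))" .
    qed
  qed
qed

lemma concentrationI:
  assumes "\<And>c r a. 0 < c \<Longrightarrow> c \<le> 1 \<Longrightarrow> radius r \<Longrightarrow> a > 0 \<Longrightarrow>
    \<exists>b. (b \<longlongrightarrow> 0) at_top \<and> (\<forall>\<^sub>F s in at_top. prob {\<omega> \<in> space M. \<bar>cs c (r s) s \<omega> - expectation (cs c (r s) s)\<bar> \<ge> a * (s * V s)} \<le> b s)"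
  shows concentration
  unfolding concentration_def
proof (intro allI impI)
  fix c :: real and r :: "real \<Rightarrow> real" and a :: real assume c: "0 < c" "c \<le> 1" and r: "radius r" and a: "a > 0"
  obtain b where b: "(b \<longlongrightarrow> 0) at_top"
    "\<forall>\<^sub>F s in at_top. prob {\<omega> \<in> space M. \<bar>cs c (r s) s \<omega> - expectation (cs c (r s) s)\<bar> \<ge> a * (s * V s)} \<le> b s"
    using assms[OF c r a] by blast
  show "((\<lambda>s. prob {\<omega> \<in> space M. \<bar>cs c (r s) s \<omega> - expectation (cs c (r s) s)\<bar> \<ge> a * (s * V s)}) \<longlongrightarrow> 0) at_top"
    by (rule tendsto_sandwich[OF _ b(2) tendsto_const b(1)]) simp
qed

section \<open>Concentration in the Poisson case\<close>

lemma poisson_concentration: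
  assumes poisson: "\<And>s. s \<ge> 1 \<Longrightarrow> poisson_process_on M (scaled s D) (X s) (\<lambda>y. lam (y /\<^sub>R s))"
  shows concentration
proof (rule concentrationI)
  fix c :: real and r :: "real \<Rightarrow> real" and a :: real assume c: "0 < c" "c \<le> 1" and r: "radius r" and a: "a > 0"
  let ?m = "\<lambda>s. expectation (cs c (r s) s)"
  \<comment> \<open>Chebyshev's bound, \<open>mumax\<close> times the mean over the square of a s V,
    factored so that the mean over s V converges and a factor 1 / (s V) remains.\<close>
  let ?b = "\<lambda>s. mumax / a\<^sup>2 * (?m s / (s * V s)) * (1 / (s * V s))"
  have "(?b \<longlongrightarrow> mumax / a\<^sup>2 * J c * 0) at_top"
    by (intro tendsto_mult tendsto_const mean_limit c r const_over_sV)
  moreover have "\<forall>\<^sub>F s in at_top. prob {\<omega> \<in> space M. \<bar>cs c (r s) s \<omega> - ?m s\<bar> \<ge> a * (s * V s)} \<le> ?b s"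
    using eventually_ge_at_top[of 1]
  proof eventually_elim
    fix s :: real assume s: "1 \<le> s"
    have sV: "s * V s > 0" using s V_pos[OF s] by simp
    have l_eq': "lam (y /\<^sub>R s) * indicator (scaled s D) y = lam0 (y /\<^sub>R s)" for y
      by (auto simp: indicator_def mem_scaled_D[OF s] lam0_def zero_ext_def)
    have ps: "poisson_setting M (scaled s D) (X s) (\<lambda>y. lam (y /\<^sub>R s))"
    proof
      show "(\<lambda>y. ennreal (lam (y /\<^sub>R s)) * indicator (scaled s D) y) \<in> borel_measurable borel"
        unfolding l_eq[OF s] by measurable
      show "set_integrable lborel (scaled s D) (\<lambda>y. lam (y /\<^sub>R s))"
        unfolding set_integrable_def
      proof (rule integrableI_bounded_set[where B=lammax])
        have eqs: "indicator (scaled s D) y *\<^sub>R lam (y /\<^sub>R s) = lam0 (y /\<^sub>R s)" for y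
          using l_eq'[of y] by (simp add: mult.commute)
        show "(\<lambda>y. indicator (scaled s D) y *\<^sub>R lam (y /\<^sub>R s)) \<in> borel_measurable lborel"
          unfolding eqs by simp
        show "AE y in lborel. y \<in> scaled s D \<longrightarrow> norm (indicator (scaled s D) y *\<^sub>R lam (y /\<^sub>R s)) \<le> lammax"
          unfolding eqs using lam0_le lam0_nonneg by (intro AE_I2) simp
        show "emeasure lborel (scaled s D) < \<infinity>"
          by (rule emeasure_bounded_finite[OF bounded_scaled[OF D(2)]])
      qed (use scaled_D_borel[OF s] in auto)
      show "0 \<le> lam (y /\<^sub>R s)" if "y \<in> scaled s D" for y
        using that lam(3) mem_scaled_D[OF s] by blast
    qed (use s poisson intensity scaled_D_borel bounded_scaled[OF D(2)] prob_space_axioms in auto)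
    have m: "(LINT y|lborel. f c (r s) s y * (lam (y /\<^sub>R s) * indicator (scaled s D) y)) = ?m s"
      unfolding l_eq' cs_def[abs_def]
      using campbell_real(2)[OF s f_measurable[OF c(1), of "r s" s] f_bounds] by simp
    have "prob {\<omega> \<in> space M. \<bar>cs c (r s) s \<omega> - ?m s\<bar> \<ge> a * (s * V s)} \<le> mumax * ?m s / (a * (s * V s))\<^sup>2"
      using poisson_chebyshev[OF ps f_measurable[OF c(1), of "r s" s] f_bounds, of "a * (s * V s)"] a sV
      unfolding m by (simp add: cs_def)
    also have "\<dots> = ?b s" by (simp add: power2_eq_square)
    finally show "prob {\<omega> \<in> space M. \<bar>cs c (r s) s \<omega> - ?m s\<bar> \<ge> a * (s * V s)} \<le> ?b s" .
  qed
  ultimately show "\<exists>b. (b \<longlongrightarrow> 0) at_top \<and> (\<forall>\<^sub>F s in at_top. prob {\<omega> \<in> space M. \<bar>cs c (r s) s \<omega> - ?m s\<bar> \<ge> a * (s * V s)} \<le> b s)"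
    by (intro exI[of _ ?b]) simp
qed

end

section \<open>Ergodic networks\<close>

lemma stationary_nn_integral:
  assumes Y: "stationary_process M Y" and F: "F \<in> borel_measurable configs"
  shows "(\<integral>\<^sup>+\<omega>. F (translate z (Y \<omega>)) \<partial>M) = (\<integral>\<^sup>+\<omega>. F (Y \<omega>) \<partial>M)"
proof -
  have Ym: "Y \<in> measurable M configs" using Y by (simp add: stationary_process_def point_process_on_def)
  have tm: "(\<lambda>\<omega>. translate z (Y \<omega>)) \<in> measurable M configs"
    using measurable_compose[OF Ym translate_measurable] .
  have "(\<integral>\<^sup>+\<omega>. F (translate z (Y \<omega>)) \<partial>M) = (\<integral>\<^sup>+\<phi>. F \<phi> \<partial>distr M configs (\<lambda>\<omega>. translate z (Y \<omega>)))"
    using F by (intro nn_integral_distr[OF tm, symmetric]) auto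
  also have "distr M configs (\<lambda>\<omega>. translate z (Y \<omega>)) = distr M configs Y"
    using Y by (simp add: stationary_process_def translate_def)
  also have "(\<integral>\<^sup>+\<phi>. F \<phi> \<partial>distr M configs Y) = (\<integral>\<^sup>+\<omega>. F (Y \<omega>) \<partial>M)"
    using F by (intro nn_integral_distr[OF Ym]) auto
  finally show ?thesis .
qed

lemma stationary_card:
  fixes Y :: "'w \<Rightarrow> 'a::euclidean_space set" and H :: "nat \<Rightarrow> ennreal"
  assumes Y: "stationary_process M Y" and B: "B \<in> sets borel" "bounded B"
  shows "(\<integral>\<^sup>+\<omega>. H (card (Y \<omega> \<inter> translate z B)) \<partial>M) = (\<integral>\<^sup>+\<omega>. H (card (Y \<omega> \<inter> B)) \<partial>M)"
proof -
  have "(\<lambda>\<phi>. H (card (\<phi> \<inter> B))) \<in> borel_measurable configs"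
    using measurable_compose[OF measurable_card_configs[OF B], of H borel] by simp
  from stationary_nn_integral[OF Y this, of "- z"] show ?thesis by (simp add: card_translate_Int)
qed

lemma translate_cball: "translate z (cball y r) = cball (z + y) r" for y :: "'a::euclidean_space"
  unfolding translate_def by (rule cball_translation[symmetric])

context network
begin

lemma g_at_top: "filterlim g at_top at_top"
  unfolding filterlim_at_top
proof
  fix Z :: real
  have "\<not> bdd_above (g ` {1..})" using g by (simp add: admissible_scale_def)
  then obtain s0 where s0: "s0 \<ge> 1" "g s0 > Z"
    unfolding bdd_above_def by (auto simp: not_le)
  have "mono_on {1..} g" using g by (simp add: admissible_scale_def)
  then have mono: "Z \<le> g s" if "s \<ge> s0" for s
    using s0 that monotone_onD[of "{1..}" "(\<le>)" "(\<le>)" g s0 s] by simp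
  show "\<forall>\<^sub>F s in at_top. Z \<le> g s" using eventually_ge_at_top[of s0] by eventually_elim (rule mono)
qed

lemma const_over_g: "((\<lambda>s. R / g s) \<longlongrightarrow> 0) at_top"
  by (rule tendsto_divide_0[OF tendsto_const]) (rule filterlim_at_top_imp_at_infinity[OF g_at_top])

text \<open>Length of the part of the backward ray from x inside D.\<close>

definition "ray_length = ray_integral e1 x (\<lambda>y. if y \<in> D then 1 else 0) 0 0"

definition "region c r a s = halfcyl e1 (s *\<^sub>R x) r a \<inter> scaled s (dilate x c D)"

lemma region_borel: "s > 0 \<Longrightarrow> c > 0 \<Longrightarrow> region c r a s \<in> sets borel"
  unfolding region_def using open_scaled[OF _ dilate_open, of s c] by auto

lemma region_bounded: "bounded (region c r a s)"
  unfolding region_def using D by (intro bounded_Int disjI2 bounded_scaled bounded_dilate)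

text \<open>A constant R disappears in the limit, since R / g and R / s vanish, so enlarged and
  shrunk regions differ in limiting volume only through c. The factor c may exceed 1, as it can for
  the outer region in \<open>count_limit\<close>.\<close>

lemma region_volume:
  assumes c: "c > 0" and r: "radius r"
  shows "((\<lambda>s. measure lborel (region c (r s + R) R s) / (s * V s)) \<longlongrightarrow> c * ray_length) at_top"
proof -
  let ?G = "\<lambda>y. if y \<in> dilate x c D then 1 else 0 :: real"
  have dc: "open (dilate x c D)" "convex (dilate x c D)" "bounded (dilate x c D)" "x \<in> dilate x c D"
    using D x c by (auto intro: open_dilate convex_dilate bounded_dilate dilate_center)
  obtain R' where R': "ray_setting e1 x ?G 1 R'"
    using ray_setting_indicator[OF e1 dc continuous_on_const, of 1 1 ?G] by auto
  have rad: "radius (\<lambda>s. r s + R)"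
    using r const_over_g by (intro radiusI radius_add) (auto simp: radius_def)
  have "((\<lambda>s::real. R / s) \<longlongrightarrow> 0) at_top"
    by (rule tendsto_divide_0[OF tendsto_const]) (rule filterlim_at_top_imp_at_infinity[OF filterlim_ident])
  then have lim: "((\<lambda>s. (LINT z|lborel. indicator (halfcyl e1 (s *\<^sub>R x) (r s + R) R) z * ?G (z /\<^sub>R s)) / (s * V s)) \<longlongrightarrow> ray_integral e1 x ?G 0 0) at_top"
    using ray_setting.halfcyl_integral_tendsto'[OF R', of "\<lambda>s. r s + R" "\<lambda>_. R" g] rad g_pos
    by (simp add: radius_def V_def)
  have ev: "\<forall>\<^sub>F s in at_top. measure lborel (region c (r s + R) R s) / (s * V s) =
     (LINT z|lborel. indicator (halfcyl e1 (s *\<^sub>R x) (r s + R) R) z * ?G (z /\<^sub>R s)) / (s * V s)"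
    using eventually_gt_at_top[of 0]
  proof eventually_elim
    fix s :: real assume s: "0 < s"
    have "(LINT z|lborel. indicator (halfcyl e1 (s *\<^sub>R x) (r s + R) R) z * ?G (z /\<^sub>R s)) =
          (LINT z|lborel. indicator (region c (r s + R) R s) z)"
      using s by (intro Bochner_Integration.integral_cong) (auto simp: region_def indicator_def mem_scaled_iff)
    also have "\<dots> = measure lborel (region c (r s + R) R s)" by simp
    finally show "measure lborel (region c (r s + R) R s) / (s * V s) =
     (LINT z|lborel. indicator (halfcyl e1 (s *\<^sub>R x) (r s + R) R) z * ?G (z /\<^sub>R s)) / (s * V s)" by simp
  qed
  have "ray_integral e1 x ?G 0 0 = c * ray_length"
    unfolding ray_length_def by (rule ray_integral_dilate[OF c])
  then show ?thesis using tendsto_cong[THEN iffD2, OF ev lim] by simp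
qed

text \<open>The dilates are separated by s (c' - c) \<rho>, which exceeds any constant R for large
  s; the cylinder itself only grows by R in radius and in length.\<close>

lemma region_fattening:
  assumes \<rho>: "cball x \<rho> \<subseteq> D" and c: "0 < c" "c < c'" and s: "s > 0" and R: "0 \<le> R" "R \<le> s * ((c' - c) * \<rho>)"
    and z: "z \<in> region c r a s"
  shows "cball z R \<subseteq> region c' (r + R) (a + R) s"
proof
  fix w assume w: "w \<in> cball z R"
  have n: "norm (w - z) \<le> R" using w by (simp add: dist_norm norm_minus_commute)
  have "(w - z) \<bullet> e1 \<le> norm (w - z)" using Basis_le_norm[OF e1, of "w - z"] by simp
  moreover have "(w - s *\<^sub>R x) \<bullet> e1 = (z - s *\<^sub>R x) \<bullet> e1 + (w - z) \<bullet> e1" by (simp add: inner_diff_left)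
  ultimately have 1: "(w - s *\<^sub>R x) \<bullet> e1 \<le> a + R" using z n by (simp add: region_def halfcyl_def)
  have "perp e1 (w - s *\<^sub>R x) = perp e1 (z - s *\<^sub>R x) + perp e1 (w - z)" by (simp add: perp_diff)
  then have "norm (perp e1 (w - s *\<^sub>R x)) \<le> norm (perp e1 (z - s *\<^sub>R x)) + norm (perp e1 (w - z))"
    by (simp add: norm_triangle_ineq)
  also have "\<dots> \<le> r + R" using z n norm_perp_le[OF e1, of "w - z"] by (simp add: region_def halfcyl_def)
  finally have 2: "norm (perp e1 (w - s *\<^sub>R x)) \<le> r + R" .
  have "cball z (s * ((c' - c) * \<rho>)) \<subseteq> scaled s (dilate x c' D)"
    using z c s by (intro scaled_dilate_cball[OF D(3) \<rho>]) (auto simp: region_def)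
  moreover have "w \<in> cball z (s * ((c' - c) * \<rho>))" using w R(2) by simp
  ultimately show "w \<in> region c' (r + R) (a + R) s" using 1 2 by (auto simp: region_def halfcyl_def)
qed

lemma cs_region:
  assumes s: "s \<ge> 1" and \<omega>: "\<omega> \<in> space M" and c: "0 < c" "c \<le> 1" and m: "\<And>y. y \<in> D \<Longrightarrow> mu y = m"
  shows "cs c r s \<omega> = m * real (card (X s \<omega> \<inter> region c r 0 s))"
proof -
  have "f c r s z = (if z \<in> region c r 0 s then m else 0)" for z
    using s dilate_subset[OF c] m by (auto simp: f_def region_def indicator_def mem_scaled_iff mu0_def zero_ext_def)
  then have "cs c r s \<omega> = (\<Sum>z\<in>X s \<omega>. if z \<in> region c r 0 s then m else 0)" by (simp add: cs_def)
  also have "\<dots> = (\<Sum>z\<in>X s \<omega> \<inter> region c r 0 s. m)"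
    using X_finite[OF s \<omega>] by (rule sum.inter_restrict[symmetric])
  finally show ?thesis by simp
qed

end

locale ergodic_network = network M i D lam mu X A g h x
  for M :: "'w measure" and i :: "'n::finite" and D :: "(real ^ 'n) set" and lam mu :: "real ^ 'n \<Rightarrow> real"
    and X :: "real \<Rightarrow> 'w \<Rightarrow> (real ^ 'n) set" and A :: "real ^ 'n \<Rightarrow> (real ^ 'n) set \<Rightarrow> real ^ 'n"
    and g h :: "real \<Rightarrow> real" and x :: "real ^ 'n" +
  fixes Y :: "'w \<Rightarrow> (real ^ 'n) set" and m0 :: real
  assumes ergodic: "ergodic_process M Y"
    and X_eq: "\<And>s \<omega>. s \<ge> 1 \<Longrightarrow> \<omega> \<in> space M \<Longrightarrow> X s \<omega> = Y \<omega> \<inter> scaled s D"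
    and mu_const: "\<And>y. y \<in> D \<Longrightarrow> mu y = m0"
begin

lemma stationary: "stationary_process M Y"
  using ergodic by (simp add: ergodic_process_def)

lemma mean_in_window:
  assumes s: "s \<ge> 1" and B: "B \<in> sets borel" "bounded B" "B \<subseteq> scaled s D"
  shows "(\<integral>\<^sup>+\<omega>. of_nat (card (Y \<omega> \<inter> B)) \<partial>M) = (\<integral>\<^sup>+y\<in>B. ennreal (lam (y /\<^sub>R s)) \<partial>lborel)"
proof -
  have "(\<integral>\<^sup>+\<omega>. of_nat (card (Y \<omega> \<inter> B)) \<partial>M) = (\<integral>\<^sup>+\<omega>. of_nat (card (X s \<omega> \<inter> B)) \<partial>M)"
  proof (rule nn_integral_cong)
    fix \<omega> assume "\<omega> \<in> space M"
    then have "X s \<omega> \<inter> B = Y \<omega> \<inter> B" using X_eq[OF s] B(3) by auto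
    then show "of_nat (card (Y \<omega> \<inter> B)) = (of_nat (card (X s \<omega> \<inter> B)) :: ennreal)" by simp
  qed
  then show ?thesis using intensity[OF s] B by (simp add: has_intensity_on_def)
qed

text \<open>Stationarity gives equal mean counts in equal balls about y0 and y1. By continuity the
  intensity is below a near y0 and above b > a near y1, where a and b trisect the gap, and this
  makes the second mean larger. The scale is s = 1, where the domain is D itself.\<close>

lemma lam_not_less:
  assumes y: "y0 \<in> D" "y1 \<in> D"
  shows "\<not> lam y0 < lam y1"
proof
  assume less: "lam y0 < lam y1"
  define a where "a = (2 * lam y0 + lam y1) / 3"
  define b where "b = (lam y0 + 2 * lam y1) / 3"
  have ab: "lam y0 < a" "a < b" "b < lam y1" using less by (auto simp: a_def b_def field_simps)
  have cont: "isCont lam y" if "y \<in> D" for y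
    using lam(1) D(1) that by (simp add: continuous_on_eq_continuous_at)
  have "\<forall>\<^sub>F y in nhds y0. lam y < a \<and> y \<in> D"
    using order_tendstoD(2)[OF cont[OF y(1), unfolded isCont_def tendsto_at_iff_tendsto_nhds] ab(1)] eventually_nhds_in_open[OF D(1) y(1)]
    by eventually_elim simp
  then obtain r0 where r0: "r0 > 0" "\<And>y. dist y y0 < r0 \<Longrightarrow> lam y < a \<and> y \<in> D" by (auto simp: eventually_nhds_metric)
  have "\<forall>\<^sub>F y in nhds y1. b < lam y \<and> y \<in> D"
    using order_tendstoD(1)[OF cont[OF y(2), unfolded isCont_def tendsto_at_iff_tendsto_nhds] ab(3)] eventually_nhds_in_open[OF D(1) y(2)]
    by eventually_elim simp
  then obtain r1 where r1: "r1 > 0" "\<And>y. dist y y1 < r1 \<Longrightarrow> b < lam y \<and> y \<in> D" by (auto simp: eventually_nhds_metric)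
  define r where "r = min r0 r1 / 2"
  have r: "r > 0" "r < r0" "r < r1" using r0(1) r1(1) by (auto simp: r_def min_def)
  have in0: "lam y < a \<and> y \<in> D" if "y \<in> cball y0 r" for y using r0(2)[of y] r that by (simp add: dist_commute)
  have in1: "b < lam y \<and> y \<in> D" if "y \<in> cball y1 r" for y using r1(2)[of y] r that by (simp add: dist_commute)
  have in0': "ennreal (lam y) \<le> ennreal a" if "y \<in> cball y0 r" for y
    using in0[OF that] by (intro ennreal_leI) simp
  have in1': "ennreal b \<le> ennreal (lam y)" if "y \<in> cball y1 r" for y
    using in1[OF that] by (intro ennreal_leI) simp
  let ?v = "emeasure lborel (cball y0 r)"
  have v: "?v = ennreal (unit_ball_vol (real CARD('n)) * r ^ CARD('n))"
    "emeasure lborel (cball y1 r) = ennreal (unit_ball_vol (real CARD('n)) * r ^ CARD('n))"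
    using r by (simp_all add: emeasure_cball)
  have sc: "scaled 1 D = D" by (simp add: scaled_def)
  have "ennreal b * emeasure lborel (cball y1 r) = (\<integral>\<^sup>+y. ennreal b * indicator (cball y1 r) y \<partial>lborel)"
    by (simp add: nn_integral_cmult_indicator)
  also have "\<dots> \<le> (\<integral>\<^sup>+y\<in>cball y1 r. ennreal (lam (y /\<^sub>R 1)) \<partial>lborel)"
    using in1' by (intro nn_integral_mono) (auto simp: indicator_def)
  also have "\<dots> = (\<integral>\<^sup>+\<omega>. of_nat (card (Y \<omega> \<inter> cball y1 r)) \<partial>M)"
    using in1 by (intro mean_in_window[symmetric]) (auto simp: sc)
  also have "\<dots> = (\<integral>\<^sup>+\<omega>. of_nat (card (Y \<omega> \<inter> cball y0 r)) \<partial>M)"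
    using stationary_card[OF stationary, of "cball y0 r" of_nat "y1 - y0"] by (simp add: translate_cball)
  also have "\<dots> = (\<integral>\<^sup>+y\<in>cball y0 r. ennreal (lam (y /\<^sub>R 1)) \<partial>lborel)"
    using in0 by (intro mean_in_window) (auto simp: sc)
  also have "\<dots> \<le> (\<integral>\<^sup>+y. ennreal a * indicator (cball y0 r) y \<partial>lborel)"
    using in0' by (intro nn_integral_mono) (auto simp: indicator_def)
  also have "\<dots> = ennreal a * ?v" by (simp add: nn_integral_cmult_indicator)
  finally have le: "ennreal b * ennreal (unit_ball_vol (real CARD('n)) * r ^ CARD('n)) \<le> ennreal a * ennreal (unit_ball_vol (real CARD('n)) * r ^ CARD('n))"
    unfolding v .
  have a0: "0 \<le> a" "0 \<le> b" using lam(3)[OF y(1)] ab by auto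
  have vp: "unit_ball_vol (real CARD('n)) * r ^ CARD('n) > 0" using r by simp
  have "b * (unit_ball_vol (real CARD('n)) * r ^ CARD('n)) \<le> a * (unit_ball_vol (real CARD('n)) * r ^ CARD('n))"
    using le a0 vp by (simp add: ennreal_mult[symmetric])
  then have "b \<le> a" using vp by (simp only: mult_le_cancel_right_pos)
  then show False using ab by simp
qed

lemma lam_const: "y \<in> D \<Longrightarrow> lam y = lam x"
  using lam_not_less[of y x] lam_not_less[of x y] x by force

text \<open>Moments of Y are only known through the windows s D; every bounded set can be translated
  into one of them for large s.\<close>

lemma window_exists:
  assumes B: "bounded B"
  obtains s0 where "\<And>s. s \<ge> s0 \<Longrightarrow> s \<ge> 1 \<and> translate (s *\<^sub>R x) B \<subseteq> scaled s D"
proof -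
  obtain \<rho> where \<rho>: "\<rho> > 0" "cball x \<rho> \<subseteq> D" using D(1) x open_contains_cball by blast
  obtain b where b: "b > 0" "\<And>y. y \<in> B \<Longrightarrow> norm y \<le> b" using B by (auto simp: bounded_pos)
  show thesis
  proof (rule that[of "max 1 (b / \<rho>)"])
    fix s assume s: "s \<ge> max 1 (b / \<rho>)"
    then have s1: "s \<ge> 1" and "b / \<rho> \<le> s" by auto
    then have sb: "b \<le> s * \<rho>" using \<rho> by (simp add: divide_le_eq)
    have "translate (s *\<^sub>R x) B \<subseteq> cball (s *\<^sub>R x) (s * \<rho>)"
      using b(2) sb by (force simp: translate_def dist_norm)
    also have "\<dots> \<subseteq> scaled s D" using s1 by (intro cball_scaled_center[OF \<rho>(2)]) simp
    finally show "s \<ge> 1 \<and> translate (s *\<^sub>R x) B \<subseteq> scaled s D" using s1 by simp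
  qed
qed

text \<open>Stationarity transports both moment conditions from a translate of B inside a window;
  for the second moment s must in addition be such that the square of the total count is
  integrable.\<close>

sublocale E: ergodic_setting M Y "lam x"
proof
  show "ergodic_process M Y" by (rule ergodic)
  show "0 \<le> lam x" by (rule lam(3)[OF x])
  fix B :: "(real ^ 'n) set" assume B: "B \<in> sets borel" "bounded B"
  obtain s0 where s0: "\<And>s. s \<ge> s0 \<Longrightarrow> s \<ge> 1 \<and> translate (s *\<^sub>R x) B \<subseteq> scaled s D"
    by (rule window_exists[OF B(2)]) (rule that)
  have tB: "translate z B \<in> sets borel" "bounded (translate z B)" for z
    using B by (auto intro: translate_borel translate_bounded)
  show "(\<integral>\<^sup>+\<omega>. of_nat (card (Y \<omega> \<inter> B)) \<partial>M) = ennreal (lam x) * emeasure lborel B"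
  proof -
    have s: "s0 \<ge> 1" "translate (s0 *\<^sub>R x) B \<subseteq> scaled s0 D" using s0[of s0] by auto
    have "(\<integral>\<^sup>+\<omega>. of_nat (card (Y \<omega> \<inter> B)) \<partial>M) = (\<integral>\<^sup>+\<omega>. of_nat (card (Y \<omega> \<inter> translate (s0 *\<^sub>R x) B)) \<partial>M)"
      by (rule stationary_card[OF stationary B, symmetric])
    also have "\<dots> = (\<integral>\<^sup>+y\<in>translate (s0 *\<^sub>R x) B. ennreal (lam (y /\<^sub>R s0)) \<partial>lborel)"
      by (rule mean_in_window[OF s(1) tB s(2)])
    also have "\<dots> = (\<integral>\<^sup>+y. ennreal (lam x) * indicator (translate (s0 *\<^sub>R x) B) y \<partial>lborel)"
      using s lam_const mem_scaled_D[OF s(1)] by (intro nn_integral_cong) (auto simp: indicator_def subset_iff)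
    also have "\<dots> = ennreal (lam x) * emeasure lborel B"
      using tB emeasure_translate[OF B(1)] by (simp add: nn_integral_cmult_indicator)
    finally show ?thesis .
  qed
  show "(\<integral>\<^sup>+\<omega>. ennreal ((real (card (Y \<omega> \<inter> B)))\<^sup>2) \<partial>M) < \<infinity>"
  proof -
    have "\<forall>\<^sub>F s in at_top. integrable M (\<lambda>\<omega>. (real (card (X s \<omega>)))\<^sup>2) \<and> s \<ge> s0"
      using sq_int eventually_ge_at_top[of s0] by eventually_elim simp
    then obtain s where i: "integrable M (\<lambda>\<omega>. (real (card (X s \<omega>)))\<^sup>2)" and "s \<ge> s0"
      using eventually_happens'[OF trivial_limit_at_top_linorder] by blast
    then have s: "s \<ge> 1" "translate (s *\<^sub>R x) B \<subseteq> scaled s D" using s0 by auto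
    have "(\<integral>\<^sup>+\<omega>. ennreal ((real (card (Y \<omega> \<inter> B)))\<^sup>2) \<partial>M) = (\<integral>\<^sup>+\<omega>. ennreal ((real (card (Y \<omega> \<inter> translate (s *\<^sub>R x) B)))\<^sup>2) \<partial>M)"
      by (rule stationary_card[OF stationary B, where H="\<lambda>k. ennreal ((real k)\<^sup>2)", symmetric])
    also have "\<dots> \<le> (\<integral>\<^sup>+\<omega>. ennreal ((real (card (X s \<omega>)))\<^sup>2) \<partial>M)"
    proof (rule nn_integral_mono)
      fix \<omega> assume \<omega>: "\<omega> \<in> space M"
      have "card (Y \<omega> \<inter> translate (s *\<^sub>R x) B) \<le> card (X s \<omega>)"
        using X_eq[OF s(1) \<omega>] s(2) X_finite[OF s(1) \<omega>] by (intro card_mono) auto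
      then show "ennreal ((real (card (Y \<omega> \<inter> translate (s *\<^sub>R x) B)))\<^sup>2) \<le> ennreal ((real (card (X s \<omega>)))\<^sup>2)"
        by (intro ennreal_leI power_mono) auto
    qed
    also have "\<dots> < \<infinity>" using i nn_integral_eq_integral[OF i] by simp
    finally show ?thesis .
  qed
qed

text \<open>The order of choices matters: \<tau> and \<eta> from \<theta>, then the average F, then
  its range R, and only then s to infinity, so that the boundary layer of width R is absorbed
  between the dilates c - \<tau> and c + \<tau>.\<close>

lemma count_limit:
  assumes c: "0 < c" "c \<le> 1" and r: "radius r"
  shows "((\<lambda>s. expectation (\<lambda>\<omega>. \<bar>real (card (Y \<omega> \<inter> region c (r s) 0 s)) - lam x * measure lborel (region c (r s) 0 s)\<bar>) / (s * V s)) \<longlongrightarrow> 0) at_top"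
proof (rule tendstoI)
  fix \<theta> :: real assume \<theta>: "\<theta> > 0"
  obtain \<rho> where \<rho>: "\<rho> > 0" "cball x \<rho> \<subseteq> D" using D(1) x open_contains_cball by blast
  let ?L = ray_length and ?l = "lam x"
  have L: "?L \<ge> 0" unfolding ray_length_def ray_integral_def
    by (intro Bochner_Integration.integral_nonneg) (simp add: indicator_def)
  have l: "?l \<ge> 0" by (rule lam(3)[OF x])
  \<comment> \<open>\<tau> controls the contribution of the volume between the two dilates, \<eta>
    the mean error of the averages, each to at most \<theta> / 4; the bound c / 2 keeps c - \<tau>
    positive.\<close>
  define \<tau> where "\<tau> = min (c / 2) (\<theta> / (8 * (?l * ?L + 1)))"
  define \<eta> where "\<eta> = \<theta> / (16 * (?L + 1))"
  have \<tau>: "\<tau> > 0" "\<tau> < c" "\<tau> \<le> 1"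
  proof -
    have "\<tau> \<le> c / 2" unfolding \<tau>_def by (rule min.cobounded1)
    then show "\<tau> < c" "\<tau> \<le> 1" using c by auto
    show "\<tau> > 0" using c \<theta> L l by (simp add: \<tau>_def add_nonneg_pos)
  qed
  have \<eta>: "\<eta> > 0" using \<theta> L by (simp add: \<eta>_def)
  have small: "2 * \<eta> * ((c + \<tau>) * ?L) + ?l * ((c + \<tau>) * ?L - (c - \<tau>) * ?L) < \<theta>"
  proof -
    have "\<tau> * (8 * (?l * ?L + 1)) \<le> \<theta>"
    proof -
      have "\<tau> \<le> \<theta> / (8 * (?l * ?L + 1))" unfolding \<tau>_def by (rule min.cobounded2)
      moreover have "8 * (?l * ?L + 1) > 0" using l L by (simp add: add_nonneg_pos)
      ultimately show ?thesis by (simp add: pos_le_divide_eq)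
    qed
    moreover have "?l * ((c + \<tau>) * ?L - (c - \<tau>) * ?L) = 2 * (\<tau> * (?l * ?L))" by (simp add: algebra_simps)
    ultimately have 1: "?l * ((c + \<tau>) * ?L - (c - \<tau>) * ?L) \<le> \<theta> / 4"
      using \<tau>(1) by (simp add: algebra_simps)
    have "(c + \<tau>) * ?L \<le> 2 * (?L + 1)" using c \<tau> L by (intro mult_mono) auto
    then have "2 * \<eta> * ((c + \<tau>) * ?L) \<le> 2 * \<eta> * (2 * (?L + 1))" using \<eta> by (intro mult_left_mono) auto
    also have "\<dots> = \<theta> / 4" using L by (simp add: \<eta>_def field_simps)
    finally show ?thesis using 1 \<theta> by linarith
  qed
  obtain F where F: "avg F" "(LINT \<phi>|E.P. \<bar>F \<phi> - ?l\<bar>) < \<eta>" by (rule E.ergodic_average[OF \<eta>])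
  obtain R' where R': "\<And>S Out In. S \<in> sets borel \<Longrightarrow> bounded S \<Longrightarrow> Out \<in> sets borel \<Longrightarrow> bounded Out \<Longrightarrow> In \<in> sets borel \<Longrightarrow>
      (\<And>z. z \<in> S \<Longrightarrow> cball z R' \<subseteq> Out) \<Longrightarrow> (\<And>z. z \<in> In \<Longrightarrow> cball z R' \<subseteq> S) \<Longrightarrow> In \<subseteq> S \<Longrightarrow> S \<subseteq> Out \<Longrightarrow>
      (LINT \<omega>|M. \<bar>real (card (Y \<omega> \<inter> S)) - ?l * measure lborel S\<bar>) \<le>
        2 * (LINT \<phi>|E.P. \<bar>F \<phi> - ?l\<bar>) * measure lborel Out + ?l * (measure lborel Out - measure lborel In)"
    apply (rule E.count_deviation[OF F(1)])
    subgoal premises prems for R' by (rule prems(1)[of R']) (fact prems(2))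
    done
  define R where "R = max 0 R'"
  let ?O = "\<lambda>s. region (c + \<tau>) (r s + R) R s" and ?I = "\<lambda>s. region (c - \<tau>) (r s + - R) (- R) s"
  let ?d = "LINT \<phi>|E.P. \<bar>F \<phi> - ?l\<bar>"
  have d0: "?d \<ge> 0" by (intro Bochner_Integration.integral_nonneg) simp
  have "((\<lambda>s. 2 * ?d * (measure lborel (?O s) / (s * V s)) + ?l * (measure lborel (?O s) / (s * V s) - measure lborel (?I s) / (s * V s)))
     \<longlongrightarrow> 2 * ?d * ((c + \<tau>) * ?L) + ?l * ((c + \<tau>) * ?L - (c - \<tau>) * ?L)) at_top"
    using c \<tau> by (intro tendsto_intros region_volume r) auto
  moreover have "2 * ?d * ((c + \<tau>) * ?L) + ?l * ((c + \<tau>) * ?L - (c - \<tau>) * ?L) < \<theta>"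
  proof -
    have "2 * ?d * ((c + \<tau>) * ?L) \<le> 2 * \<eta> * ((c + \<tau>) * ?L)"
      using F(2) L c \<tau> by (intro mult_right_mono) auto
    then show ?thesis using small by linarith
  qed
  ultimately have ev: "\<forall>\<^sub>F s in at_top. 2 * ?d * (measure lborel (?O s) / (s * V s)) + ?l * (measure lborel (?O s) / (s * V s) - measure lborel (?I s) / (s * V s)) < \<theta>"
    by (rule order_tendstoD(2))
  have "\<forall>\<^sub>F s in at_top. R / (\<tau> * \<rho>) \<le> s" by (rule eventually_ge_at_top)
  then show "\<forall>\<^sub>F s in at_top. dist (expectation (\<lambda>\<omega>. \<bar>real (card (Y \<omega> \<inter> region c (r s) 0 s)) - ?l * measure lborel (region c (r s) 0 s)\<bar>) / (s * V s)) 0 < \<theta>"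
    using ev eventually_ge_at_top[of 1]
  proof eventually_elim
    fix s :: real
    assume Rs: "R / (\<tau> * \<rho>) \<le> s" and s: "1 \<le> s"
      and lt: "2 * ?d * (measure lborel (?O s) / (s * V s)) + ?l * (measure lborel (?O s) / (s * V s) - measure lborel (?I s) / (s * V s)) < \<theta>"
    have sV: "s * V s > 0" using s V_pos[OF s] by simp
    have R: "0 \<le> R" "R \<le> s * (\<tau> * \<rho>)" "R' \<le> R" using Rs \<tau> \<rho> by (auto simp: R_def divide_le_eq)
    have fat1: "cball z R \<subseteq> ?O s" if "z \<in> region c (r s) 0 s" for z
      using region_fattening[OF \<rho>(2) c(1), of "c + \<tau>" s R z "r s" 0] \<tau> s R that by simp
    have fat2: "cball z R \<subseteq> region c (r s) 0 s" if "z \<in> ?I s" for z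
      using region_fattening[OF \<rho>(2), of "c - \<tau>" c s R z "r s + - R" "- R"] \<tau> s R that by simp
    have "expectation (\<lambda>\<omega>. \<bar>real (card (Y \<omega> \<inter> region c (r s) 0 s)) - ?l * measure lborel (region c (r s) 0 s)\<bar>) \<le>
      2 * ?d * measure lborel (?O s) + ?l * (measure lborel (?O s) - measure lborel (?I s))"
    proof (rule R')
      show "cball z R' \<subseteq> ?O s" if "z \<in> region c (r s) 0 s" for z
        using fat1[OF that] subset_cball[OF R(3)] by blast
      show "cball z R' \<subseteq> region c (r s) 0 s" if "z \<in> ?I s" for z
        using fat2[OF that] subset_cball[OF R(3)] by blast
      show "?I s \<subseteq> region c (r s) 0 s" "region c (r s) 0 s \<subseteq> ?O s"
        using fat1 fat2 R(1) by (meson centre_in_cball subset_iff)+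
    qed (use s c \<tau> in \<open>auto intro!: region_borel region_bounded\<close>)
    then have "expectation (\<lambda>\<omega>. \<bar>real (card (Y \<omega> \<inter> region c (r s) 0 s)) - ?l * measure lborel (region c (r s) 0 s)\<bar>) / (s * V s) \<le>
      (2 * ?d * measure lborel (?O s) + ?l * (measure lborel (?O s) - measure lborel (?I s))) / (s * V s)"
      using sV by (intro divide_right_mono) auto
    also have "\<dots> = 2 * ?d * (measure lborel (?O s) / (s * V s)) + ?l * (measure lborel (?O s) / (s * V s) - measure lborel (?I s) / (s * V s))"
      by (simp add: add_divide_distrib diff_divide_distrib right_diff_distrib)
    also note lt
    finally have "expectation (\<lambda>\<omega>. \<bar>real (card (Y \<omega> \<inter> region c (r s) 0 s)) - ?l * measure lborel (region c (r s) 0 s)\<bar>) / (s * V s) < \<theta>" .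
    moreover have "expectation (\<lambda>\<omega>. \<bar>real (card (Y \<omega> \<inter> region c (r s) 0 s)) - ?l * measure lborel (region c (r s) 0 s)\<bar>) / (s * V s) \<ge> 0"
      using sV by (intro divide_nonneg_nonneg Bochner_Integration.integral_nonneg) auto
    ultimately show "dist (expectation (\<lambda>\<omega>. \<bar>real (card (Y \<omega> \<inter> region c (r s) 0 s)) - ?l * measure lborel (region c (r s) 0 s)\<bar>) / (s * V s)) 0 < \<theta>"
      by (simp add: dist_real_def)
  qed
qed

text \<open>With constant rate and, by \<open>lam_const\<close>, constant intensity,
  \<open>cs\<close> is m0 times the count in the region and its mean is m0 \<open>lam x\<close>
  times the volume. Markov's inequality then reduces the claim to
  \<open>count_limit\<close>.\<close>

lemma ergodic_concentration: concentration
proof (rule concentrationI)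
  fix c :: real and r :: "real \<Rightarrow> real" and a :: real assume c: "0 < c" "c \<le> 1" and r: "radius r" and a: "a > 0"
  let ?S = "\<lambda>s. region c (r s) 0 s"
  let ?\<Delta> = "\<lambda>s. expectation (\<lambda>\<omega>. \<bar>real (card (Y \<omega> \<inter> ?S s)) - lam x * measure lborel (?S s)\<bar>)"
  let ?b = "\<lambda>s. m0 / a * (?\<Delta> s / (s * V s))"
  have m0: "m0 \<ge> 0" using mu(3)[OF x] mu_const[OF x] by simp
  have "(?b \<longlongrightarrow> m0 / a * 0) at_top" by (intro tendsto_mult tendsto_const count_limit c r)
  moreover have "\<forall>\<^sub>F s in at_top. prob {\<omega> \<in> space M. \<bar>cs c (r s) s \<omega> - expectation (cs c (r s) s)\<bar> \<ge> a * (s * V s)} \<le> ?b s"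
    using eventually_ge_at_top[of 1]
  proof eventually_elim
    fix s :: real assume s: "1 \<le> s"
    have sV: "s * V s > 0" using s V_pos[OF s] by simp
    have S: "?S s \<in> sets borel" "bounded (?S s)" using s c by (auto intro: region_borel region_bounded)
    have SD: "?S s \<subseteq> scaled s D" using scaled_mono[OF dilate_subset[OF c]] by (auto simp: region_def)
    have cs_eq: "cs c (r s) s \<omega> = m0 * real (card (Y \<omega> \<inter> ?S s))" if "\<omega> \<in> space M" for \<omega>
    proof -
      have "X s \<omega> \<inter> ?S s = Y \<omega> \<inter> ?S s" using X_eq[OF s that] SD by auto
      then show ?thesis using cs_region[OF s that c mu_const] by simp
    qed
    have E: "expectation (cs c (r s) s) = m0 * (lam x * measure lborel (?S s))"
    proof -
      have G: "indicator (halfcyl e1 (s *\<^sub>R x) (r s) 0) z * G c (z /\<^sub>R s) = m0 * lam x * indicator (?S s) z" for z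
        using s dilate_subset[OF c] lam_const mu_const
        by (auto simp: G_def region_def indicator_def mem_scaled_iff lam0_def mu0_def zero_ext_def)
      show ?thesis unfolding cs_expectation(2)[OF s c(1)] G by simp
    qed
    let ?u = "\<lambda>\<omega>. \<bar>cs c (r s) s \<omega> - expectation (cs c (r s) s)\<bar>"
    have iu: "integrable M ?u" using cs_expectation(1)[OF s c(1), of "r s"] by auto
    have "prob {\<omega> \<in> space M. ?u \<omega> \<ge> a * (s * V s)} \<le> expectation ?u / (a * (s * V s))"
      using a sV by (intro integral_Markov_inequality_measure[OF iu, of "{}"]) auto
    also have "expectation ?u = expectation (\<lambda>\<omega>. m0 * \<bar>real (card (Y \<omega> \<inter> ?S s)) - lam x * measure lborel (?S s)\<bar>)"
      using m0 by (intro Bochner_Integration.integral_cong) (auto simp: E cs_eq abs_mult right_diff_distrib[symmetric])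
    also have "\<dots> = m0 * ?\<Delta> s" by simp
    also have "m0 * ?\<Delta> s / (a * (s * V s)) = ?b s" by simp
    finally show "prob {\<omega> \<in> space M. ?u \<omega> \<ge> a * (s * V s)} \<le> ?b s" .
  qed
  ultimately show "\<exists>b. (b \<longlongrightarrow> 0) at_top \<and> (\<forall>\<^sub>F s in at_top. prob {\<omega> \<in> space M. \<bar>cs c (r s) s \<omega> - expectation (cs c (r s) s)\<bar> \<ge> a * (s * V s)} \<le> b s)"
    by (intro exI[of _ ?b]) simp
qed

end

section \<open>Normalisation by the expected number of crossing nodes\<close>

lemma tendsto_in_prob_scale:
  fixes Z :: "real \<Rightarrow> 'w \<Rightarrow> real"
  assumes M: "prob_space M" and Z: "tendsto_in_prob M Z a" and q: "(q \<longlongrightarrow> b) at_top"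
    and meas: "\<And>s. s \<ge> 1 \<Longrightarrow> Z s \<in> borel_measurable M"
  shows "tendsto_in_prob M (\<lambda>s \<omega>. q s * Z s \<omega>) (b * a)"
  unfolding tendsto_in_prob_def
proof (intro allI impI)
  interpret prob_space M by (rule M)
  fix \<delta> :: real assume \<delta>: "\<delta> > 0"
  \<comment> \<open>Eventually \<open>\<bar>q s\<bar>\<close> is at most
    \<open>\<bar>b\<bar> + 1\<close>, so a deviation of Z by \<theta> contributes at most \<delta> /
    2; the other half is left for the deviation of q.\<close>
  define \<theta> where "\<theta> = \<delta> / (2 * (\<bar>b\<bar> + 1))"
  have \<theta>: "\<theta> > 0" using \<delta> by (simp add: \<theta>_def add_nonneg_pos)
  have lim: "((\<lambda>s. prob {\<omega> \<in> space M. \<bar>Z s \<omega> - a\<bar> > \<theta>}) \<longlongrightarrow> 0) at_top"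
    using Z \<theta> by (simp add: tendsto_in_prob_def)
  have q1: "\<forall>\<^sub>F s in at_top. \<bar>q s - b\<bar> < 1" using tendstoD[OF q, of 1] by (simp add: dist_real_def)
  have q2: "\<forall>\<^sub>F s in at_top. \<bar>q s * a - b * a\<bar> < \<delta> / 2"
    using tendstoD[OF tendsto_mult[OF q tendsto_const[of a]], of "\<delta> / 2"] \<delta> by (simp add: dist_real_def)
  show "((\<lambda>s. prob {\<omega> \<in> space M. \<bar>q s * Z s \<omega> - b * a\<bar> > \<delta>}) \<longlongrightarrow> 0) at_top"
  proof (rule tendsto_sandwich[OF _ _ tendsto_const lim])
    show "\<forall>\<^sub>F s in at_top. prob {\<omega> \<in> space M. \<bar>q s * Z s \<omega> - b * a\<bar> > \<delta>} \<le> prob {\<omega> \<in> space M. \<bar>Z s \<omega> - a\<bar> > \<theta>}"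
      using q1 q2 eventually_ge_at_top[of 1]
    proof eventually_elim
      fix s :: real assume q: "\<bar>q s - b\<bar> < 1" "\<bar>q s * a - b * a\<bar> < \<delta> / 2" and s: "1 \<le> s"
      have [measurable]: "Z s \<in> borel_measurable M" by (rule meas[OF s])
      have "\<theta> < \<bar>Z s \<omega> - a\<bar>" if "\<delta> < \<bar>q s * Z s \<omega> - b * a\<bar>" for \<omega>
      proof (rule ccontr)
        assume "\<not> \<theta> < \<bar>Z s \<omega> - a\<bar>"
        then have "\<bar>q s\<bar> * \<bar>Z s \<omega> - a\<bar> \<le> (\<bar>b\<bar> + 1) * \<theta>" using q(1) by (intro mult_mono) auto
        also have "\<dots> = \<delta> / 2" by (simp add: \<theta>_def field_simps add_nonneg_eq_0_iff)
        finally have "\<bar>q s * (Z s \<omega> - a)\<bar> \<le> \<delta> / 2" by (simp add: abs_mult)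
        moreover have "q s * Z s \<omega> - b * a = q s * (Z s \<omega> - a) + (q s * a - b * a)" by (simp add: algebra_simps)
        ultimately show False using that q(2) by linarith
      qed
      then show "prob {\<omega> \<in> space M. \<bar>q s * Z s \<omega> - b * a\<bar> > \<delta>} \<le> prob {\<omega> \<in> space M. \<bar>Z s \<omega> - a\<bar> > \<theta>}"
        by (intro finite_measure_mono) auto
    qed
  qed simp
qed

theorem theorem2:
  fixes M :: "'w measure"
    and i :: "'n::finite"
    and D :: "(real ^ 'n) set"
    and lam mu lamA :: "real ^ 'n \<Rightarrow> real"
    and X :: "real \<Rightarrow> 'w \<Rightarrow> (real ^ 'n) set"
    and A :: "real ^ 'n \<Rightarrow> (real ^ 'n) set \<Rightarrow> real ^ 'n"
    and g h :: "real \<Rightarrow> real"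
    and x :: "real ^ 'n"
  assumes "prob_space M"
    and "open D" and "bounded D" and "convex D"
    and "continuous_on D lam" and "bounded (lam ` D)" and "\<forall>y\<in>D. lam y \<ge> 0"
    and "continuous_on D mu" and "bounded (mu ` D)" and "\<forall>y\<in>D. mu y \<ge> 0"
    and "\<forall>s\<ge>1. point_process_on M (scaled s D) (X s)"
    and "\<forall>s\<ge>1. has_intensity_on M (scaled s D) (X s) (\<lambda>y. lam (y /\<^sub>R s))"
    and "directed_navigation i A"
    and no_cycles: "\<forall>s\<ge>1. AE \<omega> in M. \<forall>y \<in> X s \<omega>. \<forall>k\<ge>1.
           nav_iter A (X s \<omega>) k y = y \<longrightarrow> A y (X s \<omega>) = y"
    and "admissible_scale g" and "admissible_scale h"
    and "x \<in> D"
    and D1_pos: "\<forall>y\<in>D. lamA y > 0"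
    and D1: "\<forall>y\<in>D. ((\<lambda>s. prob_space.expectation M (\<lambda>\<omega>. real (card (crossing_nodes i g A s y (X s \<omega>))))
               / enn2real (hausdorff_measure (CARD('n) - 1) (link_window i g s y))) \<longlongrightarrow> lamA y) at_top"
    and D2: "\<forall>\<epsilon>>0. (\<lambda>s. 1 - measure M {\<omega> \<in> space M. sub_ballistic i D h A s \<epsilon> (X s \<omega>)})
               \<in> O[at_top](\<lambda>s. 1 / s ^ (2 * CARD('n)))"
    and "h \<in> o[at_top](g)"
    and "\<forall>\<^sub>F s in at_top. integrable M (\<lambda>\<omega>. (real (card (X s \<omega>)))\<^sup>2)"
    and "(\<lambda>s. prob_space.expectation M (\<lambda>\<omega>. (real (card (X s \<omega>)))\<^sup>2))
               \<in> O[at_top](\<lambda>s. s ^ (2 * CARD('n)))"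
  shows "((\<lambda>s. 1 / s *
            (prob_space.expectation M
               (\<lambda>\<omega>. \<Sum>y \<in> crossing_nodes i g A s x (X s \<omega>). traffic mu A s (X s \<omega>) y)
             / prob_space.expectation M (\<lambda>\<omega>. real (card (crossing_nodes i g A s x (X s \<omega>))))))
          \<longlongrightarrow> 1 / lamA x *
            (LINT r:{..0}|lborel. zero_ext D lam (x + r *\<^sub>R axis i 1) * zero_ext D mu (x + r *\<^sub>R axis i 1)))
         at_top
       \<and> ((\<forall>s\<ge>1. poisson_process_on M (scaled s D) (X s) (\<lambda>y. lam (y /\<^sub>R s))) \<or>
          (mu constant_on D \<and>
           (\<exists>Y. ergodic_process M Y \<and> (\<forall>s\<ge>1. \<forall>\<omega>\<in>space M. X s \<omega> = Y \<omega> \<inter> scaled s D)))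
          \<longrightarrow>
          tendsto_in_prob M
            (\<lambda>s \<omega>. 1 / s *
              ((\<Sum>y \<in> crossing_nodes i g A s x (X s \<omega>). traffic mu A s (X s \<omega>) y)
               / prob_space.expectation M (\<lambda>\<omega>. real (card (crossing_nodes i g A s x (X s \<omega>))))))
            (1 / lamA x *
              (LINT r:{..0}|lborel. zero_ext D lam (x + r *\<^sub>R axis i 1) * zero_ext D mu (x + r *\<^sub>R axis i 1))))"
proof -
  interpret network M i D lam mu X A g h x
    using assms by (intro network.intro network_axioms.intro) blast+
  define E where "E s = expectation (\<lambda>\<omega>. real (card (crossing_nodes i g A s x (X s \<omega>))))" for s
  define I where "I = (LINT r:{..0}|lborel. zero_ext D lam (x + r *\<^sub>R axis i 1) * zero_ext D mu (x + r *\<^sub>R axis i 1))"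
  have JI: "J 1 = I" unfolding I_def by (rule J_1)
  have lamA: "lamA x > 0" using D1_pos \<open>x \<in> D\<close> by simp
  have haus: "enn2real (hausdorff_measure (CARD('n) - 1) (link_window i g s x)) = V s" if s: "s \<ge> 1" for s
    using enn2real_hausdorff_link_window[of g s i x] g s by (force simp: V_def admissible_scale_def)
  have "((\<lambda>s. E s / enn2real (hausdorff_measure (CARD('n) - 1) (link_window i g s x))) \<longlongrightarrow> lamA x) at_top"
    using D1 \<open>x \<in> D\<close> by (simp add: E_def)
  then have "((\<lambda>s. E s / V s) \<longlongrightarrow> lamA x) at_top"
    by (rule Lim_transform_eventually) (rule eventually_mono[OF eventually_ge_at_top[of 1]], simp only: haus)
  from tendsto_divide[OF tendsto_const this, of 1] lamA
  have q: "((\<lambda>s. V s / E s) \<longlongrightarrow> 1 / lamA x) at_top" by simp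
  \<comment> \<open>Also true for \<open>E s = 0\<close>, where division by zero makes both sides
    0.\<close>
  have rearrange: "V s / E s * (t / (s * V s)) = 1 / s * (t / E s)" if "s \<ge> 1" for s t
    using V_pos[OF that] that by simp
  have "((\<lambda>s. V s / E s * (expectation (T s) / (s * V s))) \<longlongrightarrow> 1 / lamA x * I) at_top"
    using tendsto_mult[OF q flow_mean_limit] by (simp only: JI)
  then have i: "((\<lambda>s. 1 / s * (expectation (T s) / E s)) \<longlongrightarrow> 1 / lamA x * I) at_top"
    by (rule Lim_transform_eventually) (rule eventually_mono[OF eventually_ge_at_top[of 1]], simp only: rearrange)
  have ii: "tendsto_in_prob M (\<lambda>s \<omega>. 1 / s * (T s \<omega> / E s)) (1 / lamA x * I)" if concentration
  proof -
    have "tendsto_in_prob M (\<lambda>s \<omega>. V s / E s * (T s \<omega> / (s * V s))) (1 / lamA x * I)"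
      using flow_limit_in_prob[OF that] T_measurable
      by (intro tendsto_in_prob_scale[OF prob_space_axioms _ q]) (auto simp: JI)
    moreover have "\<forall>\<^sub>F s in at_top. prob {\<omega> \<in> space M. \<delta> < \<bar>V s / E s * (T s \<omega> / (s * V s)) - 1 / lamA x * I\<bar>} =
        prob {\<omega> \<in> space M. \<delta> < \<bar>1 / s * (T s \<omega> / E s) - 1 / lamA x * I\<bar>}" for \<delta>
      using eventually_ge_at_top[of 1] by eventually_elim (simp only: rearrange)
    ultimately show ?thesis
      unfolding tendsto_in_prob_def by (auto intro: Lim_transform_eventually)
  qed
  have "concentration" if "mu constant_on D" "ergodic_process M Y" "\<forall>s\<ge>1. \<forall>\<omega>\<in>space M. X s \<omega> = Y \<omega> \<inter> scaled s D" for Y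
  proof -
    obtain m0 where "\<And>y. y \<in> D \<Longrightarrow> mu y = m0" using \<open>mu constant_on D\<close> by (auto simp: constant_on_def)
    then interpret E: ergodic_network M i D lam mu X A g h x Y m0
      using that by unfold_locales auto
    show ?thesis by (rule E.ergodic_concentration)
  qed
  then have ergodic: "concentration" if "mu constant_on D \<and> (\<exists>Y. ergodic_process M Y \<and> (\<forall>s\<ge>1. \<forall>\<omega>\<in>space M. X s \<omega> = Y \<omega> \<inter> scaled s D))"
    using that by (elim conjE exE)
  have poisson: "concentration" if "\<forall>s\<ge>1. poisson_process_on M (scaled s D) (X s) (\<lambda>y. lam (y /\<^sub>R s))"
    using that by (intro poisson_concentration) simp
  show ?thesis
    using i ii[OF poisson] ii[OF ergodic] unfolding T_def[abs_def] E_def I_def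
    by (intro conjI impI) (assumption | erule disjE)+
qed

end
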